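(* Let $F(X_1,\dots,X_n,Y_1,\dots,Y_m,Z)$ be a real Jordan polynomial of degree $1$ in $Z$. Suppose that for each JC-algebra $J$, each pairwise operator commuting (in $J$) $n$-tuple $(x_1,\dots,x_n)$ in $J$, each pairwise operator commuting (in $J$) $m$-tuple $(y_1,\dots,y_m)$ in $J$ and each element $z\in J$ one has $F(x_1,\dots,x_n,y_1,\dots,y_m,z)=0$. Then for each JB-algebra $J$, each pairwise operator commuting (in $J$) $n$-tuple $(x_1,\dots,x_n)$ in $J$, each pairwise operator commuting (in $J$) $m$-tuple $(y_1,\dots,y_m)$ in $J$ and each element $z\in J$ one has $F(x_1,\dots,x_n,y_1,\dots,y_m,z)=0$.
   Context: A real Jordan algebra is a real vector space $J$ with a commutative bilinear product $\circ$ satisfying $x\circ(y\circ x^2)=(x\circ y)\circ x^2$. A JB-algebra is a real Jordan algebra $J$ (not necessarily unital) complete in a norm satisfying $\|x\circ y\|\le\|x\|\|y\|$, $\|x\|^2=\|x^2\|$ and $\|x^2\|\le\|x^2+y^2\|$. A JC-algebra is a JB-algebra that is isometrically isomorphic to a norm-closed Jordan subalgebra of $B(H)_{sa}$ (bounded self-adjoint operators on a complex Hilbert space $H$, with product $\frac12(xy+yx)$ and operator norm) for some $H$. Elements $a,b$ of a JB-algebra $J$ operator commute in $J$ if $a\circ(b\circ c)=b\circ(a\circ c)$ for all $c\in J$. A real Jordan polynomial in the variables $X_1,\dots,X_k$ is an element of the free unital real Jordan algebra $\mathrm{FJ}$ on $\{X_1,\dots,X_k\}$ (characterized by: every map from the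 variables to a unital real Jordan algebra extends uniquely to a unital Jordan homomorphism on $\mathrm{FJ}$). This algebra is graded by the degree in each variable, and the degree of $F$ in a variable is the largest degree in that variable of a nonzero homogeneous component of $F$. For elements $a_1,\dots,a_k$ of a unital Jordan algebra $J$, $F(a_1,\dots,a_k)$ is the image of $F$ under the unital Jordan homomorphism sending $X_i$ to $a_i$; if $J$ is not unital, one evaluates in the unitization $\tilde J=\mathbb{R}1\oplus J$, with product $(\lambda1+x)\circ(\mu1+y)=\lambda\mu1+(\lambda y+\mu x+x\circ y)$. *)

theory Defs
  imports Complex_Main "HOL-Algebra.Module"
begin

section \<open>Real Jordan algebras\<close>

definition field_ring :: "'k::field ring" where
  "field_ring = \<lparr>carrier = UNIV, monoid.mult = (*), one = 1, zero = 0, add = (+)\<rparr>"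

text \<open>Algebras are module records; the multiplication of the record is the Jordan product.
  The field \<^term>\<open>one\<close> only carries meaning in \<open>unital_jordan_algebra\<close>.\<close>

locale real_comm_algebra = Module.module "field_ring :: real ring" J for J (structure) +
  assumes m_closed [simp, intro]: "\<lbrakk>x \<in> carrier J; y \<in> carrier J\<rbrakk> \<Longrightarrow> x \<otimes> y \<in> carrier J"
    and m_comm: "\<lbrakk>x \<in> carrier J; y \<in> carrier J\<rbrakk> \<Longrightarrow> x \<otimes> y = y \<otimes> x"
    and m_l_distr: "\<lbrakk>x \<in> carrier J; y \<in> carrier J; z \<in> carrier J\<rbrakk>
      \<Longrightarrow> (x \<oplus> y) \<otimes> z = x \<otimes> z \<oplus> y \<otimes> z"
    and m_smult_l: "\<lbrakk>x \<in> carrier J; y \<in> carrier J\<rbrakk> \<Longrightarrow> (r \<odot> x) \<otimes> y = r \<odot> (x \<otimes> y)"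

locale jordan_algebra = real_comm_algebra +
  assumes jordan_identity: "\<lbrakk>x \<in> carrier J; y \<in> carrier J\<rbrakk>
      \<Longrightarrow> x \<otimes> (y \<otimes> (x \<otimes> x)) = (x \<otimes> y) \<otimes> (x \<otimes> x)"

locale unital_jordan_algebra = jordan_algebra +
  assumes j_one_closed [simp, intro]: "\<one> \<in> carrier J"
    and j_l_one [simp]: "x \<in> carrier J \<Longrightarrow> \<one> \<otimes> x = x"

definition operator_commute :: "('r, 'a, 'b) module_scheme \<Rightarrow> 'a \<Rightarrow> 'a \<Rightarrow> bool" where
  "operator_commute J a b \<longleftrightarrow>
     (\<forall>c\<in>carrier J. a \<otimes>\<^bsub>J\<^esub> (b \<otimes>\<^bsub>J\<^esub> c) = b \<otimes>\<^bsub>J\<^esub> (a \<otimes>\<^bsub>J\<^esub> c))"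

definition operator_commuting_tuple ::
    "('r, 'a, 'b) module_scheme \<Rightarrow> nat \<Rightarrow> (nat \<Rightarrow> 'a) \<Rightarrow> bool" where
  "operator_commuting_tuple J n x \<longleftrightarrow>
     (\<forall>i\<in>{1..n}. x i \<in> carrier J) \<and> (\<forall>i\<in>{1..n}. \<forall>j\<in>{1..n}. operator_commute J (x i) (x j))"

definition jordan_hom ::
    "('r, 'a, 'c) module_scheme \<Rightarrow> ('r, 'b, 'd) module_scheme \<Rightarrow> ('a \<Rightarrow> 'b) set" where
  "jordan_hom J K = {h \<in> carrier J \<rightarrow> carrier K.
     (\<forall>x\<in>carrier J. \<forall>y\<in>carrier J. h (x \<oplus>\<^bsub>J\<^esub> y) = h x \<oplus>\<^bsub>K\<^esub> h y) \<and>
     (\<forall>r. \<forall>x\<in>carrier J. h (r \<odot>\<^bsub>J\<^esub> x) = r \<odot>\<^bsub>K\<^esub> h x) \<and>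
     (\<forall>x\<in>carrier J. \<forall>y\<in>carrier J. h (x \<otimes>\<^bsub>J\<^esub> y) = h x \<otimes>\<^bsub>K\<^esub> h y)}"

definition unital_jordan_hom ::
    "('r, 'a, 'c) module_scheme \<Rightarrow> ('r, 'b, 'd) module_scheme \<Rightarrow> ('a \<Rightarrow> 'b) set" where
  "unital_jordan_hom J K = {h \<in> jordan_hom J K. h \<one>\<^bsub>J\<^esub> = \<one>\<^bsub>K\<^esub>}"

definition has_unit :: "('r, 'a, 'b) module_scheme \<Rightarrow> bool" where
  "has_unit J \<longleftrightarrow> (\<exists>e\<in>carrier J. \<forall>x\<in>carrier J. e \<otimes>\<^bsub>J\<^esub> x = x)"

definition with_unit :: "('r, 'a, 'b) module_scheme \<Rightarrow> ('r, 'a, 'b) module_scheme" where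
  "with_unit J = J\<lparr>one := (THE e. e \<in> carrier J \<and> (\<forall>x\<in>carrier J. e \<otimes>\<^bsub>J\<^esub> x = x))\<rparr>"

definition unitization :: "(real, 'a, 'b) module_scheme \<Rightarrow> (real, real \<times> 'a) module" where
  "unitization J = \<lparr>carrier = UNIV \<times> carrier J,
     monoid.mult = (\<lambda>(l, x) (m, y). (l * m, (l \<odot>\<^bsub>J\<^esub> y \<oplus>\<^bsub>J\<^esub> m \<odot>\<^bsub>J\<^esub> x) \<oplus>\<^bsub>J\<^esub> x \<otimes>\<^bsub>J\<^esub> y)),
     one = (1, \<zero>\<^bsub>J\<^esub>), zero = (0, \<zero>\<^bsub>J\<^esub>),
     add = (\<lambda>(l, x) (m, y). (l + m, x \<oplus>\<^bsub>J\<^esub> y)),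
     smult = (\<lambda>r (l, x). (r * l, r \<odot>\<^bsub>J\<^esub> x))\<rparr>"


lemma field_ring_simps [simp]:
  "carrier field_ring = UNIV" "r \<otimes>\<^bsub>field_ring\<^esub> s = r * s" "r \<oplus>\<^bsub>field_ring\<^esub> s = r + s"
  "\<one>\<^bsub>field_ring\<^esub> = 1" "\<zero>\<^bsub>field_ring\<^esub> = 0"
  by (simp_all add: field_ring_def)

lemma cring_field_ring: "cring (field_ring :: 'k::field ring)"
proof (intro cringI abelian_groupI comm_monoidI)
  fix x :: 'k
  show "\<exists>y\<in>carrier field_ring. y \<oplus>\<^bsub>field_ring\<^esub> x = \<zero>\<^bsub>field_ring\<^esub>"
    by (auto intro: exI [of _ "- x"])
qed (simp_all add: algebra_simps)

lemma real_comm_algebraI: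
  fixes J (structure)
  assumes "abelian_group J"
    and "\<And>(r::real) x. x \<in> carrier J \<Longrightarrow> r \<odot> x \<in> carrier J"
    and "\<And>q r x. x \<in> carrier J \<Longrightarrow> (q + r) \<odot> x = q \<odot> x \<oplus> r \<odot> x"
    and "\<And>r x y. \<lbrakk>x \<in> carrier J; y \<in> carrier J\<rbrakk> \<Longrightarrow> r \<odot> (x \<oplus> y) = r \<odot> x \<oplus> r \<odot> y"
    and "\<And>q r x. x \<in> carrier J \<Longrightarrow> (q * r) \<odot> x = q \<odot> (r \<odot> x)"
    and "\<And>x. x \<in> carrier J \<Longrightarrow> 1 \<odot> x = x"
    and "\<And>x y. \<lbrakk>x \<in> carrier J; y \<in> carrier J\<rbrakk> \<Longrightarrow> x \<otimes> y \<in> carrier J"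
    and "\<And>x y. \<lbrakk>x \<in> carrier J; y \<in> carrier J\<rbrakk> \<Longrightarrow> x \<otimes> y = y \<otimes> x"
    and "\<And>x y z. \<lbrakk>x \<in> carrier J; y \<in> carrier J; z \<in> carrier J\<rbrakk> \<Longrightarrow> (x \<oplus> y) \<otimes> z = x \<otimes> z \<oplus> y \<otimes> z"
    and "\<And>x y r. \<lbrakk>x \<in> carrier J; y \<in> carrier J\<rbrakk> \<Longrightarrow> (r \<odot> x) \<otimes> y = r \<odot> (x \<otimes> y)"
  shows "real_comm_algebra J"
  by (intro real_comm_algebra.intro real_comm_algebra_axioms.intro moduleI cring_field_ring)
     (auto simp: assms(1-7,9,10) intro: assms(8))

context real_comm_algebra
begin

lemma rscale_closed [simp, intro]: "x \<in> carrier J \<Longrightarrow> r \<odot> x \<in> carrier J"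
  using smult_closed by simp

lemma rscale_l_distr: "x \<in> carrier J \<Longrightarrow> (q + r) \<odot> x = q \<odot> x \<oplus> r \<odot> x"
  using smult_l_distr by simp

lemma rscale_r_distr: "\<lbrakk>x \<in> carrier J; y \<in> carrier J\<rbrakk> \<Longrightarrow> r \<odot> (x \<oplus> y) = r \<odot> x \<oplus> r \<odot> y"
  using smult_r_distr by simp

lemma rscale_assoc: "x \<in> carrier J \<Longrightarrow> (q * r) \<odot> x = q \<odot> (r \<odot> x)"
  using smult_assoc1 by simp

lemma rscale_one [simp]: "x \<in> carrier J \<Longrightarrow> 1 \<odot> x = x"
  using smult_one by simp

lemma rscale_zero [simp]: "x \<in> carrier J \<Longrightarrow> 0 \<odot> x = \<zero>"
  using smult_l_null by simp

lemma rscale_r_zero [simp]: "r \<odot> \<zero> = \<zero>"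
  using smult_r_null by simp

lemma rscale_minus_one: "x \<in> carrier J \<Longrightarrow> (- 1) \<odot> x \<oplus> x = \<zero>"
  using rscale_l_distr [of x "- 1" 1] by simp

lemma m_r_distr: "\<lbrakk>x \<in> carrier J; y \<in> carrier J; z \<in> carrier J\<rbrakk> \<Longrightarrow> z \<otimes> (x \<oplus> y) = z \<otimes> x \<oplus> z \<otimes> y"
  by (metis m_comm m_l_distr M.a_closed)

lemma m_smult_r: "\<lbrakk>x \<in> carrier J; y \<in> carrier J\<rbrakk> \<Longrightarrow> y \<otimes> (r \<odot> x) = r \<odot> (y \<otimes> x)"
  by (metis m_comm m_smult_l rscale_closed)

lemma m_zero_l [simp]: "x \<in> carrier J \<Longrightarrow> \<zero> \<otimes> x = \<zero>"
  using m_smult_l [of \<zero> x 0] by simp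

lemma m_zero_r [simp]: "x \<in> carrier J \<Longrightarrow> x \<otimes> \<zero> = \<zero>"
  using m_smult_r [of \<zero> x 0] by simp

lemma operator_commute_add:
  assumes "operator_commute J a b" "operator_commute J a c"
    "a \<in> carrier J" "b \<in> carrier J" "c \<in> carrier J"
  shows "operator_commute J a (b \<oplus> c)"
  using assms by (auto simp: operator_commute_def m_l_distr m_r_distr)

lemma operator_commute_scale:
  assumes "operator_commute J a b" "a \<in> carrier J" "b \<in> carrier J"
  shows "operator_commute J a (r \<odot> b)"
  using assms by (auto simp: operator_commute_def m_smult_l m_smult_r)

lemma operator_commute_sym: "operator_commute J a b \<Longrightarrow> operator_commute J b a"
  by (auto simp: operator_commute_def)

lemma operator_commute_refl: "operator_commute J a a"
  by (auto simp: operator_commute_def)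

end

lemma unitization_simps [simp]:
  "carrier (unitization J) = UNIV \<times> carrier J"
  "(l, x) \<otimes>\<^bsub>unitization J\<^esub> (m, y) = (l * m, (l \<odot>\<^bsub>J\<^esub> y \<oplus>\<^bsub>J\<^esub> m \<odot>\<^bsub>J\<^esub> x) \<oplus>\<^bsub>J\<^esub> x \<otimes>\<^bsub>J\<^esub> y)"
  "\<one>\<^bsub>unitization J\<^esub> = (1, \<zero>\<^bsub>J\<^esub>)" "\<zero>\<^bsub>unitization J\<^esub> = (0, \<zero>\<^bsub>J\<^esub>)"
  "(l, x) \<oplus>\<^bsub>unitization J\<^esub> (m, y) = (l + m, x \<oplus>\<^bsub>J\<^esub> y)"
  "r \<odot>\<^bsub>unitization J\<^esub> (l, x) = (r * l, r \<odot>\<^bsub>J\<^esub> x)"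
  by (simp_all add: unitization_def)

lemma (in real_comm_algebra) unitization_comm_algebra: "real_comm_algebra (unitization J)"
proof (rule real_comm_algebraI)
  show "abelian_group (unitization J)"
  proof (rule abelian_groupI)
    fix x assume "x \<in> carrier (unitization J)"
    then show "\<exists>y\<in>carrier (unitization J). y \<oplus>\<^bsub>unitization J\<^esub> x = \<zero>\<^bsub>unitization J\<^esub>"
      by (intro bexI [of _ "(- 1) \<odot>\<^bsub>unitization J\<^esub> x"]) (auto simp: rscale_minus_one)
  qed (auto simp: M.a_ac)
  fix x y assume "x \<in> carrier (unitization J)" "y \<in> carrier (unitization J)"
  then show "x \<otimes>\<^bsub>unitization J\<^esub> y = y \<otimes>\<^bsub>unitization J\<^esub> x"
    by (auto simp: M.a_ac intro: m_comm)
qed (auto simp: rscale_l_distr rscale_r_distr rscale_assoc [symmetric] m_l_distr m_smult_l m_smult_r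
       algebra_simps M.a_ac)

lemma (in jordan_algebra) unitization_unital_jordan_algebra:
  "unital_jordan_algebra (unitization J)"
proof -
  interpret U: real_comm_algebra "unitization J" by (rule unitization_comm_algebra)
  have e: "operator_commute (unitization J) (0, x) (0, x \<otimes> x)" if x: "x \<in> carrier J" for x
  proof -
    have "x \<otimes> (x \<otimes> x \<otimes> z) = x \<otimes> x \<otimes> (x \<otimes> z)" if "z \<in> carrier J" for z
      using jordan_identity [OF x that] x that by (simp add: m_comm)
    then show ?thesis
      using x by (auto simp: operator_commute_def m_r_distr m_smult_r m_comm)
  qed
  have one: "operator_commute (unitization J) a (1, \<zero>)" if "a \<in> carrier (unitization J)" for a
    using that by (auto simp: operator_commute_def)
  have sq: "operator_commute (unitization J) a (a \<otimes>\<^bsub>unitization J\<^esub> a)"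
    if a: "a \<in> carrier (unitization J)" for a
  proof -
    obtain l x where ax: "a = (l, x)" and x: "x \<in> carrier J" using a by auto
    let ?U = "unitization J"
    have a_eq: "a = l \<odot>\<^bsub>?U\<^esub> (1, \<zero>) \<oplus>\<^bsub>?U\<^esub> (0, x)" using x by (simp add: ax)
    have aa_eq: "a \<otimes>\<^bsub>?U\<^esub> a = ((l * l) \<odot>\<^bsub>?U\<^esub> (1, \<zero>) \<oplus>\<^bsub>?U\<^esub> (2 * l) \<odot>\<^bsub>?U\<^esub> (0, x)) \<oplus>\<^bsub>?U\<^esub> (0, x \<otimes> x)"
      using x rscale_l_distr [of x l l] by (simp add: ax)
    have 1: "operator_commute ?U (0, x) a"
      unfolding a_eq using x
      by (intro U.operator_commute_add U.operator_commute_scale one U.operator_commute_refl) auto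
    have 2: "operator_commute ?U (0, x \<otimes> x) a"
      unfolding a_eq using x
      by (intro U.operator_commute_add U.operator_commute_scale one
            e [THEN U.operator_commute_sym]) auto
    show ?thesis
      unfolding aa_eq using x a
      by (intro U.operator_commute_add U.operator_commute_scale one
            1 [THEN U.operator_commute_sym] 2 [THEN U.operator_commute_sym]) auto
  qed
  show ?thesis
  proof
    fix a b assume a: "a \<in> carrier (unitization J)" and b: "b \<in> carrier (unitization J)"
    have "a \<otimes>\<^bsub>unitization J\<^esub> (a \<otimes>\<^bsub>unitization J\<^esub> a \<otimes>\<^bsub>unitization J\<^esub> b)
        = a \<otimes>\<^bsub>unitization J\<^esub> a \<otimes>\<^bsub>unitization J\<^esub> (a \<otimes>\<^bsub>unitization J\<^esub> b)"
      using sq [OF a] b unfolding operator_commute_def by blast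
    then show "a \<otimes>\<^bsub>unitization J\<^esub> (b \<otimes>\<^bsub>unitization J\<^esub> (a \<otimes>\<^bsub>unitization J\<^esub> a))
        = a \<otimes>\<^bsub>unitization J\<^esub> b \<otimes>\<^bsub>unitization J\<^esub> (a \<otimes>\<^bsub>unitization J\<^esub> a)"
      using a b by (metis U.m_comm U.m_closed)
  qed auto
qed

lemma with_unit_simps [simp]:
  "carrier (with_unit J) = carrier J" "mult (with_unit J) = mult J" "add (with_unit J) = add J"
  "zero (with_unit J) = zero J" "smult (with_unit J) = smult J"
  by (simp_all add: with_unit_def)

lemma (in jordan_algebra) with_unit_unital_jordan_algebra:
  assumes "has_unit J"
  shows "unital_jordan_algebra (with_unit J)"
proof -
  let ?P = "\<lambda>e. e \<in> carrier J \<and> (\<forall>x\<in>carrier J. e \<otimes> x = x)"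
  obtain e where e: "?P e" using assms by (auto simp: has_unit_def)
  have the: "(THE e. ?P e) = e"
  proof (rule the_equality [of ?P, OF e])
    fix f assume "?P f"
    with e show "f = e" by (metis m_comm)
  qed
  have ag: "abelian_group (with_unit J)"
  proof (rule abelian_groupI)
    fix x assume "x \<in> carrier (with_unit J)"
    then show "\<exists>y\<in>carrier (with_unit J). y \<oplus>\<^bsub>with_unit J\<^esub> x = \<zero>\<^bsub>with_unit J\<^esub>"
      by (intro bexI [of _ "(- 1) \<odot> x"]) (auto simp: rscale_minus_one)
  qed (auto simp: M.a_ac)
  interpret U: real_comm_algebra "with_unit J"
    by (rule real_comm_algebraI [OF ag])
       (simp_all add: rscale_l_distr rscale_r_distr rscale_assoc m_l_distr m_smult_l, rule m_comm)
  have "\<one>\<^bsub>with_unit J\<^esub> = e" by (simp add: with_unit_def the)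
  then show ?thesis
    using e by unfold_locales (simp_all add: jordan_identity)
qed


section \<open>JB-algebras and JC-algebras\<close>

record 'a normed_algebra = "(real, 'a) module" + nrm :: "'a \<Rightarrow> real"

locale jb_algebra = jordan_algebra J for J :: "('a, 'b) normed_algebra_scheme" (structure) +
  assumes nrm_eq_0: "x \<in> carrier J \<Longrightarrow> nrm J x = 0 \<longleftrightarrow> x = \<zero>"
    and nrm_nonneg: "x \<in> carrier J \<Longrightarrow> 0 \<le> nrm J x"
    and nrm_smult: "x \<in> carrier J \<Longrightarrow> nrm J (r \<odot> x) = \<bar>r\<bar> * nrm J x"
    and nrm_triangle: "\<lbrakk>x \<in> carrier J; y \<in> carrier J\<rbrakk> \<Longrightarrow> nrm J (x \<oplus> y) \<le> nrm J x + nrm J y"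
    and nrm_complete: "\<lbrakk>\<And>k. s k \<in> carrier J;
        \<And>e. e > 0 \<Longrightarrow> \<exists>N. \<forall>k\<ge>N. \<forall>l\<ge>N. nrm J (s k \<ominus> s l) < e\<rbrakk>
      \<Longrightarrow> \<exists>x\<in>carrier J. (\<lambda>k. nrm J (s k \<ominus> x)) \<longlonglongrightarrow> 0"
    and nrm_mult: "\<lbrakk>x \<in> carrier J; y \<in> carrier J\<rbrakk> \<Longrightarrow> nrm J (x \<otimes> y) \<le> nrm J x * nrm J y"
    and nrm_square: "x \<in> carrier J \<Longrightarrow> (nrm J x)\<^sup>2 = nrm J (x \<otimes> x)"
    and nrm_square_le: "\<lbrakk>x \<in> carrier J; y \<in> carrier J\<rbrakk>
      \<Longrightarrow> nrm J (x \<otimes> x) \<le> nrm J (x \<otimes> x \<oplus> y \<otimes> y)"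

text \<open>The fields \<^term>\<open>mult\<close> and \<^term>\<open>one\<close> of a Hilbert space record are irrelevant.\<close>

record 'h hilbert = "(complex, 'h) module" + inprod :: "'h \<Rightarrow> 'h \<Rightarrow> complex"

definition hnorm :: "('h, 'b) hilbert_scheme \<Rightarrow> 'h \<Rightarrow> real" where
  "hnorm H v = sqrt (Re (inprod H v v))"

locale hilbert_space = Module.module "field_ring :: complex ring" H
  for H :: "('h, 'b) hilbert_scheme" (structure) +
  assumes inprod_add: "\<lbrakk>u \<in> carrier H; v \<in> carrier H; w \<in> carrier H\<rbrakk>
      \<Longrightarrow> inprod H (u \<oplus> v) w = inprod H u w + inprod H v w"
    and inprod_smult: "\<lbrakk>u \<in> carrier H; v \<in> carrier H\<rbrakk>
      \<Longrightarrow> inprod H (c \<odot> u) v = c * inprod H u v"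
    and inprod_cnj: "\<lbrakk>u \<in> carrier H; v \<in> carrier H\<rbrakk> \<Longrightarrow> inprod H u v = cnj (inprod H v u)"
    and inprod_nonneg: "u \<in> carrier H \<Longrightarrow> 0 \<le> Re (inprod H u u)"
    and inprod_eq_0: "u \<in> carrier H \<Longrightarrow> inprod H u u = 0 \<longleftrightarrow> u = \<zero>"
    and hilbert_complete: "\<lbrakk>\<And>k. s k \<in> carrier H;
        \<And>e. e > 0 \<Longrightarrow> \<exists>N. \<forall>k\<ge>N. \<forall>l\<ge>N. hnorm H (s k \<ominus> s l) < e\<rbrakk>
      \<Longrightarrow> \<exists>u\<in>carrier H. (\<lambda>k. hnorm H (s k \<ominus> u)) \<longlonglongrightarrow> 0"

text \<open>The bounded self-adjoint operators on \<open>H\<close> with the Jordan product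
  \<open>(ST + TS)/2\<close> and the operator norm. Operators are represented by functions that are
  \<^term>\<open>undefined\<close> outside \<^term>\<open>carrier H\<close>, so that equality of operators is equality
  of functions.\<close>

definition bounded_selfadjoint_ops :: "('h, 'b) hilbert_scheme \<Rightarrow> ('h \<Rightarrow> 'h) normed_algebra" where
  "bounded_selfadjoint_ops H = \<lparr>
     carrier = {T \<in> carrier H \<rightarrow>\<^sub>E carrier H.
       (\<forall>u\<in>carrier H. \<forall>v\<in>carrier H. T (u \<oplus>\<^bsub>H\<^esub> v) = T u \<oplus>\<^bsub>H\<^esub> T v) \<and>
       (\<forall>c. \<forall>u\<in>carrier H. T (c \<odot>\<^bsub>H\<^esub> u) = c \<odot>\<^bsub>H\<^esub> T u) \<and>
       (\<exists>C. \<forall>u\<in>carrier H. hnorm H (T u) \<le> C * hnorm H u) \<and>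
       (\<forall>u\<in>carrier H. \<forall>v\<in>carrier H. inprod H (T u) v = inprod H u (T v))},
     monoid.mult = (\<lambda>S T. \<lambda>u\<in>carrier H. (1/2) \<odot>\<^bsub>H\<^esub> (S (T u) \<oplus>\<^bsub>H\<^esub> T (S u))),
     one = (\<lambda>u\<in>carrier H. u),
     zero = (\<lambda>u\<in>carrier H. \<zero>\<^bsub>H\<^esub>),
     add = (\<lambda>S T. \<lambda>u\<in>carrier H. S u \<oplus>\<^bsub>H\<^esub> T u),
     smult = (\<lambda>r T. \<lambda>u\<in>carrier H. complex_of_real r \<odot>\<^bsub>H\<^esub> T u),
     nrm = (\<lambda>T. SUP u\<in>{u \<in> carrier H. hnorm H u \<le> 1}. hnorm H (T u))\<rparr>"

definition closed_jordan_subalgebra :: "'a set \<Rightarrow> ('a, 'b) normed_algebra_scheme \<Rightarrow> bool" where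
  "closed_jordan_subalgebra K A \<longleftrightarrow> K \<subseteq> carrier A \<and> \<zero>\<^bsub>A\<^esub> \<in> K \<and>
     (\<forall>x\<in>K. \<forall>y\<in>K. x \<oplus>\<^bsub>A\<^esub> y \<in> K) \<and> (\<forall>r. \<forall>x\<in>K. r \<odot>\<^bsub>A\<^esub> x \<in> K) \<and>
     (\<forall>x\<in>K. \<forall>y\<in>K. x \<otimes>\<^bsub>A\<^esub> y \<in> K) \<and>
     (\<forall>s. \<forall>x\<in>carrier A. (\<forall>k::nat. s k \<in> K) \<longrightarrow> (\<lambda>k. nrm A (s k \<ominus>\<^bsub>A\<^esub> x)) \<longlonglongrightarrow> 0 \<longrightarrow> x \<in> K)"

definition isometrically_isomorphic ::
    "('a, 'c) normed_algebra_scheme \<Rightarrow> ('b, 'd) normed_algebra_scheme \<Rightarrow> bool" where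
  "isometrically_isomorphic J K \<longleftrightarrow> (\<exists>h\<in>jordan_hom J K. bij_betw h (carrier J) (carrier K) \<and>
     (\<forall>x\<in>carrier J. nrm K (h x) = nrm J x))"

text \<open>HOL cannot quantify over the type carrying the Hilbert space, so a type has to be fixed.
  The type \<^typ>\<open>'a \<Rightarrow> complex\<close> is large enough to lose no generality: if
  \<open>J \<noteq> 0\<close> has its carrier in \<^typ>\<open>'a\<close> and is a norm-closed Jordan subalgebra of
  \<open>B(H)\<^sub>s\<^sub>a\<close>, then \<open>H\<close> has a subspace \<open>H'\<close> that is reducing for \<open>J\<close>, has an orthonormal
  basis of cardinality at most that of \<^typ>\<open>'a\<close>, and on which \<open>J\<close> acts isometrically
  (choose for every \<open>T \<in> J\<close> a norming sequence of unit vectors and take the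
  closed \<open>J\<close>-invariant subspace generated by all of them). By its Fourier coefficients \<open>H'\<close> is
  isomorphic to a Hilbert space whose carrier is a set of functions from \<^typ>\<open>'a\<close> to the
  complex numbers. If \<open>J = 0\<close>, take \<open>H = 0\<close>.\<close>

definition jc_algebra :: "'a normed_algebra \<Rightarrow> bool" where
  "jc_algebra J \<longleftrightarrow> jb_algebra J \<and>
     (\<exists>(H :: ('a \<Rightarrow> complex) hilbert) K. hilbert_space H \<and>
        closed_jordan_subalgebra K (bounded_selfadjoint_ops H) \<and>
        isometrically_isomorphic J ((bounded_selfadjoint_ops H)\<lparr>carrier := K\<rparr>))"


section \<open>The free unital real Jordan algebra\<close>

text \<open>The free algebra is constructed as terms modulo the congruence generated by the axioms
  of unital real Jordan algebras; \<open>free_jordan_universal\<close> below is its universal property.\<close>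

datatype (jvars: 'v) jterm =
    JVar 'v | JZero | JOne
  | JAdd "'v jterm" "'v jterm"
  | JScale real "'v jterm"
  | JMult "'v jterm" "'v jterm"

inductive jeq :: "'v jterm \<Rightarrow> 'v jterm \<Rightarrow> bool" where
  jeq_refl: "jeq s s"
| jeq_sym: "jeq s t \<Longrightarrow> jeq t s"
| jeq_trans: "jeq s t \<Longrightarrow> jeq t u \<Longrightarrow> jeq s u"
| jeq_add: "jeq s s' \<Longrightarrow> jeq t t' \<Longrightarrow> jeq (JAdd s t) (JAdd s' t')"
| jeq_scale: "jeq s s' \<Longrightarrow> jeq (JScale r s) (JScale r s')"
| jeq_mult: "jeq s s' \<Longrightarrow> jeq t t' \<Longrightarrow> jeq (JMult s t) (JMult s' t')"
| jeq_add_assoc: "jeq (JAdd (JAdd s t) u) (JAdd s (JAdd t u))"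
| jeq_add_comm: "jeq (JAdd s t) (JAdd t s)"
| jeq_add_zero: "jeq (JAdd JZero s) s"
| jeq_add_neg: "jeq (JAdd (JScale (- 1) s) s) JZero"
| jeq_scale_l_distr: "jeq (JScale (q + r) s) (JAdd (JScale q s) (JScale r s))"
| jeq_scale_r_distr: "jeq (JScale r (JAdd s t)) (JAdd (JScale r s) (JScale r t))"
| jeq_scale_assoc: "jeq (JScale (q * r) s) (JScale q (JScale r s))"
| jeq_scale_one: "jeq (JScale 1 s) s"
| jeq_mult_comm: "jeq (JMult s t) (JMult t s)"
| jeq_mult_distr: "jeq (JMult (JAdd s t) u) (JAdd (JMult s u) (JMult t u))"
| jeq_mult_scale: "jeq (JMult (JScale r s) t) (JScale r (JMult s t))"
| jeq_mult_one: "jeq (JMult JOne s) s"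
| jeq_jordan: "jeq (JMult s (JMult t (JMult s s))) (JMult (JMult s t) (JMult s s))"

definition jterms :: "'v set \<Rightarrow> 'v jterm set" where
  "jterms V = {t. jvars t \<subseteq> V}"

definition jrel :: "'v set \<Rightarrow> ('v jterm \<times> 'v jterm) set" where
  "jrel V = {(s, t). s \<in> jterms V \<and> t \<in> jterms V \<and> jeq s t}"

definition jclass :: "'v set \<Rightarrow> 'v jterm \<Rightarrow> 'v jterm set" where
  "jclass V t = jrel V `` {t}"

definition free_jordan :: "'v set \<Rightarrow> (real, 'v jterm set) module" where
  "free_jordan V = \<lparr>carrier = jterms V // jrel V,
     monoid.mult = (\<lambda>A B. \<Union>s\<in>A. \<Union>t\<in>B. jclass V (JMult s t)),
     one = jclass V JOne,
     zero = jclass V JZero,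
     add = (\<lambda>A B. \<Union>s\<in>A. \<Union>t\<in>B. jclass V (JAdd s t)),
     smult = (\<lambda>r A. \<Union>s\<in>A. jclass V (JScale r s))\<rparr>"

text \<open>The value \<open>F(a)\<close> in a unital Jordan algebra; by \<open>free_jordan_universal\<close> it does not
  depend on the choice of the homomorphism.\<close>

definition jeval_unital ::
    "'v set \<Rightarrow> (real, 'a, 'b) module_scheme \<Rightarrow> ('v \<Rightarrow> 'a) \<Rightarrow> 'v jterm set \<Rightarrow> 'a" where
  "jeval_unital V J a F =
     (SOME h. h \<in> unital_jordan_hom (free_jordan V) J \<and> (\<forall>v\<in>V. h (jclass V (JVar v)) = a v)) F"

definition jordan_poly_vanishes ::
    "'v set \<Rightarrow> (real, 'a, 'b) module_scheme \<Rightarrow> 'v jterm set \<Rightarrow> ('v \<Rightarrow> 'a) \<Rightarrow> bool" where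
  "jordan_poly_vanishes V J F a \<longleftrightarrow>
     (if has_unit J then jeval_unital V (with_unit J) a F = \<zero>\<^bsub>J\<^esub>
      else jeval_unital V (unitization J) (\<lambda>v. (0, a v)) F = \<zero>\<^bsub>unitization J\<^esub>)"

primrec jhomogeneous :: "'v \<Rightarrow> nat \<Rightarrow> 'v jterm \<Rightarrow> bool" where
  "jhomogeneous v d (JVar w) \<longleftrightarrow> d = (if w = v then 1 else 0)"
| "jhomogeneous v d JZero \<longleftrightarrow> True"
| "jhomogeneous v d JOne \<longleftrightarrow> d = 0"
| "jhomogeneous v d (JAdd s t) \<longleftrightarrow> jhomogeneous v d s \<and> jhomogeneous v d t"
| "jhomogeneous v d (JScale r s) \<longleftrightarrow> jhomogeneous v d s"
| "jhomogeneous v d (JMult s t) \<longleftrightarrow> (\<exists>i j. d = i + j \<and> jhomogeneous v i s \<and> jhomogeneous v j t)"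

text \<open>The elements that are homogeneous of degree \<open>d\<close> in \<open>v\<close>, that is, the span of the
  classes of the nonassociative monomials in which \<open>v\<close> occurs exactly \<open>d\<close> times.\<close>

definition homogeneous_part :: "'v set \<Rightarrow> 'v \<Rightarrow> nat \<Rightarrow> 'v jterm set set" where
  "homogeneous_part V v d = jclass V ` {t \<in> jterms V. jhomogeneous v d t}"

definition homogeneous_decomposition ::
    "'v set \<Rightarrow> 'v \<Rightarrow> 'v jterm set \<Rightarrow> (nat \<Rightarrow> 'v jterm set) \<Rightarrow> bool" where
  "homogeneous_decomposition V v F c \<longleftrightarrow>
     (\<forall>d. c d \<in> homogeneous_part V v d) \<and> finite {d. c d \<noteq> \<zero>\<^bsub>free_jordan V\<^esub>} \<and>
     F = (\<Oplus>\<^bsub>free_jordan V\<^esub>d\<in>{d. c d \<noteq> \<zero>\<^bsub>free_jordan V\<^esub>}. c d)"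

text \<open>Existence and uniqueness of the decomposition is \<open>homogeneous_decomposition_unique\<close>.\<close>

definition homogeneous_component :: "'v set \<Rightarrow> 'v \<Rightarrow> 'v jterm set \<Rightarrow> nat \<Rightarrow> 'v jterm set" where
  "homogeneous_component V v F = (THE c. homogeneous_decomposition V v F c)"

text \<open>As for univariate polynomials, the degree of the zero polynomial is 0.\<close>

definition jdegree :: "'v set \<Rightarrow> 'v \<Rightarrow> 'v jterm set \<Rightarrow> nat" where
  "jdegree V v F = Max (insert 0 {d. homogeneous_component V v F d \<noteq> \<zero>\<^bsub>free_jordan V\<^esub>})"

subsection \<open>Universal property of the free algebra\<close>

lemma jterms_simps [simp]:
  "JVar v \<in> jterms V \<longleftrightarrow> v \<in> V" "JZero \<in> jterms V" "JOne \<in> jterms V"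
  "JAdd s t \<in> jterms V \<longleftrightarrow> s \<in> jterms V \<and> t \<in> jterms V"
  "JScale r s \<in> jterms V \<longleftrightarrow> s \<in> jterms V"
  "JMult s t \<in> jterms V \<longleftrightarrow> s \<in> jterms V \<and> t \<in> jterms V"
  by (auto simp: jterms_def)

lemma equiv_jrel: "equiv (jterms V) (jrel V)"
  by (intro equivI refl_onI symI transI) (auto simp: jrel_def intro: jeq.intros)

lemma jclass_eq_iff:
  "\<lbrakk>s \<in> jterms V; t \<in> jterms V\<rbrakk> \<Longrightarrow> jclass V s = jclass V t \<longleftrightarrow> jeq s t"
  unfolding jclass_def using eq_equiv_class_iff [OF equiv_jrel] by (auto simp: jrel_def)

lemma jclass_self: "s \<in> jterms V \<Longrightarrow> s \<in> jclass V s"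
  by (simp add: jclass_def jrel_def jeq_refl)

lemma free_jordan_carrier: "carrier (free_jordan V) = jclass V ` jterms V"
  by (auto simp: free_jordan_def quotient_def jclass_def)

lemma free_jordan_carrierE:
  assumes "A \<in> carrier (free_jordan V)"
  obtains t where "t \<in> jterms V" "A = jclass V t"
  using assms by (auto simp: free_jordan_carrier)

lemma jclass_closed [simp, intro]: "t \<in> jterms V \<Longrightarrow> jclass V t \<in> carrier (free_jordan V)"
  by (simp add: free_jordan_carrier)

lemma free_jordan_ops:
  "\<one>\<^bsub>free_jordan V\<^esub> = jclass V JOne" "\<zero>\<^bsub>free_jordan V\<^esub> = jclass V JZero"
  "\<lbrakk>s \<in> jterms V; t \<in> jterms V\<rbrakk>
     \<Longrightarrow> jclass V s \<oplus>\<^bsub>free_jordan V\<^esub> jclass V t = jclass V (JAdd s t)"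
  "\<lbrakk>s \<in> jterms V; t \<in> jterms V\<rbrakk>
     \<Longrightarrow> jclass V s \<otimes>\<^bsub>free_jordan V\<^esub> jclass V t = jclass V (JMult s t)"
  "s \<in> jterms V \<Longrightarrow> r \<odot>\<^bsub>free_jordan V\<^esub> jclass V s = jclass V (JScale r s)"
proof -
  show "jclass V s \<oplus>\<^bsub>free_jordan V\<^esub> jclass V t = jclass V (JAdd s t)"
    if "s \<in> jterms V" "t \<in> jterms V"
  proof -
    have "congruent2 (jrel V) (jrel V) (\<lambda>s t. jclass V (JAdd s t))"
      by (rule congruent2I') (auto simp: jrel_def jclass_eq_iff intro: jeq.intros)
    from UN_equiv_class2 [OF equiv_jrel equiv_jrel this that]
    show ?thesis by (simp add: free_jordan_def jclass_def)
  qed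
  show "jclass V s \<otimes>\<^bsub>free_jordan V\<^esub> jclass V t = jclass V (JMult s t)"
    if "s \<in> jterms V" "t \<in> jterms V"
  proof -
    have "congruent2 (jrel V) (jrel V) (\<lambda>s t. jclass V (JMult s t))"
      by (rule congruent2I') (auto simp: jrel_def jclass_eq_iff intro: jeq.intros)
    from UN_equiv_class2 [OF equiv_jrel equiv_jrel this that]
    show ?thesis by (simp add: free_jordan_def jclass_def)
  qed
  show "r \<odot>\<^bsub>free_jordan V\<^esub> jclass V s = jclass V (JScale r s)" if "s \<in> jterms V"
  proof -
    have "congruent (jrel V) (\<lambda>s. jclass V (JScale r s))"
      by (rule congruentI) (auto simp: jrel_def jclass_eq_iff intro: jeq.intros)
    from UN_equiv_class [OF equiv_jrel this that]
    show ?thesis by (simp add: free_jordan_def jclass_def)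
  qed
qed (simp_all add: free_jordan_def)

lemma unital_jordan_algebra_free_jordan: "unital_jordan_algebra (free_jordan V)"
proof -
  let ?F = "free_jordan V"
  have ag: "abelian_group ?F"
  proof (rule abelian_groupI)
    fix x assume "x \<in> carrier ?F"
    then obtain t where t: "t \<in> jterms V" "x = jclass V t" by (rule free_jordan_carrierE)
    show "\<exists>y\<in>carrier ?F. y \<oplus>\<^bsub>?F\<^esub> x = \<zero>\<^bsub>?F\<^esub>"
      by (rule bexI [of _ "jclass V (JScale (- 1) t)"])
         (use t in \<open>simp_all add: free_jordan_ops jclass_eq_iff jeq_add_neg\<close>)
  qed (auto elim!: free_jordan_carrierE simp: free_jordan_ops jclass_eq_iff intro: jeq.intros del: equalityI)
  interpret real_comm_algebra ?F
    by (rule real_comm_algebraI [OF ag])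
       (auto elim!: free_jordan_carrierE simp: free_jordan_ops jclass_eq_iff intro: jeq.intros del: equalityI)
  show ?thesis
    by unfold_locales
       (auto elim!: free_jordan_carrierE simp: free_jordan_ops jclass_eq_iff intro: jeq.intros del: equalityI)
qed

primrec jterm_eval :: "(real, 'a, 'b) module_scheme \<Rightarrow> ('v \<Rightarrow> 'a) \<Rightarrow> 'v jterm \<Rightarrow> 'a" where
  "jterm_eval J a (JVar v) = a v"
| "jterm_eval J a JZero = \<zero>\<^bsub>J\<^esub>"
| "jterm_eval J a JOne = \<one>\<^bsub>J\<^esub>"
| "jterm_eval J a (JAdd s t) = jterm_eval J a s \<oplus>\<^bsub>J\<^esub> jterm_eval J a t"
| "jterm_eval J a (JScale r s) = r \<odot>\<^bsub>J\<^esub> jterm_eval J a s"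
| "jterm_eval J a (JMult s t) = jterm_eval J a s \<otimes>\<^bsub>J\<^esub> jterm_eval J a t"

context unital_jordan_algebra
begin

lemma jterm_eval_closed:
  "(\<And>v. a v \<in> carrier J) \<Longrightarrow> jterm_eval J a t \<in> carrier J"
  by (induction t) auto

lemma jterm_eval_cong: "(\<And>v. v \<in> jvars t \<Longrightarrow> a v = b v) \<Longrightarrow> jterm_eval J a t = jterm_eval J b t"
  by (induction t) auto

lemma jterm_eval_jeq:
  assumes "jeq s t" and a: "\<And>v. a v \<in> carrier J"
  shows "jterm_eval J a s = jterm_eval J a t"
  using assms(1)
proof induction
  case (jeq_mult_comm s t)
  show ?case by (simp add: m_comm jterm_eval_closed a)
next
  case (jeq_add_neg s)
  show ?case by (simp add: rscale_minus_one jterm_eval_closed a)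
next
  case (jeq_jordan s t)
  show ?case by (simp add: jordan_identity jterm_eval_closed a)
qed (simp_all add: jterm_eval_closed a M.a_ac rscale_l_distr rscale_r_distr rscale_assoc
       m_l_distr m_smult_l)

lemma unital_jordan_hom_jclass:
  assumes h: "h \<in> unital_jordan_hom (free_jordan V) J" "\<forall>v\<in>V. h (jclass V (JVar v)) = a v"
    and "t \<in> jterms V"
  shows "h (jclass V t) = jterm_eval J a t"
  using assms(3)
proof (induction t)
  case JZero
  interpret F: unital_jordan_algebra "free_jordan V" by (rule unital_jordan_algebra_free_jordan)
  have "h (0 \<odot>\<^bsub>free_jordan V\<^esub> \<one>\<^bsub>free_jordan V\<^esub>) = 0 \<odot> h \<one>\<^bsub>free_jordan V\<^esub>"
    using h(1) F.j_one_closed unfolding unital_jordan_hom_def jordan_hom_def by blast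
  moreover have "h \<one>\<^bsub>free_jordan V\<^esub> = \<one>" using h(1) by (auto simp: unital_jordan_hom_def)
  ultimately show ?case by (simp add: free_jordan_ops(2))
qed (use h in \<open>simp_all add: unital_jordan_hom_def jordan_hom_def
       free_jordan_ops(1) free_jordan_ops(3-5) [symmetric]\<close>)

lemma free_jordan_universal:
  assumes a: "\<And>v. v \<in> V \<Longrightarrow> a v \<in> carrier J"
  shows "\<exists>h\<in>unital_jordan_hom (free_jordan V) J. \<forall>v\<in>V. h (jclass V (JVar v)) = a v"
    and "\<lbrakk>g \<in> unital_jordan_hom (free_jordan V) J; \<forall>v\<in>V. g (jclass V (JVar v)) = a v;
          h \<in> unital_jordan_hom (free_jordan V) J; \<forall>v\<in>V. h (jclass V (JVar v)) = a v;
          F \<in> carrier (free_jordan V)\<rbrakk> \<Longrightarrow> g F = h F"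
proof -
  define b where "b v = (if v \<in> V then a v else \<zero>)" for v
  have b: "b v \<in> carrier J" for v by (simp add: b_def a)
  define h where "h A = jterm_eval J b (SOME t. t \<in> A)" for A
  have h: "h (jclass V t) = jterm_eval J b t" if "t \<in> jterms V" for t
  proof -
    have "(SOME s. s \<in> jclass V t) \<in> jclass V t" using jclass_self [OF that] by (rule someI)
    then show ?thesis
      unfolding h_def by (metis (no_types, lifting) ImageE b case_prodD jclass_def jrel_def
          jterm_eval_jeq mem_Collect_eq singletonD)
  qed
  have "h \<in> unital_jordan_hom (free_jordan V) J"
    by (auto simp: unital_jordan_hom_def jordan_hom_def free_jordan_ops h jterm_eval_closed b
        elim!: free_jordan_carrierE)
  moreover have "\<forall>v\<in>V. h (jclass V (JVar v)) = a v" by (simp add: h b_def)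
  ultimately show "\<exists>h\<in>unital_jordan_hom (free_jordan V) J. \<forall>v\<in>V. h (jclass V (JVar v)) = a v"
    by blast
next
  show "g F = h F"
    if "g \<in> unital_jordan_hom (free_jordan V) J" "\<forall>v\<in>V. g (jclass V (JVar v)) = a v"
      "h \<in> unital_jordan_hom (free_jordan V) J" "\<forall>v\<in>V. h (jclass V (JVar v)) = a v"
      "F \<in> carrier (free_jordan V)"
    using that by (metis unital_jordan_hom_jclass free_jordan_carrierE)
qed

lemma jeval_unital_jclass:
  assumes a: "\<And>v. v \<in> V \<Longrightarrow> a v \<in> carrier J" and t: "t \<in> jterms V"
  shows "jeval_unital V J a (jclass V t) = jterm_eval J a t"
proof -
  define h where "h = (SOME h. h \<in> unital_jordan_hom (free_jordan V) J \<and> (\<forall>v\<in>V. h (jclass V (JVar v)) = a v))"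
  have "\<exists>h. h \<in> unital_jordan_hom (free_jordan V) J \<and> (\<forall>v\<in>V. h (jclass V (JVar v)) = a v)"
    using free_jordan_universal(1) [of V a] a by blast
  then have h: "h \<in> unital_jordan_hom (free_jordan V) J \<and> (\<forall>v\<in>V. h (jclass V (JVar v)) = a v)"
    unfolding h_def by (rule someI_ex)
  have "h (jclass V t) = jterm_eval J a t"
    using unital_jordan_hom_jclass h t by blast
  then show ?thesis by (simp add: jeval_unital_def h_def)
qed

end

subsection \<open>Grading of the free algebra\<close>

interpretation free_jordan: unital_jordan_algebra "free_jordan V" for V
  by (rule unital_jordan_algebra_free_jordan)

lemma homogeneous_part_closed: "x \<in> homogeneous_part V v d \<Longrightarrow> x \<in> carrier (free_jordan V)"
  by (auto simp: homogeneous_part_def)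

lemma homogeneous_part_zero: "\<zero>\<^bsub>free_jordan V\<^esub> \<in> homogeneous_part V v d"
  by (auto simp: homogeneous_part_def free_jordan_ops)

lemma homogeneous_part_add:
  "\<lbrakk>x \<in> homogeneous_part V v d; y \<in> homogeneous_part V v d\<rbrakk>
     \<Longrightarrow> x \<oplus>\<^bsub>free_jordan V\<^esub> y \<in> homogeneous_part V v d"
  by (auto simp: homogeneous_part_def free_jordan_ops)

lemma homogeneous_part_scale:
  "x \<in> homogeneous_part V v d \<Longrightarrow> r \<odot>\<^bsub>free_jordan V\<^esub> x \<in> homogeneous_part V v d"
  by (auto simp: homogeneous_part_def free_jordan_ops)

lemma homogeneous_part_mult:
  "\<lbrakk>x \<in> homogeneous_part V v i; y \<in> homogeneous_part V v j\<rbrakk>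
     \<Longrightarrow> x \<otimes>\<^bsub>free_jordan V\<^esub> y \<in> homogeneous_part V v (i + j)"
  by (fastforce simp: homogeneous_part_def free_jordan_ops)

lemma homogeneous_decompositionI:
  assumes c: "\<And>d. c d \<in> homogeneous_part V v d" and A: "finite A"
    and "\<And>d. d \<notin> A \<Longrightarrow> c d = \<zero>\<^bsub>free_jordan V\<^esub>"
    and F: "F = (\<Oplus>\<^bsub>free_jordan V\<^esub>d\<in>A. c d)"
  shows "homogeneous_decomposition V v F c"
proof -
  let ?S = "{d. c d \<noteq> \<zero>\<^bsub>free_jordan V\<^esub>}"
  have S: "?S \<subseteq> A" using assms(3) by auto
  then have "finite ?S" using A by (rule finite_subset)
  moreover have "(\<Oplus>\<^bsub>free_jordan V\<^esub>d\<in>?S. c d) = (\<Oplus>\<^bsub>free_jordan V\<^esub>d\<in>A. c d)"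
    using homogeneous_part_closed [OF c]
    by (intro free_jordan.add.finprod_mono_neutral_cong_left A S) auto
  ultimately show ?thesis using c F by (simp add: homogeneous_decomposition_def)
qed

lemma homogeneous_decompositionE:
  assumes "homogeneous_decomposition V v F c" "finite A"
    and "\<And>d. d \<notin> A \<Longrightarrow> c d = \<zero>\<^bsub>free_jordan V\<^esub>"
  shows "F = (\<Oplus>\<^bsub>free_jordan V\<^esub>d\<in>A. c d)"
proof -
  let ?S = "{d. c d \<noteq> \<zero>\<^bsub>free_jordan V\<^esub>}"
  have S: "?S \<subseteq> A" using assms(3) by auto
  have "(\<Oplus>\<^bsub>free_jordan V\<^esub>d\<in>?S. c d) = (\<Oplus>\<^bsub>free_jordan V\<^esub>d\<in>A. c d)"
    using assms(1)
    by (intro free_jordan.add.finprod_mono_neutral_cong_left assms(2) S)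
       (auto simp: homogeneous_decomposition_def intro: homogeneous_part_closed)
  then show ?thesis using assms(1) by (simp add: homogeneous_decomposition_def)
qed

lemma homogeneous_decomposition_add:
  assumes "homogeneous_decomposition V v F c" "homogeneous_decomposition V v G b"
  shows "homogeneous_decomposition V v (F \<oplus>\<^bsub>free_jordan V\<^esub> G) (\<lambda>d. c d \<oplus>\<^bsub>free_jordan V\<^esub> b d)"
proof -
  let ?A = "{d. c d \<noteq> \<zero>\<^bsub>free_jordan V\<^esub>} \<union> {d. b d \<noteq> \<zero>\<^bsub>free_jordan V\<^esub>}"
  have c: "\<And>d. c d \<in> homogeneous_part V v d" and b: "\<And>d. b d \<in> homogeneous_part V v d"
    and A: "finite ?A"
    using assms by (auto simp: homogeneous_decomposition_def)
  have "F = (\<Oplus>\<^bsub>free_jordan V\<^esub>d\<in>?A. c d)" "G = (\<Oplus>\<^bsub>free_jordan V\<^esub>d\<in>?A. b d)"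
    by (rule homogeneous_decompositionE [OF assms(1) A] homogeneous_decompositionE [OF assms(2) A];
        simp)+
  then have "F \<oplus>\<^bsub>free_jordan V\<^esub> G = (\<Oplus>\<^bsub>free_jordan V\<^esub>d\<in>?A. c d \<oplus>\<^bsub>free_jordan V\<^esub> b d)"
    using homogeneous_part_closed [OF c] homogeneous_part_closed [OF b]
    by (simp add: free_jordan.finsum_addf)
  with A c b show ?thesis
    by (intro homogeneous_decompositionI [where A = ?A] homogeneous_part_add) auto
qed

inductive_set homogeneous_sums :: "'v set \<Rightarrow> 'v \<Rightarrow> 'v jterm set set" for V v where
  homogeneous_sums_part: "x \<in> homogeneous_part V v d \<Longrightarrow> x \<in> homogeneous_sums V v"
| homogeneous_sums_add: "\<lbrakk>x \<in> homogeneous_sums V v; y \<in> homogeneous_sums V v\<rbrakk>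
    \<Longrightarrow> x \<oplus>\<^bsub>free_jordan V\<^esub> y \<in> homogeneous_sums V v"

lemma homogeneous_sums_closed: "x \<in> homogeneous_sums V v \<Longrightarrow> x \<in> carrier (free_jordan V)"
  by (induction rule: homogeneous_sums.induct) (auto intro: homogeneous_part_closed)

lemma homogeneous_sums_scale:
  "x \<in> homogeneous_sums V v \<Longrightarrow> r \<odot>\<^bsub>free_jordan V\<^esub> x \<in> homogeneous_sums V v"
  by (induction rule: homogeneous_sums.induct)
     (auto simp: free_jordan.rscale_r_distr homogeneous_sums_closed
       intro: homogeneous_sums.intros homogeneous_part_scale)

lemma homogeneous_sums_mult:
  assumes "x \<in> homogeneous_sums V v" "y \<in> homogeneous_sums V v"
  shows "x \<otimes>\<^bsub>free_jordan V\<^esub> y \<in> homogeneous_sums V v"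
  using assms(1)
proof induction
  case (homogeneous_sums_part x d)
  from assms(2) show ?case
  proof induction
    case (homogeneous_sums_part y e)
    then show ?case
      using homogeneous_part_mult [OF \<open>x \<in> homogeneous_part V v d\<close>]
      by (blast intro: homogeneous_sums.intros)
  next
    case (homogeneous_sums_add y z)
    then show ?case
      using homogeneous_part_closed [OF \<open>x \<in> homogeneous_part V v d\<close>]
      by (simp add: free_jordan.m_r_distr homogeneous_sums_closed homogeneous_sums.intros(2))
  qed
next
  case (homogeneous_sums_add x z)
  then show ?case
    using assms(2)
    by (simp add: free_jordan.m_l_distr homogeneous_sums_closed homogeneous_sums.intros(2))
qed

lemma carrier_homogeneous_sums: "t \<in> jterms V \<Longrightarrow> jclass V t \<in> homogeneous_sums V v"
proof (induction t)
  case (JVar w)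
  then show ?case
    by (intro homogeneous_sums_part [of _ _ _ "if w = v then 1 else 0"])
       (auto simp: homogeneous_part_def)
next
  case JZero
  then show ?case
    by (intro homogeneous_sums_part [of _ _ _ 0]) (auto simp: homogeneous_part_def)
next
  case JOne
  then show ?case
    by (intro homogeneous_sums_part [of _ _ _ 0]) (auto simp: homogeneous_part_def)
next
  case (JAdd s t)
  then show ?case
    using homogeneous_sums_add by (force simp: free_jordan_ops(3) [symmetric])
next
  case (JScale r t)
  then show ?case
    using homogeneous_sums_scale by (force simp: free_jordan_ops(5) [symmetric])
next
  case (JMult s t)
  then show ?case
    using homogeneous_sums_mult by (force simp: free_jordan_ops(4) [symmetric])
qed

lemma homogeneous_decomposition_exists:
  assumes "F \<in> carrier (free_jordan V)"
  shows "\<exists>c. homogeneous_decomposition V v F c"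
proof -
  have "F \<in> homogeneous_sums V v"
    using assms carrier_homogeneous_sums by (metis free_jordan_carrierE)
  then show ?thesis
  proof induction
    case (homogeneous_sums_part x d)
    then have "homogeneous_decomposition V v x (\<lambda>i. if i = d then x else \<zero>\<^bsub>free_jordan V\<^esub>)"
      by (intro homogeneous_decompositionI [where A = "{d}"])
         (auto simp: homogeneous_part_zero homogeneous_part_closed)
    then show ?case by blast
  qed (blast intro: homogeneous_decomposition_add)
qed

lemma homogeneous_sum_zero:
  assumes "\<And>d. c d \<in> homogeneous_part V v d"
    and "(\<Oplus>\<^bsub>free_jordan V\<^esub>d\<in>{..N::nat}. c d) = \<zero>\<^bsub>free_jordan V\<^esub>" and "d \<le> N"
  shows "c d = \<zero>\<^bsub>free_jordan V\<^esub>"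
proof -
  let ?F = "free_jordan V"
  define a where "a w = (if w = v then 2 else 1) \<odot>\<^bsub>?F\<^esub> jclass V (JVar w)" for w
  obtain h where h: "h \<in> unital_jordan_hom ?F ?F" "\<forall>w\<in>V. h (jclass V (JVar w)) = a w"
    using free_jordan.free_jordan_universal(1) [of V a V] by (auto simp: a_def)
  have eval: "jterm_eval ?F a t = 2 ^ d \<odot>\<^bsub>?F\<^esub> jclass V t"
    if "t \<in> jterms V" "jhomogeneous v d t" for t d
    using that
  proof (induction t arbitrary: d)
    case JZero
    then show ?case by (simp add: free_jordan_ops(2) [symmetric])
  next
    case (JScale r t)
    then show ?case
      by (simp add: free_jordan_ops(5) [symmetric] free_jordan.rscale_assoc [symmetric] mult.commute)
  next
    case (JMult s t)
    then show ?case
      by (auto simp: free_jordan_ops(4) [symmetric] free_jordan.m_smult_l free_jordan.m_smult_r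
          free_jordan.rscale_assoc [symmetric] power_add mult.commute)
  qed (auto simp: a_def free_jordan_ops(1) free_jordan_ops(3) [symmetric] free_jordan.rscale_r_distr)
  have h_part: "h x = 2 ^ d \<odot>\<^bsub>?F\<^esub> x" if "x \<in> homogeneous_part V v d" for x d
    using that free_jordan.unital_jordan_hom_jclass [OF h] eval
    by (auto simp: homogeneous_part_def)
  have h_zero: "h \<zero>\<^bsub>?F\<^esub> = \<zero>\<^bsub>?F\<^esub>"
    using h_part [OF homogeneous_part_zero] by simp
  have h_sum: "h (\<Oplus>\<^bsub>?F\<^esub>d\<in>A. c d) = (\<Oplus>\<^bsub>?F\<^esub>d\<in>A. h (c d))"
    if "finite A" "\<And>d. c d \<in> carrier ?F" for A :: "nat set" and c
    using that(1)
  proof induction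
    case (insert i A)
    have h_closed: "h x \<in> carrier ?F" if "x \<in> carrier ?F" for x
      using h(1) that by (auto simp: unital_jordan_hom_def jordan_hom_def)
    have "h (c i \<oplus>\<^bsub>?F\<^esub> (\<Oplus>\<^bsub>?F\<^esub>d\<in>A. c d)) = h (c i) \<oplus>\<^bsub>?F\<^esub> h (\<Oplus>\<^bsub>?F\<^esub>d\<in>A. c d)"
      using h(1) that(2) free_jordan.finsum_closed [of c A]
      by (auto simp: unital_jordan_hom_def jordan_hom_def)
    with insert show ?case
      by (simp add: free_jordan.finsum_insert that(2) h_closed)
  qed (simp add: h_zero)
  show ?thesis
    using assms
  proof (induction N arbitrary: c d)
    case 0
    then show ?case using homogeneous_part_closed [OF "0.prems"(1)] by simp
  next
    case (Suc N)
    note [simp] = homogeneous_part_closed [OF Suc.prems(1)]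
    define b where "b d = (2 ^ d - 2 ^ Suc N) \<odot>\<^bsub>?F\<^esub> c d" for d
    have b: "b d \<in> homogeneous_part V v d" for d
      unfolding b_def by (intro homogeneous_part_scale Suc.prems)
    note [simp] = homogeneous_part_closed [OF b]
    have "b d = h (c d) \<oplus>\<^bsub>?F\<^esub> (- (2 ^ Suc N)) \<odot>\<^bsub>?F\<^esub> c d" for d
      unfolding b_def h_part [OF Suc.prems(1)]
      using free_jordan.rscale_l_distr [of "c d" V "2 ^ d" "- (2 ^ Suc N)"] by simp
    then have "(\<Oplus>\<^bsub>?F\<^esub>d\<in>{..Suc N}. b d)
        = (\<Oplus>\<^bsub>?F\<^esub>d\<in>{..Suc N}. h (c d)) \<oplus>\<^bsub>?F\<^esub> (\<Oplus>\<^bsub>?F\<^esub>d\<in>{..Suc N}. (- (2 ^ Suc N)) \<odot>\<^bsub>?F\<^esub> c d)"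
      by (simp add: free_jordan.finsum_addf h_part [OF Suc.prems(1)] del: free_jordan.finsum_Suc)
    also have "\<dots> = h (\<Oplus>\<^bsub>?F\<^esub>d\<in>{..Suc N}. c d) \<oplus>\<^bsub>?F\<^esub> (- (2 ^ Suc N)) \<odot>\<^bsub>?F\<^esub> (\<Oplus>\<^bsub>?F\<^esub>d\<in>{..Suc N}. c d)"
      by (simp add: h_sum free_jordan.finsum_smult_ldistr del: free_jordan.finsum_Suc)
    also have "\<dots> = \<zero>\<^bsub>?F\<^esub>" by (simp only: Suc.prems(2) h_zero) simp
    finally have "(\<Oplus>\<^bsub>?F\<^esub>d\<in>{..N}. b d) = \<zero>\<^bsub>?F\<^esub>"
      by (simp add: free_jordan.finsum_Suc b_def)
    from Suc.IH [OF b this] have b0: "b d = \<zero>\<^bsub>?F\<^esub>" if "d \<le> N" for d using that .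
    have c0: "c d = \<zero>\<^bsub>?F\<^esub>" if "d \<le> N" for d
    proof -
      have "(2::real) ^ d < 2 ^ Suc N" using that by (intro power_strict_increasing) auto
      then have "c d = inverse (2 ^ d - 2 ^ Suc N) \<odot>\<^bsub>?F\<^esub> b d"
        unfolding b_def by (subst free_jordan.rscale_assoc [symmetric]) auto
      then show ?thesis by (simp add: b0 [OF that])
    qed
    have "(\<Oplus>\<^bsub>?F\<^esub>d\<in>{..N}. c d) = (\<Oplus>\<^bsub>?F\<^esub>d\<in>{..N}. \<zero>\<^bsub>?F\<^esub>)"
      by (rule free_jordan.finsum_cong') (auto simp: c0)
    then have "c (Suc N) = \<zero>\<^bsub>?F\<^esub>"
      using Suc.prems(2) by (simp add: free_jordan.finsum_Suc)
    with c0 Suc.prems(3) show ?case by (cases "d = Suc N") auto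
  qed
qed

lemma homogeneous_decomposition_unique:
  assumes "F \<in> carrier (free_jordan V)"
  shows "\<exists>!c. homogeneous_decomposition V v F c"
proof (rule ex_ex1I [OF homogeneous_decomposition_exists [OF assms]])
  fix c b
  let ?F = "free_jordan V"
  assume *: "homogeneous_decomposition V v F c" "homogeneous_decomposition V v F b"
  then have cb: "\<And>d. c d \<in> homogeneous_part V v d" "\<And>d. b d \<in> homogeneous_part V v d"
    and "finite ({d. c d \<noteq> \<zero>\<^bsub>?F\<^esub>} \<union> {d. b d \<noteq> \<zero>\<^bsub>?F\<^esub>})"
    by (auto simp: homogeneous_decomposition_def)
  note [simp] = cb [THEN homogeneous_part_closed]
  obtain N where N: "\<And>d. d \<notin> {..N} \<Longrightarrow> c d = \<zero>\<^bsub>?F\<^esub> \<and> b d = \<zero>\<^bsub>?F\<^esub>"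
  proof -
    from \<open>finite _\<close> obtain N where "{d. c d \<noteq> \<zero>\<^bsub>?F\<^esub>} \<union> {d. b d \<noteq> \<zero>\<^bsub>?F\<^esub>} \<subseteq> {..N}"
      unfolding finite_nat_set_iff_bounded_le by blast
    then show ?thesis using that [of N] by blast
  qed
  have F: "F = (\<Oplus>\<^bsub>?F\<^esub>d\<in>{..N}. c d)" "F = (\<Oplus>\<^bsub>?F\<^esub>d\<in>{..N}. b d)"
    by (rule homogeneous_decompositionE [OF *(1)] homogeneous_decompositionE [OF *(2)];
        use N in auto)+
  have "(\<Oplus>\<^bsub>?F\<^esub>d\<in>{..N}. (- 1) \<odot>\<^bsub>?F\<^esub> c d \<oplus>\<^bsub>?F\<^esub> b d) = (- 1) \<odot>\<^bsub>?F\<^esub> F \<oplus>\<^bsub>?F\<^esub> F"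
    by (subst (1) F(1), subst F(2)) (simp add: free_jordan.finsum_addf free_jordan.finsum_smult_ldistr)
  also have "\<dots> = \<zero>\<^bsub>?F\<^esub>" using assms by (rule free_jordan.rscale_minus_one)
  finally have zero: "(\<Oplus>\<^bsub>?F\<^esub>d\<in>{..N}. (- 1) \<odot>\<^bsub>?F\<^esub> c d \<oplus>\<^bsub>?F\<^esub> b d) = \<zero>\<^bsub>?F\<^esub>" .
  show "c = b"
  proof
    fix d
    show "c d = b d"
    proof (cases "d \<le> N")
      case True
      have "(- 1) \<odot>\<^bsub>?F\<^esub> c d \<oplus>\<^bsub>?F\<^esub> b d = \<zero>\<^bsub>?F\<^esub>"
        by (rule homogeneous_sum_zero [where v = v, OF _ zero True])
           (intro homogeneous_part_add homogeneous_part_scale cb)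
      then have "b d \<oplus>\<^bsub>?F\<^esub> (- 1) \<odot>\<^bsub>?F\<^esub> c d = c d \<oplus>\<^bsub>?F\<^esub> (- 1) \<odot>\<^bsub>?F\<^esub> c d"
        using free_jordan.rscale_minus_one [of "c d" V] by (simp add: free_jordan.a_comm)
      then show ?thesis by simp
    qed (use N [of d] in auto)
  qed
qed


datatype jvar = VarX nat | VarY nat | VarZ

definition xyz_vars :: "nat \<Rightarrow> nat \<Rightarrow> jvar set" where
  "xyz_vars n m = VarX ` {1..n} \<union> VarY ` {1..m} \<union> {VarZ}"

primrec xyz_assign :: "(nat \<Rightarrow> 'a) \<Rightarrow> (nat \<Rightarrow> 'a) \<Rightarrow> 'a \<Rightarrow> jvar \<Rightarrow> 'a" where
  "xyz_assign x y z (VarX i) = x i"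
| "xyz_assign x y z (VarY j) = y j"
| "xyz_assign x y z VarZ = z"

end

theory Submission
  imports Defs "HOL-Library.Multiset" "HOL-Library.Function_Algebras" "HOL-Analysis.Product_Vector" "HOL-Analysis.L2_Norm"
begin

text \<open>In a JB-algebra two analytic facts hold that fail for general Jordan algebras. First, the
  operator commutant of an element is a subalgebra: an obstruction to this would be a derivation \<open>D\<close>
  with \<open>D\<^sup>m (b\<^sup>m) = m! w\<^sup>m\<close>, which the norm forbids unless \<open>w = 0\<close>, or else an element with vanishing
  square. Hence \<open>x\<^sub>1, \<dots>, x\<^sub>n\<close> generate a strongly associative subalgebra, and so do the \<open>y\<^sub>j\<close>.
  Secondly, an alternating trilinear expression \<open>w\<close> in one of these subalgebras, which is a derivation
  in each argument, vanishes: evaluated at the two components of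
  \<open>(1 + i n f / N)\<^sup>N\<close>, which stay bounded, it grows like \<open>n w(f, x, z)\<close>.

  These two facts make the multiplications by the \<open>x\<^sub>i\<close> and \<open>y\<^sub>j\<close> sums \<open>(lam + rho) / 2\<close> of formal left
  and right multiplications on an extension of the algebra by an odd part. Left multiplications commute
  with right ones, and within each of the two families of variables everything commutes. So the value of
  a polynomial linear in \<open>Z\<close> depends only on its associative expansion \<open>p Z q\<close>, with \<open>p\<close> and \<open>q\<close> read modulo
  these commutations; finite matrices supported on chains of two-by-two blocks already separate
  the words \<open>p\<close> and \<open>q\<close>, so the polynomials vanishing on JC-algebras have zero expansion.\<close>

section \<open>Multiplication operators\<close>

text \<open>A JB-algebra may be exceptional, so there need not be an associative envelope in which
  left and right multiplication by x could be formed. The odd part stands in for the skew elements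
  of an envelope: it is spanned by formal symbols for \<open>[y, j]/2\<close> and
  \<open>(y j z - z j y)/2\<close>, divided by the common kernel of two kinds of test functionals
  with values in the even part. Relations in the odd part thereby become identities between
  multiplication operators on the algebra itself. The operator calculus wants a type as its algebra,
  while JB-algebras are records. Identities are therefore proved in algebras presented by letters
  and relations, and reach a JB-algebra by evaluation of terms; only the relations have to be
  checked there, and this is where the norm enters. Two difficulties remain. The JC-algebras at hand
  live on the type \<open>'a\<close> of the given JB-algebra, so matrix algebras must be encoded
  into that type. And a polynomial of degree 1 in Z may contain a part of degree 0, which is brought
  to degree 1 by multiplication with Z.\<close>

class jordan = real_vector +
  fixes jmul :: "'a \<Rightarrow> 'a \<Rightarrow> 'a" (infixl "\<bullet>" 70)
    and junit :: 'a
  assumes jmul_comm: "x \<bullet> y = y \<bullet> x"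
    and jmul_add_left: "(x + y) \<bullet> z = x \<bullet> z + y \<bullet> z"
    and jmul_scaleR_left: "(r *\<^sub>R x) \<bullet> y = r *\<^sub>R (x \<bullet> y)"
    and junit_left: "junit \<bullet> x = x"
    and jordan_law: "x \<bullet> (y \<bullet> (x \<bullet> x)) = (x \<bullet> y) \<bullet> (x \<bullet> x)"

typedef (overloaded) 'a endo = "{f :: 'a::real_vector \<Rightarrow> 'a. linear f}"
  morphisms app Endo
  by (rule exI [of _ "\<lambda>x. x"]) (simp add: linear_ident)

setup_lifting type_definition_endo

instantiation endo :: (real_vector) real_algebra
begin
lift_definition zero_endo :: "'a endo" is "\<lambda>x. 0" by (simp add: linear_zero)
lift_definition plus_endo :: "'a endo \<Rightarrow> 'a endo \<Rightarrow> 'a endo" is "\<lambda>f g x. f x + g x"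
  by (rule linear_compose_add)
lift_definition minus_endo :: "'a endo \<Rightarrow> 'a endo \<Rightarrow> 'a endo" is "\<lambda>f g x. f x - g x"
  by (rule linear_compose_sub)
lift_definition uminus_endo :: "'a endo \<Rightarrow> 'a endo" is "\<lambda>f x. - f x"
  by (rule linear_compose_neg)
lift_definition scaleR_endo :: "real \<Rightarrow> 'a endo \<Rightarrow> 'a endo" is "\<lambda>r f x. r *\<^sub>R f x"
  by (rule linear_compose_scale_right)
lift_definition times_endo :: "'a endo \<Rightarrow> 'a endo \<Rightarrow> 'a endo" is "\<lambda>f g x. f (g x)"
  using linear_compose unfolding o_def by blast
instance
  by standard (transfer; auto simp: fun_eq_iff linear_add linear_scale algebra_simps)+
end

instantiation endo :: (real_vector) monoid_mult
begin
lift_definition one_endo :: "'a endo" is "\<lambda>x. x" by (simp add: linear_ident)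
instance by standard (transfer; simp)+
end

lemma endo_eqI: "(\<And>x. app f x = app g x) \<Longrightarrow> f = g"
  by transfer auto

lemma linear_app: "linear (app f)"
  using app [of f] by simp

lemma app_vec [simp]:
  "app f 0 = 0" "app f (x + y) = app f x + app f y" "app f (x - y) = app f x - app f y"
  "app f (- x) = - app f x" "app f (r *\<^sub>R x) = r *\<^sub>R app f x"
  using linear_app [of f] by (auto simp: linear_0 linear_add linear_diff linear_neg linear_scale)

lemma app_simps [simp]:
  "app 0 x = 0" "app (f + g) x = app f x + app g x" "app (f - g) x = app f x - app g x"
  "app (- f) x = - app f x" "app (r *\<^sub>R f) x = r *\<^sub>R app f x" "app (f * g) x = app f (app g x)"
  "app 1 x = x"
  by (simp_all add: zero_endo.rep_eq plus_endo.rep_eq minus_endo.rep_eq uminus_endo.rep_eq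
      scaleR_endo.rep_eq times_endo.rep_eq one_endo.rep_eq)

lemma app_Endo: "linear f \<Longrightarrow> app (Endo f) = f"
  by (simp add: Endo_inverse)

context jordan
begin

lemma jmul_add_right: "z \<bullet> (x + y) = z \<bullet> x + z \<bullet> y"
  using jmul_add_left jmul_comm by metis

lemma jmul_scaleR_right: "y \<bullet> (r *\<^sub>R x) = r *\<^sub>R (y \<bullet> x)"
  using jmul_scaleR_left jmul_comm by metis

end

lemma linear_jmul: "linear (\<lambda>y. x \<bullet> y :: 'a::jordan)"
  by (rule linearI) (simp_all add: jmul_add_right jmul_scaleR_right)

definition L :: "'a::jordan \<Rightarrow> 'a endo" where "L x = Endo (\<lambda>y. x \<bullet> y)"

lemma app_L [simp]: "app (L x) y = x \<bullet> y"
  by (simp add: L_def app_Endo linear_jmul)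

lemma L_add: "L (x + y) = L x + L y"
  by (rule endo_eqI) (simp add: jmul_add_left)

lemma L_scaleR: "L (r *\<^sub>R x) = r *\<^sub>R L x"
  by (rule endo_eqI) (simp add: jmul_scaleR_left)

lemma L_junit: "L junit = 1"
  by (rule endo_eqI) (simp add: junit_left)

lemma jmul_zero_left: "0 \<bullet> x = (0 :: 'a::jordan)"
  using jmul_scaleR_left [of 0 "0 :: 'a" x] by simp

lemma jmul_zero_right: "x \<bullet> 0 = (0 :: 'a::jordan)"
  using jmul_zero_left [of x] by (simp add: jmul_comm)

lemma L_zero: "L (0 :: 'a::jordan) = 0"
  by (rule endo_eqI) (simp add: jmul_zero_left)

lemma L_minus: "L (- x) = - L x" and L_diff: "L (x - y) = L x - L y"
  using L_scaleR [of "- 1" x] L_scaleR [of "- 1" y] L_add [of x "- y"] by simp_all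

lemma L_square_commute: "L x * L (x \<bullet> x) = L (x \<bullet> x) * L x"
proof (rule endo_eqI)
  fix y show "app (L x * L (x \<bullet> x)) y = app (L (x \<bullet> x) * L x) y"
    using jordan_law [of x y] by (simp add: jmul_comm)
qed

text \<open>The first linearization of the Jordan identity, obtained by polarizing the cubic map
  \<open>x \<mapsto> [L x, L (x \<bullet> x)]\<close>.\<close>

lemma L_linearized:
  "L x * L (y \<bullet> z) + L y * L (z \<bullet> x) + L z * L (x \<bullet> y)
   = L (y \<bullet> z) * L x + L (z \<bullet> x) * L y + L (x \<bullet> y) * L z"
proof -
  define c where "c u = L u * L (u \<bullet> u) - L (u \<bullet> u) * L u" for u :: 'a
  have c0: "c u = 0" for u by (simp add: c_def L_square_commute)
  have "c (x + y + z) - c (x + y) - c (y + z) - c (x + z) + c x + c y + c z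
    = 2 *\<^sub>R ((L x * L (y \<bullet> z) + L y * L (z \<bullet> x) + L z * L (x \<bullet> y))
       - (L (y \<bullet> z) * L x + L (z \<bullet> x) * L y + L (x \<bullet> y) * L z))"
    unfolding c_def
    by (simp add: L_add jmul_add_left jmul_add_right algebra_simps scaleR_2
        jmul_comm [of y x] jmul_comm [of z x] jmul_comm [of z y])
  then show ?thesis by (simp add: c0)
qed

text \<open>Applied to w, the right side of the linearized identity does not change when z and w are
  exchanged. Hence the two left sides agree, and one solves for
  \<open>((x \<bullet> y) \<bullet> z) \<bullet> w\<close>.\<close>

lemma L_product:
  "L ((x \<bullet> y) \<bullet> z) = L x * L (y \<bullet> z) + L y * L (z \<bullet> x) + L z * L (x \<bullet> y)
     - L x * L z * L y - L y * L z * L x"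
proof (rule endo_eqI)
  fix w
  have s: "x \<bullet> ((y \<bullet> z) \<bullet> w) + y \<bullet> ((z \<bullet> x) \<bullet> w) + z \<bullet> ((x \<bullet> y) \<bullet> w)
      = (y \<bullet> z) \<bullet> (x \<bullet> w) + (z \<bullet> x) \<bullet> (y \<bullet> w) + (x \<bullet> y) \<bullet> (z \<bullet> w)" for x y z w :: 'a
    using arg_cong [OF L_linearized [of x y z], of "\<lambda>f. app f w"] by simp
  show "app (L ((x \<bullet> y) \<bullet> z)) w = app (L x * L (y \<bullet> z) + L y * L (z \<bullet> x) + L z * L (x \<bullet> y)
     - L x * L z * L y - L y * L z * L x) w"
    using s [of x y z w] s [of x y w z] by (simp add: jmul_comm algebra_simps)
qed

text \<open>In a special Jordan algebra \<open>PP x y\<close> is \<open>- 1/4\<close> times the composition of the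
  commutators with \<open>x\<close> and \<open>y\<close>, which explains the derivation rules below.\<close>

definition PP :: "'a::jordan \<Rightarrow> 'a \<Rightarrow> 'a endo" where "PP x y = L y * L x - L (x \<bullet> y)"

lemma PP_add: "PP (x + x') y = PP x y + PP x' y" "PP x (y + y') = PP x y + PP x y'"
  by (simp_all add: PP_def L_add jmul_add_left jmul_add_right algebra_simps)

lemma PP_scaleR: "PP (r *\<^sub>R x) y = r *\<^sub>R PP x y" "PP x (r *\<^sub>R y) = r *\<^sub>R PP x y"
  by (simp_all add: PP_def L_scaleR jmul_scaleR_left jmul_scaleR_right algebra_simps)

lemma L_mul: "L (x \<bullet> y) = L y * L x - PP x y"
  by (simp add: PP_def)

lemma PP_swap: "PP y x = PP x y + L x * L y - L y * L x"
  by (simp add: PP_def jmul_comm)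

lemma PP_product_left: "PP (y \<bullet> z) x = L y * PP z x + L z * PP y x"
  using L_product [of y z x] by (simp add: PP_def algebra_simps jmul_comm)

lemma PP_product_right: "PP x (y \<bullet> z) = PP x z * L y + PP x y * L z"
  using L_product [of y z x] L_linearized [of x y z] by (simp add: PP_def algebra_simps jmul_comm)

lemma PP_cyclic:
  "PP x y * L z + PP y z * L x + PP z x * L y = L z * PP x y + L x * PP y z + L y * PP z x"
  using L_linearized [of x y z] by (simp add: PP_def algebra_simps jmul_comm)

text \<open>Expanding \<open>PP x (a \<bullet> (a' \<bullet> b))\<close> by the product rule leaves
  exactly one term that is not symmetric in a and a'. In a special algebra the rule says that ad a
  and ad a' commute.\<close>

lemma PP_exchange_right:
  assumes "a \<bullet> (a' \<bullet> b) = a' \<bullet> (a \<bullet> b)" "L a * L a' = L a' * L a"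
  shows "PP x a * PP a' b = PP x a' * PP a b"
proof -
  have *: "PP x (a \<bullet> (a' \<bullet> b)) = PP x b * L a' * L a + PP x a' * L b * L a + PP x a * L b * L a' - PP x a * PP a' b"
    for a a' by (simp add: PP_product_right L_mul algebra_simps)
  show ?thesis using * [of a a'] * [of a' a] assms by (simp add: algebra_simps)
qed

lemma PP_exchange_left:
  assumes "a \<bullet> (a' \<bullet> b) = a' \<bullet> (a \<bullet> b)" "L a * L a' = L a' * L a"
  shows "PP b a * PP a' x = PP b a' * PP a x"
proof -
  have *: "PP (a \<bullet> (a' \<bullet> b)) x = L a * L a' * PP b x + L a * L b * PP a' x + (L a' * L b - PP b a') * PP a x"
    for a a' by (simp add: PP_product_left L_mul jmul_comm [of a' b] algebra_simps)
  show ?thesis using * [of a a'] * [of a' a] assms by (simp add: algebra_simps)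
qed

lemma jmul_diff_right: "z \<bullet> (x - y) = z \<bullet> x - z \<bullet> (y :: 'a::jordan)"
  by (metis app_L app_vec(3))

lemma jmul_diff_left: "(x - y) \<bullet> z = x \<bullet> z - y \<bullet> (z :: 'a::jordan)"
  using jmul_diff_right [of z x y] by (simp add: jmul_comm)

section \<open>Pairs of strongly associative subalgebras\<close>

text \<open>The two sets will be the subalgebras generated by the X and by the Y letters. Reading
  \<open>a \<bullet> (x \<bullet> v) - (x \<bullet> a) \<bullet> v\<close> as \<open>PP x a\<close>
  applied to v, \<open>jS_exchange\<close> says that \<open>PP x a * L c * PP a' b\<close> is
  symmetric in a and a'. Without the inner factor this follows from commutation
  (\<open>jS_xch\<close>); with \<open>L c\<close> in between it will come from the vanishing of
  \<open>wtri\<close>.\<close>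

class jordan_pair = jordan +
  fixes jS :: "bool \<Rightarrow> 'a set"
  assumes jS_add: "\<lbrakk>x \<in> jS i; y \<in> jS i\<rbrakk> \<Longrightarrow> x + y \<in> jS i"
    and jS_mul: "\<lbrakk>x \<in> jS i; y \<in> jS i\<rbrakk> \<Longrightarrow> x \<bullet> y \<in> jS i"
    and jS_commute: "\<lbrakk>x \<in> jS i; y \<in> jS i\<rbrakk> \<Longrightarrow> x \<bullet> (y \<bullet> u) = y \<bullet> (x \<bullet> u)"
    and jS_exchange: "\<lbrakk>a \<in> jS i; c \<in> jS i; a' \<in> jS i; x \<in> jS (\<not> i); b \<in> jS (\<not> i)\<rbrakk> \<Longrightarrow>
      a \<bullet> (x \<bullet> (c \<bullet> (b \<bullet> (a' \<bullet> u) - (a' \<bullet> b) \<bullet> u))) - (x \<bullet> a) \<bullet> (c \<bullet> (b \<bullet> (a' \<bullet> u) - (a' \<bullet> b) \<bullet> u))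
      = a' \<bullet> (x \<bullet> (c \<bullet> (b \<bullet> (a \<bullet> u) - (a \<bullet> b) \<bullet> u))) - (x \<bullet> a') \<bullet> (c \<bullet> (b \<bullet> (a \<bullet> u) - (a \<bullet> b) \<bullet> u))"

section \<open>Vanishing operator expressions and commutation rules inside one subalgebra\<close>

definition cyc :: "'a::jordan \<Rightarrow> 'a \<Rightarrow> 'a \<Rightarrow> 'a endo" where
  "cyc x y z = PP x y * L z - L z * PP x y + (PP y z * L x - L x * PP y z)
     + (PP z x * L y - L y * PP z x)"

definition xch :: "'a::jordan \<Rightarrow> 'a \<Rightarrow> 'a \<Rightarrow> 'a \<Rightarrow> 'a endo" where
  "xch x a a' b = PP x a * PP a' b - PP x a' * PP a b"

definition swp :: "'a::jordan \<Rightarrow> 'a \<Rightarrow> 'a endo" where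
  "swp x y = PP x y - PP y x - (L y * L x - L x * L y)"

text \<open>With known identities brought to one side and named, a long operator identity is proved
  by writing the difference of its sides as an explicit combination of \<open>cyc\<close>,
  \<open>xch\<close> and \<open>swp\<close> terms. Plain expansion verifies the combination, and its
  terms vanish.\<close>

lemma cyc_eq_0: "cyc x y z = 0"
  using PP_cyclic [of x y z] by (simp add: cyc_def algebra_simps)

lemma swp_eq_0: "swp x y = 0"
  by (simp add: swp_def PP_swap [of x y] algebra_simps)

lemma jS_LL: "\<lbrakk>x \<in> jS i; y \<in> jS i\<rbrakk> \<Longrightarrow> L x * L y = L y * L x"
  by (rule endo_eqI) (simp add: jS_commute)

lemma jS_PP_sym: "\<lbrakk>x \<in> jS i; y \<in> jS i\<rbrakk> \<Longrightarrow> PP x y = PP y x"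
  using jS_LL [of x i y] by (simp add: PP_def jmul_comm)

lemma jS_PL:
  assumes "x \<in> jS i" "y \<in> jS i" "z \<in> jS i"
  shows "PP y z * L x = L x * PP y z"
proof -
  have "L z * (L x * w) = L x * (L z * w)" for w
    using jS_LL [OF assms(3) assms(1)] by (simp flip: mult.assoc)
  then show ?thesis
    using jS_LL [OF assms(2) assms(1)] jS_LL [OF jS_mul [OF assms(2,3)] assms(1)]
    by (simp add: PP_def algebra_simps)
qed

lemma jS_xch: "\<lbrakk>a \<in> jS i; a' \<in> jS i\<rbrakk> \<Longrightarrow> PP x a * PP a' b = PP x a' * PP a b"
  by (rule PP_exchange_right) (simp_all add: jS_commute jS_LL)

lemma jS_xch': "\<lbrakk>a \<in> jS i; a' \<in> jS i\<rbrakk> \<Longrightarrow> PP b a * PP a' x = PP b a' * PP a x"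
  by (rule PP_exchange_left) (simp_all add: jS_commute jS_LL)

lemma xch_eq_0: "\<lbrakk>a \<in> jS i; a' \<in> jS i\<rbrakk> \<Longrightarrow> xch x a a' b = 0"
  using jS_xch [of a i a' x b] by (simp add: xch_def)

lemma jS_PLP:
  assumes "a \<in> jS i" "c \<in> jS i" "a' \<in> jS i" "x \<in> jS (\<not> i)" "b \<in> jS (\<not> i)"
  shows "PP x a * (L c * PP a' b) = PP x a' * (L c * PP a b)"
  by (rule endo_eqI) (use jS_exchange [OF assms] in \<open>simp add: PP_def jmul_diff_right algebra_simps\<close>)

lemma left_commuteI: "(x :: 'a :: semigroup_mult) * y = y * x \<Longrightarrow> x * (y * z) = y * (x * z)"
  by (simp flip: mult.assoc)

text \<open>The commutations of two elements of one subalgebra, oriented for rewriting; the variants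
  with w reach into right-nested products.\<close>

lemma jS_normal2:
  assumes "x \<in> jS i" "y \<in> jS i"
  shows "L y * L x = L x * L y" "L y * (L x * w) = L x * (L y * w)"
    "PP y x = PP x y"
    "PP x x * L x = L x * PP x x" "PP x x * (L x * w) = L x * (PP x x * w)"
    "PP x x * L y = L y * PP x x" "PP x x * (L y * w) = L y * (PP x x * w)"
    "PP x y * L x = L x * PP x y" "PP x y * (L x * w) = L x * (PP x y * w)"
    "PP x y * L y = L y * PP x y" "PP x y * (L y * w) = L y * (PP x y * w)"
    "PP y y * L x = L x * PP y y" "PP y y * (L x * w) = L x * (PP y y * w)"
    "PP y y * L y = L y * PP y y" "PP y y * (L y * w) = L y * (PP y y * w)"
  using assms by (auto intro: jS_LL jS_PP_sym jS_PL left_commuteI)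

lemma jS_normal3:
  assumes "x \<in> jS i" "y \<in> jS i" "z \<in> jS i"
  shows "L y * L x = L x * L y" "L y * (L x * w) = L x * (L y * w)"
    "L z * L x = L x * L z" "L z * (L x * w) = L x * (L z * w)"
    "L z * L y = L y * L z" "L z * (L y * w) = L y * (L z * w)"
    "PP y x = PP x y" "PP z x = PP x z" "PP z y = PP y z"
    "PP x y * L x = L x * PP x y" "PP x y * (L x * w) = L x * (PP x y * w)"
    "PP x y * L y = L y * PP x y" "PP x y * (L y * w) = L y * (PP x y * w)"
    "PP x y * L z = L z * PP x y" "PP x y * (L z * w) = L z * (PP x y * w)"
    "PP x z * L x = L x * PP x z" "PP x z * (L x * w) = L x * (PP x z * w)"
    "PP x z * L y = L y * PP x z" "PP x z * (L y * w) = L y * (PP x z * w)"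
    "PP x z * L z = L z * PP x z" "PP x z * (L z * w) = L z * (PP x z * w)"
    "PP y z * L x = L x * PP y z" "PP y z * (L x * w) = L x * (PP y z * w)"
    "PP y z * L y = L y * PP y z" "PP y z * (L y * w) = L y * (PP y z * w)"
    "PP y z * L z = L z * PP y z" "PP y z * (L z * w) = L z * (PP y z * w)"
  using assms by (auto intro: jS_LL jS_PP_sym jS_PL left_commuteI)

section \<open>Generators of the odd part and the functionals that test them\<close>

definition UU :: "'a::jordan \<Rightarrow> 'a \<Rightarrow> 'a endo" where "UU x y = L x * L y + PP x y"

text \<open>\<open>UU x y\<close> is the linearized quadratic operator
  \<open>L x * L y + L y * L x - L (x \<bullet> y)\<close>, in a special algebra
  \<open>u -> (x u y + y u x)/2\<close>.\<close>

lemma UU_sym: "UU y x = UU x y"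
  by (simp add: UU_def PP_swap [of y x] algebra_simps)

text \<open>Inside an envelope \<open>GD i y\<close> is the map \<open>j -> [y, j]/2\<close> and
  \<open>GO i y z\<close> is \<open>j -> (y j z - z j y)/2\<close>, both with skew values on
  symmetric j. The flag is the subalgebra of y; in \<open>GO\<close> the element z lies in the other
  one.\<close>

datatype 'a gen = GD bool 'a | GO bool 'a 'a

text \<open>The symmetrized product of x with the value of a generator, expanded into generators
  composed with operators on the even part. For x and y in different subalgebras the expansion is
  \<open>x \<circ> [y, j]/2 = [x, y \<circ> j]/2 - (x j y - y j x)/2\<close>, which is the reason
  for having \<open>GO\<close> at all.\<close>

fun lm :: "bool \<Rightarrow> 'a::jordan \<Rightarrow> 'a gen \<Rightarrow> ('a gen \<times> 'a endo) list" where
  "lm i x (GD j y) = (if i = j then [(GD j y, L x)] else [(GD i x, L y), (GO i x y, - 1)])"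
| "lm i x (GO j y z) =
    (if i = j then [(GO j y z, L x), (GO j x z, L y), (GD (\<not> j) z, UU y x), (GD j x, - UU y z)]
     else [(GO j y z, L x), (GO j y x, L z), (GD j y, - UU z x), (GD (\<not> j) x, UU z y)])"

text \<open>Half the commutator of x with the value of a generator. It is even again, hence an
  operator on the algebra. In \<open>d2\<close> and \<open>d3\<close> the generator is first
  multiplied by one or two further elements.\<close>

fun dd :: "bool \<Rightarrow> 'a::jordan \<Rightarrow> 'a gen \<Rightarrow> 'a endo" where
  "dd i x (GD j y) = - PP x y"
| "dd i x (GO j y z) =
    (if i = j then L y * PP x z - PP x y * L z else PP x z * L y - L z * PP x y)"

definition lsum :: "('g \<Rightarrow> 'a::real_vector endo) \<Rightarrow> ('g \<times> 'a endo) list \<Rightarrow> 'a endo" where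
  "lsum f xs = (\<Sum>(g, m)\<leftarrow>xs. f g * m)"

lemma lsum_simps [simp]: "lsum f [] = 0" "lsum f ((g, m) # xs) = f g * m + lsum f xs"
  by (simp_all add: lsum_def)

definition d2 where "d2 i x j y g = lsum (dd i x) (lm j y g)"
definition d3 where "d3 i x j y k z g = lsum (d2 i x j y) (lm k z g)"

primrec valid :: "'a::jordan_pair gen \<Rightarrow> bool" where
  "valid (GD i y) \<longleftrightarrow> y \<in> jS i"
| "valid (GO i y z) \<longleftrightarrow> y \<in> jS i \<and> z \<in> jS (\<not> i)"

text \<open>The expression \<open>(y j z - z j y)/2\<close> is antisymmetric in y and z. So case
  distinctions over generators may fix the subalgebra of the first argument of
  \<open>GO\<close>.\<close>

lemma flip_GO:
  "dd i x (GO (\<not> j) z y) = - dd i x (GO j y z)"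
  "d2 i x k w (GO (\<not> j) z y) = - d2 i x k w (GO j y z)"
  "d3 i x k w l v (GO (\<not> j) z y) = - d3 i x k w l v (GO j y z)"
proof -
  show 1: "dd i x (GO (\<not> j) z y) = - dd i x (GO j y z)" for i x j y z
    by auto
  show 2: "d2 i x k w (GO (\<not> j) z y) = - d2 i x k w (GO j y z)" for i x k w j y z
    by (cases i; cases j; cases k) (simp_all add: d2_def UU_sym [of z y] algebra_simps)
  show "d3 i x k w l v (GO (\<not> j) z y) = - d3 i x k w l v (GO j y z)"
    unfolding d3_def using 2 [of i x k w] by (cases j; cases l) (auto simp: UU_sym [of z y] algebra_simps d2_def)
qed

lemma gen_cases_flip:
  assumes "valid g"
    and "\<And>y. y \<in> jS i \<Longrightarrow> P (GD i y)" "\<And>y. y \<in> jS (\<not> i) \<Longrightarrow> P (GD (\<not> i) y)"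
    and "\<And>y z. \<lbrakk>y \<in> jS i; z \<in> jS (\<not> i)\<rbrakk> \<Longrightarrow> P (GO i y z)"
    and "\<And>y z. P (GO i y z) \<Longrightarrow> P (GO (\<not> i) z y)"
  shows "P g"
proof (cases g)
  case (GD j y)
  with assms(1-3) show ?thesis by (cases "j = i") auto
next
  case (GO j y z)
  show ?thesis
  proof (cases "j = i")
    case True
    with GO assms(1,4) show ?thesis by auto
  next
    case False
    then have "j = (\<not> i)" by auto
    with GO assms(1) assms(4,5) [of z y] show ?thesis by simp
  qed
qed

text \<open>The envelope identity behind it is \<open>[c, a \<circ> u] = a \<circ> [c, u]\<close>
  for commuting a and c.\<close>

lemma E3:
  fixes a c :: "'a::jordan_pair"
  assumes c: "c \<in> jS i" and a: "a \<in> jS i" and g: "valid g"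
  shows "d2 i c i a g = L a * dd i c g"
proof (rule gen_cases_flip [where i = i, OF g])
  fix y :: 'a assume y: "y \<in> jS i"
  show "d2 i c i a (GD i y) = L a * dd i c (GD i y)"
    using jS_PL [OF a c y] by (simp add: d2_def)
next
  fix y :: 'a show "d2 i c i a (GD (\<not> i) y) = L a * dd i c (GD (\<not> i) y)"
    by (simp add: d2_def algebra_simps)
next
  fix y z :: 'a assume y: "y \<in> jS i" and z: "z \<in> jS (\<not> i)"
  have "d2 i c i a (GO i y z) - L a * dd i c (GO i y z)
      = xch z y c a - cyc c (y \<bullet> z) a + L y * cyc c a z"
    by (simp add: d2_def UU_def cyc_def xch_def PP_product_left PP_product_right L_mul
        PP_swap [of z y] PP_swap [of z c] PP_swap [of z a] jS_normal3 [OF y a c] algebra_simps)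
  also have "\<dots> = 0" by (simp add: cyc_eq_0 xch_eq_0 [OF y c])
  finally show "d2 i c i a (GO i y z) = L a * dd i c (GO i y z)" by simp
qed (simp add: flip_GO del: dd.simps)


text \<open>The envelope identity behind it is \<open>[x, w \<circ> u] + [w, x \<circ> u] = x
  \<circ> [w, u] + w \<circ> [x, u]\<close>; the remaining terms \<open>[x, w] \<circ> u\<close> and
  \<open>[w, x] \<circ> u\<close> cancel.\<close>

lemma E5:
  fixes x w :: "'a::jordan_pair"
  assumes x: "x \<in> jS i" and w: "w \<in> jS (\<not> i)" and g: "valid g"
  shows "d2 i x (\<not> i) w g + d2 (\<not> i) w i x g = L x * dd (\<not> i) w g + L w * dd i x g"
proof (rule gen_cases_flip [where i = i, OF g])
  fix y :: 'a assume y: "y \<in> jS i"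
  have "d2 i x (\<not> i) w (GD i y) + d2 (\<not> i) w i x (GD i y)
      - (L x * dd (\<not> i) w (GD i y) + L w * dd i x (GD i y)) = - cyc y x w"
    by (simp add: d2_def cyc_def jS_PP_sym [OF x y] PP_swap [of w x] PP_swap [of w y] algebra_simps
        jS_LL [OF y x] left_commuteI [OF jS_LL [OF y x]])
  then show "d2 i x (\<not> i) w (GD i y) + d2 (\<not> i) w i x (GD i y)
      = L x * dd (\<not> i) w (GD i y) + L w * dd i x (GD i y)" by (simp add: cyc_eq_0)
next
  fix y :: 'a assume y: "y \<in> jS (\<not> i)"
  have "d2 i x (\<not> i) w (GD (\<not> i) y) + d2 (\<not> i) w i x (GD (\<not> i) y)
      - (L x * dd (\<not> i) w (GD (\<not> i) y) + L w * dd i x (GD (\<not> i) y)) = - cyc x y w"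
    by (simp add: d2_def cyc_def jS_PP_sym [OF w y] PP_swap [of w x] PP_swap [of y x] algebra_simps
        jS_LL [OF y w] left_commuteI [OF jS_LL [OF y w]])
  then show "d2 i x (\<not> i) w (GD (\<not> i) y) + d2 (\<not> i) w i x (GD (\<not> i) y)
      = L x * dd (\<not> i) w (GD (\<not> i) y) + L w * dd i x (GD (\<not> i) y)" by (simp add: cyc_eq_0)
next
  fix y z :: 'a assume y: "y \<in> jS i" and z: "z \<in> jS (\<not> i)"
  have "d2 i x (\<not> i) w (GO i y z) + d2 (\<not> i) w i x (GO i y z)
      - (L x * dd (\<not> i) w (GO i y z) + L w * dd i x (GO i y z))
      = - cyc y x (z \<bullet> w) + cyc x z w * L y + L w * cyc y x z"
    by (simp add: d2_def UU_def cyc_def PP_product_left PP_product_right L_mul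
        PP_swap [of z y] PP_swap [of z x] PP_swap [of w y] PP_swap [of w x]
        jS_normal2 [OF y x] jS_normal2 [OF z w] algebra_simps)
  then show "d2 i x (\<not> i) w (GO i y z) + d2 (\<not> i) w i x (GO i y z)
      = L x * dd (\<not> i) w (GO i y z) + L w * dd i x (GO i y z)" by (simp add: cyc_eq_0)
next
  fix y z :: 'a
  assume "d2 i x (\<not> i) w (GO i y z) + d2 (\<not> i) w i x (GO i y z)
      = L x * dd (\<not> i) w (GO i y z) + L w * dd i x (GO i y z)"
  then have "- (d2 i x (\<not> i) w (GO i y z) + d2 (\<not> i) w i x (GO i y z))
      = - (L x * dd (\<not> i) w (GO i y z) + L w * dd i x (GO i y z))" by simp
  then show "d2 i x (\<not> i) w (GO (\<not> i) z y) + d2 (\<not> i) w i x (GO (\<not> i) z y)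
      = L x * dd (\<not> i) w (GO (\<not> i) z y) + L w * dd i x (GO (\<not> i) z y)"
    by (simp only: flip_GO) (simp del: dd.simps)
qed

text \<open>Write \<open>E_a\<close> and \<open>e_a\<close> for half the commutator with a, from
  even to odd and back. On the odd part the multiplications by a and b should commute up to
  \<open>E_a e_b - E_b e_a\<close>; applying \<open>e_c\<close> with
  \<open>e_c E_a = - PP c a\<close> produces the two correction terms. Thus a \<open>d3\<close> of
  this shape reduces to \<open>d2\<close> and \<open>dd\<close>.\<close>

lemma E4:
  fixes a b c :: "'a::jordan_pair"
  assumes c: "c \<in> jS i" and a: "a \<in> jS i" and b: "b \<in> jS (\<not> i)" and g: "valid g"
  shows "d3 i c (\<not> i) b i a g
    = L a * d2 i c (\<not> i) b g + PP c a * dd (\<not> i) b g - PP c b * dd i a g"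
proof (rule gen_cases_flip [where i = i, OF g])
  fix y :: 'a assume y: "y \<in> jS i"
  have "d3 i c (\<not> i) b i a (GD i y) - (L a * d2 i c (\<not> i) b (GD i y)
      + PP c a * dd (\<not> i) b (GD i y) - PP c b * dd i a (GD i y))
      = xch b y c a - cyc c (y \<bullet> b) a + L y * cyc c a b"
    by (simp add: d3_def d2_def UU_def cyc_def xch_def PP_product_left PP_product_right L_mul
        PP_swap [of b y] PP_swap [of b c] PP_swap [of b a] jS_normal3 [OF y a c] algebra_simps)
  then show "d3 i c (\<not> i) b i a (GD i y) = L a * d2 i c (\<not> i) b (GD i y)
      + PP c a * dd (\<not> i) b (GD i y) - PP c b * dd i a (GD i y)"
    by (simp add: cyc_eq_0 xch_eq_0 [OF y c])
next
  fix y :: 'a assume y: "y \<in> jS (\<not> i)"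
  show "d3 i c (\<not> i) b i a (GD (\<not> i) y) = L a * d2 i c (\<not> i) b (GD (\<not> i) y)
      + PP c a * dd (\<not> i) b (GD (\<not> i) y) - PP c b * dd i a (GD (\<not> i) y)"
    by (simp add: d3_def d2_def UU_def jS_normal2 [OF y b] jS_normal2 [OF c a]
        PP_swap [of b c] PP_swap [of b a] PP_swap [of y c] PP_swap [of y a] algebra_simps)
next
  fix y z :: 'a assume y: "y \<in> jS i" and z: "z \<in> jS (\<not> i)"
  have "d3 i c (\<not> i) b i a (GO i y z) - (L a * d2 i c (\<not> i) b (GO i y z)
      + PP c a * dd (\<not> i) b (GO i y z) - PP c b * dd i a (GO i y z))
      = - PP c b * cyc y a z - cyc c (z \<bullet> b) a * L y - PP c a * cyc y z b - xch a y c b * L z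
        - xch a y c z * L b + cyc c (z \<bullet> b) (y \<bullet> a) - cyc y c (z \<bullet> b) * L a"
    by (simp add: d3_def d2_def UU_def cyc_def xch_def PP_product_left PP_product_right L_mul
        PP_swap [of b y] PP_swap [of b c] PP_swap [of b a] PP_swap [of z y] PP_swap [of z c] PP_swap [of z a]
        jS_normal3 [OF y a c] jS_normal2 [OF z b] algebra_simps)
  then show "d3 i c (\<not> i) b i a (GO i y z) = L a * d2 i c (\<not> i) b (GO i y z)
      + PP c a * dd (\<not> i) b (GO i y z) - PP c b * dd i a (GO i y z)"
    by (simp add: cyc_eq_0 xch_eq_0 [OF y c])
qed (simp add: flip_GO del: dd.simps)

text \<open>This is \<open>e_x\<close> applied to the expected relation
  \<open>E_a e_a' = E_a' e_a\<close>.\<close>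

lemma R1:
  fixes a a' x :: "'a::jordan_pair"
  assumes a: "a \<in> jS i" and a': "a' \<in> jS i" and x: "x \<in> jS k" and g: "valid g"
  shows "PP x a * dd i a' g = PP x a' * dd i a g"
proof (rule gen_cases_flip [where i = i, OF g])
  fix y z :: 'a assume y: "y \<in> jS i" and z: "z \<in> jS (\<not> i)"
  \<comment> \<open>On \<open>GO\<close> generators a factor \<open>L y\<close> stands between the
    two \<open>PP\<close>. For x in the subalgebra of y it can be moved out and plain exchange
    suffices; for x in the other one this is the axiom \<open>jS_exchange\<close>.\<close>
  have 1: "PP x a * (L y * PP a' z) = PP x a' * (L y * PP a z)"
  proof (cases "k = i")
    case True
    then have "PP x a * L y = L y * PP x a" "PP x a' * L y = L y * PP x a'"
      using x a a' y by (auto intro: jS_PL)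
    then show ?thesis using jS_xch [OF a a', of x z] by (simp flip: mult.assoc) (simp add: mult.assoc)
  next
    case False
    then have "k = (\<not> i)" by auto
    with jS_PLP [OF a y a' _ z] x show ?thesis by simp
  qed
  have 2: "PP x a * (PP a' y * L z) = PP x a' * (PP a y * L z)"
    using jS_xch [OF a a', of x y] by (simp flip: mult.assoc)
  show "PP x a * dd i a' (GO i y z) = PP x a' * dd i a (GO i y z)"
    using 1 2 by (simp add: algebra_simps)
qed (use jS_xch [OF a a'] in \<open>auto simp: flip_GO simp del: dd.simps(2)\<close>)

section \<open>Formal combinations of generators with operator coefficients\<close>

lemma lsum_add: "lsum (\<lambda>g. f g + h g) n = lsum f n + lsum h n"
  by (induction n) (auto simp: algebra_simps)

lemma lsum_diff: "lsum (\<lambda>g. f g - h g) n = lsum f n - lsum h n"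
  by (induction n) (auto simp: algebra_simps)

lemma lsum_mult: "lsum (\<lambda>g. m * f g) n = m * lsum f n"
  by (induction n) (auto simp: algebra_simps)

lemma lsum_append: "lsum f (n @ n') = lsum f n + lsum f n'"
  by (induction n) (auto simp: algebra_simps)

definition lvalid :: "('a::jordan_pair gen \<times> 'a endo) list \<Rightarrow> bool" where
  "lvalid n \<longleftrightarrow> (\<forall>(g, m)\<in>set n. valid g)"

lemma lsum_cong: "lvalid n \<Longrightarrow> (\<And>g. valid g \<Longrightarrow> f g = h g) \<Longrightarrow> lsum f n = lsum h n"
  by (induction n) (auto simp: lvalid_def)

lemma lvalid_lm:
  assumes "valid g" "x \<in> jS i"
  shows "lvalid (lm i x g)"
  using assms by (cases g; cases i; cases "case g of GD j _ \<Rightarrow> j | GO j _ _ \<Rightarrow> j") (auto simp: lvalid_def)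

definition lmap :: "bool \<Rightarrow> 'a::jordan \<Rightarrow> ('a gen \<times> 'a endo) list \<Rightarrow> ('a gen \<times> 'a endo) list" where
  "lmap i x n = concat (map (\<lambda>(g, m). map (\<lambda>(g', m'). (g', m' * m)) (lm i x g)) n)"

lemma lsum_map_mult: "lsum f (map (\<lambda>(g', m'). (g', m' * m)) n) = lsum f n * m"
  by (induction n) (auto simp: algebra_simps)

lemma lsum_lmap: "lsum f (lmap i x n) = lsum (\<lambda>g. lsum f (lm i x g)) n"
  by (induction n) (auto simp: lmap_def lsum_append lsum_map_mult)

lemma lvalid_lmap: "\<lbrakk>lvalid n; x \<in> jS i\<rbrakk> \<Longrightarrow> lvalid (lmap i x n)"
  using lvalid_lm unfolding lvalid_def lmap_def by fastforce

definition lneg :: "('g \<times> 'a::real_vector endo) list \<Rightarrow> ('g \<times> 'a endo) list" where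
  "lneg n = map (\<lambda>(g, m). (g, - m)) n"

lemma lsum_lneg: "lsum f (lneg n) = - lsum f n"
  by (induction n) (auto simp: lneg_def)

lemma lvalid_lneg: "lvalid (lneg n) = lvalid n" and lvalid_append: "lvalid (n @ n') \<longleftrightarrow> lvalid n \<and> lvalid n'"
  by (auto simp: lvalid_def lneg_def)

lemma
  fixes c x y :: "'a::jordan_pair"
  assumes "valid g" "y \<in> jS k"
  shows d3_same: "\<lbrakk>c \<in> jS i; x \<in> jS i\<rbrakk> \<Longrightarrow> d3 i c i x k y g = L x * d2 i c k y g"
    and d3_other: "\<lbrakk>c \<in> jS i; x \<in> jS (\<not> i)\<rbrakk> \<Longrightarrow>
      d3 i c (\<not> i) x k y g = L c * d2 (\<not> i) x k y g + L x * d2 i c k y g - d3 (\<not> i) x i c k y g"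
proof -
  have v: "lvalid (lm k y g)" using assms by (rule lvalid_lm)
  show "d3 i c i x k y g = L x * d2 i c k y g" if "c \<in> jS i" "x \<in> jS i"
    unfolding d3_def d2_def [of i c k] by (subst lsum_mult [symmetric], rule lsum_cong [OF v], rule E3 [OF that])
  show "d3 i c (\<not> i) x k y g = L c * d2 (\<not> i) x k y g + L x * d2 i c k y g - d3 (\<not> i) x i c k y g"
    if "c \<in> jS i" "x \<in> jS (\<not> i)"
    unfolding d3_def d2_def [of _ _ k] lsum_mult [symmetric] lsum_add [symmetric] lsum_diff [symmetric]
    by (rule lsum_cong [OF v]) (use E5 [OF that] in \<open>simp add: algebra_simps\<close>)
qed

text \<open>The formal combinations on which all the functionals vanish; they are the ones that are
  divided out in the odd part.\<close>

definition null :: "('a::jordan_pair gen \<times> 'a endo) list \<Rightarrow> bool" where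
  "null n \<longleftrightarrow> (\<forall>i. \<forall>x\<in>jS i. lsum (dd i x) n = 0 \<and> (\<forall>j. \<forall>y\<in>jS j. lsum (d2 i x j y) n = 0))"

text \<open>Within one subalgebra \<open>d2\<close> is an operator multiple of \<open>dd\<close> by
  \<open>E3\<close>, and \<open>E5\<close> trades the two mixed orders for each other, so a single
  mixed order remains to be tested.\<close>

lemma nullI:
  assumes n: "lvalid n"
    and 1: "\<And>k x. x \<in> jS k \<Longrightarrow> lsum (dd k x) n = 0"
    and 2: "\<And>c d. \<lbrakk>c \<in> jS i; d \<in> jS (\<not> i)\<rbrakk> \<Longrightarrow> lsum (d2 i c (\<not> i) d) n = 0"
  shows "null n"
proof -
  have same: "lsum (d2 k x k y) n = 0" if "x \<in> jS k" "y \<in> jS k" for k x y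
  proof -
    have "lsum (d2 k x k y) n = lsum (\<lambda>g. L y * dd k x g) n"
      by (rule lsum_cong [OF n], rule E3) (use that in auto)
    then show ?thesis by (simp add: lsum_mult 1 that)
  qed
  have other: "lsum (d2 (\<not> i) d i c) n = 0" if "c \<in> jS i" "d \<in> jS (\<not> i)" for c d
  proof -
    have "lsum (d2 i c (\<not> i) d) n + lsum (d2 (\<not> i) d i c) n
        = L c * lsum (dd (\<not> i) d) n + L d * lsum (dd i c) n"
      unfolding lsum_mult [symmetric] lsum_add [symmetric]
      by (rule lsum_cong [OF n], rule E5) (use that in auto)
    then show ?thesis by (simp add: 1 2 that)
  qed
  have "lsum (d2 k x j y) n = 0" if "x \<in> jS k" "y \<in> jS j" for k x j y
  proof (cases "j = k")
    case True
    then show ?thesis using same that by simp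
  next
    case False
    then have "j = (\<not> k)" by auto
    then show ?thesis using that 2 other by (cases "k = i") (auto simp: eq_commute [of k])
  qed
  with 1 show ?thesis by (auto simp: null_def)
qed

section \<open>Relations in the odd part between elements of one subalgebra\<close>

context
  fixes a a' :: "'a::jordan_pair" and i :: bool and g :: "'a gen"
  assumes a: "a \<in> jS i" and a': "a' \<in> jS i" and g: "valid g"
begin

lemma R1_lm: "\<lbrakk>x \<in> jS k; y \<in> jS l\<rbrakk> \<Longrightarrow> PP x a * d2 i a' l y g = PP x a' * d2 i a l y g"
  unfolding d2_def lsum_mult [symmetric]
  by (rule lsum_cong [OF lvalid_lm [OF g]]) (auto intro: R1 [OF a a'])

text \<open>Up to sign the bracket is \<open>d2 i c (\<not> i) d (GD i a)\<close>, so this is the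
  exchange rule for the mixed functional. The cyclic identity rewrites the bracket so that every
  summand falls under \<open>R1\<close> or \<open>R1_lm\<close>.\<close>

lemma exchange_mixed:
  assumes c: "c \<in> jS i" and d: "d \<in> jS (\<not> i)"
  shows "(PP c d * L a + PP c a * L d - L a * PP c d) * dd i a' g
    = (PP c d * L a' + PP c a' * L d - L a' * PP c d) * dd i a g"
proof -
  have *: "PP c d * L a + PP c a * L d - L a * PP c d = L d * PP c a - PP d a * L c + L c * PP d a" if "a \<in> jS i" for a
    using PP_cyclic [of c d a] jS_PP_sym [OF c that] by (simp add: algebra_simps)
  have "(L d * PP c a - PP d a * L c + L c * PP d a) * dd i a' g
      = (L d * PP c a' - PP d a' * L c + L c * PP d a') * dd i a g"
    using R1 [OF a a' c g] R1 [OF a a' d g] R1_lm [OF d c]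
    by (simp add: E3 [OF a c g] E3 [OF a' c g] algebra_simps)
  then show ?thesis by (simp only: * [OF a] * [OF a'])
qed

lemma null_commute_LL: "null (lmap i a (lm i a' g) @ lneg (lmap i a' (lm i a g)))"
proof (rule nullI [where i = i])
  show "lvalid (lmap i a (lm i a' g) @ lneg (lmap i a' (lm i a g)))"
    using a a' g by (simp add: lvalid_append lvalid_lneg lvalid_lmap lvalid_lm)
next
  have LL: "L a * (L a' * m) = L a' * (L a * m)" for m
    by (rule left_commuteI [OF jS_LL [OF a a']])
  fix k and x :: 'a assume x: "x \<in> jS k"
  have "d3 k x i a i a' g = d3 k x i a' i a g"
  proof (cases "k = i")
    case True
    then show ?thesis using x a a' g by (simp add: d3_same E3 LL)
  next
    case False
    then have k: "k = (\<not> i)" by auto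
    have d: "x \<in> jS (\<not> i)" using x k by simp
    \<comment> \<open>\<open>d3_other\<close> interchanges x and p; the three resulting terms are
      then reduced by \<open>E3\<close>, \<open>E5\<close> and \<open>E4\<close>.\<close>
    have *: "d3 (\<not> i) x i p i q g = L x * (L q * dd i p g)
        + L p * (L q * dd (\<not> i) x g + L x * dd i q g - d2 i q (\<not> i) x g)
        - (L q * d2 i p (\<not> i) x g + PP p q * dd (\<not> i) x g - PP p x * dd i q g)"
      if "p \<in> jS i" "q \<in> jS i" for p q
    proof -
      have "L q * dd (\<not> i) x g + L x * dd i q g - d2 i q (\<not> i) x g = d2 (\<not> i) x i q g"
        using E5 [OF that(2) d g] by (simp add: algebra_simps)
      then show ?thesis
        using d3_other [OF g that(2), where i = "\<not> i" and c = x and x = p] by (simp add: that d g E4 E3)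
    qed
    have "d3 (\<not> i) x i a i a' g - d3 (\<not> i) x i a' i a g = PP x a * dd i a' g - PP x a' * dd i a g"
      unfolding * [OF a a'] * [OF a' a]
      by (simp add: PP_swap [of a x] PP_swap [of a' x] jS_PP_sym [OF a' a] LL algebra_simps)
    then show ?thesis unfolding k using R1 [OF a a' d g] by simp
  qed
  then show "lsum (dd k x) (lmap i a (lm i a' g) @ lneg (lmap i a' (lm i a g))) = 0"
    by (simp add: lsum_append lsum_lneg lsum_lmap d3_def d2_def [abs_def])
next
  fix c d :: 'a assume c: "c \<in> jS i" and d: "d \<in> jS (\<not> i)"
  \<comment> \<open>Two elements of the functional and two of the argument are involved.
    \<open>E4\<close> pulls a out of the functional, which leaves expressions with one factor
    less.\<close>
  have *: "lsum (d2 i c (\<not> i) d) (lmap i a (lm i a' g)) = L a * d3 i c (\<not> i) d i a' g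
      + PP c a * d2 (\<not> i) d i a' g - PP c d * (L a' * dd i a g)" if "a \<in> jS i" "a' \<in> jS i" for a a'
  proof -
    have "lsum (d2 i c (\<not> i) d) (lmap i a (lm i a' g)) = lsum (d3 i c (\<not> i) d i a) (lm i a' g)"
      by (simp add: lsum_lmap d3_def [abs_def])
    also have "\<dots> = lsum (\<lambda>g. L a * d2 i c (\<not> i) d g + PP c a * dd (\<not> i) d g - PP c d * dd i a g) (lm i a' g)"
      by (rule lsum_cong [OF lvalid_lm [OF g that(2)]], rule E4 [OF c that(1) d])
    also have "\<dots> = L a * d3 i c (\<not> i) d i a' g + PP c a * d2 (\<not> i) d i a' g - PP c d * d2 i a i a' g"
      by (simp add: lsum_add lsum_diff lsum_mult d3_def d2_def [abs_def])
    finally show ?thesis by (simp add: E3 [OF that g])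
  qed
  have **: "d2 (\<not> i) d i a g = L a * dd (\<not> i) d g + L d * dd i a g - d2 i a (\<not> i) d g" if "a \<in> jS i" for a
    using E5 [OF that d g] by (simp add: algebra_simps)
  have LL: "L a * (L a' * m) = L a' * (L a * m)" for m
    by (rule left_commuteI [OF jS_LL [OF a a']])
  have "lsum (d2 i c (\<not> i) d) (lmap i a (lm i a' g)) - lsum (d2 i c (\<not> i) d) (lmap i a' (lm i a g))
      = (PP c d * L a + PP c a * L d - L a * PP c d) * dd i a' g
        - (PP c d * L a' + PP c a' * L d - L a' * PP c d) * dd i a g
        - (PP c a * d2 i a' (\<not> i) d g - PP c a' * d2 i a (\<not> i) d g)"
    unfolding * [OF a a'] * [OF a' a] ** [OF a] ** [OF a'] E4 [OF c a d g] E4 [OF c a' d g]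
    by (simp add: algebra_simps LL left_commuteI [OF jS_PL [OF a c a']] left_commuteI [OF jS_PL [OF a' c a]])
  then have "lsum (d2 i c (\<not> i) d) (lmap i a (lm i a' g)) = lsum (d2 i c (\<not> i) d) (lmap i a' (lm i a g))"
    using exchange_mixed [OF c d] R1_lm [OF c d] by simp
  then show "lsum (d2 i c (\<not> i) d) (lmap i a (lm i a' g) @ lneg (lmap i a' (lm i a g))) = 0"
    by (simp add: lsum_append lsum_lneg)
qed

lemma null_commute_EE: "null [(GD i a, dd i a' g), (GD i a', - dd i a g)]"
proof (rule nullI [where i = i])
  show "lvalid [(GD i a, dd i a' g), (GD i a', - dd i a g)]"
    using a a' by (simp add: lvalid_def)
next
  fix k and x :: 'a assume "x \<in> jS k"
  then show "lsum (dd k x) [(GD i a, dd i a' g), (GD i a', - dd i a g)] = 0"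
    using R1 [OF a a' _ g] by simp
next
  fix c d :: 'a assume c: "c \<in> jS i" and d: "d \<in> jS (\<not> i)"
  have *: "d2 i c (\<not> i) d (GD i a) = - (PP c d * L a + PP c a * L d - L a * PP c d)" for a
    by (simp add: d2_def algebra_simps)
  show "lsum (d2 i c (\<not> i) d) [(GD i a, dd i a' g), (GD i a', - dd i a g)] = 0"
  proof -
    have "lsum (d2 i c (\<not> i) d) [(GD i a, dd i a' g), (GD i a', - dd i a g)]
        = (PP c d * L a' + PP c a' * L d - L a' * PP c d) * dd i a g
          - (PP c d * L a + PP c a * L d - L a * PP c d) * dd i a' g"
      by (simp add: * algebra_simps)
    then show ?thesis using exchange_mixed [OF c d] by simp
  qed
qed

end

section \<open>The mixed relation: multiplications by a and b commute up to
  \<open>E_a e_b - E_b e_a\<close>\<close>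

definition resid :: "bool \<Rightarrow> 'a::jordan \<Rightarrow> 'a \<Rightarrow> 'a gen \<Rightarrow> ('a gen \<times> 'a endo) list" where
  "resid i a b g = lmap i a (lm (\<not> i) b g) @ lneg (lmap (\<not> i) b (lm i a g))
     @ [(GD i a, - dd (\<not> i) b g), (GD (\<not> i) b, dd i a g)]"

lemma lsum_resid: "lsum f (resid i a b g) = lsum (\<lambda>g. lsum f (lm i a g)) (lm (\<not> i) b g)
    - lsum (\<lambda>g. lsum f (lm (\<not> i) b g)) (lm i a g) - f (GD i a) * dd (\<not> i) b g + f (GD (\<not> i) b) * dd i a g"
  by (simp add: resid_def lsum_append lsum_lneg lsum_lmap)

context
  fixes i :: bool and c d :: "'a::jordan_pair"
  assumes c: "c \<in> jS i" and d: "d \<in> jS (\<not> i)"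
begin

abbreviation "tst \<equiv> \<lambda>a b y z. lsum (d2 i c (\<not> i) d) (resid i a b (GO i y z))"

text \<open>The hardest test of the mixed relation, an identity of degree six. Only the diagonal
  case, in which the generator repeats the letters a and b, is computed; polarization will recover
  the general one. The sums \<open>?T0\<close> to \<open>?T10\<close> are successive forms of the
  value, and each passage exhibits the difference as a combination of vanishing \<open>cyc\<close>,
  \<open>swp\<close> and \<open>xch\<close> terms.\<close>

lemma resid_GO_diagonal:
  assumes a: "a \<in> jS i" and b: "b \<in> jS (\<not> i)"
  shows "tst a b a b = 0"
proof -
  let ?T0 = "L a * PP c b * L d * L a * L b + L a * PP c b * L d * L a * L b
      + L a * PP c b * L d * L a * L b + L a * PP c b * L d * L a * L b
      + L a * PP c d * L b * L a * L b + L a * PP c d * L b * L a * L b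
      + L a * PP c d * L b * L a * L b + L a * PP c d * L b * L a * L b
      + L a * PP c d * L b * L a * L b + L a * PP c d * L b * L a * L b
      + L a * PP c d * L b * PP a b + L a * PP c d * L b * PP a b + L a * PP c d * PP b b * L a
      + PP a c * L b * L b * L d * L a + PP a c * L b * L b * L d * L a
      + PP a c * L b * L b * L d * L a + PP a c * L d * L a * L b * L b
      + PP a c * L d * L a * L b * L b + PP a c * L d * L a * L b * L b
      + PP a c * L d * L a * PP b b + PP a c * L d * PP a b * L b + PP a c * L d * PP a b * L b
      + PP a c * PP b d * L a * L b + PP a c * PP b d * L a * L b + PP a c * PP b d * L a * L b
      + PP a c * PP b d * L a * L b + PP c b * L b * L d * L a * L a + PP c b * L b * L d * PP a a
      + PP c b * L d * L a * L b * L a + PP c b * L d * L a * L b * L a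
      + PP c b * L d * PP a b * L a + PP c b * L d * PP a b * L a + PP c d * L a * L a * L b * L b
      + PP c d * L a * L a * L b * L b + PP c d * L a * L a * L b * L b
      + PP c d * L a * L a * PP b b + PP c d * L a * L b * L b * L a
      + PP c d * L a * L b * L b * L a + PP c d * L a * L b * L b * L a
      + PP c d * L a * PP a b * L b + PP c d * L a * PP a b * L b + PP c d * PP a b * L b * L a
      + PP c d * PP a b * L b * L a + PP c d * PP a b * L b * L a + PP c d * PP a b * L b * L a
      - L a * PP c b * L b * L d * L a - L a * PP c b * L b * L d * L a
      - L a * PP c b * L b * L d * L a - L a * PP c b * L b * L d * L a
      - L a * PP c d * L a * L b * L b - L a * PP c d * L a * L b * L b
      - L a * PP c d * L a * L b * L b - L a * PP c d * L a * PP b b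
      - L a * PP c d * L b * L b * L a - L a * PP c d * L b * L b * L a
      - L a * PP c d * L b * L b * L a - L a * PP c d * PP a b * L b - L a * PP c d * PP a b * L b
      - PP a c * L b * L d * L a * L b - PP a c * L b * L d * L a * L b
      - PP a c * L b * L d * L a * L b - PP a c * L b * L d * L a * L b
      - PP a c * L b * L d * L a * L b - PP a c * L b * L d * L a * L b
      - PP a c * L b * L d * PP a b - PP a c * L b * L d * PP a b - PP a c * L b * PP b d * L a
      - PP a c * L b * PP b d * L a - PP a c * L b * PP b d * L a - PP a c * L b * PP b d * L a
      - PP a c * L d * PP b b * L a - PP c b * L d * L a * L a * L b
      - PP c b * L d * L a * L a * L b - PP c b * L d * L a * L a * L b
      - PP c b * L d * L a * PP a b - PP c b * L d * L a * PP a b - PP c b * L d * PP a a * L b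
      - PP c d * L a * L b * L a * L b - PP c d * L a * L b * L a * L b
      - PP c d * L a * L b * L a * L b - PP c d * L a * L b * L a * L b
      - PP c d * L a * L b * L a * L b - PP c d * L a * L b * L a * L b
      - PP c d * L a * L b * PP a b - PP c d * L a * L b * PP a b - PP c d * L a * PP b b * L a
      - PP c d * PP a b * L a * L b - PP c d * PP a b * L a * L b - PP c d * PP a b * L a * L b
      - PP c d * PP a b * L a * L b"
  let ?T1 = "L a * PP c b * L d * L a * L b + L a * PP c b * L d * L a * L b
      + L a * PP c b * L d * L a * L b + L a * PP c b * L d * L a * L b
      + L a * PP c d * L b * L a * L b + L a * PP c d * L b * L a * L b
      + L a * PP c d * L b * L a * L b + L a * PP c d * L b * L a * L b
      + L a * PP c d * PP b b * L a + L a * PP c d * PP b b * L a + PP a c * L b * L b * L d * L a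
      + PP a c * L b * L b * L d * L a + PP a c * L d * L a * L b * L b
      + PP a c * L d * L a * L b * L b + PP a c * L d * L a * PP b b + PP a c * L d * L a * PP b b
      + PP a c * PP b d * L a * L b + PP a c * PP b d * L a * L b + PP a c * PP b d * L a * L b
      + PP a c * PP b d * L a * L b + PP c b * L b * L d * L a * L a
      + PP c b * L b * L d * L a * L a + PP c b * L b * L d * PP a a + PP c b * L b * L d * PP a a
      + PP c d * L a * L a * L b * L b + PP c d * L a * L a * L b * L b
      + PP c d * L a * L a * L b * L b + PP c d * L a * L a * PP b b
      + PP c d * L a * L b * L b * L a + PP c d * L a * L b * L b * L a
      + PP c d * L a * L b * L b * L a + PP c d * L a * PP a b * L b + PP c d * L a * PP a b * L b
      + PP c d * PP a b * L b * L a + PP c d * PP a b * L b * L a + PP c d * PP a b * L b * L a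
      + PP c d * PP a b * L b * L a - L a * PP c b * L b * L d * L a
      - L a * PP c b * L b * L d * L a - L a * PP c b * L b * L d * L a
      - L a * PP c b * L b * L d * L a - L a * PP c d * L a * L b * L b
      - L a * PP c d * L a * L b * L b - L a * PP c d * L a * PP b b - L a * PP c d * L a * PP b b
      - L a * PP c d * L b * L b * L a - L a * PP c d * L b * L b * L a
      - PP a c * L b * L d * L a * L b - PP a c * L b * L d * L a * L b
      - PP a c * L b * L d * L a * L b - PP a c * L b * L d * L a * L b
      - PP a c * L b * PP b d * L a - PP a c * L b * PP b d * L a - PP a c * L b * PP b d * L a
      - PP a c * L b * PP b d * L a - PP a c * L d * PP b b * L a - PP a c * L d * PP b b * L a
      - PP c b * L d * L a * L a * L b - PP c b * L d * L a * L a * L b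
      - PP c b * L d * PP a a * L b - PP c b * L d * PP a a * L b - PP c d * L a * L b * L a * L b
      - PP c d * L a * L b * L a * L b - PP c d * L a * L b * L a * L b
      - PP c d * L a * L b * L a * L b - PP c d * L a * L b * L a * L b
      - PP c d * L a * L b * L a * L b - PP c d * L a * L b * PP a b - PP c d * L a * L b * PP a b
      - PP c d * L a * PP b b * L a - PP c d * PP a b * L a * L b - PP c d * PP a b * L a * L b
      - PP c d * PP a b * L a * L b - PP c d * PP a b * L a * L b"
  let ?T2 = "L a * PP c b * L d * L a * L b + L a * PP c b * L d * L a * L b
      + L a * PP c b * L d * L a * L b + L a * PP c b * L d * L a * L b
      + L a * PP c d * L b * L a * L b + L a * PP c d * L b * L a * L b
      + L a * PP c d * L b * L a * L b + L a * PP c d * L b * L a * L b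
      + L a * PP c d * PP b b * L a + L a * PP c d * PP b b * L a + PP a c * L b * L b * L d * L a
      + PP a c * L b * L b * L d * L a + PP a c * L d * L a * L b * L b
      + PP a c * L d * L a * L b * L b + PP a c * L d * L a * PP b b + PP a c * L d * L a * PP b b
      + PP a c * PP b d * L a * L b + PP a c * PP b d * L a * L b + PP a c * PP b d * L a * L b
      + PP a c * PP b d * L a * L b + PP c b * L b * L d * L a * L a
      + PP c b * L b * L d * L a * L a + PP c b * L b * L d * PP a a + PP c b * L b * L d * PP a a
      + PP c d * L a * L a * L b * L b + PP c d * L a * L a * PP b b + PP c d * L b * L a * PP a b
      + PP c d * L b * L a * PP a b + PP c d * L b * L b * L a * L a
      + PP c d * L b * L b * L a * L a + PP c d * L b * L b * PP a a + PP c d * L b * L b * PP a a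
      + PP c d * PP a a * L b * L b + PP c d * PP a a * PP b b - L a * PP c b * L b * L d * L a
      - L a * PP c b * L b * L d * L a - L a * PP c b * L b * L d * L a
      - L a * PP c b * L b * L d * L a - L a * PP c d * L a * L b * L b
      - L a * PP c d * L a * L b * L b - L a * PP c d * L a * PP b b - L a * PP c d * L a * PP b b
      - L a * PP c d * L b * L b * L a - L a * PP c d * L b * L b * L a
      - PP a c * L b * L d * L a * L b - PP a c * L b * L d * L a * L b
      - PP a c * L b * L d * L a * L b - PP a c * L b * L d * L a * L b
      - PP a c * L b * PP b d * L a - PP a c * L b * PP b d * L a - PP a c * L b * PP b d * L a
      - PP a c * L b * PP b d * L a - PP a c * L d * PP b b * L a - PP a c * L d * PP b b * L a
      - PP c b * L d * L a * L a * L b - PP c b * L d * L a * L a * L b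
      - PP c b * L d * PP a a * L b - PP c b * L d * PP a a * L b - PP c d * L b * L a * L a * L b
      - PP c d * L b * L a * L b * L a - PP c d * L b * L a * L b * L a
      - PP c d * L b * PP a a * L b - PP c d * L b * PP a a * L b - PP c d * L b * PP a a * L b
      - PP c d * L b * PP a b * L a - PP c d * L b * PP a b * L a - PP c d * PP b b * L a * L a
      - PP c d * PP b b * PP a a"
  let ?T3 = "L a * L c * L d * L a * L b * L b + L a * L c * L d * L a * L b * L b
      + L a * PP c b * L d * L a * L b + L a * PP c b * L d * L a * L b
      + L a * PP c b * L d * L a * L b + L a * PP c b * L d * L a * L b
      + L a * PP c d * L b * L a * L b + L a * PP c d * L b * L a * L b
      + L a * PP c d * L b * L a * L b + L a * PP c d * L b * L a * L b
      + L a * PP c d * PP b b * L a + L a * PP c d * PP b b * L a + L c * PP a d * L a * L b * L b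
      + L c * PP a d * L a * L b * L b + L c * PP a d * PP b b * L a + L c * PP a d * PP b b * L a
      + L d * L a * L a * L c * L b * L b + L d * L a * L a * L c * L b * L b
      + L d * L a * PP a c * L b * L b + L d * L a * PP a c * L b * L b
      + PP a c * L b * L b * L d * L a + PP a c * L b * L b * L d * L a
      + PP a c * L d * L a * PP b b + PP a c * L d * L a * PP b b + PP a c * PP b d * L a * L b
      + PP a c * PP b d * L a * L b + PP a c * PP b d * L a * L b + PP a c * PP b d * L a * L b
      + PP c b * L b * L d * L a * L a + PP c b * L b * L d * L a * L a
      + PP c b * L b * L d * PP a a + PP c b * L b * L d * PP a a + PP c d * L a * L a * PP b b
      + PP c d * L b * L b * L a * L a + PP c d * L b * L b * PP a a + PP c d * PP a a * L b * L b
      + PP c d * PP a a * PP b b - L a * L d * L a * L c * L b * L b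
      - L a * L d * L a * L c * L b * L b - L a * PP c b * L b * L d * L a
      - L a * PP c b * L b * L d * L a - L a * PP c b * L b * L d * L a
      - L a * PP c b * L b * L d * L a - L a * PP c d * L a * PP b b - L a * PP c d * L a * PP b b
      - L a * PP c d * L b * L b * L a - L a * PP c d * L b * L b * L a
      - L c * L d * L a * L a * L b * L b - L c * L d * L a * L a * L b * L b
      - L c * PP a b * PP b d * L a - L c * PP a b * PP b d * L a - PP a c * L b * L d * L a * L b
      - PP a c * L b * L d * L a * L b - PP a c * L b * L d * L a * L b
      - PP a c * L b * L d * L a * L b - PP a c * L b * PP b d * L a - PP a c * L b * PP b d * L a
      - PP a c * L b * PP b d * L a - PP a c * L b * PP b d * L a - PP a c * L d * PP b b * L a
      - PP a c * L d * PP b b * L a - PP a d * L a * L c * L b * L b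
      - PP a d * L a * L c * L b * L b - PP c b * L d * L a * L a * L b
      - PP c b * L d * L a * L a * L b - PP c b * L d * PP a a * L b - PP c b * L d * PP a a * L b
      - PP c d * L a * L a * L b * L b - PP c d * L b * L a * L a * L b
      - PP c d * L b * L a * L a * L b - PP c d * L b * PP a a * L b - PP c d * L b * PP a a * L b
      - PP c d * PP b b * L a * L a - PP c d * PP b b * PP a a"
  let ?T4 = "L a * L c * L d * L a * PP b b + L a * L c * L d * L a * PP b b
      + L a * PP a c * L b * L b * L d + L a * PP a c * L b * L b * L d
      + L a * PP c b * L d * L a * L b + L a * PP c b * L d * L a * L b
      + L a * PP c b * L d * L a * L b + L a * PP c b * L d * L a * L b
      + L a * PP c d * L b * L a * L b + L a * PP c d * L b * L a * L b
      + L a * PP c d * L b * L a * L b + L a * PP c d * L b * L a * L b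
      + L a * PP c d * PP b b * L a + L a * PP c d * PP b b * L a + L c * PP a d * L a * PP b b
      + L c * PP a d * L a * PP b b + L c * PP a d * PP b b * L a + L c * PP a d * PP b b * L a
      + L d * L a * L a * L c * PP b b + L d * L a * L a * L c * PP b b
      + L d * L a * PP a c * PP b b + L d * L a * PP a c * PP b b + PP a a * PP c d * L b * L b
      + PP a c * L b * L b * L d * L a + PP a c * L b * L b * L d * L a
      + PP a c * PP b d * L a * L b + PP a c * PP b d * L a * L b + PP a c * PP b d * L a * L b
      + PP a c * PP b d * L a * L b + PP c b * L b * L d * L a * L a
      + PP c b * L b * L d * L a * L a + PP c b * L b * L d * PP a a + PP c b * L b * L d * PP a a
      + PP c d * L b * L b * L a * L a + PP c d * L b * L b * PP a a + PP c d * PP a a * PP b b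
      - L a * L a * PP c d * L b * L b - L a * L d * L a * L c * PP b b
      - L a * L d * L a * L c * PP b b - L a * PP c b * L b * L d * L a
      - L a * PP c b * L b * L d * L a - L a * PP c b * L b * L d * L a
      - L a * PP c b * L b * L d * L a - L a * PP c d * L b * L b * L a
      - L a * PP c d * L b * L b * L a - L c * L d * L a * L a * PP b b
      - L c * L d * L a * L a * PP b b - L c * PP a b * PP b d * L a - L c * PP a b * PP b d * L a
      - PP a c * L b * L d * L a * L b - PP a c * L b * L d * L a * L b
      - PP a c * L b * L d * L a * L b - PP a c * L b * L d * L a * L b
      - PP a c * L b * PP b d * L a - PP a c * L b * PP b d * L a - PP a c * L b * PP b d * L a
      - PP a c * L b * PP b d * L a - PP a c * L d * PP b b * L a - PP a c * L d * PP b b * L a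
      - PP a d * L a * L c * PP b b - PP a d * L a * L c * PP b b - PP c b * L d * L a * L a * L b
      - PP c b * L d * L a * L a * L b - PP c b * L d * PP a a * L b - PP c b * L d * PP a a * L b
      - PP c d * L a * L a * PP b b - PP c d * L b * L a * L a * L b
      - PP c d * L b * L a * L a * L b - PP c d * L b * PP a a * L b - PP c d * L b * PP a a * L b
      - PP c d * PP b b * L a * L a - PP c d * PP b b * PP a a"
  let ?T5 = "L a * PP a c * L b * L b * L d + L a * PP a c * L b * L b * L d + L a * PP a c * L d * PP b b
      + L a * PP a c * L d * PP b b + L a * PP c b * L d * L a * L b
      + L a * PP c b * L d * L a * L b + L a * PP c b * L d * L a * L b
      + L a * PP c b * L d * L a * L b + L a * PP c d * L b * L a * L b
      + L a * PP c d * L b * L a * L b + L a * PP c d * L b * L a * L b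
      + L a * PP c d * L b * L a * L b + L a * PP c d * PP b b * L a + L a * PP c d * PP b b * L a
      + L c * L b * PP b d * PP a a + L c * L b * PP b d * PP a a + L c * L d * PP b b * PP a a
      + L c * PP a d * PP b b * L a + L c * PP a d * PP b b * L a + L b * L b * L c * L d * PP a a
      + L b * L b * PP c d * PP a a + L b * L d * L c * L b * PP a a
      + L b * L d * L c * L b * PP a a + L b * L d * PP c b * PP a a + L b * L d * PP c b * PP a a
      + PP a a * PP c d * L b * L b + PP a a * PP c d * PP b b + PP a c * L b * L b * L d * L a
      + PP a c * L b * L b * L d * L a + PP a c * PP b d * L a * L b + PP a c * PP b d * L a * L b
      + PP a c * PP b d * L a * L b + PP a c * PP b d * L a * L b + PP c b * L b * L d * L a * L a
      + PP c b * L b * L d * L a * L a + PP c d * L b * L b * L a * L a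
      - L a * L a * PP c d * L b * L b - L a * L a * PP c d * PP b b
      - L a * PP c b * L b * L d * L a - L a * PP c b * L b * L d * L a
      - L a * PP c b * L b * L d * L a - L a * PP c b * L b * L d * L a
      - L a * PP c d * L b * L b * L a - L a * PP c d * L b * L b * L a
      - L c * L b * L b * L d * PP a a - L c * PP a b * PP b d * L a - L c * PP a b * PP b d * L a
      - L b * L b * L d * L c * PP a a - L b * L b * L d * L c * PP a a
      - L b * PP b d * L c * PP a a - L b * PP b d * L c * PP a a - PP a c * L b * L d * L a * L b
      - PP a c * L b * L d * L a * L b - PP a c * L b * L d * L a * L b
      - PP a c * L b * L d * L a * L b - PP a c * L b * PP b d * L a - PP a c * L b * PP b d * L a
      - PP a c * L b * PP b d * L a - PP a c * L b * PP b d * L a - PP a c * L d * PP b b * L a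
      - PP a c * L d * PP b b * L a - PP c b * L d * L a * L a * L b
      - PP c b * L d * L a * L a * L b - PP c b * L d * PP a a * L b - PP c b * L d * PP a a * L b
      - PP c d * L b * L a * L a * L b - PP c d * L b * L a * L a * L b
      - PP c d * L b * PP a a * L b - PP c d * L b * PP a a * L b - PP c d * PP b b * L a * L a
      - PP b b * L c * L d * PP a a - PP b b * PP c d * PP a a"
  let ?T6 = "L a * PP a c * L b * L b * L d + L a * PP a c * L b * L b * L d + L a * PP a c * L d * PP b b
      + L a * PP a c * L d * PP b b + L a * PP c b * L d * L a * L b
      + L a * PP c b * L d * L a * L b + L a * PP c b * L d * L a * L b
      + L a * PP c b * L d * L a * L b + L a * PP c d * L b * L a * L b
      + L a * PP c d * L b * L a * L b + L a * PP c d * L b * L a * L b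
      + L a * PP c d * L b * L a * L b + L a * PP c d * PP b b * L a + L a * PP c d * PP b b * L a
      + L c * L b * PP b d * PP a a + L c * L b * PP b d * PP a a + L c * L d * PP b b * L a * L a
      + L c * L d * PP b b * L a * L a + L c * PP a d * PP b b * L a + L c * PP a d * PP b b * L a
      + L c * PP b b * PP a a * L d + L c * PP b d * L a * L b * L a
      + L c * PP b d * L a * L b * L a + L c * PP b d * PP a b * L a + L c * PP b d * PP a b * L a
      + L b * L b * L c * L d * L a * L a + L b * L b * L c * L d * PP a a
      + L b * L b * PP c d * L a * L a + L b * L b * PP c d * PP a a
      + L b * L d * L c * L b * L a * L a + L b * L d * L c * L b * L a * L a
      + L b * L d * L c * L b * PP a a + L b * L d * L c * L b * PP a a
      + L b * L d * PP c b * L a * L a + L b * L d * PP c b * L a * L a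
      + L b * L d * PP c b * PP a a + L b * L d * PP c b * PP a a + PP a a * PP c d * L b * L b
      + PP a a * PP c d * PP b b + PP a c * L b * L b * L d * L a + PP a c * L b * L b * L d * L a
      + PP a c * PP b d * L a * L b + PP a c * PP b d * L a * L b + PP a c * PP b d * L a * L b
      + PP a c * PP b d * L a * L b - L a * L a * PP c d * L b * L b - L a * L a * PP c d * PP b b
      - L a * PP c b * L b * L d * L a - L a * PP c b * L b * L d * L a
      - L a * PP c b * L b * L d * L a - L a * PP c b * L b * L d * L a
      - L a * PP c d * L b * L b * L a - L a * PP c d * L b * L b * L a
      - L c * L b * L b * L d * L a * L a - L c * L b * L b * L d * PP a a
      - L c * PP a b * PP b d * L a - L c * PP a b * PP b d * L a - L c * PP b b * L a * L a * L d
      - L c * PP b b * L a * PP a d - L c * PP b b * L a * PP a d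
      - L b * L b * L d * L a * L a * L c - L b * L b * L d * L a * L a * L c
      - L b * L b * L d * L c * PP a a - L b * L b * L d * L c * PP a a
      - L b * PP b d * L a * L a * L c - L b * PP b d * L a * L a * L c
      - L b * PP b d * L c * PP a a - L b * PP b d * L c * PP a a - PP a c * L b * L d * L a * L b
      - PP a c * L b * L d * L a * L b - PP a c * L b * L d * L a * L b
      - PP a c * L b * L d * L a * L b - PP a c * L b * PP b d * L a - PP a c * L b * PP b d * L a
      - PP a c * L b * PP b d * L a - PP a c * L b * PP b d * L a - PP a c * L d * PP b b * L a
      - PP a c * L d * PP b b * L a - PP c b * L d * L a * L a * L b
      - PP c b * L d * L a * L a * L b - PP c b * L d * PP a a * L b - PP c b * L d * PP a a * L b
      - PP c d * L b * L a * L a * L b - PP c d * L b * L a * L a * L b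
      - PP c d * L b * PP a a * L b - PP c d * L b * PP a a * L b - PP b b * L c * L d * L a * L a
      - PP b b * L c * L d * PP a a - PP b b * PP c d * L a * L a - PP b b * PP c d * PP a a"
  let ?T7 = "L a * L a * L c * L b * PP b d + L a * L a * L c * L b * PP b d + L a * L c * PP a d * PP b b
      + L a * L c * PP a d * PP b b + L a * PP a c * L b * L b * L d
      + L a * PP a c * L b * L b * L d + L a * PP a c * L b * L b * L d
      + L a * PP a c * L b * L b * L d + L a * PP c b * L d * L a * L b
      + L a * PP c b * L d * L a * L b + L a * PP c b * L d * L a * L b
      + L a * PP c b * L d * L a * L b + L a * PP c d * L b * L a * L b
      + L a * PP c d * L b * L a * L b + L a * PP c d * L b * L a * L b
      + L a * PP c d * L b * L a * L b + L a * PP c d * PP b b * L a + L a * PP c d * PP b b * L a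
      + L c * L b * L b * L a * L a * L d + L c * L b * L b * L a * L a * L d
      + L c * L b * L b * L a * L a * L d + L c * L b * L b * L a * L a * L d
      + L c * L b * L b * L a * PP a d + L c * L b * L b * L a * PP a d
      + L c * L b * PP b d * PP a a + L c * L b * PP b d * PP a a + L c * L d * PP b b * L a * L a
      + L c * L d * PP b b * L a * L a + L c * PP a d * PP b b * L a + L c * PP a d * PP b b * L a
      + L c * PP b d * L a * L b * L a + L c * PP b d * L a * L b * L a
      + L c * PP b d * PP a b * L a + L c * PP b d * PP a b * L a
      + L b * L b * L a * L d * L a * L c + L b * L b * L a * L d * L a * L c
      + L b * L b * L c * L d * L a * L a + L b * L b * L c * L d * L a * L a
      + L b * L b * PP a d * L a * L c + L b * L b * PP a d * L a * L c
      + L b * L b * PP c d * L a * L a + L b * L b * PP c d * L a * L a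
      + L b * L d * L a * L b * L a * L c + L b * L d * L a * L b * L a * L c
      + L b * L d * L a * L b * L a * L c + L b * L d * L a * L b * L a * L c
      + L b * L d * L c * L b * L a * L a + L b * L d * L c * L b * L a * L a
      + L b * L d * L c * L b * L a * L a + L b * L d * L c * L b * L a * L a
      + L b * L d * PP a b * L a * L c + L b * L d * PP a b * L a * L c
      + L b * L d * PP a b * L a * L c + L b * L d * PP a b * L a * L c
      + L b * L d * PP c b * L a * L a + L b * L d * PP c b * L a * L a
      + L b * L d * PP c b * L a * L a + L b * L d * PP c b * L a * L a
      + L b * PP b d * L a * PP a c + L b * PP b d * L a * PP a c + L b * PP b d * L a * PP a c
      + L b * PP b d * L a * PP a c + L d * PP b b * L a * L a * L c
      + L d * PP b b * L a * L a * L c + L d * PP b b * L a * PP a c + L d * PP b b * L a * PP a c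
      + PP a a * PP c b * L b * L d + PP a a * PP c b * L b * L d + PP a a * PP c d * L b * L b
      + PP a a * PP c d * L b * L b + PP a c * L b * L b * L d * L a
      + PP a c * L b * L b * L d * L a + PP a c * PP b d * L a * L b + PP a c * PP b d * L a * L b
      + PP a c * PP b d * L a * L b + PP a c * PP b d * L a * L b - L a * L a * PP c b * L b * L d
      - L a * L a * PP c b * L b * L d - L a * L a * PP c d * L b * L b
      - L a * L a * PP c d * L b * L b - L a * L c * PP a d * L b * L b
      - L a * L c * PP a d * L b * L b - L a * PP a c * L b * PP b d - L a * PP a c * L b * PP b d
      - L a * PP a c * L b * PP b d - L a * PP a c * L b * PP b d - L a * PP c b * L b * L d * L a
      - L a * PP c b * L b * L d * L a - L a * PP c b * L b * L d * L a
      - L a * PP c b * L b * L d * L a - L a * PP c d * L b * L b * L a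
      - L a * PP c d * L b * L b * L a - L c * L b * L a * L b * L a * L d
      - L c * L b * L a * L b * L a * L d - L c * L b * L a * L b * L a * L d
      - L c * L b * L a * L b * L a * L d - L c * L b * L b * L a * L d * L a
      - L c * L b * L b * L a * L d * L a - L c * L b * L b * PP a d * L a
      - L c * L b * L b * PP a d * L a - L c * L b * PP a b * L a * L d
      - L c * L b * PP a b * L a * L d - L c * L b * PP a b * L a * L d
      - L c * L b * PP a b * L a * L d - L c * PP a a * L b * PP b d - L c * PP a a * L b * PP b d
      - L c * PP a b * PP b d * L a - L c * PP a b * PP b d * L a - L c * PP b b * L a * PP a d
      - L c * PP b b * L a * PP a d - L b * L b * L d * L a * L a * L c
      - L b * L b * L d * L a * L a * L c - L b * L b * L d * L a * L a * L c
      - L b * L b * L d * L a * L a * L c - L b * L b * L d * L a * L a * L c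
      - L b * L b * L d * L a * L a * L c - L b * L b * L d * L a * L a * L c
      - L b * L b * L d * L a * L a * L c - L b * L b * L d * L a * L a * L c
      - L b * L b * L d * L a * L a * L c - L b * L b * L d * L a * PP a c
      - L b * L b * L d * L a * PP a c - L b * PP b d * L a * L a * L c
      - L b * PP b d * L a * L a * L c - L b * PP b d * L a * L a * L c
      - L b * PP b d * L a * L a * L c - PP a c * L b * L d * L a * L b
      - PP a c * L b * L d * L a * L b - PP a c * L b * L d * L a * L b
      - PP a c * L b * L d * L a * L b - PP a c * L b * PP b d * L a - PP a c * L b * PP b d * L a
      - PP a c * L b * PP b d * L a - PP a c * L b * PP b d * L a - PP a c * L d * PP b b * L a
      - PP a c * L d * PP b b * L a - PP c b * L d * L a * L a * L b
      - PP c b * L d * L a * L a * L b - PP c b * L d * PP a a * L b - PP c b * L d * PP a a * L b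
      - PP c d * L b * L a * L a * L b - PP c d * L b * L a * L a * L b
      - PP c d * L b * PP a a * L b - PP c d * L b * PP a a * L b - PP b b * L a * L d * L a * L c
      - PP b b * L a * L d * L a * L c - PP b b * L c * L d * L a * L a
      - PP b b * L c * L d * L a * L a - PP b b * PP a d * L a * L c - PP b b * PP a d * L a * L c
      - PP b b * PP c d * L a * L a - PP b b * PP c d * L a * L a"
  let ?T8 = "L a * PP a c * L b * L b * L d + L a * PP a c * L b * L b * L d
      + L a * PP a c * L b * L b * L d + L a * PP a c * L b * L b * L d
      + L a * PP c b * L d * L a * L b + L a * PP c b * L d * L a * L b
      + L a * PP c b * L d * L a * L b + L a * PP c b * L d * L a * L b
      + L a * PP c d * L b * L a * L b + L a * PP c d * L b * L a * L b
      + L a * PP c d * L b * L a * L b + L a * PP c d * L b * L a * L b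
      + L c * L b * L b * L d * L a * L a + L c * L b * L b * L d * L a * L a
      + L c * L b * L b * L d * L a * L a + L c * L b * L b * L d * L a * L a
      + L c * L b * PP b d * L a * L a + L c * L b * PP b d * L a * L a
      + L c * L d * PP b b * L a * L a + L c * L d * PP b b * L a * L a
      + L c * PP a d * L b * L b * L a + L c * PP a d * L b * L b * L a
      + L c * PP b d * L a * L b * L a + L c * PP b d * L a * L b * L a
      + L c * PP b d * PP a b * L a + L c * PP b d * PP a b * L a
      + L b * L a * L b * L c * L d * L a + L b * L a * L b * L c * L d * L a
      + L b * L a * L b * L c * L d * L a + L b * L a * L b * L c * L d * L a
      + L b * L c * L b * L a * L d * L a + L b * L c * L b * L a * L d * L a
      + L b * L c * L b * L a * L d * L a + L b * L c * L b * L a * L d * L a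
      + L b * L b * L a * L d * L a * L c + L b * L b * L a * L d * L a * L c
      + L b * L b * L c * L d * L a * L a + L b * L b * L c * L d * L a * L a
      + L b * L b * PP a d * L a * L c + L b * L b * PP a d * L a * L c
      + L b * L b * PP c d * L a * L a + L b * L b * PP c d * L a * L a
      + L b * PP a b * L c * L d * L a + L b * PP a b * L c * L d * L a
      + L b * PP a b * L c * L d * L a + L b * PP a b * L c * L d * L a
      + L b * PP c b * L a * L d * L a + L b * PP c b * L a * L d * L a
      + L b * PP c b * L a * L d * L a + L b * PP c b * L a * L d * L a
      + PP a a * PP c b * L b * L d + PP a a * PP c b * L b * L d + PP a a * PP c d * L b * L b
      + PP a a * PP c d * L b * L b + PP a c * L b * L b * L d * L a
      + PP a c * L b * L b * L d * L a + PP a c * PP b d * L a * L b + PP a c * PP b d * L a * L b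
      + PP a c * PP b d * L a * L b + PP a c * PP b d * L a * L b + PP b b * PP a c * L d * L a
      + PP b b * PP a c * L d * L a - L a * L a * PP c b * L b * L d
      - L a * L a * PP c b * L b * L d - L a * L a * PP c d * L b * L b
      - L a * L a * PP c d * L b * L b - L a * L c * L b * PP b d * L a
      - L a * L c * L b * PP b d * L a - L a * L c * L b * PP b d * L a
      - L a * L c * L b * PP b d * L a - L a * PP a c * L b * PP b d - L a * PP a c * L b * PP b d
      - L a * PP a c * L b * PP b d - L a * PP a c * L b * PP b d - L a * PP c b * L b * L d * L a
      - L a * PP c b * L b * L d * L a - L a * PP c b * L b * L d * L a
      - L a * PP c b * L b * L d * L a - L c * L b * L b * L a * L d * L a
      - L c * L b * L b * L a * L d * L a - L c * L b * L b * PP a d * L a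
      - L c * L b * L b * PP a d * L a - L c * L b * L d * L a * L b * L a
      - L c * L b * L d * L a * L b * L a - L c * L b * L d * L a * L b * L a
      - L c * L b * L d * L a * L b * L a - L c * L b * L d * PP a b * L a
      - L c * L b * L d * PP a b * L a - L c * L b * L d * PP a b * L a
      - L c * L b * L d * PP a b * L a - L c * PP a b * PP b d * L a - L c * PP a b * PP b d * L a
      - L b * L b * L a * L c * L d * L a - L b * L b * L a * L c * L d * L a
      - L b * L b * L a * L c * L d * L a - L b * L b * L a * L c * L d * L a
      - L b * L b * L a * L c * L d * L a - L b * L b * L a * L c * L d * L a
      - L b * L b * L a * L c * L d * L a - L b * L b * L a * L c * L d * L a
      - L b * L b * L a * PP c d * L a - L b * L b * L a * PP c d * L a
      - L b * L b * L c * PP a d * L a - L b * L b * L c * PP a d * L a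
      - L b * L b * L d * L a * L a * L c - L b * L b * L d * L a * L a * L c
      - L b * L b * L d * L a * PP a c - L b * L b * L d * L a * PP a c
      - PP a c * L b * L d * L a * L b - PP a c * L b * L d * L a * L b
      - PP a c * L b * L d * L a * L b - PP a c * L b * L d * L a * L b
      - PP a c * L d * PP b b * L a - PP a c * L d * PP b b * L a - PP c b * L d * L a * L a * L b
      - PP c b * L d * L a * L a * L b - PP c b * L d * PP a a * L b - PP c b * L d * PP a a * L b
      - PP c d * L b * L a * L a * L b - PP c d * L b * L a * L a * L b
      - PP c d * L b * PP a a * L b - PP c d * L b * PP a a * L b - PP b b * L a * L c * L d * L a
      - PP b b * L a * L c * L d * L a"
  let ?T9 = "L a * PP a c * L b * L b * L d + L a * PP a c * L b * L b * L d
      + L a * PP a c * L b * L b * L d + L a * PP a c * L b * L b * L d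
      + L a * PP c b * L d * L a * L b + L a * PP c b * L d * L a * L b
      + L a * PP c b * L d * L a * L b + L a * PP c b * L d * L a * L b
      + L a * PP c d * L b * L a * L b + L a * PP c d * L b * L a * L b
      + L a * PP c d * L b * L a * L b + L a * PP c d * L b * L a * L b
      + L c * L b * L a * L b * L d * L a + L c * L b * L a * L b * L d * L a
      + L c * L b * L a * L b * L d * L a + L c * L b * L a * L b * L d * L a
      + L c * L b * L b * L d * L a * L a + L c * L b * L b * L d * L a * L a
      + L c * L b * L b * L d * L a * L a + L c * L b * L b * L d * L a * L a
      + L c * L b * PP a b * L d * L a + L c * L b * PP a b * L d * L a
      + L c * L b * PP a b * L d * L a + L c * L b * PP a b * L d * L a
      + L c * L b * PP b d * L a * L a + L c * L b * PP b d * L a * L a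
      + L c * L d * PP b b * L a * L a + L c * L d * PP b b * L a * L a
      + L c * PP a d * L b * L b * L a + L c * PP a d * L b * L b * L a
      + L c * PP b d * L a * L b * L a + L c * PP b d * L a * L b * L a
      + L c * PP b d * PP a b * L a + L c * PP b d * PP a b * L a + PP a a * PP c b * L b * L d
      + PP a a * PP c b * L b * L d + PP a a * PP c d * L b * L b + PP a a * PP c d * L b * L b
      + PP a c * PP b d * L a * L b + PP a c * PP b d * L a * L b + PP a c * PP b d * L a * L b
      + PP a c * PP b d * L a * L b - L a * L a * PP c b * L b * L d
      - L a * L a * PP c b * L b * L d - L a * L a * PP c d * L b * L b
      - L a * L a * PP c d * L b * L b - L a * L c * L b * PP b d * L a
      - L a * L c * L b * PP b d * L a - L a * L c * L b * PP b d * L a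
      - L a * L c * L b * PP b d * L a - L a * PP a c * L b * PP b d - L a * PP a c * L b * PP b d
      - L a * PP a c * L b * PP b d - L a * PP a c * L b * PP b d
      - L c * L b * L b * L a * L d * L a - L c * L b * L b * L a * L d * L a
      - L c * L b * L b * L a * L d * L a - L c * L b * L b * L a * L d * L a
      - L c * L b * L b * PP a d * L a - L c * L b * L b * PP a d * L a
      - L c * L b * L d * L a * L b * L a - L c * L b * L d * L a * L b * L a
      - L c * L b * L d * L a * L b * L a - L c * L b * L d * L a * L b * L a
      - L c * L b * L d * PP a b * L a - L c * L b * L d * PP a b * L a
      - L c * L b * L d * PP a b * L a - L c * L b * L d * PP a b * L a
      - L c * PP a b * PP b d * L a - L c * PP a b * PP b d * L a - L c * PP b b * L a * L d * L a
      - L c * PP b b * L a * L d * L a - PP a c * L b * L d * L a * L b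
      - PP a c * L b * L d * L a * L b - PP a c * L b * L d * L a * L b
      - PP a c * L b * L d * L a * L b - PP c b * L d * L a * L a * L b
      - PP c b * L d * L a * L a * L b - PP c b * L d * PP a a * L b - PP c b * L d * PP a a * L b
      - PP c d * L b * L a * L a * L b - PP c d * L b * L a * L a * L b
      - PP c d * L b * PP a a * L b - PP c d * L b * PP a a * L b"
  let ?T10 = "L a * PP a c * L b * L b * L d + L a * PP a c * L b * L b * L d
      + L a * PP a c * L b * L b * L d + L a * PP a c * L b * L b * L d
      + L a * PP c b * L d * L a * L b + L a * PP c b * L d * L a * L b
      + L a * PP c b * L d * L a * L b + L a * PP c b * L d * L a * L b
      + L a * PP c d * L b * L a * L b + L a * PP c d * L b * L a * L b
      + L a * PP c d * L b * L a * L b + L a * PP c d * L b * L a * L b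
      + L c * L b * L a * L b * L d * L a + L c * L b * L a * L b * L d * L a
      + L c * L b * L b * L d * L a * L a + L c * L b * L b * L d * L a * L a
      + L c * L b * PP a b * L d * L a + L c * L b * PP a b * L d * L a
      + L c * L b * PP a d * L b * L a + L c * L b * PP a d * L b * L a
      + L c * L b * PP b d * L a * L a + L c * L b * PP b d * L a * L a
      + PP a a * PP c b * L b * L d + PP a a * PP c b * L b * L d + PP a a * PP c d * L b * L b
      + PP a a * PP c d * L b * L b + PP a c * PP b d * L a * L b + PP a c * PP b d * L a * L b
      + PP a c * PP b d * L a * L b + PP a c * PP b d * L a * L b - L a * L a * PP c b * L b * L d
      - L a * L a * PP c b * L b * L d - L a * L a * PP c d * L b * L b
      - L a * L a * PP c d * L b * L b - L a * PP a c * L b * PP b d - L a * PP a c * L b * PP b d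
      - L a * PP a c * L b * PP b d - L a * PP a c * L b * PP b d - L c * L b * L a * PP b d * L a
      - L c * L b * L a * PP b d * L a - L c * L b * L b * L a * L d * L a
      - L c * L b * L b * L a * L d * L a - L c * L b * L b * PP a d * L a
      - L c * L b * L b * PP a d * L a - L c * L b * L d * L a * L b * L a
      - L c * L b * L d * L a * L b * L a - L c * L b * L d * PP a b * L a
      - L c * L b * L d * PP a b * L a - PP a c * L b * L d * L a * L b
      - PP a c * L b * L d * L a * L b - PP a c * L b * L d * L a * L b
      - PP a c * L b * L d * L a * L b - PP c b * L d * L a * L a * L b
      - PP c b * L d * L a * L a * L b - PP c b * L d * PP a a * L b - PP c b * L d * PP a a * L b
      - PP c d * L b * L a * L a * L b - PP c d * L b * L a * L a * L b
      - PP c d * L b * PP a a * L b - PP c d * L b * PP a a * L b"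
  \<comment> \<open>Under these rules both sides expand into words in \<open>L\<close> and
    \<open>PP\<close> of single letters, sorted as far as commutation inside each subalgebra
    allows.\<close>
  note rules = cyc_def swp_def xch_def PP_product_left PP_product_right L_mul
    PP_swap [of b a] PP_swap [of b c] PP_swap [of d a] PP_swap [of d c]
    jS_normal2 [OF a c] jS_normal2 [OF b d] algebra_simps
  have "tst a b a b = ?T0"
    by (simp add: lsum_resid d2_def UU_def rules)
  also have "?T0 = ?T1"
  proof -
    have "?T0 - (?T1) = PP c b * L d * cyc a a b + PP a c * L d * cyc a b b - L a * PP c d * cyc a b b"
      by (simp add: rules)
    then show ?thesis by (simp add: cyc_eq_0 swp_eq_0 xch_eq_0 [OF a c] xch_eq_0 [OF b d])
  qed
  also have "?T1 = ?T2"
  proof -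
    have "?T1 - (?T2) = - PP c d * cyc a a b * L b - PP c d * cyc a a b * L b + PP c d * cyc a b (a \<bullet> b)
        + PP c d * cyc a a (b \<bullet> b)"
      by (simp add: rules)
    then show ?thesis by (simp add: cyc_eq_0 swp_eq_0 xch_eq_0 [OF a c] xch_eq_0 [OF b d])
  qed
  also have "?T2 = ?T3"
  proof -
    have "?T2 - (?T3) = - PP c d * L b * cyc a a b + L c * xch a b d b * L a + L c * xch a b d b * L a
        + cyc a c d * L a * L b * L b + cyc a c d * L a * L b * L b"
      by (simp add: rules)
    then show ?thesis by (simp add: cyc_eq_0 swp_eq_0 xch_eq_0 [OF a c] xch_eq_0 [OF b d])
  qed
  also have "?T3 = ?T4"
  proof -
    have "?T3 - (?T4) = - swp (a \<bullet> a) (c \<bullet> d) * L b * L b - cyc a a d * L c * L b * L b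
        + cyc a c d * L a * PP b b + cyc a c d * L a * PP b b"
      by (simp add: rules)
    then show ?thesis by (simp add: cyc_eq_0 swp_eq_0 xch_eq_0 [OF a c] xch_eq_0 [OF b d])
  qed
  also have "?T4 = ?T5"
  proof -
    have "?T4 - (?T5) = - cyc c d (a \<bullet> a) * PP b b + cyc c b b * L d * PP a a
        + cyc c d (b \<bullet> b) * PP a a"
      by (simp add: rules)
    then show ?thesis by (simp add: cyc_eq_0 swp_eq_0 xch_eq_0 [OF a c] xch_eq_0 [OF b d])
  qed
  also have "?T5 = ?T6"
  proof -
    have "?T5 - (?T6) = - L c * PP b b * cyc a a d + L c * xch b b d a * L a + L c * xch b b d a * L a
        + swp c ((b \<bullet> b) \<bullet> d) * L a * L a"
      by (simp add: rules)
    then show ?thesis by (simp add: cyc_eq_0 swp_eq_0 xch_eq_0 [OF a c] xch_eq_0 [OF b d])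
  qed
  also have "?T6 = ?T7"
  proof -
    have "?T6 - (?T7) = L c * L b * L b * cyc a a d - L c * swp (a \<bullet> a) (b \<bullet> b) * L d
        + swp ((a \<bullet> a) \<bullet> c) ((b \<bullet> b) \<bullet> d)"
      by (simp add: rules)
    then show ?thesis by (simp add: cyc_eq_0 swp_eq_0 xch_eq_0 [OF a c] xch_eq_0 [OF b d])
  qed
  also have "?T7 = ?T8"
  proof -
    have "?T7 - (?T8) = - L c * cyc d (b \<bullet> b) (a \<bullet> a) - PP b b * cyc a c d * L a
        - PP b b * cyc a c d * L a - cyc d (b \<bullet> b) (a \<bullet> c) * L a
        - cyc d (b \<bullet> b) (a \<bullet> c) * L a"
      by (simp add: rules)
    then show ?thesis by (simp add: cyc_eq_0 swp_eq_0 xch_eq_0 [OF a c] xch_eq_0 [OF b d])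
  qed
  also have "?T8 = ?T9"
  proof -
    have "?T8 - (?T9) = L b * L b * cyc a c d * L a + L b * L b * cyc a c d * L a
        + cyc a c (b \<bullet> b) * L d * L a + cyc a c (b \<bullet> b) * L d * L a
        - cyc c b b * L a * L d * L a - cyc c b b * L a * L d * L a"
      by (simp add: rules)
    then show ?thesis by (simp add: cyc_eq_0 swp_eq_0 xch_eq_0 [OF a c] xch_eq_0 [OF b d])
  qed
  also have "?T9 = ?T10"
  proof -
    have "?T9 - (?T10) = - L c * cyc a b b * L d * L a - L c * cyc a b b * L d * L a
        - L c * swp (a \<bullet> b) (b \<bullet> d) * L a
        - L c * swp (a \<bullet> b) (b \<bullet> d) * L a + L c * cyc a b d * L b * L a
        + L c * cyc a b d * L b * L a"
      by (simp add: rules)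
    then show ?thesis by (simp add: cyc_eq_0 swp_eq_0 xch_eq_0 [OF a c] xch_eq_0 [OF b d])
  qed
  also have "?T10 = 0"
  proof -
    have "?T10 - (0) = L c * L b * cyc a b d * L a + L c * L b * cyc a b d * L a
        + cyc c (b \<bullet> d) (a \<bullet> a) * L b + cyc c (b \<bullet> d) (a \<bullet> a) * L b
        - cyc a c (b \<bullet> d) * L a * L b - cyc a c (b \<bullet> d) * L a * L b
        - cyc a c (b \<bullet> d) * L a * L b - cyc a c (b \<bullet> d) * L a * L b"
      by (simp add: rules)
    then show ?thesis by (simp add: cyc_eq_0 swp_eq_0 xch_eq_0 [OF a c] xch_eq_0 [OF b d])
  qed
  finally show ?thesis .
qed

text \<open>For a functional that respects the flip, exchanging a with y or b with z changes the
  value only by multiples of \<open>cyc\<close>. This symmetry makes the diagonal case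
  sufficient.\<close>

lemma resid_GO_sym:
  assumes flip: "\<And>j y z. f (GO (\<not> j) z y) = - f (GO j y z)"
    and a: "a \<in> jS i" and y: "y \<in> jS i" and b: "b \<in> jS (\<not> i)" and z: "z \<in> jS (\<not> i)"
  shows "lsum f (resid i a b (GO i y z)) = lsum f (resid i y b (GO i a z))"
    and "lsum f (resid i a b (GO i y z)) = lsum f (resid i a z (GO i y b))"
proof -
  have "lsum f (resid i a b (GO i y z)) - lsum f (resid i y b (GO i a z))
      = f (GD i y) * cyc a z b - f (GD i a) * cyc y z b"
    by (simp add: lsum_resid flip UU_def cyc_def PP_swap [of b a] PP_swap [of b y] PP_swap [of z a] PP_swap [of z y]
        jS_normal2 [OF y a] jS_normal2 [OF z b] algebra_simps)
  then show "lsum f (resid i a b (GO i y z)) = lsum f (resid i y b (GO i a z))"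
    by (simp add: cyc_eq_0)
  have "lsum f (resid i a b (GO i y z)) - lsum f (resid i a z (GO i y b))
      = f (GD (\<not> i) z) * cyc a y b - f (GD (\<not> i) b) * cyc a y z"
    by (simp add: lsum_resid flip UU_def cyc_def PP_swap [of b a] PP_swap [of b y] PP_swap [of z a] PP_swap [of z y]
        jS_normal2 [OF y a] jS_normal2 [OF z b] algebra_simps)
  then show "lsum f (resid i a b (GO i y z)) = lsum f (resid i a z (GO i y b))"
    by (simp add: cyc_eq_0)
qed

lemma resid_GO:
  assumes a: "a \<in> jS i" and y: "y \<in> jS i" and b: "b \<in> jS (\<not> i)" and z: "z \<in> jS (\<not> i)"
  shows "tst a b y z = 0"
proof -
  have add: "d2 i c (\<not> i) d (GO i (y + y') z) = d2 i c (\<not> i) d (GO i y z) + d2 i c (\<not> i) d (GO i y' z)"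
    "d2 i c (\<not> i) d (GO i y (z + z')) = d2 i c (\<not> i) d (GO i y z) + d2 i c (\<not> i) d (GO i y z')"
    "d2 i c (\<not> i) d (GO (\<not> i) z (y + y')) = d2 i c (\<not> i) d (GO (\<not> i) z y) + d2 i c (\<not> i) d (GO (\<not> i) z y')"
    "d2 i c (\<not> i) d (GO (\<not> i) (z + z') y) = d2 i c (\<not> i) d (GO (\<not> i) z y) + d2 i c (\<not> i) d (GO (\<not> i) z' y)"
    "d2 i c (\<not> i) d (GD k (y + y')) = d2 i c (\<not> i) d (GD k y) + d2 i c (\<not> i) d (GD k y')" for y y' z z' k
    by (simp_all add: d2_def UU_def L_add PP_add algebra_simps)
  note sym = resid_GO_sym [of "d2 i c (\<not> i) d", OF flip_GO(2)]
  have double: "h = 0" if "h + h = 0" for h :: "'a endo"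
    using that by (metis scaleR_2 scaleR_eq_0_iff zero_neq_numeral)
  have 1: "tst a b y b = 0" if "a \<in> jS i" "y \<in> jS i" "b \<in> jS (\<not> i)" for a y b
  proof -
    \<comment> \<open>Polarization: the diagonal values vanish, so the two cross terms add up to 0,
      and by symmetry they are equal. The same is done below for b and z.\<close>
    have "tst (a + y) b (a + y) b = tst a b a b + tst a b y b + (tst y b a b + tst y b y b)"
      by (simp add: lsum_resid add UU_def L_add PP_add del: dd.simps) (simp add: L_add PP_add algebra_simps)
    then have "tst a b y b + tst a b y b = 0"
      using sym(1) [OF that(1,2,3,3)] that by (simp add: resid_GO_diagonal jS_add)
    then show ?thesis by (rule double)
  qed
  have "tst a (b + z) y (b + z) = tst a b y b + tst a b y z + (tst a z y b + tst a z y z)"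
    by (simp add: lsum_resid add UU_def L_add PP_add del: dd.simps) (simp add: L_add PP_add algebra_simps)
  then have "tst a b y z + tst a b y z = 0"
    using sym(2) [OF a y b z] a y b z by (simp add: 1 jS_add)
  then show ?thesis by (rule double)
qed

end

lemma null_resid:
  fixes a b :: "'a::jordan_pair"
  assumes a: "a \<in> jS i" and b: "b \<in> jS (\<not> i)" and g: "valid g"
  shows "null (resid i a b g)"
proof (rule nullI [where i = i])
  show "lvalid (resid i a b g)"
    using a b g unfolding resid_def lvalid_append lvalid_lneg
    by (auto intro!: lvalid_lmap lvalid_lm simp: lvalid_def [of "[_, _]"])
next
  fix k and x :: 'a assume x: "x \<in> jS k"
  have 1: "lsum (dd k x) (resid i a b g) = d3 k x i a (\<not> i) b g - d3 k x (\<not> i) b i a g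
      + PP x a * dd (\<not> i) b g - PP x b * dd i a g"
    by (simp add: lsum_resid d3_def d2_def [abs_def])
  show "lsum (dd k x) (resid i a b g) = 0"
  proof (cases "k = i")
    case True
    with x a b g show ?thesis unfolding 1 by (simp add: d3_same E4)
  next
    case False
    then have k: "k = (\<not> i)" by auto
    have x: "x \<in> jS (\<not> i)" using x k by simp
    have "d3 (\<not> i) x i a (\<not> i) b g = L b * d2 (\<not> i) x i a g + PP x b * dd i a g - PP x a * dd (\<not> i) b g"
      using E4 [OF x b _ g, of a] a by simp
    then show ?thesis using a b g x by (simp add: 1 [unfolded k] k d3_same)
  qed
next
  fix c d :: 'a assume c: "c \<in> jS i" and d: "d \<in> jS (\<not> i)"
  show "lsum (d2 i c (\<not> i) d) (resid i a b g) = 0"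
  proof (rule gen_cases_flip [where i = i, OF g])
    fix y :: 'a assume y: "y \<in> jS i"
    show "lsum (d2 i c (\<not> i) d) (resid i a b (GD i y)) = 0"
      by (simp add: lsum_resid d2_def UU_def PP_swap [of b y] PP_swap [of b a] PP_swap [of b c]
          PP_swap [of d y] PP_swap [of d a] PP_swap [of d c]
          jS_normal3 [OF y a c] jS_normal2 [OF b d] algebra_simps)
  next
    fix y :: 'a assume y: "y \<in> jS (\<not> i)"
    show "lsum (d2 i c (\<not> i) d) (resid i a b (GD (\<not> i) y)) = 0"
      by (simp add: lsum_resid d2_def UU_def PP_swap [of b a] PP_swap [of b c] PP_swap [of y a] PP_swap [of y c]
          PP_swap [of d a] PP_swap [of d c]
          jS_normal2 [OF a c] jS_normal3 [OF y b d] algebra_simps)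
  next
    fix y z :: 'a assume "y \<in> jS i" "z \<in> jS (\<not> i)"
    then show "lsum (d2 i c (\<not> i) d) (resid i a b (GO i y z)) = 0"
      using resid_GO [OF c d] a b by simp
  next
    fix y z :: 'a
    assume *: "lsum (d2 i c (\<not> i) d) (resid i a b (GO i y z)) = 0"
    have "lsum (d2 i c (\<not> i) d) (resid i a b (GO (\<not> i) z y)) = - lsum (d2 i c (\<not> i) d) (resid i a b (GO i y z))"
      by (simp add: lsum_resid flip_GO(2) UU_sym [of a y] UU_sym [of z y] UU_sym [of z b] algebra_simps)
    with * show "lsum (d2 i c (\<not> i) d) (resid i a b (GO (\<not> i) z y)) = 0" by simp
  qed
qed

section \<open>The odd part as a quotient, with its multiplication and half commutators\<close>

definition tests :: "('a::jordan_pair gen \<Rightarrow> 'a endo) set" where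
  "tests = {dd i x | i x. x \<in> jS i} \<union> {d2 i x j y | i x j y. x \<in> jS i \<and> y \<in> jS j}"

lemma tests_intros: "x \<in> jS i \<Longrightarrow> dd i x \<in> tests" "x \<in> jS i \<Longrightarrow> y \<in> jS j \<Longrightarrow> d2 i x j y \<in> tests"
  by (auto simp: tests_def)

lemma null_tests: "null n \<Longrightarrow> f \<in> tests \<Longrightarrow> lsum f n = 0"
  by (auto simp: null_def tests_def)

text \<open>Generators whose arguments lie outside the subalgebras count as 0, so that all lists may
  serve as representatives.\<close>

definition tv :: "('a gen \<Rightarrow> 'a endo) \<Rightarrow> ('a::jordan_pair gen \<times> 'a) list \<Rightarrow> 'a" where
  "tv f u = (\<Sum>(g, j)\<leftarrow>u. if valid g then app (f g) j else 0)"

lemma tv_simps [simp]: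
  "tv f [] = 0" "tv f ((g, j) # u) = (if valid g then app (f g) j else 0) + tv f u"
  "tv f (u @ u') = tv f u + tv f u'"
  by (simp_all add: tv_def)

lemma tv_cong: "(\<And>g. valid g \<Longrightarrow> f g = h g) \<Longrightarrow> tv f u = tv h u"
  by (induction u) auto

lemma tv_ops:
  "tv (\<lambda>g. f g + h g) u = tv f u + tv h u" "tv (\<lambda>g. f g - h g) u = tv f u - tv h u"
  "tv (\<lambda>g. m * f g) u = app m (tv f u)"
  by (induction u; force simp: algebra_simps)+

definition ap :: "('g \<times> 'a::real_vector endo) list \<Rightarrow> 'a \<Rightarrow> ('g \<times> 'a) list" where
  "ap n j = map (\<lambda>(g, m). (g, app m j)) n"

lemma tv_ap: "lvalid n \<Longrightarrow> tv f (ap n j) = app (lsum f n) j"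
  by (induction n) (auto simp: ap_def lvalid_def)

definition lo :: "bool \<Rightarrow> 'a \<Rightarrow> ('a::jordan_pair gen \<times> 'a) list \<Rightarrow> ('a gen \<times> 'a) list" where
  "lo i x u = concat (map (\<lambda>(g, j). if valid g \<and> x \<in> jS i then ap (lm i x g) j else []) u)"

lemma lo_simps [simp]:
  "lo i x [] = []"
  "lo i x ((g, j) # u) = (if valid g \<and> x \<in> jS i then ap (lm i x g) j else []) @ lo i x u"
  by (simp_all add: lo_def)

lemma tv_lo: "x \<in> jS i \<Longrightarrow> tv f (lo i x u) = tv (\<lambda>g. lsum f (lm i x g)) u"
  by (induction u) (auto simp: tv_ap lvalid_lm)

definition oeq :: "('a::jordan_pair gen \<times> 'a) list \<Rightarrow> ('a gen \<times> 'a) list \<Rightarrow> bool" where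
  "oeq u u' \<longleftrightarrow> (\<forall>f\<in>tests. tv f u = tv f u')"

lemma oeqD: "oeq u u' \<Longrightarrow> f \<in> tests \<Longrightarrow> tv f u = tv f u'"
  by (simp add: oeq_def)

text \<open>Before a multiplication, \<open>dd\<close> and \<open>d2\<close> turn into
  \<open>d2\<close> and \<open>d3\<close>, and every \<open>d3\<close> reduces to tests by
  \<open>E3\<close>, \<open>E4\<close> and \<open>E5\<close>. Hence the common kernel of the tests
  \<open>dd\<close> and \<open>d2\<close> is stable under multiplication, and no longer tests have
  to be added.\<close>

lemma oeq_lo:
  assumes "oeq u u'"
  shows "oeq (lo l z u) (lo l z u')"
proof (cases "z \<in> jS l")
  case z: True
  have n1: "tv (dd k x) u = tv (dd k x) u'" if "x \<in> jS k" for k x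
    using oeqD [OF assms] that by (auto simp: tests_def)
  have n2: "tv (d2 k x j y) u = tv (d2 k x j y) u'" if "x \<in> jS k" "y \<in> jS j" for k x j y
    by (rule oeqD [OF assms]) (use that in \<open>auto simp: tests_def\<close>)
  have e4: "tv (d3 i c (\<not> i) b i a) u = tv (d3 i c (\<not> i) b i a) u'"
    if "c \<in> jS i" "a \<in> jS i" "b \<in> jS (\<not> i)" for i a b c
  proof -
    have "tv (d3 i c (\<not> i) b i a) u = tv (\<lambda>g. L a * d2 i c (\<not> i) b g + PP c a * dd (\<not> i) b g - PP c b * dd i a g) u" for u
      by (rule tv_cong, rule E4) (use that in auto)
    then show ?thesis by (simp add: tv_ops n1 n2 that)
  qed
  have e4': "tv (d3 i c (\<not> i) b (\<not> i) d) u = tv (d3 i c (\<not> i) b (\<not> i) d) u'"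
    if "c \<in> jS i" "b \<in> jS (\<not> i)" "d \<in> jS (\<not> i)" for i c b d
  proof -
    have "tv (d3 i c (\<not> i) b (\<not> i) d) u = tv (\<lambda>g. L c * d2 (\<not> i) b (\<not> i) d g
        + L b * d2 i c (\<not> i) d g - d3 (\<not> i) b i c (\<not> i) d g) u" for u
      by (rule tv_cong, rule d3_other) (use that in auto)
    then show ?thesis using e4 [of b "\<not> i" d c] that by (simp add: tv_ops n1 n2)
  qed
  have same: "tv (d3 i c i x l z) u = tv (d3 i c i x l z) u'" if "c \<in> jS i" "x \<in> jS i" for i c x
  proof -
    have "tv (d3 i c i x l z) u = tv (\<lambda>g. L x * d2 i c l z g) u" for u
      by (rule tv_cong, rule d3_same) (use that z in auto)
    then show ?thesis by (simp add: tv_ops n2 that z)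
  qed
  have "tv (d3 k x j y l z) u = tv (d3 k x j y l z) u'" if "x \<in> jS k" "y \<in> jS j" for k x j y
  proof (cases "j = k")
    case True
    then show ?thesis using same that by simp
  next
    case False
    then have "j = (\<not> k)" by auto
    then show ?thesis using e4 [of x k z y] e4' [of x k y z] that z by (cases "l = k") auto
  qed
  moreover have "tv (dd k x) (lo l z u) = tv (d2 k x l z) u" "tv (d2 k x j y) (lo l z u) = tv (d3 k x j y l z) u"
    for k x j y u using z by (simp_all add: tv_lo d2_def [abs_def] d3_def [abs_def])
  ultimately show ?thesis
    unfolding oeq_def tests_def using n2 z by (fastforce simp del: tv_simps)
next
  case False
  then have "lo l z u = []" for u by (induction u) auto
  then show ?thesis by (simp add: oeq_def)
qed

quotient_type (overloaded) 'a odd = "('a::jordan_pair gen \<times> 'a) list" / oeq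
  by (rule equivpI) (auto simp: reflp_def symp_def transp_def oeq_def)

definition mapsnd :: "('a \<Rightarrow> 'a) \<Rightarrow> ('g \<times> 'a) list \<Rightarrow> ('g \<times> 'a) list" where
  "mapsnd h u = map (\<lambda>(g, j). (g, h j)) u"

lemma tv_mapsnd:
  "tv f (mapsnd uminus u) = - tv f u" "tv f (mapsnd ((*\<^sub>R) r) u) = r *\<^sub>R tv f u"
  by (induction u; force simp: mapsnd_def algebra_simps)+

instantiation odd :: (jordan_pair) real_vector
begin
lift_definition zero_odd :: "'a odd" is "[]" .
lift_definition plus_odd :: "'a odd \<Rightarrow> 'a odd \<Rightarrow> 'a odd" is "(@)" by (auto simp: oeq_def)
lift_definition uminus_odd :: "'a odd \<Rightarrow> 'a odd" is "mapsnd uminus" by (auto simp: oeq_def tv_mapsnd)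
lift_definition minus_odd :: "'a odd \<Rightarrow> 'a odd \<Rightarrow> 'a odd" is "\<lambda>u v. u @ mapsnd uminus v"
  by (auto simp: oeq_def tv_mapsnd)
lift_definition scaleR_odd :: "real \<Rightarrow> 'a odd \<Rightarrow> 'a odd" is "\<lambda>r. mapsnd ((*\<^sub>R) r)"
  by (auto simp: oeq_def tv_mapsnd)
instance
  by standard (transfer; auto simp: oeq_def tv_mapsnd algebra_simps)+
end

lift_definition Lo :: "bool \<Rightarrow> 'a \<Rightarrow> 'a::jordan_pair odd \<Rightarrow> 'a odd" is lo
  by (rule oeq_lo)

text \<open>Half the commutator with x, from the even to the odd part; \<open>eo\<close> is its
  counterpart in the opposite direction.\<close>

lift_definition Eo :: "bool \<Rightarrow> 'a \<Rightarrow> 'a \<Rightarrow> 'a::jordan_pair odd" is "\<lambda>i x j. [(GD i x, j)]" .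

lift_definition eo :: "bool \<Rightarrow> 'a \<Rightarrow> 'a::jordan_pair odd \<Rightarrow> 'a"
  is "\<lambda>i x u. if x \<in> jS i then tv (dd i x) u else 0"
  by (auto simp: oeq_def tests_intros)

lemma tv_lo_linear:
  "tv f (lo i x (u @ v)) = tv f (lo i x u) + tv f (lo i x v)"
  "tv f (lo i x (mapsnd ((*\<^sub>R) r) u)) = r *\<^sub>R tv f (lo i x u)"
proof -
  show "tv f (lo i x (u @ v)) = tv f (lo i x u) + tv f (lo i x v)" by (simp add: lo_def)
  show "tv f (lo i x (mapsnd ((*\<^sub>R) r) u)) = r *\<^sub>R tv f (lo i x u)"
    by (induction u) (auto simp: mapsnd_def lvalid_lm tv_ap algebra_simps)
qed

lemma linear_Lo: "linear (Lo i x)"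
  by (rule linearI; transfer) (simp_all add: oeq_def tv_lo_linear tv_mapsnd)

lemma linear_Eo: "linear (Eo i x)"
  by (rule linearI; transfer) (simp_all add: oeq_def tv_mapsnd)

lemma linear_eo: "linear (eo i x)"
  by (rule linearI; transfer) (simp_all add: tv_mapsnd)

lemma Eo_same: "\<lbrakk>x \<in> jS i; y \<in> jS i\<rbrakk> \<Longrightarrow> Lo i x (Eo i y j) = Eo i y (x \<bullet> j)"
  by transfer (simp add: oeq_def ap_def)

lemma Eo_other:
  "\<lbrakk>x \<in> jS i; y \<in> jS (\<not> i)\<rbrakk> \<Longrightarrow> Lo i x (Eo (\<not> i) y j) + Lo (\<not> i) y (Eo i x j)
    = Eo i x (y \<bullet> j) + Eo (\<not> i) y (x \<bullet> j)"
proof (transfer, unfold oeq_def, safe)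
  fix x y j :: 'a and i and f :: "'a gen \<Rightarrow> 'a endo"
  assume xy: "x \<in> jS i" "y \<in> jS (\<not> i)" and f: "f \<in> tests"
  have "f (GO (\<not> i) y x) = - f (GO i x y)"
    using f by (auto simp: tests_def flip_GO(1,2) simp del: dd.simps)
  then show "tv f (lo i x [(GD (\<not> i) y, j)] @ lo (\<not> i) y [(GD i x, j)])
      = tv f ([(GD i x, y \<bullet> j)] @ [(GD (\<not> i) y, x \<bullet> j)])"
    using xy by (simp add: ap_def)
qed

lemma eo_Eo: "\<lbrakk>x \<in> jS i; y \<in> jS k\<rbrakk> \<Longrightarrow> eo i x (Eo k y j) = - app (PP x y) j"
  by transfer simp

lemma eo_same: "\<lbrakk>x \<in> jS i; y \<in> jS i\<rbrakk> \<Longrightarrow> eo i x (Lo i y u) = y \<bullet> eo i x u"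
proof transfer
  fix x y :: 'a and i u assume *: "x \<in> jS i" "y \<in> jS i"
  have "tv (d2 i x i y) u = tv (\<lambda>g. L y * dd i x g) u"
    by (rule tv_cong, rule E3) (use * in auto)
  then show "(if x \<in> jS i then tv (dd i x) (lo i y u) else 0) = y \<bullet> (if x \<in> jS i then tv (dd i x) u else 0)"
    using * by (simp add: tv_lo tv_ops d2_def [abs_def])
qed

lemma eo_other: "\<lbrakk>x \<in> jS i; y \<in> jS (\<not> i)\<rbrakk> \<Longrightarrow>
  eo i x (Lo (\<not> i) y u) + eo (\<not> i) y (Lo i x u) = x \<bullet> eo (\<not> i) y u + y \<bullet> eo i x u"
proof transfer
  fix x y :: 'a and i u assume *: "x \<in> jS i" "y \<in> jS (\<not> i)"
  have "tv (\<lambda>g. d2 i x (\<not> i) y g + d2 (\<not> i) y i x g) u = tv (\<lambda>g. L x * dd (\<not> i) y g + L y * dd i x g) u"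
    by (rule tv_cong, rule E5) (use * in auto)
  then show "(if x \<in> jS i then tv (dd i x) (lo (\<not> i) y u) else 0)
      + (if y \<in> jS (\<not> i) then tv (dd (\<not> i) y) (lo i x u) else 0)
      = x \<bullet> (if y \<in> jS (\<not> i) then tv (dd (\<not> i) y) u else 0) + y \<bullet> (if x \<in> jS i then tv (dd i x) u else 0)"
    using * by (simp add: tv_lo tv_ops d2_def [abs_def])
qed

lemma Lo_commute: "\<lbrakk>x \<in> jS i; y \<in> jS i\<rbrakk> \<Longrightarrow> Lo i x (Lo i y u) = Lo i y (Lo i x u)"
proof (transfer, unfold oeq_def, safe)
  fix x y :: 'a and i u and f :: "'a gen \<Rightarrow> 'a endo" assume *: "x \<in> jS i" "y \<in> jS i" and f: "f \<in> tests"
  have "tv (\<lambda>g. lsum f (lmap i x (lm i y g))) u = tv (\<lambda>g. lsum f (lmap i y (lm i x g))) u"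
    by (rule tv_cong) (use null_tests [OF null_commute_LL [OF *] f] in \<open>simp add: lsum_append lsum_lneg\<close>)
  then show "tv f (lo i x (lo i y u)) = tv f (lo i y (lo i x u))"
    using * by (simp add: tv_lo lsum_lmap)
qed

lemma Eo_eo_commute: "\<lbrakk>x \<in> jS i; y \<in> jS i\<rbrakk> \<Longrightarrow> Eo i x (eo i y u) = Eo i y (eo i x u)"
proof (transfer, unfold oeq_def, safe)
  fix x y :: 'a and i u and f :: "'a gen \<Rightarrow> 'a endo" assume *: "x \<in> jS i" "y \<in> jS i" and f: "f \<in> tests"
  have "tv (\<lambda>g. f (GD i x) * dd i y g) u = tv (\<lambda>g. f (GD i y) * dd i x g) u"
    by (rule tv_cong) (use null_tests [OF null_commute_EE [OF *] f] in simp)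
  then show "tv f [(GD i x, if y \<in> jS i then tv (dd i y) u else 0)]
      = tv f [(GD i y, if x \<in> jS i then tv (dd i x) u else 0)]"
    using * by (simp add: tv_ops)
qed

lemma Lo_commute_other: "\<lbrakk>x \<in> jS i; y \<in> jS (\<not> i)\<rbrakk> \<Longrightarrow>
  Lo i x (Lo (\<not> i) y u) + Eo (\<not> i) y (eo i x u) = Lo (\<not> i) y (Lo i x u) + Eo i x (eo (\<not> i) y u)"
proof (transfer, unfold oeq_def, safe)
  fix x y :: 'a and i u and f :: "'a gen \<Rightarrow> 'a endo" assume *: "x \<in> jS i" "y \<in> jS (\<not> i)" and f: "f \<in> tests"
  have "tv (\<lambda>g. lsum (\<lambda>g. lsum f (lm i x g)) (lm (\<not> i) y g) + f (GD (\<not> i) y) * dd i x g) u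
      = tv (\<lambda>g. lsum (\<lambda>g. lsum f (lm (\<not> i) y g)) (lm i x g) + f (GD i x) * dd (\<not> i) y g) u"
    by (rule tv_cong) (use null_tests [OF null_resid [OF *] f] in \<open>simp add: lsum_resid algebra_simps\<close>)
  then show "tv f (lo i x (lo (\<not> i) y u) @ [(GD (\<not> i) y, if x \<in> jS i then tv (dd i x) u else 0)])
      = tv f (lo (\<not> i) y (lo i x u) @ [(GD i x, if y \<in> jS (\<not> i) then tv (dd (\<not> i) y) u else 0)])"
    using * by (simp add: tv_lo tv_ops)
qed

section \<open>Left and right multiplications on the extended algebra\<close>

definition lamf where "lamf i x = (\<lambda>(j, u). (x \<bullet> j + eo i x u, Eo i x j + Lo i x u))"
definition rhof where "rhof i x = (\<lambda>(j, u). (x \<bullet> j - eo i x u, Lo i x u - Eo i x j))"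

text \<open>In an envelope these are the products of x with \<open>j + u\<close> from the left and
  from the right, for symmetric j and skew u, sorted by parity.\<close>

definition lam :: "bool \<Rightarrow> 'a::jordan_pair \<Rightarrow> ('a \<times> 'a odd) endo" where "lam i x = Endo (lamf i x)"
definition rho :: "bool \<Rightarrow> 'a::jordan_pair \<Rightarrow> ('a \<times> 'a odd) endo" where "rho i x = Endo (rhof i x)"

lemmas lin_simps = linear_add [OF linear_Lo] linear_scale [OF linear_Lo] linear_diff [OF linear_Lo]
  linear_add [OF linear_Eo] linear_scale [OF linear_Eo] linear_diff [OF linear_Eo]
  linear_add [OF linear_eo] linear_scale [OF linear_eo] linear_diff [OF linear_eo]
  linear_neg [OF linear_Lo] linear_neg [OF linear_Eo] linear_neg [OF linear_eo]
  linear_0 [OF linear_Lo] linear_0 [OF linear_Eo] linear_0 [OF linear_eo]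

lemma app_lam: "app (lam i x) (j, u) = (x \<bullet> j + eo i x u, Eo i x j + Lo i x u)"
proof -
  have "linear (lamf i x)"
    by (rule linearI) (auto simp: lamf_def lin_simps jmul_add_right jmul_scaleR_right algebra_simps)
  then show ?thesis by (simp add: lam_def app_Endo) (simp add: lamf_def)
qed

lemma app_rho: "app (rho i x) (j, u) = (x \<bullet> j - eo i x u, Lo i x u - Eo i x j)"
proof -
  have "linear (rhof i x)"
    by (rule linearI) (auto simp: rhof_def lin_simps jmul_add_right jmul_scaleR_right algebra_simps)
  then show ?thesis by (simp add: rho_def app_Endo) (simp add: rhof_def)
qed

lemma lam_commute: "\<lbrakk>x \<in> jS i; y \<in> jS i\<rbrakk> \<Longrightarrow> lam i x * lam i y = lam i y * lam i x"
proof (rule endo_eqI, clarify)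
  fix j :: 'a and u assume *: "x \<in> jS i" "y \<in> jS i"
  show "app (lam i x * lam i y) (j, u) = app (lam i y * lam i x) (j, u)"
    using * jS_commute [OF *, of j] Lo_commute [OF *, of u] Eo_eo_commute [OF *, of u]
      jS_PP_sym [OF *]
    by (simp add: app_lam lin_simps jmul_add_right eo_Eo eo_same Eo_same algebra_simps)
qed

lemma rho_commute: "\<lbrakk>x \<in> jS i; y \<in> jS i\<rbrakk> \<Longrightarrow> rho i x * rho i y = rho i y * rho i x"
proof (rule endo_eqI, clarify)
  fix j :: 'a and u assume *: "x \<in> jS i" "y \<in> jS i"
  show "app (rho i x * rho i y) (j, u) = app (rho i y * rho i x) (j, u)"
    using * jS_commute [OF *, of j] Lo_commute [OF *, of u] Eo_eo_commute [OF *, of u]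
      jS_PP_sym [OF *]
    by (simp add: app_rho lin_simps jmul_diff_right eo_Eo eo_same Eo_same algebra_simps)
qed

text \<open>This stands for associativity, \<open>(x v) y = x (v y)\<close>. For different
  subalgebras the components are \<open>eo_other\<close>, \<open>Eo_other\<close> and the mixed
  relation \<open>Lo_commute_other\<close>, together with the swap rule for
  \<open>PP\<close>.\<close>

lemma lam_rho_commute:
  assumes x: "x \<in> jS i" and y: "y \<in> jS k"
  shows "lam i x * rho k y = rho k y * lam i x"
proof (rule endo_eqI, clarify)
  fix j :: 'a and u
  have pp: "x \<bullet> (y \<bullet> j) + app (PP x y) j = y \<bullet> (x \<bullet> j) + app (PP y x) j"
    using arg_cong [OF PP_swap [of y x], of "\<lambda>f. app f j"] by (simp add: algebra_simps)
  show "app (lam i x * rho k y) (j, u) = app (rho k y * lam i x) (j, u)"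
  proof (cases "k = i")
    case True
    then have *: "x \<in> jS i" "y \<in> jS i" using x y by auto
    show ?thesis
      using * pp Lo_commute [OF *, of u] Eo_eo_commute [OF *, of u] True
      by (simp add: app_rho app_lam lin_simps jmul_diff_right jmul_add_right eo_Eo eo_same Eo_same algebra_simps)
  next
    case False
    then have k: "k = (\<not> i)" by auto
    have *: "x \<in> jS i" "y \<in> jS (\<not> i)" using x y k by auto
    show ?thesis
      unfolding k using * pp Lo_commute_other [OF *, of u] eo_other [OF *, of u] Eo_other [OF *, of j]
      by (simp add: app_rho app_lam lin_simps jmul_diff_right jmul_add_right eo_Eo algebra_simps)
  qed
qed

lemma jmul_minus_right: "x \<bullet> (- y) = - (x \<bullet> (y :: 'a::jordan))"
  using jmul_scaleR_right [of x "- 1" y] by simp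

section \<open>Values of polynomials linear in one variable\<close>

primrec aev :: "('v \<Rightarrow> 'r::{real_algebra, monoid_mult}) \<Rightarrow> 'v jterm \<Rightarrow> 'r" where
  "aev \<phi> (JVar v) = \<phi> v"
| "aev \<phi> JZero = 0"
| "aev \<phi> JOne = 1"
| "aev \<phi> (JAdd s t) = aev \<phi> s + aev \<phi> t"
| "aev \<phi> (JScale r t) = r *\<^sub>R aev \<phi> t"
| "aev \<phi> (JMult s t) = (1/2) *\<^sub>R (aev \<phi> s * aev \<phi> t + aev \<phi> t * aev \<phi> s)"

primrec tev :: "('v \<Rightarrow> 'a::jordan) \<Rightarrow> 'v jterm \<Rightarrow> 'a" where
  "tev \<phi> (JVar v) = \<phi> v"
| "tev \<phi> JZero = 0"
| "tev \<phi> JOne = junit"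
| "tev \<phi> (JAdd s t) = tev \<phi> s + tev \<phi> t"
| "tev \<phi> (JScale r t) = r *\<^sub>R tev \<phi> t"
| "tev \<phi> (JMult s t) = tev \<phi> s \<bullet> tev \<phi> t"

section \<open>Associative expansions into weighted words\<close>

definition lprod :: "('u \<Rightarrow> 'v \<Rightarrow> 'w) \<Rightarrow> (real \<times> 'u) list \<Rightarrow> (real \<times> 'v) list \<Rightarrow> (real \<times> 'w) list" where
  "lprod h \<alpha> \<beta> = concat (map (\<lambda>u. map (\<lambda>v. (fst u * fst v / 2, h (snd u) (snd v))) \<beta>) \<alpha>)"

primrec W0 :: "'v jterm \<Rightarrow> (real \<times> 'v list) list" where
  "W0 (JVar v) = [(1, [v])]"
| "W0 JZero = []"
| "W0 JOne = [(1, [])]"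
| "W0 (JAdd s t) = W0 s @ W0 t"
| "W0 (JScale r t) = map (apfst ((*) r)) (W0 t)"
| "W0 (JMult s t) = lprod (@) (W0 s) (W0 t) @ lprod (@) (W0 t) (W0 s)"

definition wsum :: "('w \<Rightarrow> 'r::real_vector) \<Rightarrow> (real \<times> 'w) list \<Rightarrow> 'r" where
  "wsum f \<alpha> = (\<Sum>u\<leftarrow>\<alpha>. fst u *\<^sub>R f (snd u))"

lemma wsum_simps [simp]:
  "wsum f [] = 0" "wsum f (u # \<alpha>) = fst u *\<^sub>R f (snd u) + wsum f \<alpha>" "wsum f (\<alpha> @ \<beta>) = wsum f \<alpha> + wsum f \<beta>"
  by (simp_all add: wsum_def)

lemma wsum_scale [simp]: "wsum f (map (apfst ((*) r)) \<alpha>) = r *\<^sub>R wsum f \<alpha>"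
  by (induction \<alpha>) (simp_all add: scaleR_add_right)

lemma wsum_lprod:
  fixes f :: "'w \<Rightarrow> 'r::real_algebra"
  assumes "\<And>c w c' w'. \<lbrakk>(c, w) \<in> set \<alpha>; (c', w') \<in> set \<beta>\<rbrakk> \<Longrightarrow> k (h w w') = f w * g w'"
  shows "wsum k (lprod h \<alpha> \<beta>) = (1/2) *\<^sub>R (wsum f \<alpha> * wsum g \<beta>)"
proof -
  have *: "wsum k (map (\<lambda>v. (fst u * fst v / 2, h (snd u) (snd v))) \<gamma>) = (1/2) *\<^sub>R (fst u *\<^sub>R f (snd u) * wsum g \<gamma>)"
    if "u \<in> set \<alpha>" "set \<gamma> \<subseteq> set \<beta>" for u \<gamma>
    using that(2)
  proof (induction \<gamma>)
    case (Cons v \<gamma>)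
    then show ?case
      using assms [of "fst u" "snd u" "fst v" "snd v"] that(1) by (simp add: scaleR_add_right distrib_left)
  qed simp
  have "wsum k (lprod h \<gamma> \<beta>) = (1/2) *\<^sub>R (wsum f \<gamma> * wsum g \<beta>)" if "set \<gamma> \<subseteq> set \<alpha>" for \<gamma>
    using that by (induction \<gamma>) (simp_all add: lprod_def * scaleR_add_right distrib_right)
  then show ?thesis by simp
qed

lemma set_lprod:
  "(c, x) \<in> set (lprod h \<alpha> \<beta>) \<Longrightarrow> \<exists>u\<in>set \<alpha>. \<exists>v\<in>set \<beta>. x = h (snd u) (snd v)"
  unfolding lprod_def by (simp add: image_iff) blast

lemma lprod_flip_wsum:
  fixes k :: "'w \<Rightarrow> 'r::real_vector"
  shows "wsum k (lprod h \<alpha> \<beta>) = wsum k (lprod (\<lambda>u v. h v u) \<beta> \<alpha>)"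
proof -
  have 1: "wsum k (lprod h \<alpha> (v # \<beta>)) = wsum k (map (\<lambda>u. (fst u * fst v / 2, h (snd u) (snd v))) \<alpha>) + wsum k (lprod h \<alpha> \<beta>)"
    for v \<beta> by (induction \<alpha>) (simp_all add: lprod_def)
  have 2: "wsum k (lprod h \<alpha> []) = 0" by (induction \<alpha>) (simp_all add: lprod_def)
  show ?thesis
    by (induction \<beta>) (simp_all add: 1 2, simp_all add: lprod_def mult.commute)
qed

abbreviation wp :: "('v \<Rightarrow> 'r::monoid_mult) \<Rightarrow> 'v list \<Rightarrow> 'r" where "wp \<phi> w \<equiv> prod_list (map \<phi> w)"

lemma aev_W0: "aev \<phi> t = wsum (wp \<phi>) (W0 t)"
  by (induction t) (simp_all add: wsum_lprod [where f = "wp \<phi>" and g = "wp \<phi>"] scaleR_add_right)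

text \<open>The Jordan product is invariant under reversal of all words. This is needed because
  words that act from the right are stored in reversed order.\<close>

lemma aev_W0_rev: "aev \<phi> t = wsum (\<lambda>w. wp \<phi> (rev w)) (W0 t)"
proof (induction t)
  case (JMult s t)
  have "wsum (\<lambda>w. wp \<phi> (rev w)) (lprod (@) \<alpha> \<beta>)
      = (1/2) *\<^sub>R (wsum (\<lambda>w. wp \<phi> (rev w)) \<beta> * wsum (\<lambda>w. wp \<phi> (rev w)) \<alpha>)" for \<alpha> \<beta>
    unfolding lprod_flip_wsum [of _ "(@)" \<alpha> \<beta>] by (rule wsum_lprod) simp
  with JMult show ?case by (simp add: scaleR_add_right add.commute)
qed (simp_all add: scaleR_add_right)

lemma set_W0: "(c, w) \<in> set (W0 t) \<Longrightarrow> set w \<subseteq> jvars t"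
proof (induction t arbitrary: c w)
  case (JMult s t)
  have "set w \<subseteq> jvars s \<union> jvars t" if "(c, w) \<in> set (lprod (@) (W0 u) (W0 v))" "{u, v} = {s, t}" for u v
  proof -
    from set_lprod [OF that(1)] obtain c1 w1 c2 w2
      where "(c1, w1) \<in> set (W0 u)" "(c2, w2) \<in> set (W0 v)" "w = w1 @ w2"
      by force
    moreover have "u = s \<and> v = t \<or> u = t \<and> v = s" using that(2) by (simp add: doubleton_eq_iff)
    ultimately show ?thesis
      using JMult.IH(1) [of c1 w1] JMult.IH(1) [of c2 w2] JMult.IH(2) [of c1 w1] JMult.IH(2) [of c2 w2]
      by auto
  qed
  with JMult.prems show ?case by auto
next
  case (JScale r t)
  then obtain u where "u \<in> set (W0 t)" "w = snd u" by (auto simp: apfst_def map_prod_def)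
  with JScale.IH [of "fst u" "snd u"] show ?case by simp
next
  case (JAdd s t)
  then show ?case by fastforce
qed simp_all

text \<open>An entry (p, q) stands for \<open>p z (rev q)\<close>. Both words list the outermost
  factor first, so p is a word in left and q a word in right multiplications. Multiplication by a
  term without z then prepends its words to p or to q.\<close>

inductive zrep :: "'v \<Rightarrow> 'v jterm \<Rightarrow> (real \<times> 'v list \<times> 'v list) list \<Rightarrow> bool" for z where
  zrep_var: "zrep z (JVar z) [(1, [], [])]"
| zrep_zero: "zrep z JZero []"
| zrep_add: "zrep z s \<alpha> \<Longrightarrow> zrep z t \<beta> \<Longrightarrow> zrep z (JAdd s t) (\<alpha> @ \<beta>)"
| zrep_scale: "zrep z t \<beta> \<Longrightarrow> zrep z (JScale r t) (map (apfst ((*) r)) \<beta>)"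
| zrep_left: "z \<notin> jvars s \<Longrightarrow> zrep z t \<beta> \<Longrightarrow> zrep z (JMult s t)
    (lprod (\<lambda>w v. (w @ fst v, snd v)) (W0 s) \<beta> @ lprod (\<lambda>w v. (fst v, w @ snd v)) (W0 s) \<beta>)"
| zrep_right: "z \<notin> jvars s \<Longrightarrow> zrep z t \<beta> \<Longrightarrow> zrep z (JMult t s)
    (lprod (\<lambda>w v. (w @ fst v, snd v)) (W0 s) \<beta> @ lprod (\<lambda>w v. (fst v, w @ snd v)) (W0 s) \<beta>)"

lemma jhomogeneous_0_jvars: "jhomogeneous z 0 t \<Longrightarrow> z \<notin> jvars t"
  by (induction t) (auto split: if_splits)

lemma jhomogeneous_1_zrep: "jhomogeneous z (Suc 0) t \<Longrightarrow> \<exists>\<beta>. zrep z t \<beta>"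
proof (induction t)
  case (JVar w)
  then have "w = z" by (simp split: if_splits)
  then show ?case using zrep_var by metis
next
  case (JMult s t)
  then obtain i j where ij: "Suc 0 = i + j" "jhomogeneous z i s" "jhomogeneous z j t" by auto
  then consider "i = 0" "j = Suc 0" | "i = Suc 0" "j = 0" by (cases i) auto
  then show ?case
  proof cases
    case 1
    with ij JMult.IH(2) obtain \<beta> where "zrep z t \<beta>" by auto
    have "z \<notin> jvars s" using ij 1 jhomogeneous_0_jvars by metis
    with \<open>zrep z t \<beta>\<close> show ?thesis by (intro exI, rule_tac zrep_left)
  next
    case 2
    with ij JMult.IH(1) obtain \<beta> where "zrep z s \<beta>" by auto
    have "z \<notin> jvars t" using ij 2 jhomogeneous_0_jvars by metis
    with \<open>zrep z s \<beta>\<close> show ?thesis by (intro exI, rule_tac zrep_right)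
  qed
next
  case (JAdd s t)
  then show ?case using zrep_add by fastforce
next
  case (JScale r t)
  then show ?case using zrep_scale by fastforce
next
  case JZero
  show ?case by (rule exI, rule zrep_zero)
qed simp

section \<open>The lifted multiplications and their values\<close>

context
  fixes side :: "'v \<Rightarrow> bool" and val :: "'v \<Rightarrow> 'a::jordan_pair" and XY :: "'v set"
  assumes val: "\<And>v. v \<in> XY \<Longrightarrow> val v \<in> jS (side v)"
begin

abbreviation "lamv \<equiv> \<lambda>v. lam (side v) (val v)"
abbreviation "rhov \<equiv> \<lambda>v. rho (side v) (val v)"

text \<open>Built from the lifts of the letters alone, \<open>LV t\<close> should be multiplication
  by the value of t and \<open>EV t\<close> half the commutator with it. On the even part this is
  confirmed by \<open>LV_EV_value_aux\<close>.\<close>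

definition "LV t = (1/2) *\<^sub>R (aev lamv t + aev rhov t)"
definition "EV t = (1/2) *\<^sub>R (aev lamv t - aev rhov t)"

lemma aev_commute_rho:
  assumes "jvars t \<subseteq> XY" "v \<in> XY"
  shows "aev lamv t * rhov v = rhov v * aev lamv t"
  using assms(1)
proof (induction t)
  case (JMult s t)
  then have e: "aev lamv s * rhov v = rhov v * aev lamv s" "aev lamv t * rhov v = rhov v * aev lamv t"
    by auto
  show ?case
    by (simp add: e left_commuteI [OF e(1)] left_commuteI [OF e(2)] mult.assoc distrib_left distrib_right)
qed (auto simp: lam_rho_commute val assms(2) distrib_left distrib_right)

lemma aev_commute:
  assumes s: "jvars s \<subseteq> XY" and "jvars t \<subseteq> XY"
  shows "aev lamv s * aev rhov t = aev rhov t * aev lamv s"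
  using assms(2)
proof (induction t)
  case (JMult t t')
  then have e: "aev lamv s * aev rhov t = aev rhov t * aev lamv s" "aev lamv s * aev rhov t' = aev rhov t' * aev lamv s"
    by auto
  show ?case
    by (simp add: e left_commuteI [OF e(1)] left_commuteI [OF e(2)] mult.assoc distrib_left distrib_right)
qed (auto simp: aev_commute_rho [OF s] distrib_left distrib_right)

text \<open>Conjugation with the grading involution \<open>(j, u) -> (j, - u)\<close> interchanges
  \<open>lam\<close> and \<open>rho\<close>. Hence \<open>LV\<close> preserves parity and
  \<open>EV\<close> reverses it.\<close>

lemma parity_aev: "app (aev rhov t) (j, - u) = (\<lambda>(j, u). (j, - u)) (app (aev lamv t) (j, u))"
proof (induction t arbitrary: j u)
  case (JMult s t)
  obtain a b a' b' where 1: "app (aev lamv t) (j, u) = (a, b)" "app (aev lamv s) (j, u) = (a', b')"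
    by fastforce
  obtain p q p' q' where 2: "app (aev lamv s) (a, b) = (p, q)" "app (aev lamv t) (a', b') = (p', q')"
    by fastforce
  show ?case
    using JMult.IH(1) [of j u] JMult.IH(2) [of j u] JMult.IH(1) [of a b] JMult.IH(2) [of a' b'] 1 2
    by (simp add: scaleR_add_right)
qed (simp_all add: app_lam app_rho lin_simps case_prod_unfold zero_prod_def)

lemma LV_even: "snd (app (LV t) (j, 0)) = 0" and EV_even: "fst (app (EV t) (j, 0)) = 0"
  using parity_aev [of t j 0] by (auto simp: LV_def EV_def case_prod_unfold)

lemma LV_odd: "fst (app (LV t) (0, u)) = 0" and EV_odd: "snd (app (EV t) (0, u)) = 0"
proof -
  have "app (aev rhov t) (0, u) = - app (aev rhov t) (0, - u)"
    using app_vec(4) [of "aev rhov t" "(0, u)"] by simp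
  then show "fst (app (LV t) (0, u)) = 0" "snd (app (EV t) (0, u)) = 0"
    using parity_aev [of t 0 u] by (auto simp: LV_def EV_def case_prod_unfold)
qed

lemma half_half: "(1/2) *\<^sub>R x + (1/2) *\<^sub>R x = (x :: 'b::real_vector)"
  by (simp flip: scaleR_add_left)

lemma LV_mult: "LV (JMult s t) = (1/2) *\<^sub>R (LV s * LV t + LV t * LV s + EV s * EV t + EV t * EV s)"
proof -
  have "LV s * LV t + EV s * EV t = (1/2) *\<^sub>R (aev lamv s * aev lamv t + aev rhov s * aev rhov t)" for s t
  proof -
    have "LV s * LV t + EV s * EV t = (1/4) *\<^sub>R (2 *\<^sub>R (aev lamv s * aev lamv t + aev rhov s * aev rhov t))"
      unfolding LV_def EV_def by (simp add: distrib_left distrib_right left_diff_distrib right_diff_distrib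
          scaleR_add_right scaleR_diff_right scaleR_2)
    then show ?thesis by simp
  qed
  note * = this
  have "LV (JMult s t) = (1/2) *\<^sub>R ((LV s * LV t + EV s * EV t) + (LV t * LV s + EV t * EV s))"
    unfolding * by (simp add: LV_def [of "JMult s t"] scaleR_add_right)
  then show ?thesis by (simp add: ac_simps)
qed

lemma EV_mult:
  assumes "jvars s \<subseteq> XY" "jvars t \<subseteq> XY"
  shows "EV (JMult s t) = EV s * LV t + EV t * LV s" "EV (JMult s t) = LV t * EV s + LV s * EV t"
proof -
  note c = aev_commute [OF assms] aev_commute [OF assms(2,1)]
  show "EV (JMult s t) = EV s * LV t + EV t * LV s" "EV (JMult s t) = LV t * EV s + LV s * EV t"
    unfolding LV_def EV_def by (simp_all add: c distrib_left distrib_right left_diff_distrib right_diff_distrib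
          scaleR_add_right scaleR_diff_right)
qed

lemma EV_simps:
  "EV JZero = 0" "EV JOne = 0" "EV (JAdd s t) = EV s + EV t" "EV (JScale r t) = r *\<^sub>R EV t"
  "LV JZero = 0" "LV JOne = 1" "LV (JAdd s t) = LV s + LV t" "LV (JScale r t) = r *\<^sub>R LV t"
  by (simp_all add: EV_def LV_def scaleR_add_right scaleR_diff_right half_half)

lemma EV_var: "app (EV (JVar v)) (j, 0) = (0, Eo (side v) (val v) j)"
  "app (EV (JVar v)) (0, u) = (eo (side v) (val v) u, 0)"
  "app (LV (JVar v)) (j, 0) = (val v \<bullet> j, 0)"
  by (simp_all add: EV_def LV_def app_lam app_rho lin_simps half_half jmul_zero_right)

lemma PP_unit: "PP junit x = 0" "PP x junit = 0"
  by (simp_all add: PP_def L_junit junit_left jmul_comm [of x])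

lemma PP_zero: "PP 0 x = 0" "PP x 0 = 0"
  by (simp_all add: PP_def L_zero jmul_zero_left jmul_zero_right)

lemma app_zero_pair [simp]: "app f (0, 0) = (0 :: 'c::real_vector, 0 :: 'd::real_vector)"
  using app_vec(1) [of f] unfolding zero_prod_def .

text \<open>The two claims need each other: by \<open>LV_mult\<close> the operator \<open>LV\<close>
  of a product contains products of two \<open>EV\<close>, and by \<open>EV_mult\<close> an
  \<open>EV\<close> of a product contains \<open>LV\<close>. One induction on the total size serves
  both.\<close>

lemma LV_EV_value_aux:
  "(\<forall>t. jvars t \<subseteq> XY \<longrightarrow> size t \<le> n \<longrightarrow> (\<forall>j. app (LV t) (j, 0) = (tev val t \<bullet> j, 0)))
   \<and> (\<forall>t s. jvars t \<subseteq> XY \<longrightarrow> jvars s \<subseteq> XY \<longrightarrow> size t + size s \<le> n \<longrightarrow>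
        (\<forall>j. app (EV t) (app (EV s) (j, 0)) = (- app (PP (tev val t) (tev val s)) j, 0)))"
proof (induction n rule: less_induct)
  case (less n)
  have IH1: "app (LV t) (j, 0) = (tev val t \<bullet> j, 0)" if "jvars t \<subseteq> XY" "size t < n" for t j
    using less.IH [OF that(2)] that by auto
  have IH2: "app (EV t) (app (EV s) (j, 0)) = (- app (PP (tev val t) (tev val s)) j, 0)"
    if "jvars t \<subseteq> XY" "jvars s \<subseteq> XY" "size t + size s < n" for t s j
    using less.IH [OF that(3)] that by auto
  have 1: "app (LV t) (j, 0) = (tev val t \<bullet> j, 0)" if "jvars t \<subseteq> XY" "size t \<le> n" for t j
  proof (cases t)
    case (JVar v)
    then show ?thesis by (simp add: EV_var)
  next
    \<comment> \<open>By the definition of \<open>PP\<close> the four terms of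
      \<open>LV_mult\<close> add up to twice the multiplication by the product.\<close>
    case (JMult s u)
    with that show ?thesis
      by (simp add: LV_mult IH1 IH2) (simp add: PP_def algebra_simps jmul_comm [of "tev val u" "tev val s"] half_half
          flip: scaleR_add_right)
  qed (use that in \<open>simp_all add: EV_simps IH1 jmul_add_left jmul_scaleR_left junit_left jmul_zero_left zero_prod_def\<close>)
  have 3: "app (EV (JVar v)) (app (EV s) (j, 0)) = (- app (PP (val v) (tev val s)) j, 0)"
    if "v \<in> XY" "jvars s \<subseteq> XY" "size (JVar v) + size s \<le> n" for v s j
  proof (cases s)
    case (JVar w)
    then show ?thesis using that val [of v] val [of w] by (simp add: EV_var eo_Eo)
  next
    case (JMult s u)
    with that show ?thesis
      using IH2 [of "JVar v" s] IH2 [of "JVar v" u]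
      by (simp add: EV_mult(1) IH1 PP_product_right algebra_simps)
  qed (use that IH2 [of "JVar v"] in \<open>simp_all add: EV_simps PP_add PP_scaleR PP_unit PP_zero zero_prod_def\<close>)
  have 2: "app (EV t) (app (EV s) (j, 0)) = (- app (PP (tev val t) (tev val s)) j, 0)"
    if "jvars t \<subseteq> XY" "jvars s \<subseteq> XY" "size t + size s \<le> n" for t s j
  proof (cases t)
    case (JVar v)
    then show ?thesis using 3 that by simp
  next
    case (JMult t u)
    with that show ?thesis
      by (simp add: EV_mult(2) IH1 IH2 PP_product_left jmul_minus_right)
  qed (use that in \<open>simp_all add: EV_simps IH2 PP_add PP_scaleR PP_unit PP_zero zero_prod_def\<close>)
  show ?case using 1 2 by blast
qed

lemma fst_LV:
  assumes "jvars s \<subseteq> XY"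
  shows "fst (app (LV s) v) = tev val s \<bullet> fst v"
proof -
  have "app (LV s) v = app (LV s) (fst v, 0) + app (LV s) (0, snd v)"
    by (simp flip: app_vec)
  then show ?thesis
    using LV_EV_value_aux [of "size s"] assms LV_odd [of s "snd v"] by simp
qed

lemma wp_commute:
  "\<lbrakk>set p \<subseteq> XY; set q \<subseteq> XY\<rbrakk> \<Longrightarrow> wp lamv p * wp rhov q = wp rhov q * wp lamv p"
proof (induction p)
  case (Cons v p)
  have "lamv v * wp rhov q = wp rhov q * lamv v"
    using Cons.prems(2)
  proof (induction q)
    case (Cons w q)
    have e: "lamv v * rhov w = rhov w * lamv v"
      using Cons.prems \<open>set (v # p) \<subseteq> XY\<close> by (auto intro: lam_rho_commute val)
    from Cons show ?case by (simp add: mult.assoc left_commuteI [OF e])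
  qed simp
  with Cons show ?case by (simp add: mult.assoc) (simp flip: mult.assoc)
qed simp

lemma set_zrep:
  "\<lbrakk>zrep z t \<beta>; jvars t \<subseteq> insert z XY; (c, p, q) \<in> set \<beta>\<rbrakk> \<Longrightarrow> set p \<subseteq> XY \<and> set q \<subseteq> XY"
proof (induction arbitrary: c p q rule: zrep.induct)
  case (zrep_scale t \<beta> r)
  then obtain c' where "(c', p, q) \<in> set \<beta>" by (auto simp: apfst_def map_prod_def)
  moreover have "jvars t \<subseteq> insert z XY" using zrep_scale.prems by simp
  ultimately show ?case using zrep_scale.IH by blast
next
  case (zrep_left s t \<beta>)
  then obtain u v where u: "u \<in> set (W0 s)" and v: "v \<in> set \<beta>"
    and pq: "(p, q) = (snd u @ fst (snd v), snd (snd v)) \<or> (p, q) = (fst (snd v), snd u @ snd (snd v))"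
    by (auto dest!: set_lprod)
  have "set (snd u) \<subseteq> XY" using set_W0 [of "fst u" "snd u" s] u zrep_left.prems(1) zrep_left.hyps by auto
  moreover have "set (fst (snd v)) \<subseteq> XY \<and> set (snd (snd v)) \<subseteq> XY"
    using zrep_left.IH [of "fst v" "fst (snd v)" "snd (snd v)"] zrep_left.prems(1) v by simp
  ultimately show ?case using pq by auto
next
  case (zrep_right s t \<beta>)
  then obtain u v where u: "u \<in> set (W0 s)" and v: "v \<in> set \<beta>"
    and pq: "(p, q) = (snd u @ fst (snd v), snd (snd v)) \<or> (p, q) = (fst (snd v), snd u @ snd (snd v))"
    by (auto dest!: set_lprod)
  have "set (snd u) \<subseteq> XY" using set_W0 [of "fst u" "snd u" s] u zrep_right.prems(1) zrep_right.hyps by auto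
  moreover have "set (fst (snd v)) \<subseteq> XY \<and> set (snd (snd v)) \<subseteq> XY"
    using zrep_right.IH [of "fst v" "fst (snd v)" "snd (snd v)"] zrep_right.prems(1) v by simp
  ultimately show ?case using pq by auto
next
  case (zrep_add s \<alpha> t \<beta>)
  have "jvars s \<subseteq> insert z XY" "jvars t \<subseteq> insert z XY" using zrep_add.prems by auto
  moreover have "(c, p, q) \<in> set \<alpha> \<or> (c, p, q) \<in> set \<beta>" using zrep_add.prems by simp
  ultimately show ?case using zrep_add.IH by blast
qed simp_all

lemma tev_cong: "(\<And>v. v \<in> jvars t \<Longrightarrow> \<phi> v = \<psi> v) \<Longrightarrow> tev \<phi> t = tev \<psi> t"
  by (induction t) auto

abbreviation "wlr \<equiv> \<lambda>(p, q). wp lamv p * wp rhov q"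

text \<open>\<open>LV s\<close> is half of a left plus half of a right multiplication, and these
  prepend the words of s to p and to q. For q one has to pass \<open>lam\<close> through
  \<open>rho\<close>.\<close>

lemma LV_wsum:
  assumes "jvars s \<subseteq> XY" "\<And>c p q. (c, p, q) \<in> set \<beta> \<Longrightarrow> set p \<subseteq> XY \<and> set q \<subseteq> XY"
  shows "wsum wlr (lprod (\<lambda>w v. (w @ fst v, snd v)) (W0 s) \<beta> @ lprod (\<lambda>w v. (fst v, w @ snd v)) (W0 s) \<beta>)
    = LV s * wsum wlr \<beta>"
proof -
  have 1: "wsum wlr (lprod (\<lambda>w v. (w @ fst v, snd v)) (W0 s) \<beta>) = (1/2) *\<^sub>R (wsum (wp lamv) (W0 s) * wsum wlr \<beta>)"
    by (rule wsum_lprod) (auto simp: mult.assoc)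
  have 2: "wsum wlr (lprod (\<lambda>w v. (fst v, w @ snd v)) (W0 s) \<beta>) = (1/2) *\<^sub>R (wsum (wp rhov) (W0 s) * wsum wlr \<beta>)"
  proof (rule wsum_lprod)
    fix c w c' v assume w: "(c, w) \<in> set (W0 s)" and v: "(c', v) \<in> set \<beta>"
    obtain p q where v_eq: "v = (p, q)" by fastforce
    have "set p \<subseteq> XY" "set w \<subseteq> XY" using assms v v_eq set_W0 [OF w] by auto
    then have "wp lamv p * wp rhov w = wp rhov w * wp lamv p" by (rule wp_commute)
    then show "wlr (fst v, w @ snd v) = wp rhov w * wlr v" by (simp add: v_eq flip: mult.assoc)
  qed
  show ?thesis by (simp add: 1 2 LV_def aev_W0 distrib_right scaleR_add_right)
qed

text \<open>From here on the value of a term linear in z is governed by its expansion alone, and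
  every relation between the lifted letters acts on it.\<close>

lemma zrep_value:
  assumes "zrep z t \<beta>" "jvars t \<subseteq> insert z XY" "\<phi> z = zz" "\<And>v. v \<in> XY \<Longrightarrow> v \<noteq> z \<Longrightarrow> \<phi> v = val v"
  shows "tev \<phi> t = fst (app (wsum wlr \<beta>) (zz, 0))"
  using assms(1,2)
proof (induction rule: zrep.induct)
  case (zrep_left s t \<beta>)
  then have s: "jvars s \<subseteq> XY" by auto
  have "tev \<phi> s = tev val s" by (rule tev_cong) (use s zrep_left assms(4) in auto)
  moreover have "wsum wlr (lprod (\<lambda>w v. (w @ fst v, snd v)) (W0 s) \<beta> @ lprod (\<lambda>w v. (fst v, w @ snd v)) (W0 s) \<beta>)
    = LV s * wsum wlr \<beta>"
    using zrep_left set_zrep by (intro LV_wsum s) auto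
  ultimately show ?case using zrep_left by (simp only:) (simp add: fst_LV [OF s])
next
  case (zrep_right s t \<beta>)
  then have s: "jvars s \<subseteq> XY" by auto
  have "tev \<phi> s = tev val s" by (rule tev_cong) (use s zrep_right assms(4) in auto)
  moreover have "wsum wlr (lprod (\<lambda>w v. (w @ fst v, snd v)) (W0 s) \<beta> @ lprod (\<lambda>w v. (fst v, w @ snd v)) (W0 s) \<beta>)
    = LV s * wsum wlr \<beta>"
    using zrep_right set_zrep by (intro LV_wsum s) auto
  ultimately show ?case using zrep_right by (simp only:) (simp add: fst_LV [OF s] jmul_comm [of _ "tev val s"])
qed (auto simp: assms(3))

end

section \<open>Normal forms of words and chains of matrices\<close>

definition ins :: "('v \<Rightarrow> bool) \<Rightarrow> 'v \<Rightarrow> (bool \<times> 'v multiset) list \<Rightarrow> (bool \<times> 'v multiset) list" where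
  "ins side v bs = (case bs of [] \<Rightarrow> [(side v, {#v#})]
     | b # r \<Rightarrow> if fst b = side v then (fst b, add_mset v (snd b)) # r else (side v, {#v#}) # bs)"

text \<open>The normal form of a word when letters of equal side commute: its maximal one-sided
  blocks, each reduced to a multiset.\<close>

primrec nf :: "('v \<Rightarrow> bool) \<Rightarrow> 'v list \<Rightarrow> (bool \<times> 'v multiset) list" where
  "nf side [] = []"
| "nf side (v # p) = ins side v (nf side p)"

definition mlist :: "'v multiset \<Rightarrow> 'v list" where "mlist M = (SOME xs. mset xs = M)"

lemma mset_mlist [simp]: "mset (mlist M) = M"
  unfolding mlist_def by (rule someI_ex) (rule ex_mset)

lemma set_mlist [simp]: "set (mlist M) = set_mset M"
  by (metis mset_mlist set_mset_mset)

definition cw :: "(bool \<times> 'v multiset) list \<Rightarrow> 'v list" where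
  "cw bs = concat (map (\<lambda>b. mlist (snd b)) bs)"

lemma cw_simps [simp]: "cw [] = []" "cw (b # bs) = mlist (snd b) @ cw bs"
  by (simp_all add: cw_def)

lemma wp_perm:
  fixes f :: "'v \<Rightarrow> 'r::monoid_mult"
  assumes "mset xs = mset ys" "\<And>u v. \<lbrakk>u \<in> set xs; v \<in> set xs\<rbrakk> \<Longrightarrow> f u * f v = f v * f u"
  shows "wp f xs = wp f ys"
  using assms
proof (induction xs arbitrary: ys)
  case (Cons x xs)
  then have "x \<in> set ys" using mset_eq_setD [OF Cons.prems(1)] by auto
  then obtain ys1 ys2 where ys: "ys = ys1 @ x # ys2" by (auto dest: split_list)
  with Cons.prems(1) have m: "mset xs = mset (ys1 @ ys2)" by simp
  have sub: "set ys1 \<subseteq> set xs" using mset_eq_setD [OF m] by simp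
  have comm: "f x * f z = f z * f x" if "z \<in> set xs" for z using Cons.prems(2) that by simp
  have mv: "wp f (x # zs) = wp f zs * f x" if "set zs \<subseteq> set xs" for zs
    using that
  proof (induction zs)
    case (Cons z zs)
    then have c: "f x * f z = f z * f x" by (intro comm) simp
    have "wp f (x # z # zs) = f z * wp f (x # zs)" using arg_cong [OF c, of "\<lambda>y. y * wp f zs"] by (simp add: mult.assoc)
    also have "\<dots> = wp f (z # zs) * f x" using Cons.IH Cons.prems by (simp add: mult.assoc)
    finally show ?case .
  qed simp
  have "wp f xs = wp f (ys1 @ ys2)" by (rule Cons.IH [OF m]) (simp add: Cons.prems(2))
  then have "wp f (x # xs) = wp f (x # ys1) * wp f ys2" by (simp add: mult.assoc)
  also have "\<dots> = wp f ys" unfolding mv [OF sub] ys by (simp add: mult.assoc)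
  finally show ?case .
qed simp

lemma nf_letters: "\<forall>c\<in>set (nf side p). \<forall>v\<in>#snd c. v \<in> set p \<and> side v = fst c"
proof (induction p)
  case (Cons w p)
  then show ?case by (cases "nf side p") (auto simp: ins_def split: if_splits)
qed simp

lemma wp_nf:
  fixes f :: "'v \<Rightarrow> 'r::monoid_mult"
  assumes "\<And>u v. \<lbrakk>u \<in> set p; v \<in> set p; side u = side v\<rbrakk> \<Longrightarrow> f u * f v = f v * f u"
  shows "wp f p = wp f (cw (nf side p))"
  using assms
proof (induction p)
  case (Cons v p)
  then have IH: "wp f p = wp f (cw (nf side p))" by simp
  show ?case
  proof (cases "nf side p")
    case Nil
    have "wp f [v] = wp f (mlist {#v#})" by (rule wp_perm) auto
    with IH Nil show ?thesis by (simp add: ins_def)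
  next
    case (Cons b r)
    obtain s M where b: "b = (s, M)" by fastforce
    show ?thesis
    proof (cases "s = side v")
      case True
      have *: "u \<in> set (v # p) \<and> side u = s" if "u \<in> set (v # mlist M)" for u
        using that nf_letters [of side p] Cons b True by auto
      have "wp f (v # mlist M) = wp f (mlist (add_mset v M))"
        by (rule wp_perm) (use * Cons.prems in auto)
      with IH Cons b True show ?thesis by (simp add: ins_def flip: mult.assoc)
    next
      case False
      have "wp f [v] = wp f (mlist {#v#})" by (rule wp_perm) auto
      with IH Cons b False show ?thesis by (simp add: ins_def)
    qed
  qed
qed simp

section \<open>Coefficients of classes of words and independence of characters\<close>

definition coef :: "('w \<Rightarrow> 'k) \<Rightarrow> (real \<times> 'w) list \<Rightarrow> 'k \<Rightarrow> real" where
  "coef k \<beta> \<kappa> = wsum (\<lambda>w. if k w = \<kappa> then 1 else 0) \<beta>"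

lemma wsum_group:
  assumes "finite K" "\<And>c w. (c, w) \<in> set \<beta> \<Longrightarrow> k w \<in> K \<and> f w = g (k w)"
  shows "wsum f \<beta> = (\<Sum>\<kappa>\<in>K. coef k \<beta> \<kappa> *\<^sub>R g \<kappa>)"
  using assms(2)
proof (induction \<beta>)
  case (Cons u \<beta>)
  have u: "k (snd u) \<in> K" "f (snd u) = g (k (snd u))" using Cons.prems [of "fst u" "snd u"] by auto
  have "(\<Sum>\<kappa>\<in>K. coef k (u # \<beta>) \<kappa> *\<^sub>R g \<kappa>)
      = (\<Sum>\<kappa>\<in>K. if k (snd u) = \<kappa> then fst u *\<^sub>R g \<kappa> else 0) + (\<Sum>\<kappa>\<in>K. coef k \<beta> \<kappa> *\<^sub>R g \<kappa>)"
    unfolding sum.distrib [symmetric] by (rule sum.cong) (auto simp: coef_def scaleR_add_left)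
  also have "(\<Sum>\<kappa>\<in>K. coef k \<beta> \<kappa> *\<^sub>R g \<kappa>) = wsum f \<beta>"
    by (rule Cons.IH [symmetric]) (use Cons.prems in auto)
  also have "(\<Sum>\<kappa>\<in>K. if k (snd u) = \<kappa> then fst u *\<^sub>R g \<kappa> else 0) + wsum f \<beta> = wsum f (u # \<beta>)"
    using assms(1) u by simp
  finally show ?case by simp
qed (simp add: coef_def)

text \<open>Dedekind's theorem for functions that are multiplicative with respect to an arbitrary
  operation. Subtracting \<open>\<chi> \<kappa>0 a\<close> times the relation at b from the relation
  at \<open>mul a b\<close> removes \<kappa>0, and a is chosen so that a given other coefficient
  survives.\<close>

lemma characters_independent:
  fixes \<chi> :: "'k \<Rightarrow> 'm \<Rightarrow> real"
  assumes "finite K" "inj_on \<chi> K" "\<And>\<kappa> a b. \<kappa> \<in> K \<Longrightarrow> \<chi> \<kappa> (mul a b) = \<chi> \<kappa> a * \<chi> \<kappa> b"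
    "\<And>\<kappa>. \<kappa> \<in> K \<Longrightarrow> \<chi> \<kappa> e = 1" "\<And>a. (\<Sum>\<kappa>\<in>K. c \<kappa> * \<chi> \<kappa> a) = 0" "\<kappa> \<in> K"
  shows "c \<kappa> = 0"
  using assms
proof (induction K arbitrary: c \<kappa> rule: finite_induct)
  case (insert \<kappa>0 K)
  have *: "c \<kappa> = 0" if \<kappa>: "\<kappa> \<in> K" for \<kappa>
  proof -
    have "\<chi> \<kappa> \<noteq> \<chi> \<kappa>0" using insert \<kappa> by (auto simp: inj_on_def)
    then obtain a where a: "\<chi> \<kappa> a \<noteq> \<chi> \<kappa>0 a" by auto
    have "(\<Sum>\<kappa>\<in>K. (c \<kappa> * (\<chi> \<kappa> a - \<chi> \<kappa>0 a)) * \<chi> \<kappa> b) = 0" for b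
    proof -
      have 1: "c \<kappa>0 * \<chi> \<kappa>0 (mul a b) + (\<Sum>\<kappa>\<in>K. c \<kappa> * \<chi> \<kappa> (mul a b)) = 0"
        using insert.prems(4) [of "mul a b"] insert.hyps by simp
      have 2: "c \<kappa>0 * \<chi> \<kappa>0 b + (\<Sum>\<kappa>\<in>K. c \<kappa> * \<chi> \<kappa> b) = 0"
        using insert.prems(4) [of b] insert.hyps by simp
      have 3: "(\<Sum>\<kappa>\<in>K. c \<kappa> * \<chi> \<kappa> (mul a b)) = (\<Sum>\<kappa>\<in>K. c \<kappa> * (\<chi> \<kappa> a * \<chi> \<kappa> b))"
        by (rule sum.cong) (simp_all add: insert.prems(2))
      have "(\<Sum>\<kappa>\<in>K. (c \<kappa> * (\<chi> \<kappa> a - \<chi> \<kappa>0 a)) * \<chi> \<kappa> b)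
          = (\<Sum>\<kappa>\<in>K. c \<kappa> * (\<chi> \<kappa> a * \<chi> \<kappa> b)) - \<chi> \<kappa>0 a * (\<Sum>\<kappa>\<in>K. c \<kappa> * \<chi> \<kappa> b)"
        by (simp add: algebra_simps sum_subtractf sum_distrib_left)
      also have "\<dots> = - \<chi> \<kappa>0 a * (c \<kappa>0 * \<chi> \<kappa>0 b + (\<Sum>\<kappa>\<in>K. c \<kappa> * \<chi> \<kappa> b))"
        using 1 3 by (simp add: insert.prems(2) algebra_simps)
      finally show ?thesis using 2 by simp
    qed
    then have "c \<kappa> * (\<chi> \<kappa> a - \<chi> \<kappa>0 a) = 0"
      using insert.prems(1)
      by (intro insert.IH [where c = "\<lambda>\<kappa>. c \<kappa> * (\<chi> \<kappa> a - \<chi> \<kappa>0 a)", OF _ _ _ _ \<kappa>])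
        (simp_all add: insert.prems(2,3))
    with a show ?thesis by simp
  qed
  moreover have "c \<kappa>0 = 0"
    using insert.prems(4) [of e] insert.hyps insert.prems(3) * by simp
  ultimately show ?case using insert.prems(5) by auto
qed simp

section \<open>Monomials attached to lists of blocks\<close>

primrec mono :: "(bool \<times> 'v multiset) list \<Rightarrow> (nat \<Rightarrow> 'v \<Rightarrow> real) \<Rightarrow> real" where
  "mono [] f = 1"
| "mono (b # r) f = (\<Prod>v\<in>#snd b. f (length r) v) * mono r f"

text \<open>Blocks are numbered from the right: number 0 is the block that acts first.\<close>

primrec tmatch :: "(nat \<Rightarrow> bool) \<Rightarrow> (bool \<times> 'v multiset) list \<Rightarrow> bool" where
  "tmatch t [] \<longleftrightarrow> True"
| "tmatch t (b # r) \<longleftrightarrow> fst b = t (length r) \<and> tmatch t r"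

text \<open>The two-by-two matrix M with all entries 1 satisfies \<open>M * M = 2 * M\<close>, so k
  letters acting on the same edge contribute \<open>2 ^ (k - 1)\<close>.\<close>

primrec mweight :: "(bool \<times> 'v multiset) list \<Rightarrow> real" where
  "mweight [] = 1"
| "mweight (b # r) = 2 ^ (size (snd b) - 1) * mweight r"

lemma mono_mult: "mono bs (\<lambda>i v. f i v * g i v) = mono bs f * mono bs g"
  by (induction bs) (simp_all add: prod_mset.distrib)

lemma mono_one: "mono bs (\<lambda>i v. 1) = 1"
  by (induction bs) simp_all

lemma mono_cong: "(\<And>i v. i < length bs \<Longrightarrow> f i v = g i v) \<Longrightarrow> mono bs f = mono bs g"
  by (induction bs) simp_all

lemma mweight_nonzero: "mweight bs > 0"
  by (induction bs) simp_all

lemma prod_mset_point: "(\<Prod>w\<in>#M. if w = v then 2 else 1 :: real) = 2 ^ count M v"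
  by (induction M) auto

text \<open>Giving a single variable the value 2 and all others the value 1 reads off its exponent.
  The sides of the blocks are not visible in the monomial and come from t.\<close>

lemma mono_inject:
  assumes "\<And>f. mono bs f = mono bs' f" "length bs = length bs'" "tmatch t bs" "tmatch t bs'"
  shows "bs = bs'"
  using assms
proof (induction bs arbitrary: bs')
  case (Cons b r)
  then obtain b' r' where bs': "bs' = b' # r'" by (cases bs') auto
  have len: "length r = length r'" using Cons.prems bs' by simp
  have "count (snd b) v = count (snd b') v" for v
  proof -
    define f where "f i w = (if i = length r \<and> w = v then 2 else 1 :: real)" for i w
    have "mono r f = mono r (\<lambda>i v. 1)" "mono r' f = mono r' (\<lambda>i v. 1)"
      by (rule mono_cong, simp add: f_def len)+
    then have "(\<Prod>w\<in>#snd b. f (length r) w) = (\<Prod>w\<in>#snd b'. f (length r) w)"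
      using Cons.prems(1) [of f] by (simp add: bs' len mono_one)
    then show ?thesis by (simp add: f_def prod_mset_point)
  qed
  then have "snd b = snd b'" by (rule multiset_eqI)
  moreover have "fst b = fst b'" using Cons.prems bs' by simp
  moreover have "r = r'"
  proof (rule Cons.IH)
    fix f
    define g where "g i v = (if i < length r then f i v else (1::real))" for i and v :: 'a
    have "mono r g = mono r f" "mono r' g = mono r' f" by (rule mono_cong, simp add: g_def len)+
    then show "mono r f = mono r' f"
      using Cons.prems(1) [of g] by (simp add: bs' len) (simp add: g_def len)
  qed (use Cons.prems bs' in auto)
  ultimately show ?case by (simp add: bs' prod_eq_iff)
qed simp

primrec alternating :: "(bool \<times> 'b) list \<Rightarrow> bool" where
  "alternating [] \<longleftrightarrow> True"
| "alternating (b # r) \<longleftrightarrow> alternating r \<and> (r \<noteq> [] \<longrightarrow> fst b \<noteq> fst (hd r))"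

lemma alternating_nf: "alternating (nf side p)"
proof (induction p)
  case (Cons v p)
  then show ?case by (cases "nf side p") (auto simp: ins_def)
qed simp

lemma alternating_tmatch: "alternating bs \<Longrightarrow> tmatch (\<lambda>i. fst (last bs) = even i) bs"
proof (induction bs)
  case (Cons b r)
  then show ?case by (cases r) auto
qed simp

instantiation "fun" :: (type, real_vector) real_vector
begin
definition scaleR_fun :: "real \<Rightarrow> ('a \<Rightarrow> 'b) \<Rightarrow> 'a \<Rightarrow> 'b" where "scaleR_fun r f = (\<lambda>x. r *\<^sub>R f x)"
instance by standard (auto simp: scaleR_fun_def fun_eq_iff algebra_simps)
end

section \<open>Chains of two-by-two blocks\<close>

context
  fixes side :: "'v \<Rightarrow> bool" and Len :: "bool \<Rightarrow> nat" and tau :: "bool \<Rightarrow> nat \<Rightarrow> bool"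
    and \<alpha> :: "bool \<Rightarrow> nat \<Rightarrow> 'v \<Rightarrow> real"
begin

definition link :: "'v \<Rightarrow> (bool \<times> nat \<Rightarrow> real) \<Rightarrow> bool \<Rightarrow> nat \<Rightarrow> real" where
  "link v u b i = (if i < Len b \<and> tau b i = side v then \<alpha> b i v * (u (b, i) + u (b, Suc i)) else 0)"

text \<open>The chain b has the nodes 0 to \<open>Len b\<close>. A letter v acts on the edge from i
  to i + 1, provided that the side \<open>tau b i\<close> of the edge is that of v, by the matrix
  with all four entries \<open>\<alpha> b i v\<close>. If the sides alternate, edges of equal side
  are disjoint, which makes letters of equal side commute.\<close>

definition chain :: "'v \<Rightarrow> (bool \<times> nat \<Rightarrow> real) endo" where
  "chain v = Endo (\<lambda>u (b, d). link v u b d + (case d of 0 \<Rightarrow> 0 | Suc i \<Rightarrow> link v u b i))"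

lemma app_chain: "app (chain v) u (b, d) = link v u b d + (case d of 0 \<Rightarrow> 0 | Suc i \<Rightarrow> link v u b i)"
proof -
  have "linear (\<lambda>u (b, d). link v u b d + (case d of 0 \<Rightarrow> 0 | Suc i \<Rightarrow> link v u b i))"
    by (intro linearI)
       (auto simp: fun_eq_iff link_def scaleR_fun_def plus_fun_def algebra_simps split: nat.splits)
  then show ?thesis unfolding chain_def by (simp add: app_Endo)
qed

definition unitv :: "bool \<times> nat \<Rightarrow> bool \<times> nat \<Rightarrow> real" where
  "unitv n m = (if m = n then 1 else 0)"

definition bval :: "bool \<Rightarrow> (bool \<times> 'v multiset) list \<Rightarrow> real" where
  "bval b bs = (if tmatch (tau b) bs then mweight bs * mono bs (\<alpha> b) else 0)"

lemma bval_Nil: "bval b [] = 1"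
  by (simp add: bval_def)

lemma bval_Cons:
  "bval b (c # r) = (if fst c = tau b (length r)
     then 2 ^ (size (snd c) - 1) * (\<Prod>v\<in>#snd c. \<alpha> b (length r) v) * bval b r else 0)"
  by (simp add: bval_def)

definition cent :: "'v list \<Rightarrow> bool \<Rightarrow> nat \<Rightarrow> real" where
  "cent p b d = app (wp chain p) (unitv (b, 0)) (b, d)"

lemma cent_Cons:
  "cent (v # p) b d = link v (\<lambda>(b, i). cent p b i) b d + (case d of 0 \<Rightarrow> 0 | Suc i \<Rightarrow> link v (\<lambda>(b, i). cent p b i) b i)"
  by (simp add: cent_def app_chain link_def split: nat.splits)

lemma size_nf_pos: "\<forall>c\<in>set (nf side p). 0 < size (snd c)"
proof (induction p)
  case (Cons w p)
  then show ?case by (cases "nf side p") (auto simp: ins_def split: if_splits)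
qed simp

text \<open>Each block advances by at most one edge, so from node 0 a word reaches node
  \<open>length (nf side p)\<close> only by spending block i on edge i. The third claim, that the
  other end of the last edge carries the same entry, is what the induction needs when a further
  letter joins the leading block.\<close>

lemma cent_nf:
  assumes tau: "\<And>b i. tau b (Suc i) = (\<not> tau b i)"
  shows "length (nf side p) \<le> Len b \<Longrightarrow>
    (\<forall>d>length (nf side p). cent p b d = 0) \<and> cent p b (length (nf side p)) = bval b (nf side p) \<and>
    (\<forall>s M r. nf side p = (s, M) # r \<longrightarrow> s = tau b (length r) \<longrightarrow> cent p b (length r) = bval b (nf side p))"
proof (induction p)
  case Nil
  show ?case by (simp add: cent_def unitv_def bval_Nil)
next
  case (Cons v p)
  let ?bs = "nf side p"
  show ?case
  proof (cases "?bs = [] \<or> fst (hd ?bs) \<noteq> side v")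
    case True
    then have nf: "nf side (v # p) = (side v, {#v#}) # ?bs"
      by (cases ?bs) (auto simp: ins_def)
    with Cons.prems have len: "length ?bs < Len b" by simp
    with Cons.IH have IH: "\<forall>d>length ?bs. cent p b d = 0" "cent p b (length ?bs) = bval b ?bs" by auto
    have 1: "cent (v # p) b d = 0" if "d > Suc (length ?bs)" for d
      using that IH(1) by (auto simp: cent_Cons link_def split: nat.splits)
    have 2: "cent (v # p) b (Suc (length ?bs)) = bval b ((side v, {#v#}) # ?bs)"
      using IH len by (simp add: cent_Cons link_def bval_Cons)
    \<comment> \<open>The preceding edge has the other side, so only the edge numbered
      \<open>length ?bs\<close> contributes.\<close>
    have 3: "cent (v # p) b (length ?bs) = bval b ((side v, {#v#}) # ?bs)" if "side v = tau b (length ?bs)"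
      using IH len that tau [of b "length ?bs - 1"]
      by (auto simp: cent_Cons link_def bval_Cons split: nat.splits)
    show ?thesis unfolding nf using 1 2 3 by auto
  next
    case False
    then obtain M r where bs: "?bs = (side v, M) # r" by (cases ?bs) auto
    then have nf: "nf side (v # p) = (side v, add_mset v M) # r" by (simp add: ins_def)
    with Cons.prems have len: "length r < Len b" by simp
    have M: "Suc (size M - 1) = size M" using size_nf_pos [of p] bs by simp
    have IH: "\<forall>d>Suc (length r). cent p b d = 0" "cent p b (Suc (length r)) = bval b ?bs"
      "side v = tau b (length r) \<Longrightarrow> cent p b (length r) = bval b ?bs"
      using Cons.IH len bs by auto
    have z: "bval b ?bs = 0" if "tau b (length r) \<noteq> side v"
      using that by (simp add: bs bval_Cons)
    \<comment> \<open>M is nonempty, so the exponent of the weight does grow by one. The factor 2 is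
      the sum over the two equal ends of the edge.\<close>
    have step: "bval b ((side v, add_mset v M) # r) = 2 * \<alpha> b (length r) v * bval b ?bs"
      using M by (simp add: bs bval_Cons) (metis power_Suc)
    have 1: "cent (v # p) b d = 0" if "d > Suc (length r)" for d
    proof -
      define d' where "d' = d - 1"
      with that have d': "d = Suc d'" "d' \<ge> Suc (length r)" by simp_all
      show ?thesis
      proof (cases "d' = Suc (length r)")
        case True
        then show ?thesis using IH z tau d' by (auto simp: cent_Cons link_def)
      next
        case False
        then show ?thesis using IH(1) d' by (auto simp: cent_Cons link_def)
      qed
    qed
    have 2: "cent (v # p) b (Suc (length r)) = bval b ((side v, add_mset v M) # r)"
      unfolding step using IH z len tau by (auto simp: cent_Cons link_def)
    have 3: "cent (v # p) b (length r) = bval b ((side v, add_mset v M) # r)" if "side v = tau b (length r)"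
      unfolding step using IH len that tau [of b "length r - 1"]
      by (auto simp: cent_Cons link_def split: nat.splits)
    show ?thesis unfolding nf using 1 2 3 by auto
  qed
qed

end

text \<open>Among the classes with nonzero coefficient take one with the largest total number of
  blocks, and make the chains exactly as long as its two words. Only classes with the same lengths
  and the same sides contribute to the end entries, and as functions of \<alpha> their contributions
  are multiples of distinct characters.\<close>

lemma coef_eq_0:
  fixes \<beta> :: "(real \<times> 'v list \<times> 'v list) list" and side :: "'v \<Rightarrow> bool"
  defines "k \<equiv> (\<lambda>(p, q). (nf side p, nf side q))"
  assumes vanish: "\<And>Len tau \<alpha>. (\<And>b i. tau b (Suc i) = (\<not> tau b i)) \<Longrightarrow>
    wsum (\<lambda>(p, q). cent side Len tau \<alpha> p True (Len True) * cent side Len tau \<alpha> q False (Len False)) \<beta> = 0"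
  shows "coef k \<beta> \<kappa> = 0"
proof (rule ccontr)
  assume nz: "coef k \<beta> \<kappa> \<noteq> 0"
  define K where "K = k ` snd ` set \<beta>"
  have fin: "finite K" by (simp add: K_def)
  have outside: "coef k \<beta> \<kappa> = 0" if "\<kappa> \<notin> K" for \<kappa>
  proof -
    have "\<forall>u\<in>set \<beta>. k (snd u) \<noteq> \<kappa>" using that by (auto simp: K_def)
    then show ?thesis by (induction \<beta>) (auto simp: coef_def)
  qed
  define sz where "sz \<kappa> = length (fst \<kappa>) + length (snd \<kappa>)" for \<kappa> :: "(bool \<times> 'v multiset) list \<times> (bool \<times> 'v multiset) list"
  define K1 where "K1 = {\<kappa> \<in> K. coef k \<beta> \<kappa> \<noteq> 0}"
  have "finite K1" "\<kappa> \<in> K1" using nz outside [of \<kappa>] fin unfolding K1_def by simp_all blast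
  then have "Max (sz ` K1) \<in> sz ` K1" by (intro Max_in) auto
  then obtain \<kappa>0 where k0: "\<kappa>0 \<in> K1" "sz \<kappa>0 = Max (sz ` K1)" by auto
  then have \<kappa>0: "\<kappa>0 \<in> K1" "\<And>\<kappa>. \<kappa> \<in> K1 \<Longrightarrow> sz \<kappa> \<le> sz \<kappa>0"
    using \<open>finite K1\<close> by simp_all
  obtain P Q where PQ: "\<kappa>0 = (P, Q)" by fastforce
  obtain p0 q0 where pq0: "P = nf side p0" "Q = nf side q0"
    using \<kappa>0(1) PQ by (auto simp: K1_def K_def k_def)
  define Len where "Len b = (if b then length P else length Q)" for b
  \<comment> \<open>Edge 0 gets the side of the last block, which acts first; the other sides
    alternate as in any normal form.\<close>
  define tau where "tau b i = (fst (last (if b then P else Q)) = even i)" for b and i :: nat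
  define K2 where "K2 = {(P', Q') \<in> K1. length P' = length P \<and> length Q' = length Q \<and> tmatch (tau True) P' \<and> tmatch (tau False) Q'}"
  define c where "c = (\<lambda>(P', Q'). coef k \<beta> (P', Q') * mweight P' * mweight Q')"
  define \<chi> where "\<chi> = (\<lambda>(P', Q') (\<alpha> :: bool \<Rightarrow> nat \<Rightarrow> 'v \<Rightarrow> real). mono P' (\<alpha> True) * mono Q' (\<alpha> False))"
  have tau: "tau b (Suc i) = (\<not> tau b i)" for b i by (auto simp: tau_def)
  have main: "(\<Sum>\<kappa>\<in>K2. c \<kappa> * \<chi> \<kappa> \<alpha>) = 0" for \<alpha>
  proof -
    define F where "F p q = cent side Len tau \<alpha> p True (Len True) * cent side Len tau \<alpha> q False (Len False)" for p q
    define G where "G = (\<lambda>(P', Q'). if length P' = length P \<and> length Q' = length Q then bval tau \<alpha> True P' * bval tau \<alpha> False Q' else 0)"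
    define H where "H = (\<lambda>(p, q). if coef k \<beta> (k (p, q)) = 0 then F p q else G (k (p, q)))"
    have FG: "F p q = G (k (p, q))" if "k (p, q) \<in> K1" for p q
    proof -
      have sz: "length (nf side p) + length (nf side q) \<le> length P + length Q"
        using \<kappa>0(2) [OF that] by (simp add: k_def sz_def PQ)
      have A: "cent side Len tau \<alpha> p True (length P) = (if length (nf side p) = length P then bval tau \<alpha> True (nf side p) else 0)"
        if "length (nf side p) \<le> length P"
        using cent_nf [where side = side and Len = Len and tau = tau and \<alpha> = \<alpha> and p = p and b = True, OF tau] that
        by (auto simp: Len_def)
      have B: "cent side Len tau \<alpha> q False (length Q) = (if length (nf side q) = length Q then bval tau \<alpha> False (nf side q) else 0)"
        if "length (nf side q) \<le> length Q"
        using cent_nf [where side = side and Len = Len and tau = tau and \<alpha> = \<alpha> and p = q and b = False, OF tau] that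
        by (auto simp: Len_def)
      \<comment> \<open>By maximality a word that is too long has a partner that is too short and
        whose end entry is 0.\<close>
      consider "length (nf side p) = length P" "length (nf side q) = length Q"
        | "length (nf side p) < length P" | "length (nf side q) < length Q" using sz by linarith
      then show ?thesis by cases (use A B in \<open>simp_all add: F_def G_def k_def Len_def\<close>)
    qed
    \<comment> \<open>Outside \<open>K1\<close> the coefficient is 0. The value there only has to
      depend on the class, which the representative words \<open>cw\<close> ensure.\<close>
    define g where "g \<kappa> = (if \<kappa> \<in> K1 then G \<kappa> else F (cw (fst \<kappa>)) (cw (snd \<kappa>)))" for \<kappa>
    have Fnf: "cent side Len tau \<alpha> p b d = cent side Len tau \<alpha> (cw (nf side p)) b d" for p b d
    proof -
      have "chain side Len tau \<alpha> u * chain side Len tau \<alpha> v = chain side Len tau \<alpha> v * chain side Len tau \<alpha> u"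
        if uv: "side u = side v" for u v
      proof (rule endo_eqI, rule ext)
        fix w and n :: "bool \<times> nat"
        obtain b d where n: "n = (b, d)" by fastforce
        show "app (chain side Len tau \<alpha> u * chain side Len tau \<alpha> v) w n
          = app (chain side Len tau \<alpha> v * chain side Len tau \<alpha> u) w n"
          using tau [of b d] tau [of b "d - 1"] tau [of b "d - 2"] uv
          by (cases d; cases "d - 1") (auto simp: n app_chain link_def algebra_simps split: nat.splits)
      qed
      from wp_nf [where f = "chain side Len tau \<alpha>" and side = side and p = p, OF this]
      show ?thesis by (simp add: cent_def)
    qed
    have "wsum (\<lambda>(p, q). F p q) \<beta> = (\<Sum>\<kappa>\<in>K. coef k \<beta> \<kappa> *\<^sub>R g \<kappa>)"
    proof (rule wsum_group [OF fin])
      fix c w assume w: "(c, w) \<in> set \<beta>"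
      obtain p q where pq: "w = (p, q)" by fastforce
      have "F p q = F (cw (nf side p)) (cw (nf side q))"
        using Fnf unfolding F_def by metis
      moreover have "k w \<in> K" unfolding K_def using w by (metis imageI snd_conv)
      ultimately show "k w \<in> K \<and> (case w of (p, q) \<Rightarrow> F p q) = g (k w)"
        using FG [of p q] by (auto simp: pq g_def k_def)
    qed
    moreover have "wsum (\<lambda>(p, q). F p q) \<beta> = 0" unfolding F_def by (rule vanish) (rule tau)
    moreover have "(\<Sum>\<kappa>\<in>K. coef k \<beta> \<kappa> *\<^sub>R g \<kappa>) = (\<Sum>\<kappa>\<in>K2. c \<kappa> * \<chi> \<kappa> \<alpha>)"
    proof (rule sum.mono_neutral_cong_right [OF fin])
      show "K2 \<subseteq> K" by (auto simp: K2_def K1_def)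
      show "\<forall>\<kappa>\<in>K - K2. coef k \<beta> \<kappa> *\<^sub>R g \<kappa> = 0"
        by (auto simp: K2_def K1_def g_def G_def bval_def split: if_splits)
      show "coef k \<beta> \<kappa> *\<^sub>R g \<kappa> = c \<kappa> * \<chi> \<kappa> \<alpha>" if "\<kappa> \<in> K2" for \<kappa>
        using that by (auto simp: K2_def g_def G_def bval_def c_def \<chi>_def)
    qed
    ultimately show ?thesis by simp
  qed
  have "c \<kappa>0 = 0"
  proof (rule characters_independent [where \<chi> = \<chi> and K = K2 and c = c
        and mul = "\<lambda>\<alpha> \<alpha>' b i v. \<alpha> b i v * \<alpha>' b i v" and e = "\<lambda>b i v. 1"])
    show "finite K2" by (rule finite_subset [OF _ fin]) (auto simp: K2_def K1_def)
    show "inj_on \<chi> K2"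
    proof (rule inj_onI)
      fix x y assume xy: "x \<in> K2" "y \<in> K2" "\<chi> x = \<chi> y"
      obtain P1 Q1 P2 Q2 where x: "x = (P1, Q1)" and y: "y = (P2, Q2)" by fastforce
      have e: "mono P1 f * mono Q1 g = mono P2 f * mono Q2 g" for f g
        using fun_cong [OF xy(3), of "\<lambda>b. if b then f else g"] by (simp add: x y \<chi>_def)
      have "P1 = P2" by (rule mono_inject [where t = "tau True"])
          (use e [of _ "\<lambda>i v. 1"] xy in \<open>auto simp: x y K2_def mono_one\<close>)
      moreover have "Q1 = Q2" by (rule mono_inject [where t = "tau False"])
          (use e [of "\<lambda>i v. 1"] xy in \<open>auto simp: x y K2_def mono_one\<close>)
      ultimately show "x = y" by (simp add: x y)
    qed
    show "\<kappa>0 \<in> K2" using \<kappa>0(1) alternating_tmatch [OF alternating_nf [of side p0]] alternating_tmatch [OF alternating_nf [of side q0]]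
      by (simp add: K2_def PQ pq0 tau_def [abs_def])
    show "(\<Sum>\<kappa>\<in>K2. c \<kappa> * \<chi> \<kappa> \<alpha>) = 0" for \<alpha> by (rule main)
    show "\<chi> \<kappa> (\<lambda>b i v. \<alpha> b i v * \<alpha>' b i v) = \<chi> \<kappa> \<alpha> * \<chi> \<kappa> \<alpha>'" for \<kappa> \<alpha> \<alpha>'
      by (cases \<kappa>) (simp add: \<chi>_def mono_mult)
    show "\<chi> \<kappa> (\<lambda>b i v. 1) = 1" for \<kappa> by (cases \<kappa>) (simp add: \<chi>_def mono_one)
  qed
  then show False
    using \<kappa>0(1) mweight_nonzero [of P] mweight_nonzero [of Q] by (simp add: c_def PQ K1_def)
qed

section \<open>Commutator derivations and rotations\<close>

text \<open>The obstruction to \<open>a \<bullet> a\<close> operator commuting with b. As a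
  commutator of multiplications it is a derivation.\<close>

definition dersq :: "'a::jordan \<Rightarrow> 'a \<Rightarrow> 'a endo" where
  "dersq a b = L (a \<bullet> a) * L b - L b * L (a \<bullet> a)"

definition derivation :: "'a::jordan endo \<Rightarrow> bool" where
  "derivation D \<longleftrightarrow> (\<forall>x y. app D (x \<bullet> y) = app D x \<bullet> y + x \<bullet> app D y)"

lemma derivation_L: "derivation D \<Longrightarrow> D * L x = L x * D + L (app D x)"
  by (rule endo_eqI) (simp add: derivation_def add.commute)

lemma derivationI: "(\<And>x. D * L x = L x * D + L (app D x)) \<Longrightarrow> derivation D"
  unfolding derivation_def
proof (intro allI)
  fix x y assume "\<And>x. D * L x = L x * D + L (app D x)"
  from arg_cong [OF this [of x], of "\<lambda>f. app f y"]
  show "app D (x \<bullet> y) = app D x \<bullet> y + x \<bullet> app D y" by (simp add: add.commute)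
qed

lemma derivation_commutator: "derivation (L (x :: 'a::jordan) * L y - L y * L x)"
proof (rule derivationI)
  fix z :: 'a
  show "(L x * L y - L y * L x) * L z = L z * (L x * L y - L y * L x) + L (app (L x * L y - L y * L x) z)"
    using L_product [of x z y] L_product [of y z x]
    by (simp add: L_diff algebra_simps jmul_comm)
qed

section \<open>The derivations attached to an operator commuting pair\<close>

context
  fixes a b :: "'a::jordan"
  assumes ab: "L a * L b = L b * L a"
begin

lemma ab_app: "a \<bullet> (b \<bullet> c) = b \<bullet> (a \<bullet> c)"
  using arg_cong [OF ab, of "\<lambda>f. app f c"] by simp

lemma dersq_alt: "dersq a b = 2 *\<^sub>R (L a * L (a \<bullet> b) - L (a \<bullet> b) * L a)"
  using L_linearized [of a a b] by (simp add: dersq_def jmul_comm [of b a] scaleR_2 algebra_simps)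

lemma dersq_alt': "dersq b a = 2 *\<^sub>R (L b * L (a \<bullet> b) - L (a \<bullet> b) * L b)"
  using L_linearized [of b b a] by (simp add: dersq_def jmul_comm [of b a] scaleR_2 algebra_simps)

lemma derivation_dersq: "derivation (dersq a b)" "derivation (dersq b a)"
  unfolding dersq_def by (rule derivation_commutator)+

lemma dersq_a: "app (dersq a b) a = 0"
proof -
  have "(a \<bullet> a) \<bullet> (b \<bullet> a) = a \<bullet> ((a \<bullet> a) \<bullet> b)"
    using jordan_law [of a b] by (simp add: jmul_comm)
  moreover have "b \<bullet> ((a \<bullet> a) \<bullet> a) = a \<bullet> ((a \<bullet> a) \<bullet> b)"
    using ab_app [of "a \<bullet> a"] by (simp add: jmul_comm)
  ultimately show ?thesis by (simp add: dersq_def)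
qed

lemma dersq_swap: "app (dersq a b) b = app (dersq b a) a"
proof -
  have "a \<bullet> ((a \<bullet> b) \<bullet> b) = b \<bullet> ((a \<bullet> b) \<bullet> a)"
    using ab_app [of "a \<bullet> b"] by (simp add: jmul_comm)
  then show ?thesis by (simp add: dersq_alt dersq_alt' jmul_comm)
qed

end

context
  fixes a b :: "'a::jordan"
  assumes ab: "L a * L b = L b * L a"
begin

lemma dersq_b: "app (dersq b a) b = 0"
  by (rule dersq_a) (simp add: ab)

abbreviation "dersq_self \<equiv> app (dersq a b) b"

lemma dersq_self_commute_left: "L dersq_self * L a = L a * L dersq_self"
proof -
  have "L dersq_self = dersq a b * L b - L b * dersq a b"
    using derivation_L [OF derivation_dersq(1) [OF ab], of b] by simp
  moreover have "dersq a b * L a = L a * dersq a b"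
    using derivation_L [OF derivation_dersq(1) [OF ab], of a] by (simp add: dersq_a [OF ab] L_zero)
  note c = this ab [symmetric]
  ultimately show ?thesis
    by (simp add: left_diff_distrib right_diff_distrib mult.assoc c c [THEN left_commuteI])
qed

lemma derivation_bracket:
  assumes "derivation D"
  shows "D * (L x * L y - L y * L x) - (L x * L y - L y * L x) * D
    = L (app D x) * L y - L y * L (app D x) + (L x * L (app D y) - L (app D y) * L x)"
proof -
  have e: "D * L x = L x * D + L (app D x)" "D * L y = L y * D + L (app D y)"
    by (rule derivation_L [OF assms])+
  have f: "D * (L x * z) = L x * (D * z) + L (app D x) * z" "D * (L y * z) = L y * (D * z) + L (app D y) * z" for z
    using e by (metis mult.assoc distrib_right)+
  show ?thesis
    by (simp add: left_diff_distrib right_diff_distrib mult.assoc f e distrib_left)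
qed

text \<open>Let w be \<open>dersq_self\<close>. The commutator of \<open>dersq a b\<close> and
  \<open>dersq b a\<close> is computed twice, letting either one act on the other as a derivation.
  The two results add up to 0, and the linearized Jordan identity for w, a, b turns this sum into
  the commutator of \<open>L w\<close> with \<open>L (a \<bullet> b)\<close>.\<close>

lemma dersq_self_commute_product: "L dersq_self * L (a \<bullet> b) = L (a \<bullet> b) * L dersq_self"
proof -
  let ?D = "dersq a b" and ?E = "dersq b a"
  note d = derivation_dersq [OF ab]
  have Dbb: "app ?D (b \<bullet> b) = 2 *\<^sub>R (b \<bullet> dersq_self)"
    using d(1) by (simp add: derivation_def jmul_comm [of dersq_self] scaleR_2)
  have Eaa: "app ?E (a \<bullet> a) = 2 *\<^sub>R (a \<bullet> dersq_self)"
    using d(2) by (simp add: derivation_def jmul_comm [of dersq_self] scaleR_2 flip: dersq_swap [OF ab])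
  have 1: "?D * ?E - ?E * ?D = 2 *\<^sub>R (L (b \<bullet> dersq_self) * L a - L a * L (b \<bullet> dersq_self))"
    unfolding dersq_def [of b a] derivation_bracket [OF d(1)]
    by (simp add: Dbb dersq_a [OF ab] L_zero L_scaleR scaleR_diff_right)
  have 2: "?E * ?D - ?D * ?E = 2 *\<^sub>R (L (a \<bullet> dersq_self) * L b - L b * L (a \<bullet> dersq_self))"
    unfolding dersq_def [of a b] derivation_bracket [OF d(2)]
    by (simp add: Eaa dersq_b L_zero L_scaleR scaleR_diff_right flip: dersq_def)
  have "2 *\<^sub>R (L (b \<bullet> dersq_self) * L a - L a * L (b \<bullet> dersq_self) + (L (a \<bullet> dersq_self) * L b - L b * L (a \<bullet> dersq_self))) = 0"
    unfolding scaleR_add_right 1 [symmetric] 2 [symmetric] by simp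
  then have "L (b \<bullet> dersq_self) * L a - L a * L (b \<bullet> dersq_self) + (L (a \<bullet> dersq_self) * L b - L b * L (a \<bullet> dersq_self)) = 0"
    by simp
  then show ?thesis
    using L_linearized [of dersq_self a b] by (simp add: jmul_comm [of dersq_self] algebra_simps)
qed

text \<open>\<open>dersq a b\<close> is twice the commutator of \<open>L a\<close> and
  \<open>L (a \<bullet> b)\<close>, and \<open>dersq_self\<close> operator commutes with both a and
  \<open>a \<bullet> b\<close>.\<close>

lemma dersq_w: "app (dersq a b) dersq_self = 0"
proof -
  have "a \<bullet> ((a \<bullet> b) \<bullet> dersq_self) = dersq_self \<bullet> (a \<bullet> (a \<bullet> b))"
    using arg_cong [OF dersq_self_commute_left, of "\<lambda>f. app f (a \<bullet> b)"] by (simp add: jmul_comm)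
  moreover have "(a \<bullet> b) \<bullet> (a \<bullet> dersq_self) = dersq_self \<bullet> (a \<bullet> (a \<bullet> b))"
    using arg_cong [OF dersq_self_commute_product, of "\<lambda>f. app f a"] by (simp add: jmul_comm)
  ultimately show ?thesis by (subst dersq_alt [OF ab]) simp
qed

end

text \<open>The power with exponent \<open>2 ^ k\<close>. Iterated squares are chosen because the
  norm axiom for squares determines their norm exactly.\<close>

primrec sqiter :: "'a::jordan \<Rightarrow> nat \<Rightarrow> 'a" where
  "sqiter x 0 = x"
| "sqiter x (Suc k) = sqiter x k \<bullet> sqiter x k"

lemma derivation_Leibniz:
  assumes "derivation D"
  shows "app (D ^ n) (x \<bullet> y) = (\<Sum>j\<le>n. real (n choose j) *\<^sub>R (app (D ^ j) x \<bullet> app (D ^ (n - j)) y))"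
proof (induction n)
  case (Suc n)
  let ?f = "\<lambda>i j. app (D ^ i) x \<bullet> app (D ^ j) y"
  have D: "app D (?f i j) = ?f (Suc i) j + ?f i (Suc j)" for i j
    using assms by (simp add: derivation_def)
  have sum: "app D (\<Sum>j\<in>A. g j) = (\<Sum>j\<in>A. app D (g j))" for g and A :: "nat set"
    by (induction A rule: infinite_finite_induct) simp_all
  have "app (D ^ Suc n) (x \<bullet> y) = (\<Sum>j\<le>n. real (n choose j) *\<^sub>R ?f (Suc j) (n - j))
      + (\<Sum>j\<le>n. real (n choose j) *\<^sub>R ?f j (Suc n - j))"
    by (simp add: Suc.IH sum D scaleR_add_right sum.distrib Suc_diff_le)
  also have "(\<Sum>j\<le>n. real (n choose j) *\<^sub>R ?f j (Suc n - j)) = (\<Sum>j\<le>Suc n. real (n choose j) *\<^sub>R ?f j (Suc n - j))"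
    by simp
  also have "\<dots> = ?f 0 (Suc n) + (\<Sum>j\<le>n. real (n choose Suc j) *\<^sub>R ?f (Suc j) (n - j))"
    by (subst sum.atMost_Suc_shift) simp
  also have "(\<Sum>j\<le>n. real (n choose j) *\<^sub>R ?f (Suc j) (n - j)) + (?f 0 (Suc n) + (\<Sum>j\<le>n. real (n choose Suc j) *\<^sub>R ?f (Suc j) (n - j)))
      = ?f 0 (Suc n) + (\<Sum>j\<le>n. real (Suc n choose Suc j) *\<^sub>R ?f (Suc j) (n - j))"
    by (simp add: sum.distrib scaleR_add_left)
  also have "\<dots> = (\<Sum>j\<le>Suc n. real (Suc n choose j) *\<^sub>R ?f j (Suc n - j))"
    by (subst sum.atMost_Suc_shift) simp
  finally show ?case .
qed simp

text \<open>With m = \<open>2 ^ k\<close> this is \<open>D ^ m\<close> applied to the m-th power. In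
  the Leibniz sum for the next square the two orders of differentiation add up to 2 m; unless both
  equal m, one exceeds m and kills its factor. The binomial coefficient then completes the
  factorial.\<close>

lemma derivation_sqiter:
  assumes D: "derivation D" and u: "app D x = u" "app D u = 0"
  shows "app (D ^ (2 ^ k)) (sqiter x k) = fact (2 ^ k) *\<^sub>R sqiter u k \<and> app D (sqiter u k) = 0"
proof (induction k)
  case (Suc k)
  let ?m = "2 ^ k :: nat"
  have z: "app (D ^ j) (sqiter x k) = 0" if "j > ?m" for j
  proof -
    have "j = (j - ?m - 1) + Suc ?m" using that by simp
    then have "D ^ j = D ^ (j - ?m - 1) * (D * D ^ ?m)" by (metis power_add power_Suc)
    then show ?thesis using Suc by simp
  qed
  have "app (D ^ (2 ^ Suc k)) (sqiter x (Suc k))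
      = (\<Sum>j\<le>2 ^ Suc k. real (2 ^ Suc k choose j) *\<^sub>R (app (D ^ j) (sqiter x k) \<bullet> app (D ^ (2 ^ Suc k - j)) (sqiter x k)))"
    unfolding sqiter.simps by (rule derivation_Leibniz [OF D])
  also have "\<dots> = (\<Sum>j\<in>{?m}. real (2 ^ Suc k choose j) *\<^sub>R (app (D ^ j) (sqiter x k) \<bullet> app (D ^ (2 ^ Suc k - j)) (sqiter x k)))"
  proof (rule sum.mono_neutral_right)
    have "j > ?m \<or> 2 ^ Suc k - j > ?m" if "j \<noteq> ?m" for j using that by auto
    then show "\<forall>j\<in>{..2 ^ Suc k} - {?m}. real (2 ^ Suc k choose j) *\<^sub>R (app (D ^ j) (sqiter x k) \<bullet> app (D ^ (2 ^ Suc k - j)) (sqiter x k)) = 0"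
      using z by (metis DiffE jmul_zero_left jmul_zero_right scaleR_zero_right singletonI)
  qed auto
  also have "\<dots> = (real (2 ^ Suc k choose ?m) * fact ?m * fact ?m) *\<^sub>R sqiter u (Suc k)"
    using Suc by (simp add: jmul_scaleR_left jmul_scaleR_right)
  also have "real (2 ^ Suc k choose ?m) * fact ?m * fact ?m = fact (2 ^ Suc k)"
    using binomial_fact_lemma [of ?m "2 ^ Suc k"]
    by (simp add: mult_2 ac_simps) (metis (no_types, lifting) of_nat_fact of_nat_mult mult.commute mult.left_commute)
  finally show ?case using Suc D by (simp add: derivation_def jmul_zero_left jmul_zero_right)
qed (simp add: u)

lemma dersq_sqiter:
  "L a * L b = L b * L a \<Longrightarrow>
    app (dersq a b ^ (2 ^ k)) (sqiter b k) = fact (2 ^ k) *\<^sub>R sqiter (app (dersq a b) b) k"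
  by (rule derivation_sqiter [THEN conjunct1, OF derivation_dersq(1) refl dersq_w])

text \<open>Let p, r, t be \<open>PP a a\<close>, \<open>PP b b\<close>, \<open>PP a b\<close> and
  D, E be \<open>dersq a b\<close>, \<open>dersq b a\<close>. Exchange gives
  \<open>p r = t t\<close>. The commutator of this with \<open>L a\<close> yields
  \<open>p E = - t D\<close>, and the commutator of that yields \<open>D D = 0\<close>. Finally
  \<open>D (D (c \<bullet> c)) = 2 (D c \<bullet> D c)\<close>.\<close>

lemma dersq_square_zero:
  assumes ab: "L a * L b = L b * L a" and w: "app (dersq a b) b = 0"
  shows "app (dersq a b) c \<bullet> app (dersq a b) c = 0"
proof -
  let ?D = "dersq a b" and ?E = "dersq b a"
  note d = derivation_dersq [OF ab]
  have D0: "app ?D a = 0" "app ?D b = 0" "app ?E a = 0" "app ?E b = 0"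
    using dersq_a [OF ab] dersq_b [OF ab] w dersq_swap [OF ab] by simp_all
  then have "app ?D (a \<bullet> b) = 0" using d(1) by (simp add: derivation_def jmul_zero_left jmul_zero_right)
  with D0 have D: "?D * L a = L a * ?D" "?D * L b = L b * ?D" "?D * L (a \<bullet> b) = L (a \<bullet> b) * ?D" "?E * L a = L a * ?E"
    using derivation_L [OF d(1)] derivation_L [OF d(2)] by (simp_all add: L_zero)
  let ?p = "PP a a" and ?r = "PP b b" and ?t = "PP a b"
  have t: "?t = L a * L b - L (a \<bullet> b)" by (simp add: PP_def ab)
  have Dt: "?D * ?t = ?t * ?D"
    unfolding t by (simp add: left_diff_distrib right_diff_distrib mult.assoc D D [THEN left_commuteI])
  have pr: "?p * ?r = ?t * ?t"
    by (rule PP_exchange_right) (use ab_app [OF ab] ab in simp_all)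
  have La_t: "L a * ?t = ?t * L a - (1/2) *\<^sub>R ?D"
    unfolding t dersq_alt [OF ab]
    by (simp add: left_diff_distrib right_diff_distrib mult.assoc ab ab [THEN left_commuteI])
  have La_p: "L a * ?p = ?p * L a"
    by (simp add: PP_def left_diff_distrib right_diff_distrib mult.assoc L_square_commute)
  have La_r: "L a * ?r = ?r * L a + ?E"
    unfolding PP_def dersq_def
    by (simp add: left_diff_distrib right_diff_distrib mult.assoc ab ab [THEN left_commuteI])
  have "L a * (?p * ?r) - (?p * ?r) * L a = ?p * ?E"
    using La_p La_r by (simp add: distrib_left mult.assoc flip: mult.assoc [of "L a"])
  moreover have "L a * (?t * ?t) - (?t * ?t) * L a = - (?t * ?D)"
  proof -
    have "L a * (?t * ?t) = (?t * L a - (1/2) *\<^sub>R ?D) * ?t" by (simp add: La_t flip: mult.assoc)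
    also have "\<dots> = ?t * (?t * L a - (1/2) *\<^sub>R ?D) - (1/2) *\<^sub>R (?t * ?D)"
      by (simp add: left_diff_distrib mult.assoc La_t Dt)
    also have "\<dots> = ?t * ?t * L a - ((1/2) *\<^sub>R (?t * ?D) + (1/2) *\<^sub>R (?t * ?D))"
      by (simp add: right_diff_distrib mult.assoc)
    also have "\<dots> = ?t * ?t * L a - ?t * ?D" by (simp flip: scaleR_add_left)
    finally show ?thesis by simp
  qed
  ultimately have pE: "?p * ?E = - (?t * ?D)" by (simp add: pr)
  have "L a * (?p * ?E) = ?p * ?E * L a"
    using La_p D(4) by (metis mult.assoc)
  moreover have "L a * (?t * ?D) = ?t * ?D * L a - (1/2) *\<^sub>R (?D * ?D)"
  proof -
    have "L a * (?t * ?D) = (?t * L a - (1/2) *\<^sub>R ?D) * ?D" by (simp add: La_t flip: mult.assoc)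
    then show ?thesis using D(1) by (simp add: left_diff_distrib mult.assoc)
  qed
  ultimately have DD0: "?D * ?D = 0" by (simp add: pE)
  have DD: "app ?D (app ?D x) = 0" for x by (simp add: DD0 flip: app_simps(6))
  have "app ?D (app ?D (c \<bullet> c)) = 2 *\<^sub>R (app ?D c \<bullet> app ?D c)"
    using d(1) DD [of c]
    by (simp add: derivation_def jmul_zero_left jmul_zero_right scaleR_2)
  then show ?thesis using DD [of "c \<bullet> c"] by simp
qed

section \<open>A sandwiched trilinear expression and its behaviour on rotations\<close>

definition wtri :: "'a::jordan \<Rightarrow> 'a \<Rightarrow> 'a \<Rightarrow> 'a \<Rightarrow> 'a \<Rightarrow> 'a endo" where
  "wtri a a' x y z = PP a x * L y * PP z a' - PP a z * L y * PP x a'"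

text \<open>For \<open>(v, s) = rot t k\<close> one has
  \<open>(1 + i t) ^ k = (1 - v) + i s\<close>. Storing v instead of the real part keeps the terms
  free of the unit.\<close>

primrec rot :: "'a::jordan \<Rightarrow> nat \<Rightarrow> 'a \<times> 'a" where
  "rot t 0 = (0, 0)"
| "rot t (Suc k) = (fst (rot t k) + t \<bullet> snd (rot t k), snd (rot t k) + t - t \<bullet> fst (rot t k))"

text \<open>This is \<open>(1 + t \<bullet> t) ^ k - 1\<close>, the excess of the squared modulus of
  that power over 1.\<close>

primrec rote :: "'a::jordan \<Rightarrow> nat \<Rightarrow> 'a" where
  "rote t 0 = 0"
| "rote t (Suc k) = rote t k + t \<bullet> t + (t \<bullet> t) \<bullet> rote t k"

definition strongly_associative :: "'a::jordan set \<Rightarrow> bool" where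
  "strongly_associative B \<longleftrightarrow> junit \<in> B \<and> (\<forall>x\<in>B. \<forall>y\<in>B. x + y \<in> B \<and> x \<bullet> y \<in> B \<and> L x * L y = L y * L x)
     \<and> (\<forall>r. \<forall>x\<in>B. r *\<^sub>R x \<in> B)"

context
  fixes B :: "'a::jordan set" and a a' :: 'a
  assumes B: "strongly_associative B"
begin

lemma B_closed:
  "junit \<in> B" "x \<in> B \<Longrightarrow> y \<in> B \<Longrightarrow> x + y \<in> B" "x \<in> B \<Longrightarrow> y \<in> B \<Longrightarrow> x \<bullet> y \<in> B"
  "x \<in> B \<Longrightarrow> r *\<^sub>R x \<in> B" "x \<in> B \<Longrightarrow> y \<in> B \<Longrightarrow> x - y \<in> B" "0 \<in> B"
proof -
  show *: "junit \<in> B" "x \<in> B \<Longrightarrow> y \<in> B \<Longrightarrow> x + y \<in> B" "x \<in> B \<Longrightarrow> y \<in> B \<Longrightarrow> x \<bullet> y \<in> B"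
    "x \<in> B \<Longrightarrow> r *\<^sub>R x \<in> B" for x y r
    using B by (auto simp: strongly_associative_def)
  show "x \<in> B \<Longrightarrow> y \<in> B \<Longrightarrow> x - y \<in> B" using *(2) [of x "- y"] *(4) [of y "- 1"] by simp
  show "0 \<in> B" using *(4) [OF *(1), of 0] by simp
qed

lemma B_LL: "x \<in> B \<Longrightarrow> y \<in> B \<Longrightarrow> L x * L y = L y * L x"
  using B by (auto simp: strongly_associative_def)

lemma B_app: "x \<in> B \<Longrightarrow> y \<in> B \<Longrightarrow> x \<bullet> (y \<bullet> c) = y \<bullet> (x \<bullet> c)"
  using arg_cong [OF B_LL, of x y "\<lambda>f. app f c"] by simp

lemma B_assoc: "x \<in> B \<Longrightarrow> y \<in> B \<Longrightarrow> z \<in> B \<Longrightarrow> (x \<bullet> y) \<bullet> z = x \<bullet> (y \<bullet> z)"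
  using B_app [of z x y] by (simp add: jmul_comm)

lemma B_xch: "x \<in> B \<Longrightarrow> y \<in> B \<Longrightarrow> PP p x * PP y q = PP p y * PP x q"
  by (rule PP_exchange_right) (simp_all add: B_app B_LL)

lemma B_PP_sym: "x \<in> B \<Longrightarrow> y \<in> B \<Longrightarrow> PP x y = PP y x"
  by (simp add: PP_def B_LL jmul_comm)

text \<open>In its first argument \<open>wtri\<close> behaves like a differential,
  \<open>d(f g) = g df + f dg\<close>, with the coefficients collected in the middle
  argument.\<close>

lemma wtri_mult:
  assumes "d \<in> B" "y \<in> B" "x \<in> B" "z \<in> B"
  shows "wtri a a' (d \<bullet> y) x z = wtri a a' d (x \<bullet> y) z + wtri a a' y (x \<bullet> d) z"
proof -
  have L2: "L p * L q = L (p \<bullet> q) + PP q p" if "p \<in> B" "q \<in> B" for p q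
    using B_LL [OF that] by (simp add: PP_def jmul_comm)
  have x1: "PP a p * PP q r * PP s a' = PP a q * PP p r * PP s a'" if "p \<in> B" "q \<in> B" for p q r s
    using B_xch [OF that, of a r] by simp
  have x2: "PP a p * PP q r * PP s a' = PP a p * PP q s * PP r a'" if "s \<in> B" "r \<in> B" for p q r s
    using B_xch [OF that(2,1), of q a'] by (simp add: mult.assoc)
  have e: "PP a y * PP x d * PP z a' = PP a z * PP x d * PP y a'"
    "PP a d * PP x y * PP z a' = PP a z * PP x y * PP d a'"
    unfolding x1 [OF assms(2,3), of d z] x1 [OF assms(1,3), of y z] x2 [OF assms(4,1), of x y] x2 [OF assms(4,2), of x d]
      B_PP_sym [OF assms(2,4)] B_PP_sym [OF assms(1,4)] x1 [OF assms(3,4), of y d] x1 [OF assms(3,4), of d y]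
    by (rule x2; fact assms)+
  have l: "L d * (L x * r) = L (x \<bullet> d) * r + PP x d * r" "L x * (L d * r) = L (x \<bullet> d) * r + PP x d * r"
    "L y * (L x * r) = L (x \<bullet> y) * r + PP x y * r" "L x * (L y * r) = L (x \<bullet> y) * r + PP x y * r" for r
    using L2 [OF assms(1,3)] L2 [OF assms(3,1)] L2 [OF assms(2,3)] L2 [OF assms(3,2)] B_PP_sym [OF assms(1,3)]
      B_PP_sym [OF assms(2,3)] by (simp_all add: jmul_comm [of d] jmul_comm [of y] distrib_right flip: mult.assoc)
  show ?thesis
    unfolding wtri_def PP_product_right PP_product_left distrib_left distrib_right mult.assoc l
    using e by (simp add: mult.assoc)
qed

lemma wtri_add:
  "wtri a a' (x + x') y z = wtri a a' x y z + wtri a a' x' y z"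
  "wtri a a' x (y + y') z = wtri a a' x y z + wtri a a' x y' z"
  "wtri a a' (r *\<^sub>R x) y z = r *\<^sub>R wtri a a' x y z"
  "wtri a a' x (r *\<^sub>R y) z = r *\<^sub>R wtri a a' x y z"
  by (simp_all add: wtri_def PP_add PP_scaleR L_add L_scaleR algebra_simps scaleR_diff_right)

lemma wtri_diff:
  "wtri a a' (x - x') y z = wtri a a' x y z - wtri a a' x' y z"
  "wtri a a' x (y - y') z = wtri a a' x y z - wtri a a' x y' z"
  using wtri_add(1) [of x "- x'" y z] wtri_add(3) [of "- 1" x' y z]
    wtri_add(2) [of x y "- y'" z] wtri_add(4) [of x "- 1" y' z] by simp_all

lemma wtri_zero: "wtri a a' 0 y z = 0"
  using wtri_add(3) [of 0 0 y z] by simp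

lemma rot_closed: "t \<in> B \<Longrightarrow> fst (rot t k) \<in> B \<and> snd (rot t k) \<in> B" "t \<in> B \<Longrightarrow> rote t k \<in> B"
  by (induction k) (auto intro!: B_closed)

text \<open>This is \<open>(1 - v)^2 + s^2 = (1 + t^2)^k\<close> with the unit removed.\<close>

lemma rot_circle:
  assumes t: "t \<in> B"
  shows "fst (rot t k) \<bullet> fst (rot t k) + snd (rot t k) \<bullet> snd (rot t k) = 2 *\<^sub>R fst (rot t k) + rote t k"
proof (induction k)
  case (Suc k)
  obtain v s where vs: "rot t k = (v, s)" by fastforce
  have c: "v \<in> B" "s \<in> B" "rote t k \<in> B" using rot_closed [OF t, of k] by (simp_all add: vs)
  have e: "rote t k = v \<bullet> v + s \<bullet> s - 2 *\<^sub>R v" using Suc by (simp add: vs)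
  have "v \<bullet> (t \<bullet> s) = (t \<bullet> s) \<bullet> v" "s \<bullet> t = t \<bullet> s" by (rule jmul_comm)+
  moreover have "(t \<bullet> s) \<bullet> (t \<bullet> s) = (t \<bullet> t) \<bullet> (s \<bullet> s)" "(t \<bullet> v) \<bullet> (t \<bullet> v) = (t \<bullet> t) \<bullet> (v \<bullet> v)"
    "t \<bullet> (t \<bullet> v) = (t \<bullet> t) \<bullet> v" "(t \<bullet> v) \<bullet> t = (t \<bullet> t) \<bullet> v" "(t \<bullet> v) \<bullet> s = (t \<bullet> s) \<bullet> v" "s \<bullet> (t \<bullet> v) = (t \<bullet> s) \<bullet> v"
    by (simp_all add: c t B_closed(3) B_assoc B_app [of s t] B_app [of v t] jmul_comm [of v s] jmul_comm [of v t])
  ultimately show ?case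
    unfolding rote.simps e rot.simps vs fst_conv snd_conv
    by (simp add: jmul_add_left jmul_add_right jmul_diff_left jmul_diff_right
        jmul_scaleR_right scaleR_2 algebra_simps)
qed (simp add: jmul_zero_left)

text \<open>Real and imaginary part of \<open>d(c ^ (k + 1)) = (k + 1) c ^ k dc\<close> for
  \<open>c = 1 + i t\<close>.\<close>

lemma wtri_rot:
  assumes t: "t \<in> B" and z: "z \<in> B" and x: "x \<in> B"
  shows "wtri a a' (fst (rot t (Suc k))) x z = real (Suc k) *\<^sub>R wtri a a' t (x \<bullet> snd (rot t k)) z
    \<and> wtri a a' (snd (rot t (Suc k))) x z = real (Suc k) *\<^sub>R wtri a a' t (x - x \<bullet> fst (rot t k)) z"
  using x
proof (induction k arbitrary: x)
  case 0
  then show ?case using wtri_add(4) [of t 0 x z] by (simp add: jmul_zero_right wtri_zero)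
next
  case (Suc k)
  obtain v s where vs: "rot t (Suc k) = (v, s)" by fastforce
  obtain v' s' where vs': "rot t k = (v', s')" by fastforce
  have e: "v = v' + t \<bullet> s'" "s = s' + t - t \<bullet> v'" using vs by (simp_all add: vs')
  have c: "v \<in> B" "s \<in> B" "v' \<in> B" "s' \<in> B"
    using rot_closed [OF t, of k] rot_closed [OF t, of "Suc k"] vs by (simp_all add: vs')
  note IH = Suc.IH [unfolded vs vs' fst_conv snd_conv]
  note cl = c t z Suc.prems B_closed
  let ?w = "\<lambda>x. wtri a a' t x z"
  have 1: "wtri a a' (v + t \<bullet> s) x z = real (Suc (Suc k)) *\<^sub>R ?w (x \<bullet> s)"
  proof -
    have "wtri a a' (v + t \<bullet> s) x z = real (Suc k) *\<^sub>R ?w (x \<bullet> s') + (?w (x \<bullet> s) + real (Suc k) *\<^sub>R ?w (x \<bullet> t - (x \<bullet> t) \<bullet> v'))"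
      using IH [of x] IH [of "x \<bullet> t"] cl by (simp add: wtri_add wtri_mult)
    also have "\<dots> = ?w (x \<bullet> s) + real (Suc k) *\<^sub>R ?w (x \<bullet> s' + (x \<bullet> t - (x \<bullet> t) \<bullet> v'))"
      by (simp add: wtri_add scaleR_add_right del: of_nat_Suc)
    also have "x \<bullet> s' + (x \<bullet> t - (x \<bullet> t) \<bullet> v') = x \<bullet> s"
      unfolding e(2) using cl by (simp add: B_assoc jmul_add_right jmul_diff_right)
    finally show ?thesis by (simp add: scaleR_add_left scaleR_2)
  qed
  have 2: "wtri a a' (s + t - t \<bullet> v) x z = real (Suc (Suc k)) *\<^sub>R ?w (x - x \<bullet> v)"
  proof -
    have "wtri a a' (s + t - t \<bullet> v) x z = real (Suc k) *\<^sub>R ?w (x - x \<bullet> v') + ?w x - (?w (x \<bullet> v) + real (Suc k) *\<^sub>R ?w ((x \<bullet> t) \<bullet> s'))"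
      using IH [of x] IH [of "x \<bullet> t"] cl by (simp add: wtri_add wtri_diff wtri_mult)
    also have "\<dots> = ?w (x - x \<bullet> v) + real (Suc k) *\<^sub>R ?w (x - x \<bullet> v' - (x \<bullet> t) \<bullet> s')"
      by (simp add: wtri_diff scaleR_diff_right del: of_nat_Suc)
    also have "x - x \<bullet> v' - (x \<bullet> t) \<bullet> s' = x - x \<bullet> v"
      unfolding e(1) using cl by (simp add: B_assoc jmul_add_right)
    finally show ?thesis by (simp add: scaleR_add_left scaleR_2)
  qed
  show ?case unfolding rot.simps(2) [of t "Suc k"] vs fst_conv snd_conv using 1 2 by blast
qed

text \<open>Multiply that differential by the conjugate of the k-th power: its squared modulus
  appears as the factor \<open>1 + rote t k\<close> of x.\<close>

lemma wtri_rot_sum: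
  assumes t: "t \<in> B" and z: "z \<in> B" and x: "x \<in> B"
  shows "real (Suc k) *\<^sub>R wtri a a' t (x + x \<bullet> rote t k) z
    = wtri a a' (snd (rot t (Suc k))) (x - x \<bullet> fst (rot t k)) z + wtri a a' (fst (rot t (Suc k))) (x \<bullet> snd (rot t k)) z"
proof -
  obtain v s where vs: "rot t k = (v, s)" by fastforce
  have c: "v \<in> B" "s \<in> B" using rot_closed [OF t, of k] by (simp_all add: vs)
  have e: "rote t k = v \<bullet> v + s \<bullet> s - 2 *\<^sub>R v" using rot_circle [OF t, of k] by (simp add: vs)
  have e2: "x + x \<bullet> rote t k = (x - x \<bullet> v - (x - x \<bullet> v) \<bullet> v) + (x \<bullet> s) \<bullet> s"
    unfolding e using c x by (simp add: jmul_diff_left jmul_diff_right jmul_add_right B_assoc jmul_scaleR_right scaleR_2)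
  have "x - x \<bullet> v \<in> B" "x \<bullet> s \<in> B" using c x by (auto intro: B_closed)
  then show ?thesis
    unfolding e2 using wtri_rot [OF t z, of "x - x \<bullet> v" k] wtri_rot [OF t z, of "x \<bullet> s" k]
    by (simp add: vs wtri_add scaleR_add_right)
qed

end

text \<open>With t = c f / (k + 1) the left side is linear in c. For large k the modulus of the
  powers of \<open>1 + i t\<close> is close to 1, which will keep the right side bounded in a
  JB-algebra.\<close>

lemma wtri_bound_identity:
  fixes k :: nat and c :: real
  assumes B: "strongly_associative B" and f: "f \<in> B" "z \<in> B" "x \<in> B"
  defines "t \<equiv> (c / real (Suc k)) *\<^sub>R f"
  shows "c *\<^sub>R wtri a a' f x z = wtri a a' (snd (rot t (Suc k))) (x - x \<bullet> fst (rot t k)) z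
      + wtri a a' (fst (rot t (Suc k))) (x \<bullet> snd (rot t k)) z - c *\<^sub>R wtri a a' f (x \<bullet> rote t k) z"
proof -
  have "t \<in> B" unfolding t_def using B f by (auto intro: B_closed)
  from wtri_rot_sum [OF B this f(2,3), of k a a']
  have "real (Suc k) *\<^sub>R wtri a a' t (x + x \<bullet> rote t k) z
    = wtri a a' (snd (rot t (Suc k))) (x - x \<bullet> fst (rot t k)) z + wtri a a' (fst (rot t (Suc k))) (x \<bullet> snd (rot t k)) z" .
  moreover have "real (Suc k) *\<^sub>R wtri a a' t y z = c *\<^sub>R wtri a a' f y z" for y
    unfolding t_def wtri_add(3) [OF B] by (simp del: of_nat_Suc)
  ultimately show ?thesis
    by (simp add: wtri_add(2) [OF B] scaleR_add_right eq_diff_eq del: of_nat_Suc rot.simps)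
qed

section \<open>Presented Jordan algebras and commutants in JB-algebras\<close>

text \<open>The relations belong to the type of the letters, so each set of hypotheses gets a letter
  type of its own. The quotient \<open>pj\<close> is then a type with a Jordan algebra structure, to
  which the operator calculus applies.\<close>

class presented =
  fixes prel :: "'a jterm \<Rightarrow> 'a jterm \<Rightarrow> bool"

inductive peq :: "'v::presented jterm \<Rightarrow> 'v jterm \<Rightarrow> bool" where
  peq_jeq: "jeq s t \<Longrightarrow> peq s t"
| peq_rel: "prel s t \<Longrightarrow> peq s t"
| peq_sym: "peq s t \<Longrightarrow> peq t s"
| peq_trans: "peq s t \<Longrightarrow> peq t u \<Longrightarrow> peq s u"
| peq_add: "peq s s' \<Longrightarrow> peq t t' \<Longrightarrow> peq (JAdd s t) (JAdd s' t')"
| peq_scale: "peq s s' \<Longrightarrow> peq (JScale r s) (JScale r s')"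
| peq_mult: "peq s s' \<Longrightarrow> peq t t' \<Longrightarrow> peq (JMult s t) (JMult s' t')"

quotient_type (overloaded) 'v pj = "'v::presented jterm" / peq
  by (rule equivpI) (auto intro!: reflpI sympI transpI intro: peq_jeq [OF jeq_refl] peq_sym peq_trans)

instantiation pj :: (presented) real_vector
begin
lift_definition zero_pj :: "'a pj" is JZero .
lift_definition plus_pj :: "'a pj \<Rightarrow> 'a pj \<Rightarrow> 'a pj" is JAdd by (rule peq_add)
lift_definition uminus_pj :: "'a pj \<Rightarrow> 'a pj" is "JScale (- 1)" by (rule peq_scale)
lift_definition minus_pj :: "'a pj \<Rightarrow> 'a pj \<Rightarrow> 'a pj" is "\<lambda>s t. JAdd s (JScale (- 1) t)"
  by (intro peq_add peq_scale)
lift_definition scaleR_pj :: "real \<Rightarrow> 'a pj \<Rightarrow> 'a pj" is JScale by (rule peq_scale)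
instance
proof
  fix x y z :: "'a pj" and r q :: real
  show "x + y + z = x + (y + z)" by transfer (intro peq_jeq jeq_add_assoc)
  show "x + y = y + x" by transfer (intro peq_jeq jeq_add_comm)
  show "0 + x = x" by transfer (intro peq_jeq jeq_add_zero)
  show "- x + x = 0" by transfer (intro peq_jeq jeq_add_neg)
  show "x - y = x + - y" by transfer (intro peq_jeq jeq_refl)
  show "r *\<^sub>R (x + y) = r *\<^sub>R x + r *\<^sub>R y" by transfer (intro peq_jeq jeq_scale_r_distr)
  show "(r + q) *\<^sub>R x = r *\<^sub>R x + q *\<^sub>R x" by transfer (intro peq_jeq jeq_scale_l_distr)
  show "r *\<^sub>R q *\<^sub>R x = (r * q) *\<^sub>R x" by transfer (intro peq_jeq jeq_sym [OF jeq_scale_assoc])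
  show "1 *\<^sub>R x = x" by transfer (intro peq_jeq jeq_scale_one)
qed
end

instantiation pj :: (presented) jordan
begin
lift_definition jmul_pj :: "'a pj \<Rightarrow> 'a pj \<Rightarrow> 'a pj" is JMult by (rule peq_mult)
lift_definition junit_pj :: "'a pj" is JOne .
instance
proof
  fix x y z :: "'a pj" and r :: real
  show "x \<bullet> y = y \<bullet> x" by transfer (intro peq_jeq jeq_mult_comm)
  show "(x + y) \<bullet> z = x \<bullet> z + y \<bullet> z" by transfer (intro peq_jeq jeq_mult_distr)
  show "(r *\<^sub>R x) \<bullet> y = r *\<^sub>R (x \<bullet> y)" by transfer (intro peq_jeq jeq_mult_scale)
  show "junit \<bullet> x = x" by transfer (intro peq_jeq jeq_mult_one)
  show "x \<bullet> (y \<bullet> (x \<bullet> x)) = (x \<bullet> y) \<bullet> (x \<bullet> x)" by transfer (intro peq_jeq jeq_jordan)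
qed
end

lift_definition pclass :: "'v::presented jterm \<Rightarrow> 'v pj" is "\<lambda>t. t" .

lemma pclass_eq_iff: "pclass s = pclass t \<longleftrightarrow> peq s t"
  by transfer simp

lemma pclass_simps:
  "pclass JZero = 0" "pclass JOne = junit" "pclass (JAdd s t) = pclass s + pclass t"
  "pclass (JScale r s) = r *\<^sub>R pclass s" "pclass (JMult s t) = pclass s \<bullet> pclass t"
  by (transfer, rule peq_jeq, rule jeq_refl)+

lemma pclass_cases: obtains t where "x = pclass t"
proof -
  have "\<exists>t. x = pclass t" by transfer (blast intro: peq_jeq jeq_refl)
  then show ?thesis using that by blast
qed

lemma tev_pclass: "tev (\<lambda>v. pclass (JVar v)) t = pclass t"
  by (induction t) (simp_all add: pclass_simps)

lemma (in unital_jordan_algebra) jterm_eval_peq: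
  assumes "peq s t" and a: "\<And>v. a v \<in> carrier J"
    and rel: "\<And>s t. prel s t \<Longrightarrow> jterm_eval J a s = jterm_eval J a t"
  shows "jterm_eval J a s = jterm_eval J a t"
  using assms(1) by induction (auto intro: jterm_eval_jeq a rel)

primrec unitless :: "'v jterm \<Rightarrow> bool" where
  "unitless (JVar v) \<longleftrightarrow> True"
| "unitless JZero \<longleftrightarrow> True"
| "unitless JOne \<longleftrightarrow> False"
| "unitless (JAdd s t) \<longleftrightarrow> unitless s \<and> unitless t"
| "unitless (JScale r t) \<longleftrightarrow> unitless t"
| "unitless (JMult s t) \<longleftrightarrow> unitless s \<and> unitless t"

context jordan_algebra
begin

lemma unitless_closed: "\<lbrakk>unitless t; \<And>v. a v \<in> carrier J\<rbrakk> \<Longrightarrow> jterm_eval J a t \<in> carrier J"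
  by (induction t) auto

lemma unitization_unitless:
  "\<lbrakk>unitless t; \<And>v. a v \<in> carrier J\<rbrakk> \<Longrightarrow>
    jterm_eval (unitization J) (\<lambda>v. (0, a v)) t = (0, jterm_eval J a t)"
  by (induction t) (simp_all add: unitless_closed)

text \<open>The presented algebra has a unit and J need not have one. Evaluation takes place in the
  unitization, where terms without unit have scalar part 0.\<close>

lemma unitless_transport:
  assumes eq: "tev (\<lambda>v. pclass (JVar v)) s = tev (\<lambda>v. pclass (JVar v)) t" and u: "unitless s" "unitless t"
    and a: "\<And>v. a v \<in> carrier J"
    and rel: "\<And>s t. prel s t \<Longrightarrow>
      jterm_eval (unitization J) (\<lambda>v. (0, a v)) s = jterm_eval (unitization J) (\<lambda>v. (0, a v)) t"
  shows "jterm_eval J a s = jterm_eval J a t"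
proof -
  interpret U: unital_jordan_algebra "unitization J" by (rule unitization_unital_jordan_algebra)
  have "peq s t" using eq by (simp add: tev_pclass pclass_eq_iff)
  then have "jterm_eval (unitization J) (\<lambda>v. (0, a v)) s = jterm_eval (unitization J) (\<lambda>v. (0, a v)) t"
    by (rule U.jterm_eval_peq) (simp_all add: a rel)
  then show ?thesis using u a by (simp add: unitization_unitless)
qed

lemma unitization_operator_commute:
  assumes "operator_commute J b c" "b \<in> carrier J" "c \<in> carrier J"
  shows "operator_commute (unitization J) (r, b) (s, c)"
proof -
  interpret U: unital_jordan_algebra "unitization J" by (rule unitization_unital_jordan_algebra)
  let ?U = "unitization J"
  have 0: "operator_commute ?U (0, b) (0, c)"
    using assms by (auto simp: operator_commute_def m_r_distr m_smult_r m_comm)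
  have one: "operator_commute ?U x \<one>\<^bsub>?U\<^esub>" if "x \<in> carrier ?U" for x
    using that U.j_l_one U.m_closed by (simp add: operator_commute_def del: unitization_simps)
  have split: "(r, b) = r \<odot>\<^bsub>?U\<^esub> \<one>\<^bsub>?U\<^esub> \<oplus>\<^bsub>?U\<^esub> (0, b)" if "b \<in> carrier J" for r b
    using that by simp
  have 1: "operator_commute ?U (0, b) (s, c)"
    unfolding split [OF assms(3), of s]
    using assms 0 one by (intro U.operator_commute_add U.operator_commute_scale) auto
  have "operator_commute ?U (s, c) (r, b)"
    unfolding split [OF assms(2), of r]
    using assms 1 one by (intro U.operator_commute_add U.operator_commute_scale U.operator_commute_sym [OF 1]) auto
  then show ?thesis by (rule U.operator_commute_sym)
qed

end

section \<open>The commutant identities as identities of terms\<close>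

definition tdersq :: "'v jterm \<Rightarrow> 'v jterm \<Rightarrow> 'v jterm \<Rightarrow> 'v jterm" where
  "tdersq p q t = JAdd (JMult (JMult p p) (JMult q t)) (JScale (- 1) (JMult q (JMult (JMult p p) t)))"

primrec tsqiter :: "'v jterm \<Rightarrow> nat \<Rightarrow> 'v jterm" where
  "tsqiter t 0 = t"
| "tsqiter t (Suc k) = JMult (tsqiter t k) (tsqiter t k)"

lemma tev_tdersq [simp]: "tev \<phi> (tdersq p q t) = app (dersq (tev \<phi> p) (tev \<phi> q)) (tev \<phi> t)"
  by (simp add: tdersq_def dersq_def)

lemma tev_tsqiter [simp]: "tev \<phi> (tsqiter t k) = sqiter (tev \<phi> t) k"
  by (induction k) simp_all

lemma tev_tdersq_funpow [simp]:
  "tev \<phi> ((tdersq p q ^^ n) t) = app (dersq (tev \<phi> p) (tev \<phi> q) ^ n) (tev \<phi> t)"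
  by (induction n) simp_all

lemma unitless_t [simp]: "unitless p \<Longrightarrow> unitless q \<Longrightarrow> unitless t \<Longrightarrow> unitless (tdersq p q t)"
  "unitless t \<Longrightarrow> unitless (tsqiter t k)"
  "unitless p \<Longrightarrow> unitless q \<Longrightarrow> unitless t \<Longrightarrow> unitless ((tdersq p q ^^ n) t)"
proof -
  show 1: "unitless p \<Longrightarrow> unitless q \<Longrightarrow> unitless t \<Longrightarrow> unitless (tdersq p q t)" for t by (simp add: tdersq_def)
  show "unitless t \<Longrightarrow> unitless (tsqiter t k)" by (induction k) simp_all
  show "unitless p \<Longrightarrow> unitless q \<Longrightarrow> unitless t \<Longrightarrow> unitless ((tdersq p q ^^ n) t)"
    by (induction n) (simp_all add: 1)
qed

datatype letter2 = LA | LB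

instantiation letter2 :: presented
begin
definition prel_letter2 :: "letter2 jterm \<Rightarrow> letter2 jterm \<Rightarrow> bool" where
  "prel_letter2 s t \<longleftrightarrow> (\<exists>u. s = JMult (JVar LA) (JMult (JVar LB) u) \<and> t = JMult (JVar LB) (JMult (JVar LA) u))"
instance ..
end

text \<open>MA and MB operator commute as in \<open>letter2\<close>, MC is the element acted on, and
  the second relation records that the derivation also kills MB, which a JB-algebra satisfies by
  \<open>jdersq_self\<close>.\<close>

datatype letter3 = MA | MB | MC

instantiation letter3 :: presented
begin
definition prel_letter3 :: "letter3 jterm \<Rightarrow> letter3 jterm \<Rightarrow> bool" where
  "prel_letter3 s t \<longleftrightarrow> (\<exists>u. s = JMult (JVar MA) (JMult (JVar MB) u) \<and> t = JMult (JVar MB) (JMult (JVar MA) u))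
     \<or> s = tdersq (JVar MA) (JVar MB) (JVar MB) \<and> t = JZero"
instance ..
end

lemma L_commute_pclass:
  assumes "\<And>u. peq (JMult s (JMult t u)) (JMult t (JMult s u))"
  shows "L (pclass s) * L (pclass t) = L (pclass t) * L (pclass s)"
proof (rule endo_eqI)
  fix x :: "'a pj"
  obtain u where "x = pclass u" by (rule pclass_cases)
  then show "app (L (pclass s) * L (pclass t)) x = app (L (pclass t) * L (pclass s)) x"
    using assms [of u] by (simp flip: pclass_simps add: pclass_eq_iff)
qed

lemma letter2_identity:
  "tev (\<lambda>v. pclass (JVar v)) ((tdersq (JVar LA) (JVar LB) ^^ (2 ^ k)) (tsqiter (JVar LB) k))
   = tev (\<lambda>v. pclass (JVar v)) (JScale (fact (2 ^ k)) (tsqiter (tdersq (JVar LA) (JVar LB) (JVar LB)) k))"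
proof -
  have "L (pclass (JVar LA)) * L (pclass (JVar LB)) = L (pclass (JVar LB)) * L (pclass (JVar LA))"
    by (rule L_commute_pclass, rule peq_rel) (simp add: prel_letter2_def)
  from dersq_sqiter [OF this] show ?thesis by simp
qed

lemma letter3_identity:
  "tev (\<lambda>v. pclass (JVar v)) (JMult (tdersq (JVar MA) (JVar MB) (JVar MC)) (tdersq (JVar MA) (JVar MB) (JVar MC)))
   = tev (\<lambda>v. pclass (JVar v)) JZero"
proof -
  have "L (pclass (JVar MA)) * L (pclass (JVar MB)) = L (pclass (JVar MB)) * L (pclass (JVar MA))"
    by (rule L_commute_pclass, rule peq_rel) (simp add: prel_letter3_def)
  moreover have "peq (tdersq (JVar MA) (JVar MB) (JVar MB)) JZero"
    by (rule peq_rel) (simp add: prel_letter3_def)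
  then have "app (dersq (pclass (JVar MA)) (pclass (JVar MB))) (pclass (JVar MB)) = 0"
    by (simp add: pclass_simps tev_pclass flip: pclass_eq_iff tev_tdersq [where \<phi> = "\<lambda>v. pclass (JVar v)", simplified])
  ultimately show ?thesis using dersq_square_zero by simp
qed

section \<open>Operator commutants in a JB-algebra\<close>

context jb_algebra
begin

definition jdersq :: "'a \<Rightarrow> 'a \<Rightarrow> 'a \<Rightarrow> 'a" where
  "jdersq a b c = (a \<otimes> a) \<otimes> (b \<otimes> c) \<oplus> (- 1) \<odot> (b \<otimes> ((a \<otimes> a) \<otimes> c))"

primrec jsqiter :: "'a \<Rightarrow> nat \<Rightarrow> 'a" where
  "jsqiter x 0 = x"
| "jsqiter x (Suc k) = jsqiter x k \<otimes> jsqiter x k"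

lemma eval_tdersq: "jterm_eval J f (tdersq p q t) = jdersq (jterm_eval J f p) (jterm_eval J f q) (jterm_eval J f t)"
  by (simp add: tdersq_def jdersq_def)

lemma eval_tsqiter: "jterm_eval J f (tsqiter t k) = jsqiter (jterm_eval J f t) k"
  by (induction k) simp_all

lemma eval_tdersq_funpow: "jterm_eval J f ((tdersq p q ^^ n) t) =
    (jdersq (jterm_eval J f p) (jterm_eval J f q) ^^ n) (jterm_eval J f t)"
  by (induction n) (simp_all add: eval_tdersq)

lemma jdersq_closed [intro]: "\<lbrakk>a \<in> carrier J; b \<in> carrier J; c \<in> carrier J\<rbrakk> \<Longrightarrow> jdersq a b c \<in> carrier J"
  by (simp add: jdersq_def)

lemma jsqiter_closed: "x \<in> carrier J \<Longrightarrow> jsqiter x k \<in> carrier J"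
  by (induction k) simp_all

lemma nrm_zero [simp]: "nrm J \<zero> = 0"
  using nrm_eq_0 [of \<zero>] by simp

lemma nrm_jsqiter: "x \<in> carrier J \<Longrightarrow> nrm J (jsqiter x k) = nrm J x ^ (2 ^ k)"
  by (induction k) (simp_all add: jsqiter_closed flip: nrm_square power_mult, simp add: mult.commute)

lemma nrm_mult3:
  assumes "a \<in> carrier J" "b \<in> carrier J" "nrm J b \<le> r"
  shows "nrm J (a \<otimes> b) \<le> nrm J a * r"
  using nrm_mult [OF assms(1,2)] mult_left_mono [OF assms(3) nrm_nonneg [OF assms(1)]] by linarith

lemma nrm_jdersq:
  assumes "a \<in> carrier J" "b \<in> carrier J" "c \<in> carrier J"
  shows "nrm J (jdersq a b c) \<le> (2 * nrm J (a \<otimes> a) * nrm J b) * nrm J c"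
proof -
  have "nrm J ((a \<otimes> a) \<otimes> (b \<otimes> c)) \<le> nrm J (a \<otimes> a) * (nrm J b * nrm J c)"
    "nrm J (b \<otimes> ((a \<otimes> a) \<otimes> c)) \<le> nrm J b * (nrm J (a \<otimes> a) * nrm J c)"
    using assms by (auto intro!: nrm_mult3 nrm_mult)
  moreover have "nrm J (jdersq a b c) \<le> nrm J ((a \<otimes> a) \<otimes> (b \<otimes> c)) + nrm J (b \<otimes> ((a \<otimes> a) \<otimes> c))"
    unfolding jdersq_def using assms nrm_triangle [of "(a \<otimes> a) \<otimes> (b \<otimes> c)" "(- 1) \<odot> (b \<otimes> ((a \<otimes> a) \<otimes> c))"]
    by (simp add: nrm_smult)
  ultimately show ?thesis by (simp add: algebra_simps)
qed

lemma fact_dominates: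
  fixes R W :: real
  assumes W: "0 \<le> W" and le: "\<And>k. fact (2 ^ k) * W ^ (2 ^ k) \<le> R ^ (2 ^ k)"
  shows "W = 0"
proof (rule ccontr)
  assume "W \<noteq> 0"
  with W have pos: "W > 0" by simp
  have "(\<lambda>n. inverse (fact n) * (R / W) ^ n) \<longlonglongrightarrow> 0"
    by (rule summable_LIMSEQ_zero) (use summable_exp [of "R / W"] in simp)
  then obtain N where N: "\<And>n. n \<ge> N \<Longrightarrow> norm (inverse (fact n) * (R / W) ^ n) < 1"
    using LIMSEQ_D [of _ 0 1] by fastforce
  have "N \<le> 2 ^ N" by (simp add: less_imp_le)
  from N [OF this] have "\<bar>(R / W) ^ 2 ^ N\<bar> / fact (2 ^ N) < 1"
    by (simp add: abs_mult divide_inverse mult.commute del: power_divide)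
  then have "\<bar>(R / W) ^ 2 ^ N\<bar> < fact (2 ^ N)"
    by (simp add: divide_less_eq del: power_divide)
  then have "R ^ 2 ^ N < fact (2 ^ N) * W ^ 2 ^ N"
    using pos by (simp add: power_divide field_simps)
  with le [of N] show False by simp
qed

text \<open>Let w be the element in question and m = \<open>2 ^ k\<close>. The m-th iterate of the
  bounded map \<open>jdersq a b\<close> on the m-th power of b has norm at most the m-th power of a
  constant, but it equals m! times an element whose norm is the m-th power of that of w.\<close>

lemma jdersq_self:
  assumes ab: "operator_commute J a b" and c: "a \<in> carrier J" "b \<in> carrier J"
  shows "jdersq a b b = \<zero>"
proof -
  define f where "f = case_letter2 a b"
  have f: "f v \<in> carrier J" for v using c by (cases v) (simp_all add: f_def)
  interpret U: unital_jordan_algebra "unitization J" by (rule unitization_unital_jordan_algebra)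
  have eval: "jterm_eval (unitization J) (\<lambda>v. (0, f v)) t \<in> carrier (unitization J)" for t
    by (rule U.jterm_eval_closed) (simp add: f)
  have rel: "jterm_eval (unitization J) (\<lambda>v. (0, f v)) s = jterm_eval (unitization J) (\<lambda>v. (0, f v)) t"
    if st: "prel s t" for s t
  proof -
    obtain u where "s = JMult (JVar LA) (JMult (JVar LB) u)" "t = JMult (JVar LB) (JMult (JVar LA) u)"
      using st unfolding prel_letter2_def by blast
    then show ?thesis
      using unitization_operator_commute [OF ab c, of 0 0] eval [of u] by (simp add: f_def operator_commute_def del: unitization_simps)
  qed
  let ?w = "jdersq a b b"
  define C where "C = 2 * nrm J (a \<otimes> a) * nrm J b"
  have C: "C \<ge> 0" using c by (simp add: C_def nrm_nonneg)
  have w: "?w \<in> carrier J" using c by auto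
  have pow: "(jdersq a b ^^ n) x \<in> carrier J \<and> nrm J ((jdersq a b ^^ n) x) \<le> C ^ n * nrm J x"
    if "x \<in> carrier J" for n x
  proof (induction n)
    case (Suc n)
    then have "nrm J (jdersq a b ((jdersq a b ^^ n) x)) \<le> C * (C ^ n * nrm J x)"
      using nrm_jdersq [OF c, of "(jdersq a b ^^ n) x"] mult_left_mono [OF _ C]
      unfolding C_def by (meson order_trans)
    with Suc c show ?case by auto
  qed (simp add: that)
  have "fact (2 ^ k) * nrm J ?w ^ (2 ^ k) \<le> (C * nrm J b) ^ (2 ^ k)" for k
  proof -
    have "(jdersq a b ^^ (2 ^ k)) (jsqiter b k) = fact (2 ^ k) \<odot> jsqiter ?w k"
      using unitless_transport [OF letter2_identity _ _ f rel, of k]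
      by (simp add: eval_tdersq_funpow eval_tdersq eval_tsqiter f_def)
    then have "fact (2 ^ k) * nrm J ?w ^ (2 ^ k) = nrm J ((jdersq a b ^^ (2 ^ k)) (jsqiter b k))"
      using w by (simp add: nrm_smult jsqiter_closed nrm_jsqiter)
    also have "\<dots> \<le> C ^ (2 ^ k) * nrm J b ^ (2 ^ k)"
      using pow [of "jsqiter b k" "2 ^ k"] c by (simp add: jsqiter_closed nrm_jsqiter)
    finally show ?thesis by (simp add: power_mult_distrib)
  qed
  from fact_dominates [OF nrm_nonneg [OF w] this] show ?thesis using w by (simp add: nrm_eq_0)
qed

lemma add_minus_one_eq_zero:
  assumes "x \<in> carrier J" "y \<in> carrier J" "x \<oplus> (- 1) \<odot> y = \<zero>"
  shows "x = y"
proof -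
  have "x = x \<oplus> ((- 1) \<odot> y \<oplus> y)" using assms(1,2) by (simp add: rscale_minus_one)
  also have "\<dots> = (x \<oplus> (- 1) \<odot> y) \<oplus> y" using assms(1,2) by (simp add: M.a_assoc)
  finally show ?thesis using assms by simp
qed

lemma add_minus_one_cancel:
  assumes "x \<in> carrier J" "y \<in> carrier J"
  shows "(x \<oplus> y) \<oplus> (- 1) \<odot> x = y"
proof -
  have "(x \<oplus> y) \<oplus> (- 1) \<odot> x = ((- 1) \<odot> x \<oplus> x) \<oplus> y" using assms by (simp add: M.a_ac)
  then show ?thesis using assms by (simp add: rscale_minus_one)
qed

text \<open>All values of \<open>jdersq a b\<close> have square 0 by
  \<open>dersq_square_zero\<close>, and the norm of a JB-algebra excludes nonzero elements with
  square 0.\<close>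

lemma operator_commute_square:
  assumes ab: "operator_commute J a b" and c: "a \<in> carrier J" "b \<in> carrier J"
  shows "operator_commute J (a \<otimes> a) b"
  unfolding operator_commute_def
proof
  fix x assume x: "x \<in> carrier J"
  define f where "f = case_letter3 a b x"
  have f: "f v \<in> carrier J" for v using c x by (cases v) (simp_all add: f_def)
  interpret U: unital_jordan_algebra "unitization J" by (rule unitization_unital_jordan_algebra)
  have eval: "jterm_eval (unitization J) (\<lambda>v. (0, f v)) t \<in> carrier (unitization J)" for t
    by (rule U.jterm_eval_closed) (simp add: f)
  have rel: "jterm_eval (unitization J) (\<lambda>v. (0, f v)) s = jterm_eval (unitization J) (\<lambda>v. (0, f v)) t"
    if st: "prel s t" for s t
  proof -
    consider u where "s = JMult (JVar MA) (JMult (JVar MB) u)" "t = JMult (JVar MB) (JMult (JVar MA) u)"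
      | "s = tdersq (JVar MA) (JVar MB) (JVar MB)" "t = JZero"
      using st by (auto simp: prel_letter3_def)
    then show ?thesis
    proof cases
      case (1 u)
      then show ?thesis
        using unitization_operator_commute [OF ab c, of 0 0] eval [of u] by (simp add: f_def operator_commute_def del: unitization_simps)
    next
      case 2
      have "unitless s" by (simp add: 2)
      then show ?thesis
        using unitization_unitless [of s f] f jdersq_self [OF ab c] by (simp add: 2 eval_tdersq f_def)
    qed
  qed
  let ?d = "jdersq a b x"
  have d: "?d \<in> carrier J" using c x by auto
  have "?d \<otimes> ?d = \<zero>"
    using unitless_transport [OF letter3_identity _ _ f rel] by (simp add: eval_tdersq f_def)
  then have "?d = \<zero>" using nrm_square [OF d] d by (simp add: nrm_eq_0)
  then have "(a \<otimes> a) \<otimes> (b \<otimes> x) \<oplus> (- 1) \<odot> (b \<otimes> ((a \<otimes> a) \<otimes> x)) = \<zero>" by (simp only: jdersq_def)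
  then show "(a \<otimes> a) \<otimes> (b \<otimes> x) = b \<otimes> ((a \<otimes> a) \<otimes> x)"
    by (rule add_minus_one_eq_zero [rotated 2]) (simp_all add: c x)
qed

text \<open>Polarization: the product of b and c is a combination of the squares of
  \<open>b \<oplus> c\<close>, b and c.\<close>

lemma operator_commute_mult:
  assumes ab: "operator_commute J a b" "operator_commute J a c"
    and c: "a \<in> carrier J" "b \<in> carrier J" "c \<in> carrier J"
  shows "operator_commute J a (b \<otimes> c)"
proof -
  have sq: "operator_commute J a (y \<otimes> y)" if "operator_commute J a y" "y \<in> carrier J" for y
    using operator_commute_square [OF operator_commute_sym [OF that(1)] that(2) c(1)] by (rule operator_commute_sym)
  have "(b \<oplus> c) \<otimes> (b \<oplus> c) = (b \<otimes> b \<oplus> c \<otimes> c) \<oplus> 2 \<odot> (b \<otimes> c)"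
  proof -
    have "2 \<odot> (b \<otimes> c) = b \<otimes> c \<oplus> b \<otimes> c" using rscale_l_distr [of "b \<otimes> c" 1 1] c by simp
    then show ?thesis using c by (simp add: m_l_distr m_r_distr M.a_ac m_comm [of c b])
  qed
  then have "2 \<odot> (b \<otimes> c) = (b \<oplus> c) \<otimes> (b \<oplus> c) \<oplus> (- 1) \<odot> (b \<otimes> b \<oplus> c \<otimes> c)"
    using c add_minus_one_cancel [of "b \<otimes> b \<oplus> c \<otimes> c" "2 \<odot> (b \<otimes> c)"] by simp
  moreover have "b \<otimes> c = (1/2) \<odot> (2 \<odot> (b \<otimes> c))"
    using c by (simp flip: rscale_assoc)
  ultimately have e: "b \<otimes> c = (1/2) \<odot> ((b \<oplus> c) \<otimes> (b \<oplus> c) \<oplus> (- 1) \<odot> (b \<otimes> b \<oplus> c \<otimes> c))"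
    by simp
  show ?thesis
    unfolding e using assms
    by (intro operator_commute_scale operator_commute_add sq) auto
qed

inductive_set jspan :: "'a set \<Rightarrow> 'a set" for S where
  jspan_base: "x \<in> S \<Longrightarrow> x \<in> jspan S"
| jspan_zero: "\<zero> \<in> jspan S"
| jspan_add: "x \<in> jspan S \<Longrightarrow> y \<in> jspan S \<Longrightarrow> x \<oplus> y \<in> jspan S"
| jspan_scale: "x \<in> jspan S \<Longrightarrow> r \<odot> x \<in> jspan S"
| jspan_mult: "x \<in> jspan S \<Longrightarrow> y \<in> jspan S \<Longrightarrow> x \<otimes> y \<in> jspan S"

lemma jspan_closed: "\<lbrakk>x \<in> jspan S; S \<subseteq> carrier J\<rbrakk> \<Longrightarrow> x \<in> carrier J"
  by (induction rule: jspan.induct) auto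

lemma jspan_commute1:
  assumes "x \<in> jspan S" "S \<subseteq> carrier J" "y \<in> carrier J" "\<And>s. s \<in> S \<Longrightarrow> operator_commute J y s"
  shows "operator_commute J y x"
  using assms(1)
proof induction
  case jspan_zero
  show ?case using assms(3) by (simp add: operator_commute_def)
qed (use assms jspan_closed in \<open>auto intro: operator_commute_add operator_commute_scale operator_commute_mult\<close>)

lemma jspan_commute:
  assumes "S \<subseteq> carrier J" "\<And>s t. s \<in> S \<Longrightarrow> t \<in> S \<Longrightarrow> operator_commute J s t" "x \<in> jspan S" "y \<in> jspan S"
  shows "operator_commute J x y"
proof (rule jspan_commute1 [OF assms(4,1)])
  show "x \<in> carrier J" using assms jspan_closed by simp
  fix s assume "s \<in> S"
  then show "operator_commute J x s"
    using jspan_commute1 [OF assms(3,1), of s] assms(1,2) by (auto intro: operator_commute_sym)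
qed

end

section \<open>Terms for the trilinear expression and the rotations\<close>

definition tPP :: "'v jterm \<Rightarrow> 'v jterm \<Rightarrow> 'v jterm \<Rightarrow> 'v jterm" where
  "tPP a x u = JAdd (JMult x (JMult a u)) (JScale (- 1) (JMult (JMult a x) u))"

definition twtri :: "'v jterm \<Rightarrow> 'v jterm \<Rightarrow> 'v jterm \<Rightarrow> 'v jterm \<Rightarrow> 'v jterm \<Rightarrow> 'v jterm \<Rightarrow> 'v jterm" where
  "twtri a a' x y z u = JAdd (tPP a x (JMult y (tPP z a' u))) (JScale (- 1) (tPP a z (JMult y (tPP x a' u))))"

primrec trot :: "'v jterm \<Rightarrow> nat \<Rightarrow> 'v jterm \<times> 'v jterm" where
  "trot t 0 = (JZero, JZero)"
| "trot t (Suc k) = (JAdd (fst (trot t k)) (JMult t (snd (trot t k))),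
     JAdd (JAdd (snd (trot t k)) t) (JScale (- 1) (JMult t (fst (trot t k)))))"

primrec trote :: "'v jterm \<Rightarrow> nat \<Rightarrow> 'v jterm" where
  "trote t 0 = JZero"
| "trote t (Suc k) = JAdd (JAdd (trote t k) (JMult t t)) (JMult (JMult t t) (trote t k))"

lemma tev_tPP [simp]: "tev \<phi> (tPP a x u) = app (PP (tev \<phi> a) (tev \<phi> x)) (tev \<phi> u)"
  by (simp add: tPP_def PP_def)

lemma tev_twtri [simp]: "tev \<phi> (twtri a a' x y z u) = app (wtri (tev \<phi> a) (tev \<phi> a') (tev \<phi> x) (tev \<phi> y) (tev \<phi> z)) (tev \<phi> u)"
  by (simp add: twtri_def wtri_def)

lemma tev_trot [simp]:
  "tev \<phi> (fst (trot t k)) = fst (rot (tev \<phi> t) k)" "tev \<phi> (snd (trot t k)) = snd (rot (tev \<phi> t) k)"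
  "tev \<phi> (trote t k) = rote (tev \<phi> t) k"
  by (induction k) simp_all

lemma unitless_trot [simp]:
  "unitless t \<Longrightarrow> unitless (fst (trot t k))" "unitless t \<Longrightarrow> unitless (snd (trot t k))"
  "unitless t \<Longrightarrow> unitless (trote t k)"
proof -
  have "unitless t \<Longrightarrow> unitless (fst (trot t k)) \<and> unitless (snd (trot t k))" by (induction k) simp_all
  then show "unitless t \<Longrightarrow> unitless (fst (trot t k))" "unitless t \<Longrightarrow> unitless (snd (trot t k))" by simp_all
  show "unitless t \<Longrightarrow> unitless (trote t k)" by (induction k) simp_all
qed

lemma unitless_twtri [simp]:
  "\<lbrakk>unitless a; unitless a'; unitless x; unitless y; unitless z; unitless u\<rbrakk> \<Longrightarrow> unitless (twtri a a' x y z u)"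
  by (simp add: twtri_def tPP_def)

definition rPP :: "(real, 'a, 'b) module_scheme \<Rightarrow> 'a \<Rightarrow> 'a \<Rightarrow> 'a \<Rightarrow> 'a" where
  "rPP J a x u = x \<otimes>\<^bsub>J\<^esub> (a \<otimes>\<^bsub>J\<^esub> u) \<oplus>\<^bsub>J\<^esub> (- 1) \<odot>\<^bsub>J\<^esub> ((a \<otimes>\<^bsub>J\<^esub> x) \<otimes>\<^bsub>J\<^esub> u)"

definition rwtri :: "(real, 'a, 'b) module_scheme \<Rightarrow> 'a \<Rightarrow> 'a \<Rightarrow> 'a \<Rightarrow> 'a \<Rightarrow> 'a \<Rightarrow> 'a \<Rightarrow> 'a" where
  "rwtri J a a' x y z u = rPP J a x (y \<otimes>\<^bsub>J\<^esub> rPP J z a' u) \<oplus>\<^bsub>J\<^esub> (- 1) \<odot>\<^bsub>J\<^esub> rPP J a z (y \<otimes>\<^bsub>J\<^esub> rPP J x a' u)"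

lemma eval_twtri: "jterm_eval J f (twtri a a' x y z u) = rwtri J (jterm_eval J f a) (jterm_eval J f a')
    (jterm_eval J f x) (jterm_eval J f y) (jterm_eval J f z) (jterm_eval J f u)"
  by (simp add: twtri_def tPP_def rwtri_def rPP_def)

text \<open>The letters \<open>SB\<close> generate a strongly associative subalgebra, because the
  relation covers all terms p and q in them; the letters \<open>SF\<close> stand for arbitrary
  elements.\<close>

datatype sv = SB nat | SF nat

instantiation sv :: presented
begin
definition prel_sv :: "sv jterm \<Rightarrow> sv jterm \<Rightarrow> bool" where
  "prel_sv s t \<longleftrightarrow> (\<exists>p q u. jvars p \<subseteq> range SB \<and> jvars q \<subseteq> range SB \<and>
     s = JMult p (JMult q u) \<and> t = JMult q (JMult p u))"
instance ..
end

definition svB :: "sv pj set" where "svB = {pclass p | p. jvars p \<subseteq> range SB}"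

lemma svBI: "jvars p \<subseteq> range SB \<Longrightarrow> pclass p \<in> svB"
  by (auto simp: svB_def)

lemma strongly_associative_svB: "strongly_associative svB"
  unfolding strongly_associative_def
proof (intro conjI ballI allI)
  show "junit \<in> svB" using svBI [of JOne] by (simp add: pclass_simps)
  fix x assume "x \<in> svB"
  then obtain p where p: "x = pclass p" "jvars p \<subseteq> range SB" by (auto simp: svB_def)
  show "r *\<^sub>R x \<in> svB" for r using svBI [of "JScale r p"] p by (simp add: pclass_simps)
  fix y assume "y \<in> svB"
  then obtain q where q: "y = pclass q" "jvars q \<subseteq> range SB" by (auto simp: svB_def)
  show "x + y \<in> svB" using svBI [of "JAdd p q"] p q by (simp add: pclass_simps)
  show "x \<bullet> y \<in> svB" using svBI [of "JMult p q"] p q by (simp add: pclass_simps)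
  show "L x * L y = L y * L x"
    unfolding p q by (rule L_commute_pclass, rule peq_rel) (use p q in \<open>auto simp: prel_sv_def\<close>)
qed

abbreviation (input) "vB i \<equiv> JVar (SB i)"
abbreviation (input) "vF i \<equiv> JVar (SF i)"

lemma sv_identity:
  fixes c :: real and k :: nat
  defines "T \<equiv> JScale (c / real (Suc k)) (vB 0)"
  shows "tev (\<lambda>v. pclass (JVar v)) (JScale c (twtri (vF 0) (vF 1) (vB 0) (vB 1) (vB 2) (vF 2)))
    = tev (\<lambda>v. pclass (JVar v)) (JAdd (JAdd
        (twtri (vF 0) (vF 1) (snd (trot T (Suc k))) (JAdd (vB 1) (JScale (- 1) (JMult (vB 1) (fst (trot T k))))) (vB 2) (vF 2))
        (twtri (vF 0) (vF 1) (fst (trot T (Suc k))) (JMult (vB 1) (snd (trot T k))) (vB 2) (vF 2)))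
        (JScale (- c) (twtri (vF 0) (vF 1) (vB 0) (JMult (vB 1) (trote T k)) (vB 2) (vF 2))))"
proof -
  let ?q = "\<lambda>v. pclass (JVar v :: sv jterm)"
  have B: "?q (SB i) \<in> svB" for i by (intro svBI) auto
  have "app (c *\<^sub>R wtri (?q (SF 0)) (?q (SF 1)) (?q (SB 0)) (?q (SB 1)) (?q (SB 2))) (?q (SF 2))
    = app (wtri (?q (SF 0)) (?q (SF 1)) (snd (rot (tev ?q T) (Suc k))) (?q (SB 1) - ?q (SB 1) \<bullet> fst (rot (tev ?q T) k)) (?q (SB 2))
      + wtri (?q (SF 0)) (?q (SF 1)) (fst (rot (tev ?q T) (Suc k))) (?q (SB 1) \<bullet> snd (rot (tev ?q T) k)) (?q (SB 2))
      - c *\<^sub>R wtri (?q (SF 0)) (?q (SF 1)) (?q (SB 0)) (?q (SB 1) \<bullet> rote (tev ?q T) k) (?q (SB 2))) (?q (SF 2))"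
    using wtri_bound_identity [OF strongly_associative_svB B [of 0] B [of 2] B [of 1], of c "?q (SF 0)" "?q (SF 1)" k]
    by (simp only: T_def tev.simps)
  then show ?thesis
    by (simp only: tev.simps tev_twtri tev_trot app_simps) simp
qed

lemma sv_circle:
  "tev (\<lambda>v. pclass (JVar v)) (JAdd (JMult (fst (trot (JScale r (vB 0)) k)) (fst (trot (JScale r (vB 0)) k)))
      (JMult (snd (trot (JScale r (vB 0)) k)) (snd (trot (JScale r (vB 0)) k))))
   = tev (\<lambda>v. pclass (JVar v)) (JAdd (JScale 2 (fst (trot (JScale r (vB 0)) k))) (trote (JScale r (vB 0)) k))"
proof -
  have "r *\<^sub>R pclass (vB 0) \<in> svB" using svBI [of "JScale r (vB 0)"] by (simp add: pclass_simps)
  from rot_circle [OF strongly_associative_svB this] show ?thesis by simp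
qed

lemma PP_junit: "PP junit x = (0 :: 'a::jordan endo)" "PP x junit = (0 :: 'a endo)"
  by (simp_all add: PP_def L_junit junit_left jmul_comm [of x])

lemma app_PP_junit: "app (PP a x) junit = (0 :: 'a::jordan)"
  by (simp add: PP_def jmul_comm [of _ junit] junit_left jmul_comm [of x a])

text \<open>\<open>PP\<close> vanishes if one argument is the unit and when applied to the unit, and
  with the unit in the middle \<open>wtri\<close> vanishes by exchange. So scalar parts do not
  matter, and the vanishing of \<open>wtri\<close> passes from J to its unitization.\<close>

lemma sv_unit_shift:
  "tev (\<lambda>v. pclass (JVar v)) (twtri (JAdd (JScale r1 JOne) (vF 0)) (JAdd (JScale r2 JOne) (vF 1)) (JAdd (JScale r3 JOne) (vB 0))
      (JAdd (JScale r4 JOne) (vB 1)) (JAdd (JScale r5 JOne) (vB 2)) (JAdd (JScale r6 JOne) (vF 2)))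
   = tev (\<lambda>v. pclass (JVar v)) (twtri (vF 0) (vF 1) (vB 0) (vB 1) (vB 2) (vF 2))"
proof -
  let ?q = "\<lambda>v. pclass (JVar v :: sv jterm)"
  have B: "?q (SB i) \<in> svB" for i by (intro svBI) auto
  have x: "PP p (?q (SB 0)) * PP (?q (SB 2)) r = PP p (?q (SB 2)) * PP (?q (SB 0)) r" for p r
    by (rule B_xch [OF strongly_associative_svB B B])
  then have x': "app (PP p (?q (SB 0))) (app (PP (?q (SB 2)) r) s) = app (PP p (?q (SB 2))) (app (PP (?q (SB 0)) r) s)" for p r s
    by (metis app_simps(6))
  show ?thesis
    by (simp add: wtri_def PP_add PP_scaleR PP_junit app_PP_junit L_add L_scaleR L_junit x')
qed

section \<open>Vanishing of the trilinear expression in a JB-algebra\<close>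

context jb_algebra
begin

lemma eval_jspan:
  assumes "S \<subseteq> carrier J" "jvars p \<subseteq> T" "\<And>v. v \<in> T \<Longrightarrow> h v \<in> UNIV \<times> jspan S"
  shows "jterm_eval (unitization J) h p \<in> UNIV \<times> jspan S"
  using assms(2)
proof (induction p)
  case (JMult s t)
  then show ?case
    by (cases "jterm_eval (unitization J) h s"; cases "jterm_eval (unitization J) h t")
      (auto intro!: jspan.intros(2-))
next
  case (JAdd s t)
  then show ?case
    by (cases "jterm_eval (unitization J) h s"; cases "jterm_eval (unitization J) h t")
      (auto intro!: jspan.intros(2-))
next
  case (JScale r t)
  then show ?case
    by (cases "jterm_eval (unitization J) h t") (auto intro!: jspan.intros(2-))
qed (use assms(3) in \<open>auto intro!: jspan.intros(2-)\<close>)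

lemma unitization_jspan_commute:
  assumes "S \<subseteq> carrier J" "\<And>s t. s \<in> S \<Longrightarrow> t \<in> S \<Longrightarrow> operator_commute J s t"
    "p \<in> UNIV \<times> jspan S" "q \<in> UNIV \<times> jspan S"
  shows "operator_commute (unitization J) p q"
  using assms jspan_commute [OF assms(1,2)] jspan_closed [OF _ assms(1)]
  by (auto intro!: unitization_operator_commute)

lemma rPP_closed [simp, intro]: "\<lbrakk>a \<in> carrier J; x \<in> carrier J; u \<in> carrier J\<rbrakk> \<Longrightarrow> rPP J a x u \<in> carrier J"
  by (simp add: rPP_def)

lemma nrm_rPP:
  assumes "a \<in> carrier J" "x \<in> carrier J" "u \<in> carrier J"
  shows "nrm J (rPP J a x u) \<le> 2 * nrm J a * nrm J x * nrm J u"
proof -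
  have "nrm J (x \<otimes> (a \<otimes> u)) \<le> nrm J x * (nrm J a * nrm J u)"
    using assms by (intro nrm_mult3 nrm_mult) auto
  moreover have "nrm J ((a \<otimes> x) \<otimes> u) \<le> (nrm J a * nrm J x) * nrm J u"
    using assms nrm_mult [of "a \<otimes> x" u] mult_right_mono [OF nrm_mult [of a x] nrm_nonneg [of u]] by auto
  moreover have "nrm J (rPP J a x u) \<le> nrm J (x \<otimes> (a \<otimes> u)) + nrm J ((a \<otimes> x) \<otimes> u)"
    unfolding rPP_def using assms nrm_triangle [of "x \<otimes> (a \<otimes> u)" "(- 1) \<odot> ((a \<otimes> x) \<otimes> u)"]
    by (simp add: nrm_smult)
  ultimately show ?thesis by (simp add: algebra_simps)
qed

lemma nrm_rPP2:
  assumes "a \<in> carrier J" "a' \<in> carrier J" "x \<in> carrier J" "y \<in> carrier J" "z \<in> carrier J" "u \<in> carrier J"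
  shows "nrm J (rPP J a x (y \<otimes> rPP J z a' u)) \<le> 4 * (nrm J a * nrm J a' * nrm J z * nrm J u) * (nrm J x * nrm J y)"
proof -
  have "nrm J (rPP J a x (y \<otimes> rPP J z a' u)) \<le> 2 * nrm J a * nrm J x * nrm J (y \<otimes> rPP J z a' u)"
    using assms by (intro nrm_rPP) auto
  also have "\<dots> \<le> 2 * nrm J a * nrm J x * (nrm J y * (2 * nrm J z * nrm J a' * nrm J u))"
    using assms by (intro mult_left_mono nrm_mult3 nrm_rPP mult_nonneg_nonneg nrm_nonneg) auto
  finally show ?thesis by (simp add: algebra_simps)
qed

text \<open>The constant 8 counts two summands, each with a factor 2 from both of its
  \<open>rPP\<close>.\<close>

lemma nrm_rwtri:
  assumes "a \<in> carrier J" "a' \<in> carrier J" "x \<in> carrier J" "y \<in> carrier J" "z \<in> carrier J" "u \<in> carrier J"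
  shows "nrm J (rwtri J a a' x y z u) \<le> 8 * (nrm J a * nrm J a' * nrm J z * nrm J u) * (nrm J x * nrm J y)"
proof -
  let ?p = "rPP J a x (y \<otimes> rPP J z a' u)" and ?q = "rPP J a z (y \<otimes> rPP J x a' u)"
  have c: "?p \<in> carrier J" "?q \<in> carrier J" using assms by auto
  have "nrm J (rwtri J a a' x y z u) \<le> nrm J ?p + nrm J ?q"
    unfolding rwtri_def using c nrm_triangle [of ?p "(- 1) \<odot> ?q"] by (simp add: nrm_smult)
  then show ?thesis
    using nrm_rPP2 [OF assms] nrm_rPP2 [OF assms(1,2,5,4,3,6)] by (simp add: algebra_simps)
qed

lemma rwtri_closed: "\<lbrakk>a \<in> carrier J; a' \<in> carrier J; x \<in> carrier J; y \<in> carrier J; z \<in> carrier J; u \<in> carrier J\<rbrakk>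
    \<Longrightarrow> rwtri J a a' x y z u \<in> carrier J"
  by (simp add: rwtri_def)

lemma rotation_step_bound:
  fixes c :: real and n :: nat
  assumes "n \<ge> 1" "c \<ge> 0"
  shows "\<exists>k. (1 + (real n / real (Suc k) * c)\<^sup>2) ^ Suc k - 1 \<le> 1 / n"
proof -
  \<comment> \<open>With N = k + 1 the power is at most \<open>exp t\<close> for
    \<open>t = n^2 c^2 / N\<close>. This choice gives \<open>2 t \<le> 1 / n\<close>, and
    \<open>exp t \<le> 1 + t + t^2 \<le> 1 + 2 t\<close>.\<close>
  define k where "k = nat \<lceil>2 * real n ^ 3 * c\<^sup>2\<rceil>"
  define N where "N = real (Suc k)"
  define t where "t = real n ^ 2 * c\<^sup>2 / N"
  have N: "N > 0" "2 * real n ^ 3 * c\<^sup>2 \<le> N" unfolding N_def k_def by linarith+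
  have "t * (2 * n) \<le> 1" using N by (simp add: t_def field_simps power2_eq_square power3_eq_cube)
  then have "2 * t \<le> 1 / n" using assms by (simp add: field_simps)
  moreover have "1 / real n \<le> 1" using assms by simp
  moreover have "0 \<le> t" using N by (simp add: t_def)
  ultimately have t: "0 \<le> t" "2 * t \<le> 1 / n" "t \<le> 1" by linarith+
  have "(1 + (real n / N * c)\<^sup>2) ^ Suc k \<le> exp ((real n / N * c)\<^sup>2) ^ Suc k"
    by (intro power_mono) auto
  also have "\<dots> = exp (N * (real n / N * c)\<^sup>2)"
    by (simp only: N_def exp_of_nat_mult)
  also have "N * (real n / N * c)\<^sup>2 = t" using N by (simp add: t_def field_simps power2_eq_square)
  also have "exp t \<le> 1 + t + t\<^sup>2" using t by (intro exp_bound)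
  also have "t\<^sup>2 \<le> t" using t by (simp add: power2_eq_square mult_left_le)
  finally show ?thesis using t(2) by (intro exI [of _ k]) (simp add: N_def)
qed

text \<open>The rotation identity with c = n bounds n times the norm of the expression independently
  of n.\<close>

lemma rwtri_zero:
  assumes S: "S \<subseteq> carrier J" "\<And>s t. s \<in> S \<Longrightarrow> t \<in> S \<Longrightarrow> operator_commute J s t"
    and B: "f \<in> jspan S" "x \<in> jspan S" "z \<in> jspan S" and c: "a \<in> carrier J" "a' \<in> carrier J" "u \<in> carrier J"
  shows "rwtri J a a' f x z u = \<zero>"
proof -
  interpret U: unital_jordan_algebra "unitization J" by (rule unitization_unital_jordan_algebra)
  define g where "g = case_sv (\<lambda>i. if i = 0 then f else if i = 1 then x else z) (\<lambda>i. if i = 0 then a else if i = 1 then a' else u)"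
  have Bc: "f \<in> carrier J" "x \<in> carrier J" "z \<in> carrier J" using B jspan_closed [OF _ S(1)] by auto
  have g: "g v \<in> carrier J" for v using Bc c by (cases v) (simp_all add: g_def)
  have gs [simp]: "g (SB 0) = f" "g (SB 1) = x" "g (SB (Suc 0)) = x" "g (SB 2) = z"
    "g (SF 0) = a" "g (SF 1) = a'" "g (SF (Suc 0)) = a'" "g (SF 2) = u"
    by (simp_all add: g_def)
  have rel: "jterm_eval (unitization J) (\<lambda>v. (0, g v)) s = jterm_eval (unitization J) (\<lambda>v. (0, g v)) t"
    if st: "prel s t" for s t
  proof -
    obtain p q r where pq: "jvars p \<subseteq> range SB" "jvars q \<subseteq> range SB"
      and eq: "s = JMult p (JMult q r)" "t = JMult q (JMult p r)"
      using st unfolding prel_sv_def by blast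
    have in_span: "jterm_eval (unitization J) (\<lambda>v. (0, g v)) p \<in> UNIV \<times> jspan S" if "jvars p \<subseteq> range SB" for p
      by (rule eval_jspan [OF S(1) that]) (use B in \<open>auto simp: g_def\<close>)
    have "jterm_eval (unitization J) (\<lambda>v. (0, g v)) r \<in> carrier (unitization J)"
      by (rule U.jterm_eval_closed) (simp add: g)
    then show ?thesis
      using unitization_jspan_commute [OF S in_span [OF pq(1)] in_span [OF pq(2)]]
      by (simp add: eq operator_commute_def del: unitization_simps)
  qed
  note tr = unitless_transport [OF _ _ _ g rel]
  let ?w = "rwtri J a a' f x z u"
  define K where "K = 8 * (nrm J a * nrm J a' * nrm J z * nrm J u)"
  have K: "K \<ge> 0" using c Bc by (simp add: K_def nrm_nonneg)
  \<comment> \<open>The number 21 is \<open>3 * 4 + 3 * 3\<close>, from the two terms with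
    rotations; \<open>nrm J f\<close> stems from the error term, where the factor n is absorbed by
    the smallness of \<open>E k\<close>.\<close>
  have main: "real n * nrm J ?w \<le> K * nrm J x * (21 + nrm J f)" if n: "n \<ge> 1" for n :: nat
  proof -
    obtain k where k: "(1 + (real n / real (Suc k) * nrm J f)\<^sup>2) ^ Suc k - 1 \<le> 1 / n"
      using rotation_step_bound [OF n nrm_nonneg [OF Bc(1)]] by blast
    define r where "r = real n / real (Suc k)"
    define T where "T = JScale r (vB 0)"
    define q where "q = (r * nrm J f)\<^sup>2"
    define V where "V j = jterm_eval J g (fst (trot T j))" for j
    define W where "W j = jterm_eval J g (snd (trot T j))" for j
    define E where "E j = jterm_eval J g (trote T j)" for j
    have cl: "V j \<in> carrier J" "W j \<in> carrier J" "E j \<in> carrier J" for j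
      unfolding V_def W_def E_def by (rule unitless_closed; simp add: T_def g)+
    have q0: "q \<ge> 0" by (simp add: q_def)
    have q: "nrm J ((r \<odot> f) \<otimes> (r \<odot> f)) = q"
      using Bc by (simp add: q_def nrm_smult power_mult_distrib flip: nrm_square)
    have E_bound: "nrm J (E j) \<le> (1 + q) ^ j - 1" for j
    proof (induction j)
      case 0
      then show ?case using nrm_eq_0 [of \<zero>] by (simp add: E_def)
    next
      case (Suc j)
      let ?t = "(r \<odot> f) \<otimes> (r \<odot> f)"
      have t: "?t \<in> carrier J" using Bc by simp
      have "E (Suc j) = (E j \<oplus> ?t) \<oplus> ?t \<otimes> E j" by (simp add: E_def T_def)
      then have "nrm J (E (Suc j)) \<le> (nrm J (E j) + q) + q * nrm J (E j)"
        using nrm_triangle [of "E j \<oplus> ?t" "?t \<otimes> E j"] nrm_triangle [of "E j" ?t] nrm_mult [of ?t "E j"] cl t q by simp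
      also have "\<dots> = (1 + q) * (nrm J (E j) + 1) - 1" by (simp add: algebra_simps)
      also have "\<dots> \<le> (1 + q) ^ Suc j - 1"
        using mult_left_mono [of "nrm J (E j) + 1" "(1 + q) ^ j" "1 + q"] Suc q0 by simp
      finally show ?case .
    qed
    have E_small: "nrm J (E j) \<le> 1 / n" if "j \<le> Suc k" for j
    proof -
      have "(1 + q) ^ j \<le> (1 + q) ^ Suc k" using that q0 by (intro power_increasing) auto
      then show ?thesis using E_bound [of j] k by (simp add: q_def r_def)
    qed
    \<comment> \<open>The circle identity and the axiom \<open>nrm_square_le\<close> give
      \<open>|V|^2 \<le> 2 |V| + 1\<close> and \<open>|W|^2 \<le> 2 |V| + 1\<close>. The first
      implies \<open>|V| \<le> 3\<close>, and then the second gives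
      \<open>|W| \<le> 3\<close>.\<close>
    have VW: "nrm J (V j) \<le> 3 \<and> nrm J (W j) \<le> 3" if "j \<le> Suc k" for j
    proof -
      have e: "V j \<otimes> V j \<oplus> W j \<otimes> W j = 2 \<odot> V j \<oplus> E j"
        using tr [OF sv_circle, of r j] by (simp add: V_def W_def E_def T_def)
      have "1 / real n \<le> 1" using n by simp
      then have "nrm J (2 \<odot> V j \<oplus> E j) \<le> 2 * nrm J (V j) + 1"
        using nrm_triangle [of "2 \<odot> V j" "E j"] cl E_small [OF that] by (simp add: nrm_smult)
      then have 1: "(nrm J (V j))\<^sup>2 \<le> 2 * nrm J (V j) + 1" "(nrm J (W j))\<^sup>2 \<le> 2 * nrm J (V j) + 1"
        using nrm_square_le [of "V j" "W j"] nrm_square_le [of "W j" "V j"] cl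
        by (simp_all add: nrm_square e M.a_comm [of "W j \<otimes> W j"])
      have "nrm J (V j) \<le> 3"
      proof (rule ccontr)
        assume "\<not> nrm J (V j) \<le> 3"
        then have "3 * nrm J (V j) \<le> nrm J (V j) * nrm J (V j)" by (intro mult_right_mono) auto
        with 1(1) \<open>\<not> nrm J (V j) \<le> 3\<close> show False by (simp add: power2_eq_square)
      qed
      moreover from this have "(nrm J (W j))\<^sup>2 \<le> 3\<^sup>2" using 1(2) by simp
      then have "nrm J (W j) \<le> 3" by (rule power2_le_imp_le) simp
      ultimately show ?thesis by simp
    qed
    let ?y = "x \<oplus> (- 1) \<odot> (x \<otimes> V k)"
    have id: "real n \<odot> ?w = (rwtri J a a' (W (Suc k)) ?y z u \<oplus> rwtri J a a' (V (Suc k)) (x \<otimes> W k) z u)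
        \<oplus> (- real n) \<odot> rwtri J a a' f (x \<otimes> E k) z u"
      using tr [OF sv_identity, of "real n" k]
      by (simp add: eval_twtri V_def W_def E_def T_def r_def del: trot.simps of_nat_Suc)
    have y: "?y \<in> carrier J" "nrm J ?y \<le> 4 * nrm J x"
    proof -
      show "?y \<in> carrier J" using Bc cl by simp
      have "nrm J (x \<otimes> V k) \<le> nrm J x * 3" using Bc cl VW [of k] by (intro nrm_mult3) auto
      then show "nrm J ?y \<le> 4 * nrm J x"
        using nrm_triangle [of x "(- 1) \<odot> (x \<otimes> V k)"] Bc cl by (simp add: nrm_smult)
    qed
    have xW: "nrm J (x \<otimes> W k) \<le> 3 * nrm J x"
      using nrm_mult3 [of x "W k" 3] Bc cl VW [of k] by (simp add: mult.commute)
    have xE: "n * nrm J (x \<otimes> E k) \<le> nrm J x"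
    proof -
      have "nrm J (x \<otimes> E k) \<le> nrm J x * (1 / n)" using Bc cl E_small [of k] by (intro nrm_mult3) auto
      then show ?thesis using n by (simp add: field_simps)
    qed
    have nx: "0 \<le> nrm J x" "0 \<le> nrm J f" using Bc by (simp_all add: nrm_nonneg)
    have "real n * nrm J ?w = nrm J (real n \<odot> ?w)"
      using rwtri_closed c Bc by (simp add: nrm_smult)
    also have "\<dots> \<le> nrm J (rwtri J a a' (W (Suc k)) ?y z u) + nrm J (rwtri J a a' (V (Suc k)) (x \<otimes> W k) z u)
        + n * nrm J (rwtri J a a' f (x \<otimes> E k) z u)"
    proof -
      let ?A = "rwtri J a a' (W (Suc k)) ?y z u" and ?B = "rwtri J a a' (V (Suc k)) (x \<otimes> W k) z u"
        and ?C = "rwtri J a a' f (x \<otimes> E k) z u"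
      have "?A \<in> carrier J" "?B \<in> carrier J" "?C \<in> carrier J"
        using c Bc cl y by (auto intro!: rwtri_closed)
      then show ?thesis
        unfolding id using nrm_triangle [of "?A \<oplus> ?B" "(- real n) \<odot> ?C"] nrm_triangle [of ?A ?B]
        by (simp add: nrm_smult)
    qed
    also have "nrm J (rwtri J a a' (W (Suc k)) ?y z u) \<le> K * (3 * (4 * nrm J x))"
    proof -
      have "nrm J (rwtri J a a' (W (Suc k)) ?y z u) \<le> K * (nrm J (W (Suc k)) * nrm J ?y)"
        unfolding K_def using c Bc cl y by (intro nrm_rwtri) auto
      also have "\<dots> \<le> K * (3 * (4 * nrm J x))"
        using K VW [of "Suc k"] y nrm_nonneg [OF y(1)] by (intro mult_left_mono mult_mono) auto
      finally show ?thesis .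
    qed
    also have "nrm J (rwtri J a a' (V (Suc k)) (x \<otimes> W k) z u) \<le> K * (3 * (3 * nrm J x))"
    proof -
      have "nrm J (rwtri J a a' (V (Suc k)) (x \<otimes> W k) z u) \<le> K * (nrm J (V (Suc k)) * nrm J (x \<otimes> W k))"
        unfolding K_def using c Bc cl by (intro nrm_rwtri) auto
      also have "\<dots> \<le> K * (3 * (3 * nrm J x))"
        using K VW [of "Suc k"] xW Bc cl nrm_nonneg [of "x \<otimes> W k"] by (intro mult_left_mono mult_mono) auto
      finally show ?thesis .
    qed
    also have "n * nrm J (rwtri J a a' f (x \<otimes> E k) z u) \<le> K * (nrm J f * nrm J x)"
    proof -
      have "nrm J (rwtri J a a' f (x \<otimes> E k) z u) \<le> K * (nrm J f * nrm J (x \<otimes> E k))"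
        unfolding K_def using c Bc cl by (intro nrm_rwtri) auto
      then have "n * nrm J (rwtri J a a' f (x \<otimes> E k) z u) \<le> n * (K * (nrm J f * nrm J (x \<otimes> E k)))"
        by (intro mult_left_mono) auto
      also have "\<dots> = K * nrm J f * (n * nrm J (x \<otimes> E k))" by simp
      also have "\<dots> \<le> K * nrm J f * nrm J x" using xE K nx by (intro mult_left_mono) auto
      finally show ?thesis by (simp add: mult.assoc)
    qed
    finally show ?thesis by (simp add: algebra_simps)
  qed
  have w: "?w \<in> carrier J" using rwtri_closed c Bc by simp
  have "nrm J ?w \<le> 0"
  proof (rule ccontr)
    assume "\<not> nrm J ?w \<le> 0"
    then obtain n where n: "K * nrm J x * (21 + nrm J f) < real n * nrm J ?w"
      using reals_Archimedean3 [of "nrm J ?w"] by auto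
    have "real n * nrm J ?w \<le> real (Suc n) * nrm J ?w" using w by (intro mult_right_mono) (auto simp: nrm_nonneg)
    with n main [of "Suc n"] show False by simp
  qed
  then show ?thesis using w nrm_nonneg [OF w] nrm_eq_0 [OF w] by simp
qed

lemma unitization_rwtri_zero:
  assumes S: "S \<subseteq> carrier J" "\<And>s t. s \<in> S \<Longrightarrow> t \<in> S \<Longrightarrow> operator_commute J s t"
    and B: "x \<in> UNIV \<times> jspan S" "y \<in> UNIV \<times> jspan S" "z \<in> UNIV \<times> jspan S"
    and c: "a \<in> carrier (unitization J)" "a' \<in> carrier (unitization J)" "u \<in> carrier (unitization J)"
  shows "rwtri (unitization J) a a' x y z u = \<zero>\<^bsub>unitization J\<^esub>"
proof -
  interpret U: unital_jordan_algebra "unitization J" by (rule unitization_unital_jordan_algebra)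
  define g where "g = case_sv (\<lambda>i. if i = 0 then snd x else if i = 1 then snd y else snd z)
    (\<lambda>i. if i = 0 then snd a else if i = 1 then snd a' else snd u)"
  have Bs: "snd x \<in> jspan S" "snd y \<in> jspan S" "snd z \<in> jspan S" using B by auto
  then have Bc: "snd x \<in> carrier J" "snd y \<in> carrier J" "snd z \<in> carrier J" using jspan_closed [OF _ S(1)] by auto
  have cc: "snd a \<in> carrier J" "snd a' \<in> carrier J" "snd u \<in> carrier J" using c by auto
  have g: "g v \<in> carrier J" for v using Bc cc by (cases v) (simp_all add: g_def)
  have gs [simp]: "g (SB 0) = snd x" "g (SB 1) = snd y" "g (SB (Suc 0)) = snd y" "g (SB 2) = snd z"
    "g (SF 0) = snd a" "g (SF 1) = snd a'" "g (SF (Suc 0)) = snd a'" "g (SF 2) = snd u"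
    by (simp_all add: g_def)
  let ?h = "\<lambda>v. (0, g v)"
  have rel: "jterm_eval (unitization J) ?h s = jterm_eval (unitization J) ?h t"
    if st: "prel s t" for s t
  proof -
    obtain p q r where pq: "jvars p \<subseteq> range SB" "jvars q \<subseteq> range SB"
      and eq: "s = JMult p (JMult q r)" "t = JMult q (JMult p r)"
      using st unfolding prel_sv_def by blast
    have in_span: "jterm_eval (unitization J) ?h p \<in> UNIV \<times> jspan S" if "jvars p \<subseteq> range SB" for p
      by (rule eval_jspan [OF S(1) that]) (use Bs in \<open>auto simp: g_def\<close>)
    have "jterm_eval (unitization J) ?h r \<in> carrier (unitization J)"
      by (rule U.jterm_eval_closed) (simp add: g)
    then show ?thesis
      using unitization_jspan_commute [OF S in_span [OF pq(1)] in_span [OF pq(2)]]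
      by (simp add: eq operator_commute_def del: unitization_simps)
  qed
  have shift: "jterm_eval (unitization J) ?h (JAdd (JScale (fst w) JOne) (JVar v)) = w"
    if "g v = snd w" "snd w \<in> carrier J" for v w
    using that by (cases w) simp
  have "rwtri (unitization J) a a' x y z u = jterm_eval (unitization J) ?h
      (twtri (JAdd (JScale (fst a) JOne) (vF 0)) (JAdd (JScale (fst a') JOne) (vF 1)) (JAdd (JScale (fst x) JOne) (vB 0))
      (JAdd (JScale (fst y) JOne) (vB 1)) (JAdd (JScale (fst z) JOne) (vB 2)) (JAdd (JScale (fst u) JOne) (vF 2)))"
    unfolding eval_twtri shift [of "SF 0" a, OF gs(5) cc(1)] shift [of "SF 1" a', OF gs(6) cc(2)]
      shift [of "SB 0" x, OF gs(1) Bc(1)] shift [of "SB 1" y, OF gs(2) Bc(2)] shift [of "SB 2" z, OF gs(4) Bc(3)]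
      shift [of "SF 2" u, OF gs(8) cc(3)] ..
  also have "\<dots> = jterm_eval (unitization J) ?h (twtri (vF 0) (vF 1) (vB 0) (vB 1) (vB 2) (vF 2))"
    by (rule U.jterm_eval_peq [OF sv_unit_shift [unfolded tev_pclass pclass_eq_iff] _ rel]) (simp add: g)
  also have "\<dots> = (0, jterm_eval J g (twtri (vF 0) (vF 1) (vB 0) (vB 1) (vB 2) (vF 2)))"
    by (rule unitization_unitless) (simp_all add: g)
  also have "\<dots> = \<zero>\<^bsub>unitization J\<^esub>"
    using rwtri_zero [OF S Bs cc] by (simp add: eval_twtri)
  finally show ?thesis .
qed

end

section \<open>Presented algebras with two strongly associative subalgebras\<close>

class presented_pair = presented +
  fixes pletters :: "bool \<Rightarrow> 'a set"
  assumes prel_commute: "\<lbrakk>jvars p \<subseteq> pletters i; jvars q \<subseteq> pletters i\<rbrakk> \<Longrightarrow>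
      prel (JMult p (JMult q u)) (JMult q (JMult p u))"
    and prel_exchange: "\<lbrakk>jvars x \<subseteq> pletters i; jvars y \<subseteq> pletters i; jvars z \<subseteq> pletters i\<rbrakk> \<Longrightarrow>
      prel (twtri a a' x y z u) JZero"

instantiation pj :: (presented_pair) jordan_pair
begin
definition jS_pj :: "bool \<Rightarrow> 'a pj set" where "jS_pj i = {pclass p | p. jvars p \<subseteq> pletters i}"
instance
proof
  fix x y u c a a' b :: "'a pj" and i
  show "x + y \<in> jS i" if xy: "x \<in> jS i" "y \<in> jS i"
  proof -
    obtain p q where "x = pclass p" "y = pclass q" "jvars p \<subseteq> pletters i" "jvars q \<subseteq> pletters i"
      using xy by (auto simp: jS_pj_def)
    then have "x + y = pclass (JAdd p q)" "jvars (JAdd p q) \<subseteq> pletters i" by (simp_all add: pclass_simps)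
    then show ?thesis unfolding jS_pj_def by blast
  qed
  show "x \<bullet> y \<in> jS i" if xy: "x \<in> jS i" "y \<in> jS i"
  proof -
    obtain p q where "x = pclass p" "y = pclass q" "jvars p \<subseteq> pletters i" "jvars q \<subseteq> pletters i"
      using xy by (auto simp: jS_pj_def)
    then have "x \<bullet> y = pclass (JMult p q)" "jvars (JMult p q) \<subseteq> pletters i" by (simp_all add: pclass_simps)
    then show ?thesis unfolding jS_pj_def by blast
  qed
  show "x \<bullet> (y \<bullet> u) = y \<bullet> (x \<bullet> u)" if xy: "x \<in> jS i" "y \<in> jS i"
  proof -
    obtain p q where "x = pclass p" "y = pclass q" "jvars p \<subseteq> pletters i" "jvars q \<subseteq> pletters i"
      using xy by (auto simp: jS_pj_def)
    moreover obtain r where "u = pclass r" by (rule pclass_cases)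
    ultimately show ?thesis
      using peq_rel [OF prel_commute, of p i q r] by (simp add: pclass_eq_iff flip: pclass_simps)
  qed
  show "a \<bullet> (x \<bullet> (c \<bullet> (b \<bullet> (a' \<bullet> u) - (a' \<bullet> b) \<bullet> u))) - (x \<bullet> a) \<bullet> (c \<bullet> (b \<bullet> (a' \<bullet> u) - (a' \<bullet> b) \<bullet> u))
      = a' \<bullet> (x \<bullet> (c \<bullet> (b \<bullet> (a \<bullet> u) - (a \<bullet> b) \<bullet> u))) - (x \<bullet> a') \<bullet> (c \<bullet> (b \<bullet> (a \<bullet> u) - (a \<bullet> b) \<bullet> u))"
    if *: "a \<in> jS i" "c \<in> jS i" "a' \<in> jS i"
  proof -
    obtain p q r where p: "a = pclass p" "c = pclass q" "a' = pclass r"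
      "jvars p \<subseteq> pletters i" "jvars q \<subseteq> pletters i" "jvars r \<subseteq> pletters i"
      using * unfolding jS_pj_def by blast
    obtain x' where x': "x = pclass x'" by (rule pclass_cases)
    obtain b' where b': "b = pclass b'" by (rule pclass_cases)
    obtain u' where u': "u = pclass u'" by (rule pclass_cases)
    note x = x' b' u'
    have "pclass (twtri x' b' p q r u') = pclass JZero"
      unfolding pclass_eq_iff by (rule peq_rel [OF prel_exchange [OF p(4-6)]])
    then have "pclass (twtri x' b' p q r u') = 0" by (simp only: pclass_simps)
    then have "app (wtri x b a c a') u = 0"
      using tev_twtri [of "\<lambda>v. pclass (JVar v)" x' b' p q r u'] by (simp only: tev_pclass p x)
    then show ?thesis by (simp add: wtri_def PP_def jmul_diff_right algebra_simps)
  qed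
qed
end

lemma pclass_in_jS: "jvars p \<subseteq> pletters i \<Longrightarrow> pclass p \<in> jS i"
  by (auto simp: jS_pj_def)

text \<open>The presentation for the theorem itself. \<open>VarZ\<close> belongs to neither set of
  letters, so Z stays free.\<close>

instantiation jvar :: presented_pair
begin
definition pletters_jvar :: "bool \<Rightarrow> jvar set" where "pletters_jvar i = (if i then range VarX else range VarY)"
definition prel_jvar :: "jvar jterm \<Rightarrow> jvar jterm \<Rightarrow> bool" where
  "prel_jvar s t \<longleftrightarrow> (\<exists>i p q u. jvars p \<subseteq> pletters i \<and> jvars q \<subseteq> pletters i \<and>
       s = JMult p (JMult q u) \<and> t = JMult q (JMult p u))
     \<or> (\<exists>i a a' x y z u. jvars x \<subseteq> pletters i \<and> jvars y \<subseteq> pletters i \<and> jvars z \<subseteq> pletters i \<and>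
       s = twtri a a' x y z u \<and> t = JZero)"
instance
proof
  show "prel (JMult p (JMult q u)) (JMult q (JMult p u))"
    if "jvars p \<subseteq> pletters i" "jvars q \<subseteq> pletters i" for p q u :: "jvar jterm" and i
    unfolding prel_jvar_def using that by (intro disjI1) blast
  show "prel (twtri a a' x y z u) JZero"
    if "jvars x \<subseteq> pletters i" "jvars y \<subseteq> pletters i" "jvars z \<subseteq> pletters i" for a a' x y z u :: "jvar jterm" and i
    unfolding prel_jvar_def using that by (intro disjI2) blast
qed
end

text \<open>The unitization of a JB-algebra satisfies this presentation: the commutation relations
  because operator commutants are subalgebras, the exchange relations by the vanishing of
  \<open>rwtri\<close>. Z may take any value there, in particular the unit.\<close>

lemma (in jb_algebra) unitization_eval_peq:
  fixes h :: "jvar \<Rightarrow> real \<times> 'a"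
  assumes x: "operator_commuting_tuple J n x" and y: "operator_commuting_tuple J m y"
    and h: "\<And>v. h v \<in> carrier (unitization J)"
    and hX: "\<And>i. h (VarX i) \<in> UNIV \<times> jspan (x ` {1..n})" and hY: "\<And>i. h (VarY i) \<in> UNIV \<times> jspan (y ` {1..m})"
    and st: "peq s t"
  shows "jterm_eval (unitization J) h s = jterm_eval (unitization J) h t"
proof -
  interpret U: unital_jordan_algebra "unitization J" by (rule unitization_unital_jordan_algebra)
  define S where "S i = (if i then x ` {1..n} else y ` {1..m})" for i
  have S: "S i \<subseteq> carrier J" "\<And>s t. s \<in> S i \<Longrightarrow> t \<in> S i \<Longrightarrow> operator_commute J s t" for i
    using x y by (auto simp: S_def operator_commuting_tuple_def split: if_splits)
  have span: "jterm_eval (unitization J) h p \<in> UNIV \<times> jspan (S i)" if "jvars p \<subseteq> pletters i" for p i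
    by (rule eval_jspan [OF S(1) that]) (use hX hY in \<open>auto simp: S_def pletters_jvar_def split: if_splits\<close>)
  have cl: "jterm_eval (unitization J) h p \<in> carrier (unitization J)" for p
    by (rule U.jterm_eval_closed) (rule h)
  have rel: "jterm_eval (unitization J) h s = jterm_eval (unitization J) h t" if st: "prel s t" for s t
  proof -
    from st [unfolded prel_jvar_def] show ?thesis
    proof (elim disjE exE conjE)
      fix i p q u assume 1: "jvars p \<subseteq> pletters i" "jvars q \<subseteq> pletters i"
        "s = JMult p (JMult q u)" "t = JMult q (JMult p u)"
      then show ?thesis
        using unitization_jspan_commute [OF S span [OF 1(1)] span [OF 1(2)]] cl [of u]
        by (simp add: operator_commute_def del: unitization_simps)
    next
      fix i a a' x y z u assume 2: "jvars x \<subseteq> pletters i" "jvars y \<subseteq> pletters i" "jvars z \<subseteq> pletters i"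
        "s = twtri a a' x y z u" "t = JZero"
      show ?thesis
        using unitization_rwtri_zero [OF S span [OF 2(1)] span [OF 2(2)] span [OF 2(3)] cl cl cl]
        by (simp add: 2 eval_twtri del: unitization_simps)
    qed
  qed
  show ?thesis by (rule U.jterm_eval_peq [OF st h rel])
qed

section \<open>Operators on finite-dimensional Hilbert spaces\<close>

text \<open>All axioms are pulled back along the injection E into an associative algebra.\<close>

lemma special_jordan_algebraI:
  fixes A (structure) and E :: "'a \<Rightarrow> 'r::real_algebra"
  assumes cl: "\<zero> \<in> carrier A" "\<And>x y. x \<in> carrier A \<Longrightarrow> y \<in> carrier A \<Longrightarrow> x \<oplus> y \<in> carrier A"
      "\<And>(r::real) x. x \<in> carrier A \<Longrightarrow> r \<odot> x \<in> carrier A"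
      "\<And>x y. x \<in> carrier A \<Longrightarrow> y \<in> carrier A \<Longrightarrow> x \<otimes> y \<in> carrier A"
    and inj: "inj_on E (carrier A)" and E0: "E \<zero> = 0"
    and Ea: "\<And>x y. x \<in> carrier A \<Longrightarrow> y \<in> carrier A \<Longrightarrow> E (x \<oplus> y) = E x + E y"
    and Es: "\<And>r x. x \<in> carrier A \<Longrightarrow> E (r \<odot> x) = r *\<^sub>R E x"
    and Em: "\<And>x y. x \<in> carrier A \<Longrightarrow> y \<in> carrier A \<Longrightarrow> E (x \<otimes> y) = (1/2) *\<^sub>R (E x * E y + E y * E x)"
  shows "jordan_algebra A"
proof -
  note simps = E0 Ea Es Em cl
  have ag: "abelian_group A"
  proof (rule abelian_groupI)
    fix x assume "x \<in> carrier A"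
    then show "\<exists>y\<in>carrier A. y \<oplus> x = \<zero>"
      by (intro bexI [of _ "(- 1) \<odot> x"]) (auto intro!: inj_onD [OF inj] simp: simps)
  qed (auto intro!: inj_onD [OF inj] simp: simps)
  interpret real_comm_algebra A
    by (rule real_comm_algebraI [OF ag])
      (auto intro!: inj_onD [OF inj] simp: simps algebra_simps)
  show ?thesis
    by unfold_locales (rule inj_onD [OF inj]; simp add: simps algebra_simps)
qed

lemma special_commute:
  fixes A (structure) and E :: "'a \<Rightarrow> 'r::real_algebra"
  assumes "inj_on E (carrier A)" "\<And>x y. x \<in> carrier A \<Longrightarrow> y \<in> carrier A \<Longrightarrow> x \<otimes> y \<in> carrier A"
    and "\<And>x y. x \<in> carrier A \<Longrightarrow> y \<in> carrier A \<Longrightarrow> E (x \<otimes> y) = (1/2) *\<^sub>R (E x * E y + E y * E x)"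
    and x: "x \<in> carrier A" "y \<in> carrier A" and xy: "E x * E y = E y * E x"
  shows "operator_commute A x y"
  unfolding operator_commute_def
proof
  fix z assume z: "z \<in> carrier A"
  have l: "E x * (E y * w) = E y * (E x * w)" for w using xy by (metis mult.assoc)
  show "x \<otimes> (y \<otimes> z) = y \<otimes> (x \<otimes> z)"
    by (rule inj_onD [OF assms(1)]) (simp_all add: assms(2,3) x z algebra_simps xy l)
qed

section \<open>The Hilbert space of functions supported on a finite set\<close>

definition fin_hilbert :: "'a set \<Rightarrow> ('a \<Rightarrow> complex) hilbert" where
  "fin_hilbert S = \<lparr>carrier = {f. \<forall>s. s \<notin> S \<longrightarrow> f s = 0}, monoid.mult = (\<lambda>f g. f), one = (\<lambda>s. 0),
     zero = (\<lambda>s. 0), add = (\<lambda>f g s. f s + g s), smult = (\<lambda>c f s. c * f s),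
     inprod = (\<lambda>f g. \<Sum>s\<in>S. f s * cnj (g s))\<rparr>"

context
  fixes S :: "'a set"
  assumes fin: "finite S"
begin

abbreviation "HH \<equiv> fin_hilbert S"
abbreviation "BB \<equiv> bounded_selfadjoint_ops HH"

lemma HH_simps [simp]:
  "carrier HH = {f. \<forall>s. s \<notin> S \<longrightarrow> f s = 0}" "\<zero>\<^bsub>HH\<^esub> = (\<lambda>s. 0)" "f \<oplus>\<^bsub>HH\<^esub> g = (\<lambda>s. f s + g s)"
  "c \<odot>\<^bsub>HH\<^esub> f = (\<lambda>s. c * f s)" "inprod HH f g = (\<Sum>s\<in>S. f s * cnj (g s))"
  by (simp_all add: fin_hilbert_def)

lemma inprod_self: "inprod HH f f = complex_of_real (\<Sum>s\<in>S. (cmod (f s))\<^sup>2)"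
  by (simp add: complex_norm_square flip: of_real_power)

lemma hnorm_HH: "hnorm HH f = L2_set (\<lambda>s. cmod (f s)) S"
  unfolding hnorm_def inprod_self by (simp add: L2_set_def)

lemma module_HH: "Module.module (field_ring :: complex ring) HH"
proof (rule moduleI)
  show "cring (field_ring :: complex ring)" by (rule cring_field_ring)
  show "abelian_group HH"
  proof (rule abelian_groupI)
    fix x assume "x \<in> carrier HH"
    then show "\<exists>y\<in>carrier HH. y \<oplus>\<^bsub>HH\<^esub> x = \<zero>\<^bsub>HH\<^esub>" by (intro bexI [of _ "\<lambda>s. - x s"]) auto
  qed (auto simp: algebra_simps)
qed (auto simp: algebra_simps)

interpretation HM: Module.module "field_ring :: complex ring" HH
  by (rule module_HH)

lemma HH_minus: "f \<in> carrier HH \<Longrightarrow> g \<in> carrier HH \<Longrightarrow> f \<ominus>\<^bsub>HH\<^esub> g = (\<lambda>s. f s - g s)"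
  using HM.M.minus_equality [of "\<lambda>s. - g s" g] by (simp add: a_minus_def)

lemma cmod_le_L2: "s \<in> S \<Longrightarrow> cmod (f s) \<le> L2_set (\<lambda>s. cmod (f s)) S"
  by (rule member_le_L2_set [OF fin]) auto

lemma hilbert_space_HH: "hilbert_space HH"
proof (intro hilbert_space.intro hilbert_space_axioms.intro module_HH)
  show "inprod HH u v = cnj (inprod HH v u)" for u v by (simp add: mult.commute)
  show "0 \<le> Re (inprod HH u u)" for u unfolding inprod_self by (simp add: sum_nonneg)
  show "(inprod HH u u = 0) = (u = \<zero>\<^bsub>HH\<^esub>)" if "u \<in> carrier HH" for u
    using that unfolding inprod_self of_real_eq_0_iff by (auto simp: sum_nonneg_eq_0_iff fin fun_eq_iff)
next
  fix s :: "nat \<Rightarrow> 'a \<Rightarrow> complex"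
  assume s: "\<And>k. s k \<in> carrier HH" and C: "\<And>e. e > 0 \<Longrightarrow> \<exists>N. \<forall>k\<ge>N. \<forall>l\<ge>N. hnorm HH (s k \<ominus>\<^bsub>HH\<^esub> s l) < e"
  have "Cauchy (\<lambda>k. s k x)" if x: "x \<in> S" for x
  proof (rule CauchyI)
    fix e :: real assume "0 < e"
    then obtain N where "\<forall>k\<ge>N. \<forall>l\<ge>N. hnorm HH (s k \<ominus>\<^bsub>HH\<^esub> s l) < e" using C by blast
    then show "\<exists>M. \<forall>m\<ge>M. \<forall>n\<ge>M. norm (s m x - s n x) < e"
      using cmod_le_L2 [OF x] by (intro exI [of _ N]) (simp add: hnorm_HH HH_minus [OF s s], meson le_less_trans)
  qed
  then have "\<forall>x\<in>S. \<exists>l. (\<lambda>k. s k x) \<longlonglongrightarrow> l" by (simp add: Cauchy_convergent_iff convergent_def)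
  then obtain l where l: "\<And>x. x \<in> S \<Longrightarrow> (\<lambda>k. s k x) \<longlonglongrightarrow> l x" by metis
  define u where "u x = (if x \<in> S then l x else 0)" for x
  have u: "u \<in> carrier HH" by (simp add: u_def)
  have "(\<lambda>k. L2_set (\<lambda>x. cmod (s k x - u x)) S) \<longlonglongrightarrow> L2_set (\<lambda>x. 0) S"
    unfolding L2_set_def
    by (intro tendsto_real_sqrt tendsto_sum tendsto_power)
      (use l in \<open>simp add: u_def tendsto_norm_zero LIM_zero\<close>)
  then show "\<exists>u\<in>carrier HH. (\<lambda>k. hnorm HH (s k \<ominus>\<^bsub>HH\<^esub> u)) \<longlonglongrightarrow> 0"
    using u by (intro bexI [of _ u]) (simp_all add: hnorm_HH HH_minus [OF s u] L2_set_0')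
qed (auto simp: algebra_simps sum.distrib sum_distrib_left)

lemma hnorm_nonneg: "0 \<le> hnorm HH f"
  by (simp add: hnorm_HH)

lemma hnorm_add: "hnorm HH (\<lambda>s. f s + g s) \<le> hnorm HH f + hnorm HH g"
  unfolding hnorm_HH
  by (rule order_trans [OF _ L2_set_triangle_ineq]) (intro L2_set_mono norm_triangle_ineq, simp)

lemma hnorm_smult: "hnorm HH (\<lambda>s. c * f s) = cmod c * hnorm HH f"
  by (simp add: hnorm_HH norm_mult L2_set_right_distrib)

lemma hnorm_eq_0: "f \<in> carrier HH \<Longrightarrow> hnorm HH f = 0 \<longleftrightarrow> f = (\<lambda>s. 0)"
  by (auto simp: hnorm_HH L2_set_eq_0_iff fin fun_eq_iff)

lemma hnorm_square: "(hnorm HH f)\<^sup>2 = Re (inprod HH f f)"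
  unfolding inprod_self by (simp add: hnorm_HH L2_set_def sum_nonneg)

lemma inprod_bound: "cmod (inprod HH f g) \<le> hnorm HH f * hnorm HH g"
proof -
  have "cmod (inprod HH f g) \<le> (\<Sum>s\<in>S. cmod (f s) * cmod (g s))"
    by (simp, rule order_trans [OF norm_sum]) (simp add: norm_mult)
  also have "\<dots> \<le> hnorm HH f * hnorm HH g"
    using L2_set_mult_ineq [of "\<lambda>s. cmod (f s)" "\<lambda>s. cmod (g s)" S] by (simp add: hnorm_HH)
  finally show ?thesis .
qed

lemma BB_simps [simp]:
  "monoid.mult BB = (\<lambda>S T. \<lambda>u\<in>carrier HH. \<lambda>s. (1/2) * (S (T u) s + T (S u) s))"
  "\<one>\<^bsub>BB\<^esub> = (\<lambda>u\<in>carrier HH. u)" "\<zero>\<^bsub>BB\<^esub> = (\<lambda>u\<in>carrier HH. \<lambda>s. 0)"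
  "add BB = (\<lambda>S T. \<lambda>u\<in>carrier HH. \<lambda>s. S u s + T u s)"
  "smult BB = (\<lambda>r T. \<lambda>u\<in>carrier HH. \<lambda>s. complex_of_real r * T u s)"
  "nrm BB = (\<lambda>T. SUP u\<in>{u \<in> carrier HH. hnorm HH u \<le> 1}. hnorm HH (T u))"
  by (simp_all add: bounded_selfadjoint_ops_def)

definition pointv :: "'a \<Rightarrow> 'a \<Rightarrow> complex" where "pointv t s = (if s = t then 1 else 0)"

definition linop :: "(('a \<Rightarrow> complex) \<Rightarrow> ('a \<Rightarrow> complex)) \<Rightarrow> bool" where
  "linop T \<longleftrightarrow> T \<in> carrier HH \<rightarrow>\<^sub>E carrier HH \<and>
     (\<forall>u\<in>carrier HH. \<forall>v\<in>carrier HH. T (\<lambda>s. u s + v s) = (\<lambda>s. T u s + T v s)) \<and>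
     (\<forall>c. \<forall>u\<in>carrier HH. T (\<lambda>s. c * u s) = (\<lambda>s. c * T u s))"

lemma linop_add: "\<lbrakk>linop T; u \<in> carrier HH; v \<in> carrier HH\<rbrakk> \<Longrightarrow> T (\<lambda>s. u s + v s) = (\<lambda>s. T u s + T v s)"
  unfolding linop_def by (drule conjunct2, drule conjunct1, drule (1) bspec, drule (1) bspec)

lemma linop_smult: "\<lbrakk>linop T; u \<in> carrier HH\<rbrakk> \<Longrightarrow> T (\<lambda>s. c * u s) = (\<lambda>s. c * T u s)"
  unfolding linop_def by (drule conjunct2, drule conjunct2, drule spec, drule (1) bspec)

lemma linop_expand:
  assumes T: "linop T" and u: "u \<in> carrier HH"
  shows "T u = (\<lambda>s. \<Sum>t\<in>S. u t * T (pointv t) s)"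
proof -
  have p: "pointv t \<in> carrier HH" if "t \<in> S" for t using that by (auto simp: pointv_def)
  have F: "(\<lambda>s. \<Sum>t\<in>F. u t * pointv t s) \<in> carrier HH \<and>
      T (\<lambda>s. \<Sum>t\<in>F. u t * pointv t s) = (\<lambda>s. \<Sum>t\<in>F. u t * T (pointv t) s)" if "F \<subseteq> S" for F
    using finite_subset [OF that fin] that
  proof (induction F rule: finite_induct)
    case empty
    have "T (\<lambda>s. 0 * (\<lambda>s. 0) s) = (\<lambda>s. 0 * T (\<lambda>s. 0) s)"
      by (rule linop_smult [OF T]) simp
    then show ?case by simp
  next
    case (insert t F)
    let ?F = "\<lambda>s. \<Sum>t\<in>F. u t * pointv t s" and ?t = "\<lambda>s. u t * pointv t s"
    have t: "pointv t \<in> carrier HH" "?t \<in> carrier HH" using p insert by auto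
    have "T (\<lambda>s. ?t s + ?F s) = (\<lambda>s. T ?t s + T ?F s)"
      by (rule linop_add [OF T t(2)]) (use insert in blast)
    moreover have "T ?t = (\<lambda>s. u t * T (pointv t) s)" by (rule linop_smult [OF T t(1)])
    ultimately show ?case using insert t by (simp add: fun_eq_iff)
  qed
  have "u = (\<lambda>s. \<Sum>t\<in>S. u t * pointv t s)"
  proof
    fix s show "u s = (\<Sum>t\<in>S. u t * pointv t s)"
      using u fin by (cases "s \<in> S") (simp_all add: pointv_def if_distrib cong: if_cong)
  qed
  then show ?thesis using F [of S] by simp
qed

lemma linop_bound:
  assumes T: "linop T" and u: "u \<in> carrier HH"
  shows "hnorm HH (T u) \<le> (\<Sum>t\<in>S. hnorm HH (T (pointv t))) * hnorm HH u"
proof -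
  have "hnorm HH (\<lambda>s. \<Sum>t\<in>F. u t * T (pointv t) s) \<le> (\<Sum>t\<in>F. cmod (u t) * hnorm HH (T (pointv t)))" if "finite F" for F
    using that
  proof induction
    case empty
    then show ?case by (simp add: hnorm_HH L2_set_0')
  next
    case (insert t F)
    then show ?case
      using hnorm_add [of "\<lambda>s. u t * T (pointv t) s" "\<lambda>s. \<Sum>t\<in>F. u t * T (pointv t) s"] by (simp add: hnorm_smult)
  qed
  from this [OF fin] have "hnorm HH (T u) \<le> (\<Sum>t\<in>S. cmod (u t) * hnorm HH (T (pointv t)))"
    by (simp flip: linop_expand [OF assms])
  also have "\<dots> \<le> (\<Sum>t\<in>S. hnorm HH u * hnorm HH (T (pointv t)))"
    by (intro sum_mono mult_right_mono hnorm_nonneg) (simp add: hnorm_HH cmod_le_L2)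
  finally show ?thesis by (simp add: sum_distrib_left mult.commute)
qed

definition selfadj :: "(('a \<Rightarrow> complex) \<Rightarrow> ('a \<Rightarrow> complex)) \<Rightarrow> bool" where
  "selfadj T \<longleftrightarrow> (\<forall>u\<in>carrier HH. \<forall>v\<in>carrier HH. inprod HH (T u) v = inprod HH u (T v))"

lemma BB_carrier: "carrier BB = {T. linop T \<and> selfadj T}"
proof -
  have "\<exists>C. \<forall>u\<in>carrier HH. hnorm HH (T u) \<le> C * hnorm HH u" if "linop T" for T
    using linop_bound [OF that] by blast
  then show ?thesis
    unfolding bounded_selfadjoint_ops_def linop_def selfadj_def by (simp del: HH_simps(1,5)) blast
qed

lemma BB_closed_in: "T \<in> carrier BB \<Longrightarrow> u \<in> carrier HH \<Longrightarrow> T u \<in> carrier HH"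
  unfolding BB_carrier linop_def by (simp del: HH_simps) blast

lemma BB_add: "T \<in> carrier BB \<Longrightarrow> u \<in> carrier HH \<Longrightarrow> v \<in> carrier HH \<Longrightarrow> T (\<lambda>s. u s + v s) = (\<lambda>s. T u s + T v s)"
  and BB_smult: "T \<in> carrier BB \<Longrightarrow> u \<in> carrier HH \<Longrightarrow> T (\<lambda>s. c * u s) = (\<lambda>s. c * T u s)"
  and BB_selfadj: "T \<in> carrier BB \<Longrightarrow> u \<in> carrier HH \<Longrightarrow> v \<in> carrier HH \<Longrightarrow> inprod HH (T u) v = inprod HH u (T v)"
  and BB_ext: "T \<in> carrier BB \<Longrightarrow> T \<in> extensional (carrier HH)"
proof -
  show "T \<in> carrier BB \<Longrightarrow> u \<in> carrier HH \<Longrightarrow> v \<in> carrier HH \<Longrightarrow> T (\<lambda>s. u s + v s) = (\<lambda>s. T u s + T v s)"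
    "T \<in> carrier BB \<Longrightarrow> u \<in> carrier HH \<Longrightarrow> T (\<lambda>s. c * u s) = (\<lambda>s. c * T u s)"
    unfolding BB_carrier by (blast intro: linop_add linop_smult)+
  show "T \<in> carrier BB \<Longrightarrow> u \<in> carrier HH \<Longrightarrow> v \<in> carrier HH \<Longrightarrow> inprod HH (T u) v = inprod HH u (T v)"
    unfolding BB_carrier selfadj_def by blast
  show "T \<in> carrier BB \<Longrightarrow> T \<in> extensional (carrier HH)"
    unfolding BB_carrier linop_def PiE_def by blast
qed

lemma HH_closed: "u \<in> carrier HH \<Longrightarrow> v \<in> carrier HH \<Longrightarrow> (\<lambda>s. u s + v s) \<in> carrier HH"
  "u \<in> carrier HH \<Longrightarrow> (\<lambda>s. c * u s) \<in> carrier HH" "(\<lambda>s. 0) \<in> carrier HH"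
  by auto

lemma inprod_simps:
  "inprod HH (\<lambda>s. u s + v s) w = inprod HH u w + inprod HH v w"
  "inprod HH w (\<lambda>s. u s + v s) = inprod HH w u + inprod HH w v"
  "inprod HH (\<lambda>s. c * u s) w = c * inprod HH u w" "inprod HH w (\<lambda>s. c * u s) = cnj c * inprod HH w u"
  by (simp_all add: algebra_simps sum.distrib sum_distrib_left)

lemma BBI:
  assumes "T \<in> extensional (carrier HH)" "\<And>u. u \<in> carrier HH \<Longrightarrow> T u \<in> carrier HH"
    "\<And>u v. \<lbrakk>u \<in> carrier HH; v \<in> carrier HH\<rbrakk> \<Longrightarrow> T (\<lambda>s. u s + v s) = (\<lambda>s. T u s + T v s)"
    "\<And>c u. u \<in> carrier HH \<Longrightarrow> T (\<lambda>s. c * u s) = (\<lambda>s. c * T u s)"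
    "\<And>u v. \<lbrakk>u \<in> carrier HH; v \<in> carrier HH\<rbrakk> \<Longrightarrow> inprod HH (T u) v = inprod HH u (T v)"
  shows "T \<in> carrier BB"
  unfolding BB_carrier linop_def selfadj_def mem_Collect_eq using assms
  by (intro conjI ballI allI PiE_I) (auto simp: extensional_def simp del: HH_simps)

lemma BB_closed:
  "\<zero>\<^bsub>BB\<^esub> \<in> carrier BB" "\<one>\<^bsub>BB\<^esub> \<in> carrier BB"
  "X \<in> carrier BB \<Longrightarrow> Y \<in> carrier BB \<Longrightarrow> X \<oplus>\<^bsub>BB\<^esub> Y \<in> carrier BB"
  "X \<in> carrier BB \<Longrightarrow> r \<odot>\<^bsub>BB\<^esub> X \<in> carrier BB"
  "X \<in> carrier BB \<Longrightarrow> Y \<in> carrier BB \<Longrightarrow> X \<otimes>\<^bsub>BB\<^esub> Y \<in> carrier BB"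
proof -
  note cl = HH_closed BB_closed_in
  show "\<zero>\<^bsub>BB\<^esub> \<in> carrier BB" "\<one>\<^bsub>BB\<^esub> \<in> carrier BB"
    by (rule BBI; simp add: HH_closed del: HH_simps(1,5); simp)+
  show "X \<oplus>\<^bsub>BB\<^esub> Y \<in> carrier BB" if "X \<in> carrier BB" "Y \<in> carrier BB"
    by (rule BBI; simp add: cl that BB_add BB_smult inprod_simps BB_selfadj del: HH_simps(1,5))
      (simp_all add: fun_eq_iff algebra_simps)
  show "r \<odot>\<^bsub>BB\<^esub> X \<in> carrier BB" if "X \<in> carrier BB"
    by (rule BBI; simp add: cl that BB_add BB_smult inprod_simps BB_selfadj del: HH_simps(1,5))
      (simp_all add: fun_eq_iff algebra_simps)
  show "X \<otimes>\<^bsub>BB\<^esub> Y \<in> carrier BB" if "X \<in> carrier BB" "Y \<in> carrier BB"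
  proof (rule BBI)
    fix u v assume uv: "u \<in> carrier HH" "v \<in> carrier HH"
    have "inprod HH (\<lambda>s. (1/2) * (X (Y u) s + Y (X u) s)) v = inprod HH u (\<lambda>s. (1/2) * (X (Y v) s + Y (X v) s))"
      unfolding inprod_simps using that uv by (simp add: BB_selfadj cl del: HH_simps)
    then show "inprod HH ((X \<otimes>\<^bsub>BB\<^esub> Y) u) v = inprod HH u ((X \<otimes>\<^bsub>BB\<^esub> Y) v)" using uv by (simp del: HH_simps)
    show "(X \<otimes>\<^bsub>BB\<^esub> Y) (\<lambda>s. u s + v s) = (\<lambda>s. (X \<otimes>\<^bsub>BB\<^esub> Y) u s + (X \<otimes>\<^bsub>BB\<^esub> Y) v s)"
      using uv that by (simp add: cl BB_add del: HH_simps) (simp add: fun_eq_iff field_simps)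
  next
    fix u c assume u: "u \<in> carrier HH"
    have "(\<lambda>s. (1/2) * (X (Y u) s + Y (X u) s)) \<in> carrier HH"
      by (rule HH_closed(2) [OF HH_closed(1) [OF BB_closed_in [OF that(1) BB_closed_in [OF that(2) u]]
            BB_closed_in [OF that(2) BB_closed_in [OF that(1) u]]]])
    then show "(X \<otimes>\<^bsub>BB\<^esub> Y) u \<in> carrier HH" using u by (simp only: BB_simps restrict_apply if_True)
    show "(X \<otimes>\<^bsub>BB\<^esub> Y) (\<lambda>s. c * u s) = (\<lambda>s. c * (X \<otimes>\<^bsub>BB\<^esub> Y) u s)"
      using u that by (simp add: cl BB_smult del: HH_simps) (simp add: fun_eq_iff algebra_simps)
  qed (simp del: HH_simps)
qed

definition restr :: "('a \<Rightarrow> complex) \<Rightarrow> 'a \<Rightarrow> complex" where "restr f = (\<lambda>s. if s \<in> S then f s else 0)"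

text \<open>Cutting functions off outside S extends T to all functions, so that operators become
  elements of the associative algebra \<open>endo\<close>.\<close>

definition opE :: "(('a \<Rightarrow> complex) \<Rightarrow> ('a \<Rightarrow> complex)) \<Rightarrow> ('a \<Rightarrow> complex) endo" where
  "opE T = Endo (\<lambda>f. T (restr f))"

lemma restr_closed: "restr f \<in> carrier HH"
  by (simp add: restr_def)

lemma restr_id: "f \<in> carrier HH \<Longrightarrow> restr f = f"
  by (auto simp: restr_def fun_eq_iff)

lemma app_opE: "T \<in> carrier BB \<Longrightarrow> app (opE T) f = T (restr f)"
proof -
  assume T: "T \<in> carrier BB"
  have "linear (\<lambda>f. T (restr f))"
  proof (rule linearI)
    fix f g r
    have "restr (f + g) = (\<lambda>s. restr f s + restr g s)" by (auto simp: restr_def fun_eq_iff)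
    then show "T (restr (f + g)) = T (restr f) + T (restr g)"
      using T by (simp add: BB_add restr_closed plus_fun_def del: HH_simps)
    have "restr (r *\<^sub>R f) = (\<lambda>s. complex_of_real r * restr f s)"
      by (auto simp: restr_def fun_eq_iff scaleR_fun_def scaleR_conv_of_real)
    then show "T (restr (r *\<^sub>R f)) = r *\<^sub>R T (restr f)"
      using T by (simp add: BB_smult restr_closed scaleR_fun_def scaleR_conv_of_real del: HH_simps)
  qed
  then show ?thesis by (simp add: opE_def app_Endo)
qed

lemma opE_inj: "inj_on opE (carrier BB)"
proof (rule inj_onI)
  fix X Y assume XY: "X \<in> carrier BB" "Y \<in> carrier BB" "opE X = opE Y"
  show "X = Y"
  proof (rule extensionalityI [OF BB_ext [OF XY(1)] BB_ext [OF XY(2)]])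
    fix u assume u: "u \<in> carrier HH"
    show "X u = Y u" using app_opE [OF XY(1), of u] app_opE [OF XY(2), of u] XY(3) restr_id [OF u] by simp
  qed
qed

lemma opE_hom:
  "opE \<zero>\<^bsub>BB\<^esub> = 0"
  "X \<in> carrier BB \<Longrightarrow> Y \<in> carrier BB \<Longrightarrow> opE (X \<oplus>\<^bsub>BB\<^esub> Y) = opE X + opE Y"
  "X \<in> carrier BB \<Longrightarrow> opE (r \<odot>\<^bsub>BB\<^esub> X) = r *\<^sub>R opE X"
  "X \<in> carrier BB \<Longrightarrow> Y \<in> carrier BB \<Longrightarrow> opE (X \<otimes>\<^bsub>BB\<^esub> Y) = (1/2) *\<^sub>R (opE X * opE Y + opE Y * opE X)"
proof -
  note cl = BB_closed restr_closed BB_closed_in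
  show "opE \<zero>\<^bsub>BB\<^esub> = 0"
    by (rule endo_eqI, subst app_opE [OF BB_closed(1)]) (simp add: restr_closed zero_fun_def del: HH_simps)
  show "opE (X \<oplus>\<^bsub>BB\<^esub> Y) = opE X + opE Y" if "X \<in> carrier BB" "Y \<in> carrier BB"
    by (rule endo_eqI, subst app_opE [OF BB_closed(3) [OF that]])
      (simp add: restr_closed plus_fun_def app_opE that del: HH_simps)
  show "opE (r \<odot>\<^bsub>BB\<^esub> X) = r *\<^sub>R opE X" if "X \<in> carrier BB"
    by (rule endo_eqI, subst app_opE [OF BB_closed(4) [OF that]])
      (simp add: restr_closed scaleR_fun_def scaleR_conv_of_real app_opE that del: HH_simps)
  show "opE (X \<otimes>\<^bsub>BB\<^esub> Y) = (1/2) *\<^sub>R (opE X * opE Y + opE Y * opE X)" if "X \<in> carrier BB" "Y \<in> carrier BB"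
    by (rule endo_eqI, subst app_opE [OF BB_closed(5) [OF that]])
      (simp add: restr_closed restr_id BB_closed_in scaleR_fun_def scaleR_conv_of_real plus_fun_def app_opE that del: HH_simps)
qed

section \<open>The operator norm and the JB axioms for self-adjoint operators\<close>

abbreviation "opnorm \<equiv> nrm BB"

lemma opnorm_bdd:
  assumes "T \<in> carrier BB"
  shows "bdd_above ((\<lambda>u. hnorm HH (T u)) ` {u \<in> carrier HH. hnorm HH u \<le> 1})"
proof (rule bdd_aboveI2)
  fix u assume u: "u \<in> {u \<in> carrier HH. hnorm HH u \<le> 1}"
  have "hnorm HH (T u) \<le> (\<Sum>t\<in>S. hnorm HH (T (pointv t))) * hnorm HH u"
    using assms u by (intro linop_bound) (auto simp: BB_carrier)
  also have "\<dots> \<le> (\<Sum>t\<in>S. hnorm HH (T (pointv t))) * 1"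
    using u by (intro mult_left_mono sum_nonneg hnorm_nonneg) auto
  finally show "hnorm HH (T u) \<le> (\<Sum>t\<in>S. hnorm HH (T (pointv t)))" by simp
qed

lemma opnorm_le:
  assumes "\<And>u. u \<in> carrier HH \<Longrightarrow> hnorm HH u \<le> 1 \<Longrightarrow> hnorm HH (T u) \<le> C"
  shows "opnorm T \<le> C"
proof -
  have "(\<lambda>s. 0) \<in> {u \<in> carrier HH. hnorm HH u \<le> 1}" by (simp add: hnorm_HH L2_set_0')
  then show ?thesis unfolding BB_simps using assms by (intro cSUP_least) auto
qed

lemma opnorm_nonneg: "T \<in> carrier BB \<Longrightarrow> 0 \<le> opnorm T"
proof -
  assume T: "T \<in> carrier BB"
  have "(\<lambda>s. 0) \<in> {u \<in> carrier HH. hnorm HH u \<le> 1}" by (simp add: hnorm_HH L2_set_0')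
  from cSUP_upper [OF this opnorm_bdd [OF T]] show ?thesis
    using hnorm_nonneg [of "T (\<lambda>s. 0)"] by simp
qed

lemma opnorm_apply:
  assumes T: "T \<in> carrier BB" and u: "u \<in> carrier HH"
  shows "hnorm HH (T u) \<le> opnorm T * hnorm HH u"
proof (cases "hnorm HH u = 0")
  case True
  then have "u = (\<lambda>s. 0 * u s)" using hnorm_eq_0 [OF u] by simp
  then have "T u = (\<lambda>s. 0)" using BB_smult [OF T u, of 0] by simp
  then show ?thesis using True by (simp add: hnorm_HH L2_set_0' del: BB_simps)
next
  case False
  define r where "r = hnorm HH u"
  have r: "r > 0" using False hnorm_nonneg [of u] by (simp add: r_def)
  let ?v = "\<lambda>s. complex_of_real (1 / r) * u s"
  have "hnorm HH ?v = cmod (complex_of_real (1 / r)) * r" unfolding r_def by (rule hnorm_smult)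
  then have "hnorm HH ?v \<le> 1" using r by (simp add: norm_divide)
  moreover have "?v \<in> carrier HH" using u by simp
  ultimately have "hnorm HH (T ?v) \<le> opnorm T"
    unfolding BB_simps using opnorm_bdd [OF T] by (intro cSUP_upper2 [where x = ?v]) auto
  moreover have "hnorm HH (T ?v) = hnorm HH (T u) / r"
    unfolding BB_smult [OF T u] hnorm_smult using r by (simp add: norm_divide)
  ultimately show ?thesis using r by (simp add: r_def field_simps del: BB_simps)
qed

lemma opnorm_entries:
  assumes "T \<in> carrier BB"
  shows "opnorm T \<le> (\<Sum>t\<in>S. hnorm HH (T (pointv t)))"
proof (rule opnorm_le)
  fix u assume u: "u \<in> carrier HH" "hnorm HH u \<le> 1"
  have "hnorm HH (T u) \<le> (\<Sum>t\<in>S. hnorm HH (T (pointv t))) * hnorm HH u"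
    using assms u by (intro linop_bound) (auto simp: BB_carrier)
  also have "\<dots> \<le> (\<Sum>t\<in>S. hnorm HH (T (pointv t))) * 1"
    using u by (intro mult_left_mono sum_nonneg hnorm_nonneg) auto
  finally show "hnorm HH (T u) \<le> (\<Sum>t\<in>S. hnorm HH (T (pointv t)))" by simp
qed

lemma opnorm_add:
  assumes "X \<in> carrier BB" "Y \<in> carrier BB"
  shows "opnorm (X \<oplus>\<^bsub>BB\<^esub> Y) \<le> opnorm X + opnorm Y"
proof (rule opnorm_le)
  fix u assume u: "u \<in> carrier HH" "hnorm HH u \<le> 1"
  have "hnorm HH (X u) \<le> opnorm X * 1" "hnorm HH (Y u) \<le> opnorm Y * 1"
    using opnorm_apply [OF assms(1) u(1)] opnorm_apply [OF assms(2) u(1)] u(2) opnorm_nonneg assms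
    by (meson mult_left_mono order_trans)+
  then show "hnorm HH ((X \<oplus>\<^bsub>BB\<^esub> Y) u) \<le> opnorm X + opnorm Y"
    using hnorm_add [of "X u" "Y u"] u by (simp del: HH_simps BB_simps(6))
qed

lemma opnorm_smult_le:
  assumes "X \<in> carrier BB"
  shows "opnorm (r \<odot>\<^bsub>BB\<^esub> X) \<le> \<bar>r\<bar> * opnorm X"
proof (rule opnorm_le)
  fix u assume u: "u \<in> carrier HH" "hnorm HH u \<le> 1"
  have "hnorm HH (X u) \<le> opnorm X * 1"
    using opnorm_apply [OF assms u(1)] u(2) opnorm_nonneg assms by (meson mult_left_mono order_trans)
  then show "hnorm HH ((r \<odot>\<^bsub>BB\<^esub> X) u) \<le> \<bar>r\<bar> * opnorm X"
    using u by (simp add: hnorm_smult mult_left_mono del: HH_simps BB_simps(6))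
qed

lemma opnorm_smult:
  assumes X: "X \<in> carrier BB"
  shows "opnorm (r \<odot>\<^bsub>BB\<^esub> X) = \<bar>r\<bar> * opnorm X"
proof (cases "r = 0")
  case True
  then show ?thesis using opnorm_smult_le [OF X, of r] opnorm_nonneg [OF BB_closed(4) [OF X], of r] by simp
next
  case False
  have "(1 / r) \<odot>\<^bsub>BB\<^esub> (r \<odot>\<^bsub>BB\<^esub> X) = X"
    by (rule inj_onD [OF opE_inj]) (use X False in \<open>simp_all add: opE_hom BB_closed del: BB_simps\<close>)
  then have "opnorm X \<le> \<bar>1 / r\<bar> * opnorm (r \<odot>\<^bsub>BB\<^esub> X)"
    using opnorm_smult_le [OF BB_closed(4) [OF X], of "1 / r" r] by simp
  then show ?thesis using opnorm_smult_le [OF X, of r] False by (simp add: field_simps del: BB_simps)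
qed

lemma opnorm_eq_0:
  assumes X: "X \<in> carrier BB"
  shows "opnorm X = 0 \<longleftrightarrow> X = \<zero>\<^bsub>BB\<^esub>"
proof
  assume 0: "opnorm X = 0"
  show "X = \<zero>\<^bsub>BB\<^esub>"
  proof (rule extensionalityI [OF BB_ext [OF X] BB_ext [OF BB_closed(1)]])
    fix u assume u: "u \<in> carrier HH"
    have "hnorm HH (X u) = 0" using opnorm_apply [OF X u] 0 hnorm_nonneg [of "X u"] by (simp del: BB_simps)
    then show "X u = \<zero>\<^bsub>BB\<^esub> u" using hnorm_eq_0 [OF BB_closed_in [OF X u]] u by (simp del: HH_simps)
  qed
next
  assume "X = \<zero>\<^bsub>BB\<^esub>"
  then have "opnorm X \<le> 0"
    by (simp only:) (rule opnorm_le, simp add: hnorm_HH L2_set_0' del: BB_simps(6))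
  then show "opnorm X = 0" using opnorm_nonneg [OF X] by simp
qed

lemma opnorm_mult:
  assumes "X \<in> carrier BB" "Y \<in> carrier BB"
  shows "opnorm (X \<otimes>\<^bsub>BB\<^esub> Y) \<le> opnorm X * opnorm Y"
proof (rule opnorm_le)
  fix u assume u: "u \<in> carrier HH" "hnorm HH u \<le> 1"
  have *: "hnorm HH (X (Y u)) \<le> opnorm X * opnorm Y" if "X \<in> carrier BB" "Y \<in> carrier BB" for X Y
  proof -
    have "hnorm HH (X (Y u)) \<le> opnorm X * hnorm HH (Y u)"
      by (rule opnorm_apply [OF that(1) BB_closed_in [OF that(2) u(1)]])
    also have "\<dots> \<le> opnorm X * (opnorm Y * hnorm HH u)"
      by (rule mult_left_mono [OF opnorm_apply [OF that(2) u(1)] opnorm_nonneg [OF that(1)]])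
    also have "\<dots> \<le> opnorm X * (opnorm Y * 1)"
      by (rule mult_left_mono [OF mult_left_mono [OF u(2) opnorm_nonneg [OF that(2)]] opnorm_nonneg [OF that(1)]])
    finally show ?thesis by simp
  qed
  have "hnorm HH ((X \<otimes>\<^bsub>BB\<^esub> Y) u) = (1/2) * hnorm HH (\<lambda>s. X (Y u) s + Y (X u) s)"
    using u hnorm_smult [of "1/2" "\<lambda>s. X (Y u) s + Y (X u) s"] by (simp del: HH_simps)
  then show "hnorm HH ((X \<otimes>\<^bsub>BB\<^esub> Y) u) \<le> opnorm X * opnorm Y"
    using hnorm_add [of "X (Y u)" "Y (X u)"] * [OF assms] * [OF assms(2,1)] by (simp add: mult.commute del: BB_simps)
qed

text \<open>The inner product of \<open>(X^2 + Y^2) u\<close> with u is the sum of the squared norms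
  of \<open>X u\<close> and \<open>Y u\<close>. Taking Y = 0 also yields the equality for
  squares.\<close>

lemma opnorm_squares:
  assumes X: "X \<in> carrier BB" and Y: "Y \<in> carrier BB"
  shows "(opnorm X)\<^sup>2 \<le> opnorm (X \<otimes>\<^bsub>BB\<^esub> X \<oplus>\<^bsub>BB\<^esub> Y \<otimes>\<^bsub>BB\<^esub> Y)"
proof -
  let ?Q = "X \<otimes>\<^bsub>BB\<^esub> X \<oplus>\<^bsub>BB\<^esub> Y \<otimes>\<^bsub>BB\<^esub> Y"
  have Q: "?Q \<in> carrier BB" using X Y by (intro BB_closed)
  have "opnorm X \<le> sqrt (opnorm ?Q)"
  proof (rule opnorm_le)
    fix u assume u: "u \<in> carrier HH" "hnorm HH u \<le> 1"
    have Qu: "?Q u = (\<lambda>s. X (X u) s + Y (Y u) s)" using u by (simp del: HH_simps)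
    have "(hnorm HH (X u))\<^sup>2 + (hnorm HH (Y u))\<^sup>2 = Re (inprod HH (?Q u) u)"
      unfolding hnorm_square Qu inprod_simps
      using BB_selfadj [OF X BB_closed_in [OF X u(1)] u(1)] BB_selfadj [OF Y BB_closed_in [OF Y u(1)] u(1)]
      by (simp del: HH_simps)
    also have "\<dots> \<le> cmod (inprod HH (?Q u) u)" by (rule complex_Re_le_cmod)
    also have "\<dots> \<le> hnorm HH (?Q u) * hnorm HH u" by (rule inprod_bound)
    also have "\<dots> \<le> (opnorm ?Q * hnorm HH u) * hnorm HH u"
      by (rule mult_right_mono [OF opnorm_apply [OF Q u(1)] hnorm_nonneg])
    also have "\<dots> \<le> opnorm ?Q * (1 * 1)"
      unfolding mult.assoc using u hnorm_nonneg [of u] opnorm_nonneg [OF Q] by (intro mult_left_mono mult_mono) auto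
    finally have "(hnorm HH (X u))\<^sup>2 \<le> opnorm ?Q" using zero_le_power2 [of "hnorm HH (Y u)"] by linarith
    then show "hnorm HH (X u) \<le> sqrt (opnorm ?Q)" by (rule real_le_rsqrt)
  qed
  then have "(opnorm X)\<^sup>2 \<le> (sqrt (opnorm ?Q))\<^sup>2" by (intro power_mono opnorm_nonneg X)
  then show ?thesis using opnorm_nonneg [OF Q] by (simp del: BB_simps)
qed

lemma opnorm_square:
  assumes X: "X \<in> carrier BB"
  shows "(opnorm X)\<^sup>2 = opnorm (X \<otimes>\<^bsub>BB\<^esub> X)"
proof -
  have "X \<otimes>\<^bsub>BB\<^esub> X \<oplus>\<^bsub>BB\<^esub> \<zero>\<^bsub>BB\<^esub> \<otimes>\<^bsub>BB\<^esub> \<zero>\<^bsub>BB\<^esub> = X \<otimes>\<^bsub>BB\<^esub> X"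
    by (rule inj_onD [OF opE_inj]) (use X in \<open>simp_all add: opE_hom BB_closed del: BB_simps\<close>)
  then show ?thesis
    using opnorm_squares [OF X BB_closed(1)] opnorm_mult [OF X X] by (simp add: power2_eq_square del: BB_simps)
qed

text \<open>The limit is formed pointwise. By \<open>opnorm_entries\<close> the norm of a difference
  is controlled by finitely many vectors \<open>pointv t\<close>, so the convergence is in
  norm.\<close>

lemma opnorm_complete:
  assumes s: "\<And>k. s k \<in> carrier BB"
    and C: "\<And>e. e > 0 \<Longrightarrow> \<exists>N. \<forall>k\<ge>N. \<forall>l\<ge>N. opnorm (s k \<oplus>\<^bsub>BB\<^esub> (- 1) \<odot>\<^bsub>BB\<^esub> s l) < e"
  shows "\<exists>X\<in>carrier BB. (\<lambda>k. opnorm (s k \<oplus>\<^bsub>BB\<^esub> (- 1) \<odot>\<^bsub>BB\<^esub> X)) \<longlonglongrightarrow> 0"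
proof -
  interpret HS: hilbert_space HH by (rule hilbert_space_HH)
  have diff: "(s k \<oplus>\<^bsub>BB\<^esub> (- 1) \<odot>\<^bsub>BB\<^esub> X) u = (\<lambda>x. s k u x - X u x)" if "u \<in> carrier HH" for k u X
    using that by (simp del: HH_simps)
  have "\<exists>v\<in>carrier HH. (\<lambda>k. hnorm HH (s k u \<ominus>\<^bsub>HH\<^esub> v)) \<longlonglongrightarrow> 0" if u: "u \<in> carrier HH" for u
  proof (rule HS.hilbert_complete)
    show "s k u \<in> carrier HH" for k using s u by (rule BB_closed_in)
    fix e :: real assume e: "e > 0"
    have p: "hnorm HH u + 1 > 0" using hnorm_nonneg [of u] by simp
    from C [of "e / (hnorm HH u + 1)"] e p obtain N where
      N: "\<And>k l. k \<ge> N \<Longrightarrow> l \<ge> N \<Longrightarrow> opnorm (s k \<oplus>\<^bsub>BB\<^esub> (- 1) \<odot>\<^bsub>BB\<^esub> s l) < e / (hnorm HH u + 1)"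
      by (auto simp del: BB_simps)
    have "hnorm HH (s k u \<ominus>\<^bsub>HH\<^esub> s l u) < e" if kl: "k \<ge> N" "l \<ge> N" for k l
    proof -
      let ?d = "s k \<oplus>\<^bsub>BB\<^esub> (- 1) \<odot>\<^bsub>BB\<^esub> s l"
      have d: "?d \<in> carrier BB" using s by (intro BB_closed)
      have "hnorm HH (s k u \<ominus>\<^bsub>HH\<^esub> s l u) = hnorm HH (?d u)"
        unfolding HH_minus [OF BB_closed_in [OF s u] BB_closed_in [OF s u]] diff [OF u] ..
      also have "\<dots> \<le> opnorm ?d * hnorm HH u" by (rule opnorm_apply [OF d u])
      also have "\<dots> \<le> opnorm ?d * (hnorm HH u + 1)" using opnorm_nonneg [OF d] by (intro mult_left_mono) auto
      also have "\<dots> < e" using N [OF kl] p by (simp add: field_simps del: BB_simps)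
      finally show ?thesis .
    qed
    then show "\<exists>N. \<forall>k\<ge>N. \<forall>l\<ge>N. hnorm HH (s k u \<ominus>\<^bsub>HH\<^esub> s l u) < e" by blast
  qed
  then obtain X0 where X0: "\<And>u. u \<in> carrier HH \<Longrightarrow> X0 u \<in> carrier HH"
    "\<And>u. u \<in> carrier HH \<Longrightarrow> (\<lambda>k. hnorm HH (s k u \<ominus>\<^bsub>HH\<^esub> X0 u)) \<longlonglongrightarrow> 0" by metis
  define X where "X = restrict X0 (carrier HH)"
  have Xc: "X u \<in> carrier HH" if "u \<in> carrier HH" for u using X0(1) [OF that] that by (simp add: X_def del: HH_simps)
  have lim: "(\<lambda>k. hnorm HH (\<lambda>x. s k u x - X u x)) \<longlonglongrightarrow> 0" if "u \<in> carrier HH" for u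
    using X0(2) [OF that] HH_minus [OF BB_closed_in [OF s that] X0(1) [OF that]] that by (simp add: X_def del: HH_simps)
  have pt: "(\<lambda>k. s k u x) \<longlonglongrightarrow> X u x" if u: "u \<in> carrier HH" for u x
  proof (cases "x \<in> S")
    case True
    have "(\<lambda>k. s k u x - X u x) \<longlonglongrightarrow> 0"
    proof (rule tendsto_0_le [OF lim [OF u], where K = 1])
      have "cmod (s k u x - X u x) \<le> L2_set (\<lambda>x. cmod (s k u x - X u x)) S" for k
        by (rule cmod_le_L2 [OF True])
      then show "\<forall>\<^sub>F k in sequentially. norm (s k u x - X u x) \<le> norm (hnorm HH (\<lambda>x. s k u x - X u x)) * 1"
        by (simp add: hnorm_HH L2_set_nonneg)
    qed
    then show ?thesis by (simp add: LIM_zero_iff)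
  next
    case False
    then show ?thesis using Xc [OF u] BB_closed_in [OF s u] by simp
  qed
  have X: "X \<in> carrier BB"
  proof (rule BBI)
    show "X \<in> extensional (carrier HH)" by (simp add: X_def del: HH_simps)
    fix u v assume uv: "u \<in> carrier HH" "v \<in> carrier HH"
    show "X (\<lambda>s. u s + v s) = (\<lambda>s. X u s + X v s)"
    proof
      fix x
      have "(\<lambda>k. s k (\<lambda>s. u s + v s) x) \<longlonglongrightarrow> X u x + X v x"
        using tendsto_add [OF pt [OF uv(1), of x] pt [OF uv(2), of x]] by (simp add: BB_add [OF s uv])
      then show "X (\<lambda>s. u s + v s) x = X u x + X v x"
        by (rule LIMSEQ_unique [OF pt [OF HH_closed(1) [OF uv]]])
    qed
    have "(\<lambda>k. inprod HH (s k u) v) \<longlonglongrightarrow> inprod HH (X u) v" "(\<lambda>k. inprod HH u (s k v)) \<longlonglongrightarrow> inprod HH u (X v)"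
      unfolding HH_simps(5) by (intro tendsto_intros pt uv)+
    then show "inprod HH (X u) v = inprod HH u (X v)"
      unfolding BB_selfadj [OF s uv] by (rule LIMSEQ_unique)
  next
    fix u c assume u: "u \<in> carrier HH"
    show "X (\<lambda>s. c * u s) = (\<lambda>s. c * X u s)"
    proof
      fix x
      have "(\<lambda>k. s k (\<lambda>s. c * u s) x) \<longlonglongrightarrow> c * X u x"
        using tendsto_mult_left [OF pt [OF u, of x], of c] by (simp add: BB_smult [OF s u])
      then show "X (\<lambda>s. c * u s) x = c * X u x"
        by (rule LIMSEQ_unique [OF pt [OF HH_closed(2) [OF u]]])
    qed
  qed (rule Xc)
  have "(\<lambda>k. opnorm (s k \<oplus>\<^bsub>BB\<^esub> (- 1) \<odot>\<^bsub>BB\<^esub> X)) \<longlonglongrightarrow> 0"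
  proof (rule tendsto_sandwich [OF _ _ tendsto_const])
    show "(\<lambda>k. \<Sum>t\<in>S. hnorm HH (\<lambda>x. s k (pointv t) x - X (pointv t) x)) \<longlonglongrightarrow> 0"
      by (rule tendsto_null_sum, rule lim) (auto simp: pointv_def)
    have d: "s k \<oplus>\<^bsub>BB\<^esub> (- 1) \<odot>\<^bsub>BB\<^esub> X \<in> carrier BB" for k using s X by (intro BB_closed)
    show "\<forall>\<^sub>F k in sequentially. 0 \<le> opnorm (s k \<oplus>\<^bsub>BB\<^esub> (- 1) \<odot>\<^bsub>BB\<^esub> X)"
      using opnorm_nonneg [OF d] by simp
    have p: "pointv t \<in> carrier HH" if "t \<in> S" for t using that by (auto simp: pointv_def)
    have "opnorm (s k \<oplus>\<^bsub>BB\<^esub> (- 1) \<odot>\<^bsub>BB\<^esub> X) \<le> (\<Sum>t\<in>S. hnorm HH (\<lambda>x. s k (pointv t) x - X (pointv t) x))" for k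
      by (rule order_trans [OF opnorm_entries [OF d]]) (simp only: diff [OF p] order_refl cong: sum.cong)
    then show "\<forall>\<^sub>F k in sequentially. opnorm (s k \<oplus>\<^bsub>BB\<^esub> (- 1) \<odot>\<^bsub>BB\<^esub> X)
        \<le> (\<Sum>t\<in>S. hnorm HH (\<lambda>x. s k (pointv t) x - X (pointv t) x))" by (intro always_eventually allI)
  qed
  with X show ?thesis by blast
qed

end

text \<open>Factors from the right arrive in reversed order; reversal invariance of the expansion of
  s makes them match the words prepended to q.\<close>

lemma zrep_aev:
  "zrep z t \<beta> \<Longrightarrow> aev \<phi> t = wsum (\<lambda>(p, q). wp \<phi> p * \<phi> z * wp \<phi> (rev q)) \<beta>"
proof (induction rule: zrep.induct)
  case (zrep_left s t \<beta>)
  let ?k = "\<lambda>(p, q). wp \<phi> p * \<phi> z * wp \<phi> (rev q)"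
  have 1: "wsum ?k (lprod (\<lambda>w v. (w @ fst v, snd v)) (W0 s) \<beta>) = (1/2) *\<^sub>R (wsum (wp \<phi>) (W0 s) * wsum ?k \<beta>)"
    by (rule wsum_lprod) (auto simp: mult.assoc)
  have 2: "wsum ?k (lprod (\<lambda>w v. (fst v, w @ snd v)) (W0 s) \<beta>)
      = (1/2) *\<^sub>R (wsum ?k \<beta> * wsum (\<lambda>w. wp \<phi> (rev w)) (W0 s))"
    unfolding lprod_flip_wsum [of _ _ "W0 s"] by (rule wsum_lprod) (auto simp: mult.assoc)
  show ?case
    using zrep_left by (simp add: 1 2 scaleR_add_right flip: aev_W0 aev_W0_rev)
next
  case (zrep_right s t \<beta>)
  let ?k = "\<lambda>(p, q). wp \<phi> p * \<phi> z * wp \<phi> (rev q)"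
  have 1: "wsum ?k (lprod (\<lambda>w v. (w @ fst v, snd v)) (W0 s) \<beta>) = (1/2) *\<^sub>R (wsum (wp \<phi>) (W0 s) * wsum ?k \<beta>)"
    by (rule wsum_lprod) (auto simp: mult.assoc)
  have 2: "wsum ?k (lprod (\<lambda>w v. (fst v, w @ snd v)) (W0 s) \<beta>)
      = (1/2) *\<^sub>R (wsum ?k \<beta> * wsum (\<lambda>w. wp \<phi> (rev w)) (W0 s))"
    unfolding lprod_flip_wsum [of _ _ "W0 s"] by (rule wsum_lprod) (auto simp: mult.assoc)
  show ?case
    using zrep_right by (simp add: 1 2 scaleR_add_right add.commute flip: aev_W0 aev_W0_rev)
qed simp_all

lemma zrep_noz: "\<lbrakk>zrep z t \<beta>; (c, p, q) \<in> set \<beta>\<rbrakk> \<Longrightarrow> z \<notin> set p \<and> z \<notin> set q"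
proof (induction arbitrary: c p q rule: zrep.induct)
  case (zrep_scale t \<beta> r)
  then obtain c' where "(c', p, q) \<in> set \<beta>" by (auto simp: apfst_def map_prod_def)
  then show ?case using zrep_scale.IH by blast
next
  case (zrep_add s \<alpha> t \<beta>)
  have "(c, p, q) \<in> set \<alpha> \<or> (c, p, q) \<in> set \<beta>" using zrep_add.prems by simp
  then show ?case using zrep_add.IH by blast
next
  case (zrep_left s t \<beta>)
  then obtain u v where u: "u \<in> set (W0 s)" and v: "v \<in> set \<beta>"
    and pq: "(p, q) = (snd u @ fst (snd v), snd (snd v)) \<or> (p, q) = (fst (snd v), snd u @ snd (snd v))"
    by (auto dest!: set_lprod)
  have "z \<notin> set (snd u)" using set_W0 [of "fst u" "snd u" s] u zrep_left.hyps by auto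
  moreover have "z \<notin> set (fst (snd v)) \<and> z \<notin> set (snd (snd v))"
    using zrep_left.IH [of "fst v" "fst (snd v)" "snd (snd v)"] v by simp
  ultimately show ?case using pq by auto
next
  case (zrep_right s t \<beta>)
  then obtain u v where u: "u \<in> set (W0 s)" and v: "v \<in> set \<beta>"
    and pq: "(p, q) = (snd u @ fst (snd v), snd (snd v)) \<or> (p, q) = (fst (snd v), snd u @ snd (snd v))"
    by (auto dest!: set_lprod)
  have "z \<notin> set (snd u)" using set_W0 [of "fst u" "snd u" s] u zrep_right.hyps by auto
  moreover have "z \<notin> set (fst (snd v)) \<and> z \<notin> set (snd (snd v))"
    using zrep_right.IH [of "fst v" "fst (snd v)" "snd (snd v)"] v by simp
  ultimately show ?case using pq by auto
qed simp_all

lemma aev_cong: "(\<And>v. v \<in> jvars t \<Longrightarrow> \<phi> v = \<psi> v) \<Longrightarrow> aev \<phi> t = aev \<psi> t"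
  by (induction t) auto

section \<open>Chains as symmetric matrices\<close>

definition nodes :: "(bool \<Rightarrow> nat) \<Rightarrow> (bool \<times> nat) set" where
  "nodes Len = Sigma UNIV (\<lambda>b. {..Len b})"

definition supp :: "(bool \<Rightarrow> nat) \<Rightarrow> (bool \<times> nat \<Rightarrow> real) \<Rightarrow> bool" where
  "supp Len u \<longleftrightarrow> (\<forall>n. n \<notin> nodes Len \<longrightarrow> u n = 0)"

definition ip :: "(bool \<Rightarrow> nat) \<Rightarrow> (bool \<times> nat \<Rightarrow> real) \<Rightarrow> (bool \<times> nat \<Rightarrow> real) \<Rightarrow> real" where
  "ip Len u w = (\<Sum>n\<in>nodes Len. u n * w n)"

lemma finite_nodes: "finite (nodes Len)"
  by (simp add: nodes_def)

lemma ip_alt: "ip Len u w = (\<Sum>b\<in>UNIV. \<Sum>d\<le>Len b. u (b, d) * w (b, d))"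
  unfolding ip_def nodes_def by (subst sum.Sigma) auto

definition symmetric_op :: "(bool \<Rightarrow> nat) \<Rightarrow> (bool \<times> nat \<Rightarrow> real) endo \<Rightarrow> bool" where
  "symmetric_op Len B \<longleftrightarrow> (\<forall>u w. ip Len (app B u) w = ip Len u (app B w)) \<and> (\<forall>u. supp Len (app B u))"

lemma chain_sum:
  fixes k w :: "nat \<Rightarrow> real"
  shows "(\<Sum>d\<le>N. (k d + (case d of 0 \<Rightarrow> 0 | Suc i \<Rightarrow> k i)) * w d)
    = (\<Sum>d<N. k d * (w d + w (Suc d))) + k N * w N"
  by (induction N) (simp_all add: algebra_simps)

lemma symmetric_chain: "symmetric_op Len (chain side Len tau \<alpha> v)"
proof -
  have e: "ip Len (app (chain side Len tau \<alpha> v) u) w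
      = (\<Sum>b\<in>UNIV. \<Sum>d<Len b. link side Len tau \<alpha> v u b d * (w (b, d) + w (b, Suc d)))" for u w
    unfolding ip_alt app_chain chain_sum by (simp add: link_def)
  have "ip Len (app (chain side Len tau \<alpha> v) u) w = ip Len u (app (chain side Len tau \<alpha> v) w)" for u w
  proof -
    have "ip Len (app (chain side Len tau \<alpha> v) u) w = ip Len (app (chain side Len tau \<alpha> v) w) u"
      unfolding e by (intro sum.cong refl) (simp add: link_def algebra_simps)
    then show ?thesis by (simp add: ip_def mult.commute)
  qed
  moreover have "supp Len (app (chain side Len tau \<alpha> v) u)" for u
    by (auto simp: supp_def nodes_def app_chain link_def split: nat.splits)
  ultimately show ?thesis by (simp add: symmetric_op_def)
qed

text \<open>The matrix put in place of Z. It joins the two chains at their nodes 0, so that p can be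
  read off on one chain and q on the other.\<close>

definition swapZ :: "(bool \<times> nat \<Rightarrow> real) endo" where
  "swapZ = Endo (\<lambda>u (b, d). if d = 0 then u (\<not> b, 0) else 0)"

lemma app_swapZ: "app swapZ u (b, d) = (if d = 0 then u (\<not> b, 0) else 0)"
proof -
  have "linear (\<lambda>u :: bool \<times> nat \<Rightarrow> real. \<lambda>(b, d). if d = 0 then u (\<not> b, 0) else 0)"
    by (intro linearI) (auto simp: fun_eq_iff scaleR_fun_def plus_fun_def)
  from app_Endo [OF this] show ?thesis by (simp add: swapZ_def)
qed

lemma symmetric_swapZ: "symmetric_op Len swapZ"
proof -
  have "ip Len (app swapZ u) w = u (False, 0) * w (True, 0) + u (True, 0) * w (False, 0)" for u w
    by (simp add: ip_alt app_swapZ UNIV_bool if_distribR sum.delta' cong: if_cong)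
      (simp add: if_distrib [of "\<lambda>x. x * _"] cong: if_cong)
  then have "ip Len (app swapZ u) w = ip Len u (app swapZ w)" for u w
    using \<open>\<And>w u. ip Len (app swapZ u) w = _\<close> [of w u] by (simp add: ip_def mult.commute)
  moreover have "supp Len (app swapZ u)" for u
    by (auto simp: supp_def nodes_def app_swapZ)
  ultimately show ?thesis by (simp add: symmetric_op_def)
qed

lemma symmetric_zero: "symmetric_op Len 0"
  by (simp add: symmetric_op_def ip_def supp_def)

lemma chain_commute:
  assumes tau: "\<And>b i. tau b (Suc i) = (\<not> tau b i)" and uv: "side u = side v"
  shows "chain side Len tau \<alpha> u * chain side Len tau \<alpha> v = chain side Len tau \<alpha> v * chain side Len tau \<alpha> u"
proof (rule endo_eqI, rule ext)
  fix w and n :: "bool \<times> nat"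
  obtain b d where n: "n = (b, d)" by fastforce
  show "app (chain side Len tau \<alpha> u * chain side Len tau \<alpha> v) w n
    = app (chain side Len tau \<alpha> v * chain side Len tau \<alpha> u) w n"
    using tau [of b d] tau [of b "d - 1"] tau [of b "d - 2"] uv
    by (cases d; cases "d - 1") (auto simp: n app_chain link_def algebra_simps split: nat.splits)
qed

context
  fixes side :: "'v \<Rightarrow> bool" and Len :: "bool \<Rightarrow> nat" and tau :: "bool \<Rightarrow> nat \<Rightarrow> bool"
    and \<alpha> :: "bool \<Rightarrow> nat \<Rightarrow> 'v \<Rightarrow> real"
begin

abbreviation "ch \<equiv> chain side Len tau \<alpha>"

lemma wp_chain_local:
  assumes "\<And>d. u (b, d) = w (b, d)"
  shows "app (wp ch p) u (b, d) = app (wp ch p) w (b, d)"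
  by (induction p arbitrary: d) (simp_all add: assms app_chain link_def split: nat.splits)

lemma ip_wp_rev: "ip Len (app (wp ch (rev q)) u) w = ip Len u (app (wp ch q) w)"
proof (induction q arbitrary: u w)
  case (Cons v q)
  have "ip Len (app (wp ch (rev (v # q))) u) w = ip Len (app (ch v) u) (app (wp ch q) w)"
    by (simp add: Cons.IH)
  also have "\<dots> = ip Len u (app (wp ch (v # q)) w)"
    using symmetric_chain [of Len side tau \<alpha> v] by (simp add: symmetric_op_def)
  finally show ?case .
qed simp

text \<open>Letters never leave a chain, so \<open>rev q\<close> acts on the chain False,
  \<open>swapZ\<close> crosses at node 0, and p acts on the chain True. Symmetry of the matrices
  turns \<open>rev q\<close> from the end to node 0 into q from node 0 to the end.\<close>

lemma matrix_entry:
  "app (wp ch p * swapZ * wp ch (rev q)) (unitv (False, Len False)) (True, Len True)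
    = cent side Len tau \<alpha> p True (Len True) * cent side Len tau \<alpha> q False (Len False)"
proof -
  define u where "u = app (wp ch (rev q)) (unitv (False, Len False))"
  have uT: "u (True, d) = 0" for d
  proof -
    have "u (True, d) = app (wp ch (rev q)) 0 (True, d)"
      unfolding u_def by (rule wp_chain_local) (simp add: unitv_def)
    then show ?thesis by simp
  qed
  have ipu: "ip Len x (unitv n) = x n" if "n \<in> nodes Len" for x n
    unfolding ip_def unitv_def using that finite_nodes by (simp add: if_distrib cong: if_cong)
  have ipu': "ip Len (unitv n) x = x n" if "n \<in> nodes Len" for x n
    using ipu [OF that, of x] by (simp add: ip_def mult.commute)
  have "u (False, 0) = ip Len u (unitv (False, 0))" by (simp add: ipu nodes_def)
  also have "\<dots> = ip Len (unitv (False, Len False)) (app (wp ch q) (unitv (False, 0)))"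
    unfolding u_def by (rule ip_wp_rev)
  also have "\<dots> = cent side Len tau \<alpha> q False (Len False)" by (simp add: ipu' nodes_def cent_def)
  finally have u0: "u (False, 0) = cent side Len tau \<alpha> q False (Len False)" .
  have "app (wp ch p) (app swapZ u) (True, Len True) = app (wp ch p) (u (False, 0) *\<^sub>R unitv (True, 0)) (True, Len True)"
    by (rule wp_chain_local) (simp add: app_swapZ scaleR_fun_def unitv_def)
  also have "\<dots> = u (False, 0) * cent side Len tau \<alpha> p True (Len True)"
    by (simp add: cent_def) (simp add: scaleR_fun_def)
  finally show ?thesis using u0 by (simp add: u_def)
qed

end

section \<open>Real symmetric matrices as self-adjoint operators over the type
  \<open>'a\<close>\<close>

context
  fixes Len :: "bool \<Rightarrow> nat" and \<iota> :: "bool \<times> nat \<Rightarrow> 'a"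
  assumes inj: "inj \<iota>"
begin

abbreviation "SS \<equiv> \<iota> ` nodes Len"
abbreviation "HS \<equiv> fin_hilbert SS"
abbreviation "BS \<equiv> bounded_selfadjoint_ops HS"

lemma finite_SS: "finite SS"
  by (simp add: finite_nodes)

definition emb :: "(bool \<times> nat \<Rightarrow> real) \<Rightarrow> 'a \<Rightarrow> complex" where
  "emb w = (\<lambda>s. if s \<in> SS then complex_of_real (w (inv_into UNIV \<iota> s)) else 0)"

definition rep :: "('a \<Rightarrow> complex) \<Rightarrow> bool \<times> nat \<Rightarrow> real" where
  "rep f = (\<lambda>n. if n \<in> nodes Len then Re (f (\<iota> n)) else 0)"

definition imp :: "('a \<Rightarrow> complex) \<Rightarrow> bool \<times> nat \<Rightarrow> real" where
  "imp f = (\<lambda>n. if n \<in> nodes Len then Im (f (\<iota> n)) else 0)"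

text \<open>The complexification of a real matrix: it acts separately on the real and the imaginary
  part of f.\<close>

definition opB :: "(bool \<times> nat \<Rightarrow> real) endo \<Rightarrow> ('a \<Rightarrow> complex) \<Rightarrow> 'a \<Rightarrow> complex" where
  "opB B = (\<lambda>f\<in>carrier HS. \<lambda>s. emb (app B (rep f)) s + \<i> * emb (app B (imp f)) s)"

lemma opB_apply: "f \<in> carrier HS \<Longrightarrow> opB B f = (\<lambda>s. emb (app B (rep f)) s + \<i> * emb (app B (imp f)) s)"
  by (simp add: opB_def del: HH_simps)

lemma emb_closed: "emb w \<in> carrier HS"
  by (simp add: emb_def finite_SS)

lemma emb_linear:
  "emb (u + w) = (\<lambda>s. emb u s + emb w s)" "emb (r *\<^sub>R u) = (\<lambda>s. complex_of_real r * emb u s)"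
  "emb (u - w) = (\<lambda>s. emb u s - emb w s)" "emb 0 = (\<lambda>s. 0)"
  by (auto simp: emb_def fun_eq_iff scaleR_fun_def)

lemma rep_linear:
  "rep (\<lambda>s. f s + g s) = rep f + rep g" "imp (\<lambda>s. f s + g s) = imp f + imp g"
  "rep (\<lambda>s. c * f s) = Re c *\<^sub>R rep f - Im c *\<^sub>R imp f" "imp (\<lambda>s. c * f s) = Re c *\<^sub>R imp f + Im c *\<^sub>R rep f"
  by (auto simp: rep_def imp_def fun_eq_iff scaleR_fun_def)

lemma rep_emb: "supp Len u \<Longrightarrow> supp Len w \<Longrightarrow> rep (\<lambda>s. emb u s + \<i> * emb w s) = u"
  "supp Len u \<Longrightarrow> supp Len w \<Longrightarrow> imp (\<lambda>s. emb u s + \<i> * emb w s) = w"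
  by (auto simp: rep_def imp_def emb_def fun_eq_iff supp_def inj)

lemma rep_opB:
  assumes "symmetric_op Len B" "f \<in> carrier HS"
  shows "rep (opB B f) = app B (rep f)" "imp (opB B f) = app B (imp f)"
  using assms unfolding opB_apply [OF assms(2)] symmetric_op_def by (simp_all add: rep_emb)

lemma inprod_rep:
  "inprod HS f g = complex_of_real (ip Len (rep f) (rep g) + ip Len (imp f) (imp g))
    + \<i> * complex_of_real (ip Len (imp f) (rep g) - ip Len (rep f) (imp g))"
proof -
  have "inprod HS f g = (\<Sum>n\<in>nodes Len. f (\<iota> n) * cnj (g (\<iota> n)))"
    by (simp add: HH_simps [OF finite_SS] sum.reindex [OF inj_on_subset [OF inj]])
  also have "\<dots> = (\<Sum>n\<in>nodes Len. complex_of_real (rep f n * rep g n + imp f n * imp g n)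
      + \<i> * complex_of_real (imp f n * rep g n - rep f n * imp g n))"
    by (rule sum.cong) (auto simp: rep_def imp_def complex_eq_iff algebra_simps)
  also have "\<dots> = complex_of_real (\<Sum>n\<in>nodes Len. rep f n * rep g n + imp f n * imp g n)
      + \<i> * complex_of_real (\<Sum>n\<in>nodes Len. imp f n * rep g n - rep f n * imp g n)"
    unfolding of_real_sum sum_distrib_left sum.distrib [symmetric] ..
  also have "(\<Sum>n\<in>nodes Len. rep f n * rep g n + imp f n * imp g n) = ip Len (rep f) (rep g) + ip Len (imp f) (imp g)"
    unfolding ip_def by (rule sum.distrib)
  also have "(\<Sum>n\<in>nodes Len. imp f n * rep g n - rep f n * imp g n) = ip Len (imp f) (rep g) - ip Len (rep f) (imp g)"
    unfolding ip_def by (rule sum_subtractf)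
  finally show ?thesis .
qed

lemma opB_carrier:
  assumes B: "symmetric_op Len B"
  shows "opB B \<in> carrier BS"
proof (rule BBI [OF finite_SS])
  note HC = HH_closed [OF finite_SS]
  show "opB B \<in> extensional (carrier HS)" by (simp add: opB_def)
  fix u assume u: "u \<in> carrier HS"
  show "opB B u \<in> carrier HS" unfolding opB_apply [OF u] by (intro HC emb_closed)
  show "opB B (\<lambda>s. c * u s) = (\<lambda>s. c * opB B u s)" for c
    unfolding opB_apply [OF u] opB_apply [OF HC(2) [OF u]] rep_linear
    by (simp add: emb_linear fun_eq_iff complex_eq_iff algebra_simps)
  fix v assume v: "v \<in> carrier HS"
  show "opB B (\<lambda>s. u s + v s) = (\<lambda>s. opB B u s + opB B v s)"
    unfolding opB_apply [OF u] opB_apply [OF v] opB_apply [OF HC(1) [OF u v]] rep_linear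
    by (simp add: emb_linear fun_eq_iff algebra_simps)
  show "inprod HS (opB B u) v = inprod HS u (opB B v)"
    using B unfolding inprod_rep rep_opB [OF B u] rep_opB [OF B v] by (simp add: symmetric_op_def)
qed

lemma opB_emb: "supp Len w \<Longrightarrow> opB B (emb w) = emb (app B w)"
proof -
  assume w: "supp Len w"
  have z: "supp Len 0" by (simp add: supp_def)
  have "emb w = (\<lambda>s. emb w s + \<i> * emb 0 s)" by (simp add: emb_linear)
  then have "rep (emb w) = w" "imp (emb w) = 0" using rep_emb [OF w z] by simp_all
  then show ?thesis unfolding opB_apply [OF emb_closed] by (simp add: emb_linear)
qed

lemma opE_opB_commute:
  assumes B: "symmetric_op Len B" "symmetric_op Len B'" and c: "B * B' = B' * B"
  shows "opE SS (opB B) * opE SS (opB B') = opE SS (opB B') * opE SS (opB B)"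
proof (rule endo_eqI)
  fix f
  have *: "app (opE SS (opB B) * opE SS (opB B')) f
      = (\<lambda>s. emb (app (B * B') (rep (restr SS f))) s + \<i> * emb (app (B * B') (imp (restr SS f))) s)"
    if B: "symmetric_op Len B" "symmetric_op Len B'" for B B'
  proof -
    have r: "restr SS f \<in> carrier HS" by (rule restr_closed [OF finite_SS])
    have o: "opB B' (restr SS f) \<in> carrier HS" by (rule BB_closed_in [OF finite_SS opB_carrier [OF B(2)] r])
    have "app (opE SS (opB B) * opE SS (opB B')) f = opB B (opB B' (restr SS f))"
      using app_opE [OF finite_SS opB_carrier] B restr_id [OF finite_SS o] by simp
    then show ?thesis unfolding opB_apply [OF o] rep_opB [OF B(2) r] by simp
  qed
  show "app (opE SS (opB B) * opE SS (opB B')) f = app (opE SS (opB B') * opE SS (opB B)) f"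
    unfolding * [OF B] * [OF B(2,1)] c ..
qed

section \<open>The operator algebra copied into the type \<open>'a\<close>\<close>

context
  fixes \<psi> :: "(('a \<Rightarrow> complex) \<Rightarrow> 'a \<Rightarrow> complex) \<Rightarrow> 'a"
  assumes psi: "inj_on \<psi> (carrier BS)"
begin

definition "phi = inv_into (carrier BS) \<psi>"

lemma phi_psi [simp]: "T \<in> carrier BS \<Longrightarrow> phi (\<psi> T) = T"
  unfolding phi_def by (rule inv_into_f_f [OF psi])

definition JJ :: "'a normed_algebra" where
  "JJ = \<lparr>carrier = \<psi> ` carrier BS, monoid.mult = (\<lambda>x y. \<psi> (phi x \<otimes>\<^bsub>BS\<^esub> phi y)), one = \<psi> \<one>\<^bsub>BS\<^esub>,
     zero = \<psi> \<zero>\<^bsub>BS\<^esub>, add = (\<lambda>x y. \<psi> (phi x \<oplus>\<^bsub>BS\<^esub> phi y)), smult = (\<lambda>r x. \<psi> (r \<odot>\<^bsub>BS\<^esub> phi x)),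
     nrm = (\<lambda>x. nrm BS (phi x))\<rparr>"

lemma JJ_simps [simp]:
  "carrier JJ = \<psi> ` carrier BS" "x \<otimes>\<^bsub>JJ\<^esub> y = \<psi> (phi x \<otimes>\<^bsub>BS\<^esub> phi y)" "\<one>\<^bsub>JJ\<^esub> = \<psi> \<one>\<^bsub>BS\<^esub>"
  "\<zero>\<^bsub>JJ\<^esub> = \<psi> \<zero>\<^bsub>BS\<^esub>" "x \<oplus>\<^bsub>JJ\<^esub> y = \<psi> (phi x \<oplus>\<^bsub>BS\<^esub> phi y)" "r \<odot>\<^bsub>JJ\<^esub> x = \<psi> (r \<odot>\<^bsub>BS\<^esub> phi x)"
  "nrm JJ x = nrm BS (phi x)"
  by (simp_all add: JJ_def)

lemmas BS_closed = BB_closed [OF finite_SS]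
lemmas BS_hom = opE_hom [OF finite_SS]

abbreviation "EJ \<equiv> \<lambda>x. opE SS (phi x)"

lemma EJ_inj: "inj_on EJ (carrier JJ)"
  using inj_on_eq_iff [OF opE_inj [OF finite_SS]] by (auto intro!: inj_onI)

lemma EJ_mult: "\<lbrakk>x \<in> carrier JJ; y \<in> carrier JJ\<rbrakk> \<Longrightarrow> EJ (x \<otimes>\<^bsub>JJ\<^esub> y) = (1/2) *\<^sub>R (EJ x * EJ y + EJ y * EJ x)"
  using BS_closed BS_hom by (auto simp del: BB_simps)

lemma jordan_JJ: "jordan_algebra JJ"
  by (rule special_jordan_algebraI [of JJ EJ, OF _ _ _ _ EJ_inj _ _ _ EJ_mult])
    (use BS_closed BS_hom in \<open>auto simp del: BB_simps\<close>)

lemma JJ_minus: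
  assumes "x \<in> carrier JJ" "y \<in> carrier JJ"
  shows "x \<ominus>\<^bsub>JJ\<^esub> y = x \<oplus>\<^bsub>JJ\<^esub> (- 1) \<odot>\<^bsub>JJ\<^esub> y"
proof -
  interpret jordan_algebra JJ by (rule jordan_JJ)
  have "\<ominus>\<^bsub>JJ\<^esub> y = (- 1) \<odot>\<^bsub>JJ\<^esub> y"
    by (rule M.minus_equality [OF rscale_minus_one [OF assms(2)] assms(2) rscale_closed [OF assms(2)]])
  then show ?thesis by (simp add: a_minus_def)
qed

lemma BS_minus_simp:
  "\<lbrakk>X \<in> carrier BS; Y \<in> carrier BS\<rbrakk> \<Longrightarrow> phi (\<psi> X \<ominus>\<^bsub>JJ\<^esub> \<psi> Y) = X \<oplus>\<^bsub>BS\<^esub> (- 1) \<odot>\<^bsub>BS\<^esub> Y"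
  using BS_closed by (simp add: JJ_minus del: BB_simps)

lemma jb_JJ: "jb_algebra JJ"
proof (intro jb_algebra.intro jordan_JJ jb_algebra_axioms.intro)
  note F = finite_SS
  fix x assume x: "x \<in> carrier JJ"
  then obtain X where X: "x = \<psi> X" "X \<in> carrier BS" by auto
  show "(nrm JJ x = 0) = (x = \<zero>\<^bsub>JJ\<^esub>)"
    using X opnorm_eq_0 [OF F X(2)] inj_on_eq_iff [OF psi X(2) BS_closed(1)] by (simp del: BB_simps)
  show "0 \<le> nrm JJ x" using X opnorm_nonneg [OF F X(2)] by (simp del: BB_simps)
  show "nrm JJ (r \<odot>\<^bsub>JJ\<^esub> x) = \<bar>r\<bar> * nrm JJ x" for r
    using X opnorm_smult [OF F X(2)] BS_closed by (simp del: BB_simps)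
  show "(nrm JJ x)\<^sup>2 = nrm JJ (x \<otimes>\<^bsub>JJ\<^esub> x)"
    using X opnorm_square [OF F X(2)] BS_closed by (simp del: BB_simps)
  fix y assume y: "y \<in> carrier JJ"
  then obtain Y where Y: "y = \<psi> Y" "Y \<in> carrier BS" by auto
  show "nrm JJ (x \<oplus>\<^bsub>JJ\<^esub> y) \<le> nrm JJ x + nrm JJ y"
    using X Y opnorm_add [OF F X(2) Y(2)] BS_closed by (simp del: BB_simps)
  show "nrm JJ (x \<otimes>\<^bsub>JJ\<^esub> y) \<le> nrm JJ x * nrm JJ y"
    using X Y opnorm_mult [OF F X(2) Y(2)] BS_closed by (simp del: BB_simps)
  show "nrm JJ (x \<otimes>\<^bsub>JJ\<^esub> x) \<le> nrm JJ (x \<otimes>\<^bsub>JJ\<^esub> x \<oplus>\<^bsub>JJ\<^esub> y \<otimes>\<^bsub>JJ\<^esub> y)"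
    using X Y opnorm_squares [OF F X(2) Y(2)] opnorm_square [OF F X(2)] BS_closed by (simp del: BB_simps)
next
  fix s :: "nat \<Rightarrow> 'a"
  assume s: "\<And>k. s k \<in> carrier JJ"
    and C: "\<And>e. e > 0 \<Longrightarrow> \<exists>N. \<forall>k\<ge>N. \<forall>l\<ge>N. nrm JJ (s k \<ominus>\<^bsub>JJ\<^esub> s l) < e"
  define t where "t k = phi (s k)" for k
  have t: "t k \<in> carrier BS" "s k = \<psi> (t k)" for k using s [of k] by (auto simp: t_def)
  have "\<exists>X\<in>carrier BS. (\<lambda>k. nrm BS (t k \<oplus>\<^bsub>BS\<^esub> (- 1) \<odot>\<^bsub>BS\<^esub> X)) \<longlonglongrightarrow> 0"
    by (rule opnorm_complete [OF finite_SS t(1)])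
      (use C in \<open>simp add: t(2) BS_minus_simp [OF t(1) t(1)] del: BB_simps\<close>)
  then obtain X where X: "X \<in> carrier BS" "(\<lambda>k. nrm BS (t k \<oplus>\<^bsub>BS\<^esub> (- 1) \<odot>\<^bsub>BS\<^esub> X)) \<longlonglongrightarrow> 0" by blast
  then show "\<exists>x\<in>carrier JJ. (\<lambda>k. nrm JJ (s k \<ominus>\<^bsub>JJ\<^esub> x)) \<longlonglongrightarrow> 0"
    by (intro bexI [of _ "\<psi> X"]) (simp_all add: t(2) BS_minus_simp [OF t(1)] del: BB_simps)
qed

lemma jc_JJ: "jc_algebra JJ"
proof -
  have "closed_jordan_subalgebra (carrier BS) BS"
    unfolding closed_jordan_subalgebra_def using BS_closed by (simp del: BB_simps)
  moreover have "isometrically_isomorphic JJ (BS\<lparr>carrier := carrier BS\<rparr>)"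
    unfolding isometrically_isomorphic_def
  proof (intro bexI conjI ballI)
    show "bij_betw phi (carrier JJ) (carrier (BS\<lparr>carrier := carrier BS\<rparr>))"
      by (rule bij_betwI [where g = \<psi>]) auto
    show "phi \<in> jordan_hom JJ (BS\<lparr>carrier := carrier BS\<rparr>)"
      using BS_closed by (auto simp: jordan_hom_def simp del: BB_simps)
  qed simp
  ultimately show ?thesis
    unfolding jc_algebra_def using jb_JJ hilbert_space_HH [OF finite_SS] by blast
qed

lemma JJ_has_unit: "has_unit JJ" and JJ_one: "\<one>\<^bsub>with_unit JJ\<^esub> = \<psi> \<one>\<^bsub>BS\<^esub>"
proof -
  interpret jordan_algebra JJ by (rule jordan_JJ)
  have o: "\<psi> \<one>\<^bsub>BS\<^esub> \<in> carrier JJ" using BS_closed by (simp del: BB_simps)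
  have one: "\<psi> \<one>\<^bsub>BS\<^esub> \<otimes>\<^bsub>JJ\<^esub> x = x" if x: "x \<in> carrier JJ" for x
  proof -
    obtain X where X: "x = \<psi> X" "X \<in> carrier BS" using x by auto
    have "\<one>\<^bsub>BS\<^esub> \<otimes>\<^bsub>BS\<^esub> X = X"
    proof (rule extensionalityI [OF BB_ext [OF finite_SS BS_closed(5) [OF BS_closed(2) X(2)]] BB_ext [OF finite_SS X(2)]])
      fix u assume u: "u \<in> carrier HS"
      then show "(\<one>\<^bsub>BS\<^esub> \<otimes>\<^bsub>BS\<^esub> X) u = X u"
        using BB_closed_in [OF finite_SS X(2) u] by (simp add: BB_simps [OF finite_SS] del: HH_simps)
    qed
    then show ?thesis using X BS_closed by (simp del: BB_simps)
  qed
  show u: "has_unit JJ" using o one by (auto simp: has_unit_def simp del: JJ_simps)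
  interpret U: unital_jordan_algebra "with_unit JJ" by (rule with_unit_unital_jordan_algebra [OF u])
  have "\<one>\<^bsub>with_unit JJ\<^esub> \<in> carrier JJ" using U.j_one_closed by (simp add: with_unit_def del: JJ_simps)
  then have "\<psi> \<one>\<^bsub>BS\<^esub> \<otimes>\<^bsub>JJ\<^esub> \<one>\<^bsub>with_unit JJ\<^esub> = \<one>\<^bsub>with_unit JJ\<^esub>" by (rule one)
  moreover have "\<one>\<^bsub>with_unit JJ\<^esub> \<otimes>\<^bsub>JJ\<^esub> \<psi> \<one>\<^bsub>BS\<^esub> = \<psi> \<one>\<^bsub>BS\<^esub>"
    using U.j_l_one [of "\<psi> \<one>\<^bsub>BS\<^esub>"] o by (simp add: with_unit_def del: JJ_simps)
  ultimately show "\<one>\<^bsub>with_unit JJ\<^esub> = \<psi> \<one>\<^bsub>BS\<^esub>"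
    using m_comm [OF o \<open>\<one>\<^bsub>with_unit JJ\<^esub> \<in> carrier JJ\<close>] by (simp del: JJ_simps)
qed

text \<open>Matrices and coefficients are real, so it suffices to follow the operators on embedded
  real vectors.\<close>

lemma JJ_eval:
  assumes Bv: "\<And>v. symmetric_op Len (Bv v)"
  shows "\<exists>T\<in>carrier BS. jterm_eval (with_unit JJ) (\<lambda>v. \<psi> (opB (Bv v))) t = \<psi> T \<and>
    (\<forall>w. supp Len w \<longrightarrow> supp Len (app (aev Bv t) w) \<and> T (emb w) = emb (app (aev Bv t) w))"
proof (induction t)
  case (JVar v)
  show ?case
    using Bv [of v] by (intro bexI [of _ "opB (Bv v)"] opB_carrier) (auto simp: opB_emb symmetric_op_def)
next
  case JZero
  have "\<zero>\<^bsub>BS\<^esub> (emb w) = emb (app (aev Bv JZero) w) \<and> supp Len (app (aev Bv JZero) w)" for w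
    using emb_closed [of w] by (simp add: BB_simps [OF finite_SS] supp_def emb_def fun_eq_iff del: HH_simps)
  moreover have "jterm_eval (with_unit JJ) (\<lambda>v. \<psi> (opB (Bv v))) JZero = \<psi> \<zero>\<^bsub>BS\<^esub>"
    by (simp add: with_unit_def del: BB_simps)
  ultimately show ?case using BS_closed(1) by blast
next
  case JOne
  have "\<one>\<^bsub>BS\<^esub> (emb w) = emb (app (aev Bv JOne) w)" for w
    using emb_closed [of w] by (simp add: BB_simps [OF finite_SS] del: HH_simps)
  then have "supp Len w \<longrightarrow> supp Len (app (aev Bv JOne) w) \<and> \<one>\<^bsub>BS\<^esub> (emb w) = emb (app (aev Bv JOne) w)" for w
    by simp
  moreover have "jterm_eval (with_unit JJ) (\<lambda>v. \<psi> (opB (Bv v))) JOne = \<psi> \<one>\<^bsub>BS\<^esub>"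
    by (simp add: JJ_one del: BB_simps)
  ultimately show ?case using BS_closed(2) by blast
next
  case (JAdd s t)
  then obtain X Y where X: "X \<in> carrier BS" "jterm_eval (with_unit JJ) (\<lambda>v. \<psi> (opB (Bv v))) s = \<psi> X"
      "\<forall>w. supp Len w \<longrightarrow> supp Len (app (aev Bv s) w) \<and> X (emb w) = emb (app (aev Bv s) w)"
    and Y: "Y \<in> carrier BS" "jterm_eval (with_unit JJ) (\<lambda>v. \<psi> (opB (Bv v))) t = \<psi> Y"
      "\<forall>w. supp Len w \<longrightarrow> supp Len (app (aev Bv t) w) \<and> Y (emb w) = emb (app (aev Bv t) w)" by blast
  have "(X \<oplus>\<^bsub>BS\<^esub> Y) (emb w) = emb (app (aev Bv (JAdd s t)) w) \<and> supp Len (app (aev Bv (JAdd s t)) w)" if "supp Len w" for w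
    using X(3) Y(3) that emb_closed [of w] by (simp add: BB_simps [OF finite_SS] emb_linear supp_def del: HH_simps)
  moreover have "jterm_eval (with_unit JJ) (\<lambda>v. \<psi> (opB (Bv v))) (JAdd s t) = \<psi> (X \<oplus>\<^bsub>BS\<^esub> Y)"
    using X Y by (simp add: with_unit_def del: BB_simps)
  ultimately show ?case using BS_closed(3) [OF X(1) Y(1)] by blast
next
  case (JScale r t)
  then obtain Y where Y: "Y \<in> carrier BS" "jterm_eval (with_unit JJ) (\<lambda>v. \<psi> (opB (Bv v))) t = \<psi> Y"
      "\<forall>w. supp Len w \<longrightarrow> supp Len (app (aev Bv t) w) \<and> Y (emb w) = emb (app (aev Bv t) w)" by blast
  have "(r \<odot>\<^bsub>BS\<^esub> Y) (emb w) = emb (app (aev Bv (JScale r t)) w) \<and> supp Len (app (aev Bv (JScale r t)) w)" if "supp Len w" for w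
  proof
    have "supp Len (app (aev Bv t) w)" "Y (emb w) = emb (app (aev Bv t) w)" using Y(3) that by auto
    then show "(r \<odot>\<^bsub>BS\<^esub> Y) (emb w) = emb (app (aev Bv (JScale r t)) w)" "supp Len (app (aev Bv (JScale r t)) w)"
      using emb_closed [of w]
      by (simp_all add: BB_simps [OF finite_SS] emb_linear del: HH_simps) (simp add: supp_def scaleR_fun_def)
  qed
  moreover have "jterm_eval (with_unit JJ) (\<lambda>v. \<psi> (opB (Bv v))) (JScale r t) = \<psi> (r \<odot>\<^bsub>BS\<^esub> Y)"
    using Y by (simp add: with_unit_def del: BB_simps)
  ultimately show ?case using BS_closed(4) [OF Y(1)] by blast
next
  case (JMult s t)
  then obtain X Y where X: "X \<in> carrier BS" "jterm_eval (with_unit JJ) (\<lambda>v. \<psi> (opB (Bv v))) s = \<psi> X"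
      "\<forall>w. supp Len w \<longrightarrow> supp Len (app (aev Bv s) w) \<and> X (emb w) = emb (app (aev Bv s) w)"
    and Y: "Y \<in> carrier BS" "jterm_eval (with_unit JJ) (\<lambda>v. \<psi> (opB (Bv v))) t = \<psi> Y"
      "\<forall>w. supp Len w \<longrightarrow> supp Len (app (aev Bv t) w) \<and> Y (emb w) = emb (app (aev Bv t) w)" by blast
  have "(X \<otimes>\<^bsub>BS\<^esub> Y) (emb w) = emb (app (aev Bv (JMult s t)) w) \<and> supp Len (app (aev Bv (JMult s t)) w)" if "supp Len w" for w
  proof -
    have "(X \<otimes>\<^bsub>BS\<^esub> Y) (emb w) = (\<lambda>s. (1/2) * (X (Y (emb w)) s + Y (X (emb w)) s))"
      using emb_closed [of w] by (simp add: BB_simps [OF finite_SS] del: HH_simps)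
    also have "\<dots> = emb (app (aev Bv (JMult s t)) w)"
      using X(3) Y(3) that by (simp add: emb_linear)
    finally show ?thesis using X(3) Y(3) that by (simp add: supp_def scaleR_fun_def)
  qed
  moreover have "jterm_eval (with_unit JJ) (\<lambda>v. \<psi> (opB (Bv v))) (JMult s t) = \<psi> (X \<otimes>\<^bsub>BS\<^esub> Y)"
    using X Y by (simp add: with_unit_def del: BB_simps)
  ultimately show ?case using BS_closed(5) [OF X(1) Y(1)] by blast
qed

lemma emb_eq_0: "supp Len w \<Longrightarrow> emb w = (\<lambda>s. 0) \<Longrightarrow> w = 0"
proof (rule ext)
  fix n assume w: "supp Len w" "emb w = (\<lambda>s. 0)"
  show "w n = 0 n"
  proof (cases "n \<in> nodes Len")
    case True
    then show ?thesis using fun_cong [OF w(2), of "\<iota> n"] by (simp add: emb_def inj)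
  qed (use w in \<open>cases n; simp add: supp_def\<close>)
qed

lemma JJ_eval_zero:
  assumes Bv: "\<And>v. symmetric_op Len (Bv v)"
    and "jterm_eval (with_unit JJ) (\<lambda>v. \<psi> (opB (Bv v))) t = \<zero>\<^bsub>JJ\<^esub>" and w: "supp Len w"
  shows "app (aev Bv t) w = 0"
proof -
  obtain T where T: "T \<in> carrier BS" "\<psi> T = \<psi> \<zero>\<^bsub>BS\<^esub>" "supp Len (app (aev Bv t) w)" "T (emb w) = emb (app (aev Bv t) w)"
    using JJ_eval [where Bv = Bv and t = t, OF Bv] assms(2) w by (auto simp del: BB_simps)
  then have "T = \<zero>\<^bsub>BS\<^esub>" using inj_onD [OF psi T(2) T(1) BS_closed(1)] by simp
  then have "emb (app (aev Bv t) w) = (\<lambda>s. 0)"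
    using T(4) emb_closed [of w] by (simp add: BB_simps [OF finite_SS] del: HH_simps)
  with T(3) show ?thesis by (rule emb_eq_0)
qed

lemma JJ_commute:
  assumes "symmetric_op Len B" "symmetric_op Len B'" "B * B' = B' * B"
  shows "operator_commute JJ (\<psi> (opB B)) (\<psi> (opB B'))"
  by (rule special_commute [of EJ JJ, OF EJ_inj _ EJ_mult])
    (use opE_opB_commute [OF assms] opB_carrier assms BS_closed in \<open>auto simp del: BB_simps\<close>)

end

end

text \<open>The multiples of x embed the reals into \<open>'a\<close>, so \<open>'a\<close> is
  infinite and pairs of elements can be coded by elements. An operator on a finite-dimensional space
  is determined by finitely many complex entries, which are coded one after the other.\<close>

lemma (in jb_algebra) operator_encoding:
  fixes Len :: "bool \<Rightarrow> nat"
  assumes x: "x \<in> carrier J" "x \<noteq> \<zero>"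
  shows "\<exists>(\<iota> :: bool \<times> nat \<Rightarrow> 'a) (\<psi> :: (('a \<Rightarrow> complex) \<Rightarrow> 'a \<Rightarrow> complex) \<Rightarrow> 'a). inj \<iota> \<and>
    inj_on \<psi> (carrier (bounded_selfadjoint_ops (fin_hilbert (\<iota> ` nodes Len))))"
proof -
  have r: "inj (\<lambda>r. r \<odot> x)"
  proof (rule injI)
    fix r s assume "r \<odot> x = s \<odot> x"
    then have "(r - s) \<odot> x = \<zero>"
      using rscale_l_distr [of x r "- s"] rscale_l_distr [of x s "- s"] x by simp
    then have "\<bar>r - s\<bar> * nrm J x = 0" using nrm_smult [of x "r - s"] x by simp
    then show "r = s" using x nrm_eq_0 [of x] by simp
  qed
  then have inf: "infinite (UNIV :: 'a set)"
    using finite_imageD [of "\<lambda>r :: real. r \<odot> x" UNIV] finite_subset [OF subset_UNIV] infinite_UNIV_char_0 by blast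
  obtain e :: "nat \<Rightarrow> 'a" where e: "inj e" using infinite_countable_subset [OF inf] by blast
  have "\<exists>g. bij_betw g ((UNIV :: 'a set) \<times> (UNIV :: 'a set)) (UNIV :: 'a set)"
    using card_of_Times_same_infinite [OF inf] by (simp add: card_of_ordIso)
  then obtain g :: "'a \<times> 'a \<Rightarrow> 'a" where g: "inj g" by (auto simp: bij_betw_def)
  define \<iota> :: "bool \<times> nat \<Rightarrow> 'a" where "\<iota> = (\<lambda>(b, d). e (2 * d + of_bool b))"
  have \<iota>: "inj \<iota>"
  proof (rule injI, clarify)
    fix b b' d d' assume "\<iota> (b, d) = \<iota> (b', d')"
    then have "e (2 * d + of_bool b) = e (2 * d' + of_bool b')" by (simp add: \<iota>_def)
    then have *: "2 * d + of_bool b = 2 * d' + of_bool b'" by (rule injD [OF e])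
    have "odd (2 * d + of_bool b) = b" "odd (2 * d' + of_bool b') = b'" by simp_all
    with * have "b = b'" by simp
    with * show "b = b' \<and> d = d'" by simp
  qed
  define S where "S = \<iota> ` nodes Len"
  have fin: "finite S" by (simp add: S_def finite_nodes)
  obtain l where l: "set l = S \<times> S" using finite_list [OF finite_cartesian_product [OF fin fin]] by blast
  \<comment> \<open>Injective only among lists of equal length; all operators yield lists of the
    length of l.\<close>
  define enc where "enc xs = foldr (\<lambda>a b. g (a, b)) xs (e 0)" for xs
  have enc: "xs = ys" if "length xs = length ys" "enc xs = enc ys" for xs ys
    using that by (induction xs ys rule: list_induct2) (auto simp: enc_def dest: injD [OF g])
  define \<psi> where "\<psi> T = enc (map (\<lambda>(s, t). g (Re (T (pointv t) s) \<odot> x, Im (T (pointv t) s) \<odot> x)) l)"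
    for T :: "('a \<Rightarrow> complex) \<Rightarrow> 'a \<Rightarrow> complex"
  have "inj_on \<psi> (carrier (bounded_selfadjoint_ops (fin_hilbert S)))"
  proof (rule inj_onI)
    fix X Y assume XY: "X \<in> carrier (bounded_selfadjoint_ops (fin_hilbert S))"
      "Y \<in> carrier (bounded_selfadjoint_ops (fin_hilbert S))" "\<psi> X = \<psi> Y"
    have map: "map (\<lambda>(s, t). g (Re (X (pointv t) s) \<odot> x, Im (X (pointv t) s) \<odot> x)) l
        = map (\<lambda>(s, t). g (Re (Y (pointv t) s) \<odot> x, Im (Y (pointv t) s) \<odot> x)) l"
      by (rule enc) (use XY(3) in \<open>simp_all add: \<psi>_def\<close>)
    have eq: "X (pointv t) s = Y (pointv t) s" if "s \<in> S" "t \<in> S" for s t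
    proof -
      have "(s, t) \<in> set l" using that l by simp
      from bspec [OF map [unfolded map_eq_conv] this] have "g (Re (X (pointv t) s) \<odot> x, Im (X (pointv t) s) \<odot> x)
          = g (Re (Y (pointv t) s) \<odot> x, Im (Y (pointv t) s) \<odot> x)"
        by (simp only: prod.case)
      from injD [OF g this] have "Re (X (pointv t) s) \<odot> x = Re (Y (pointv t) s) \<odot> x"
        "Im (X (pointv t) s) \<odot> x = Im (Y (pointv t) s) \<odot> x" by simp_all
      from injD [OF r this(1)] injD [OF r this(2)] show ?thesis by (simp add: complex_eq_iff)
    qed
    have lin: "linop S X" "linop S Y" using XY by (simp_all add: BB_carrier [OF fin])
    show "X = Y"
    proof (rule extensionalityI [OF BB_ext [OF fin XY(1)] BB_ext [OF fin XY(2)]])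
      fix u assume u: "u \<in> carrier (fin_hilbert S)"
      have z: "X u s = 0" "Y u s = 0" if "s \<notin> S" for s
        using BB_closed_in [OF fin XY(1) u] BB_closed_in [OF fin XY(2) u] that by (simp_all add: HH_simps [OF fin])
      show "X u = Y u"
      proof
        fix s show "X u s = Y u s"
        proof (cases "s \<in> S")
          case True
          then show ?thesis
            unfolding linop_expand [OF fin lin(1) u] linop_expand [OF fin lin(2) u] by (simp add: eq)
        qed (simp add: z)
      qed
    qed
  qed
  with \<iota> show ?thesis unfolding S_def by blast
qed

section \<open>From vanishing on JC-algebras to relations in the presented algebra\<close>

definition jside :: "jvar \<Rightarrow> bool" where "jside v \<longleftrightarrow> v \<in> range VarX"

text \<open>In the presented algebra the operators \<open>lam\<close> of letters of equal side
  commute, and so do the \<open>rho\<close>. Hence words act through their normal forms, and an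
  expansion with zero coefficients acts as 0.\<close>

lemma coef_zero_peq:
  assumes t: "zrep VarZ t \<beta>" and coef: "\<And>\<kappa>. coef (\<lambda>(p, q). (nf jside p, nf jside q)) \<beta> \<kappa> = 0"
  shows "peq t JZero"
proof -
  define XY where "XY = range VarX \<union> range VarY"
  let ?q = "\<lambda>v :: jvar. pclass (JVar v)"
  have val: "?q v \<in> jS (jside v)" if "v \<in> XY" for v
    using that by (intro pclass_in_jS) (auto simp: XY_def jside_def pletters_jvar_def)
  have notZ: "v \<in> XY" if "v \<noteq> VarZ" for v
    using that by (cases v) (auto simp: XY_def)
  have UNIV: "jvars t \<subseteq> insert VarZ XY"
  proof
    fix v show "v \<in> insert VarZ XY" by (cases v) (auto simp: XY_def)
  qed
  let ?f = "\<lambda>(p, q). wp (\<lambda>v. lam (jside v) (?q v)) p * wp (\<lambda>v. rho (jside v) (?q v)) q"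
  let ?k = "\<lambda>(p, q). (nf jside p, nf jside q)"
  have "wsum ?f \<beta> = (\<Sum>\<kappa>\<in>?k ` snd ` set \<beta>. coef ?k \<beta> \<kappa> *\<^sub>R ?f (cw (fst \<kappa>), cw (snd \<kappa>)))"
  proof (rule wsum_group)
    fix c w assume w: "(c, w) \<in> set \<beta>"
    obtain p q where pq: "w = (p, q)" by fastforce
    have "VarZ \<notin> set p \<and> VarZ \<notin> set q" using zrep_noz [OF t] w pq by simp
    then have s: "set p \<subseteq> XY" "set q \<subseteq> XY" by (auto intro!: notZ)
    have 1: "wp (\<lambda>v. lam (jside v) (?q v)) p = wp (\<lambda>v. lam (jside v) (?q v)) (cw (nf jside p))"
    proof (rule wp_nf)
      fix u v assume "u \<in> set p" "v \<in> set p" "jside u = jside v"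
      then show "lam (jside u) (?q u) * lam (jside v) (?q v) = lam (jside v) (?q v) * lam (jside u) (?q u)"
        using lam_commute [of "?q u" "jside v" "?q v"] val [of u] val [of v] s by auto
    qed
    have 2: "wp (\<lambda>v. rho (jside v) (?q v)) q = wp (\<lambda>v. rho (jside v) (?q v)) (cw (nf jside q))"
    proof (rule wp_nf)
      fix u v assume "u \<in> set q" "v \<in> set q" "jside u = jside v"
      then show "rho (jside u) (?q u) * rho (jside v) (?q v) = rho (jside v) (?q v) * rho (jside u) (?q u)"
        using rho_commute [of "?q u" "jside v" "?q v"] val [of u] val [of v] s by auto
    qed
    have "?k w \<in> ?k ` snd ` set \<beta>" using w by (metis (no_types, lifting) imageI snd_conv)
    moreover have "?f w = ?f (cw (fst (?k w)), cw (snd (?k w)))" using 1 2 by (simp add: pq)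
    ultimately show "?k w \<in> ?k ` snd ` set \<beta> \<and> ?f w = ?f (cw (fst (?k w)), cw (snd (?k w)))" by blast
  qed simp
  then have "wsum ?f \<beta> = 0" by (simp add: coef)
  moreover have "tev ?q t = fst (app (wsum ?f \<beta>) (?q VarZ, 0))"
    using zrep_value [where side = jside and val = ?q and XY = XY, OF val t UNIV refl refl] by simp
  ultimately have "pclass t = 0" by (simp add: tev_pclass)
  then show ?thesis by (simp add: pclass_eq_iff flip: pclass_simps(1))
qed

text \<open>Chains are substituted for the X and Y letters. With 0 for Z only the part t0 free of Z
  is left, so it vanishes. With \<open>swapZ\<close> for Z the terms t1 and t0 times Z then vanish
  as well, and their entries between the far ends of the chains are the sums treated by
  \<open>coef_eq_0\<close>.\<close>

lemma jc_coef_zero: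
  fixes t0 t1 :: "jvar jterm"
  assumes J: "jb_algebra (J :: 'a normed_algebra)" and x: "x \<in> carrier J" "x \<noteq> \<zero>\<^bsub>J\<^esub>"
    and V: "jvars t0 \<subseteq> xyz_vars n m" "jvars t1 \<subseteq> xyz_vars n m" and t0: "VarZ \<notin> jvars t0"
    and t1: "zrep VarZ t1 \<beta>1" and t0Z: "zrep VarZ (JMult t0 (JVar VarZ)) \<beta>0"
    and vanish: "\<And>(J :: 'a normed_algebra) x y z. \<lbrakk>jc_algebra J; operator_commuting_tuple J n x;
        operator_commuting_tuple J m y; z \<in> carrier J\<rbrakk> \<Longrightarrow>
        jordan_poly_vanishes (xyz_vars n m) J (jclass (xyz_vars n m) (JAdd t0 t1)) (xyz_assign x y z)"
  shows "coef (\<lambda>(p, q). (nf jside p, nf jside q)) \<beta>1 \<kappa> = 0" "coef (\<lambda>(p, q). (nf jside p, nf jside q)) \<beta>0 \<kappa> = 0"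
proof -
  have main: "wsum (\<lambda>(p, q). cent jside Len tau \<alpha> p True (Len True) * cent jside Len tau \<alpha> q False (Len False)) \<beta>1 = 0 \<and>
     wsum (\<lambda>(p, q). cent jside Len tau \<alpha> p True (Len True) * cent jside Len tau \<alpha> q False (Len False)) \<beta>0 = 0"
    if tau: "\<And>b i. tau b (Suc i) = (\<not> tau b i)" for Len tau \<alpha>
  proof -
    obtain \<iota> :: "bool \<times> nat \<Rightarrow> 'a" and \<psi> :: "(('a \<Rightarrow> complex) \<Rightarrow> 'a \<Rightarrow> complex) \<Rightarrow> 'a" where i: "inj \<iota>"
      and p: "inj_on \<psi> (carrier (bounded_selfadjoint_ops (fin_hilbert (\<iota> ` nodes Len))))"
      using jb_algebra.operator_encoding [OF J x, of Len] by blast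
    define Bv where "Bv Z v = (if v = VarZ then Z else chain jside Len tau \<alpha> v)" for Z v
    have Bs: "symmetric_op Len (Bv Z v)" if "symmetric_op Len Z" for Z v
      using that by (simp add: Bv_def symmetric_chain)
    let ?J = "JJ Len \<iota> \<psi>"
    let ?c = "\<lambda>v. \<psi> (opB Len \<iota> (chain jside Len tau \<alpha> v))"
    have cc: "?c v \<in> carrier ?J" for v
      using opB_carrier [OF i symmetric_chain [of Len jside tau \<alpha> v]] by (simp add: JJ_simps [OF i p] del: BB_simps)
    have tX: "operator_commuting_tuple ?J n (\<lambda>i. ?c (VarX i))" "operator_commuting_tuple ?J m (\<lambda>i. ?c (VarY i))"
      unfolding operator_commuting_tuple_def using cc
      by (auto intro!: JJ_commute [OF i p] symmetric_chain chain_commute [where tau = tau, OF tau] simp: jside_def simp del: JJ_simps)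
    have sum0: "app (aev (Bv Z) (JAdd t0 t1)) w = 0" if Z: "symmetric_op Len Z" and w: "supp Len w" for Z w
    proof -
      let ?z = "\<psi> (opB Len \<iota> Z)"
      have z: "?z \<in> carrier ?J" using opB_carrier [OF i Z] by (simp add: JJ_simps [OF i p] del: BB_simps)
      have assign: "xyz_assign (\<lambda>i. ?c (VarX i)) (\<lambda>i. ?c (VarY i)) ?z = (\<lambda>v. \<psi> (opB Len \<iota> (Bv Z v)))"
      proof
        fix v show "xyz_assign (\<lambda>i. ?c (VarX i)) (\<lambda>i. ?c (VarY i)) ?z v = \<psi> (opB Len \<iota> (Bv Z v))"
          by (cases v) (simp_all add: Bv_def)
      qed
      interpret JJ: jordan_algebra ?J by (rule jordan_JJ [OF i p])
      interpret U: unital_jordan_algebra "with_unit ?J"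
        by (rule JJ.with_unit_unital_jordan_algebra [OF JJ_has_unit [OF i p]])
      have cl: "\<psi> (opB Len \<iota> (Bv Z v)) \<in> carrier (with_unit ?J)" for v
        using opB_carrier [OF i Bs [OF Z]] by (simp add: with_unit_def JJ_simps [OF i p] del: BB_simps)
      have "jeval_unital (xyz_vars n m) (with_unit ?J) (\<lambda>v. \<psi> (opB Len \<iota> (Bv Z v))) (jclass (xyz_vars n m) (JAdd t0 t1)) = \<zero>\<^bsub>?J\<^esub>"
        using vanish [OF jc_JJ [OF i p] tX z] JJ_has_unit [OF i p] unfolding assign jordan_poly_vanishes_def by simp
      then have "jterm_eval (with_unit ?J) (\<lambda>v. \<psi> (opB Len \<iota> (Bv Z v))) (JAdd t0 t1) = \<zero>\<^bsub>?J\<^esub>"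
        using U.jeval_unital_jclass [where V = "xyz_vars n m" and t = "JAdd t0 t1", OF cl] V by (simp add: jterms_def del: JJ_simps jterm_eval.simps)
      then show ?thesis by (rule JJ_eval_zero [where Bv = "Bv Z", OF i p Bs [OF Z] _ w])
    qed
    have t0c: "aev (Bv Z) t0 = aev (Bv Z') t0" for Z Z'
      by (rule aev_cong) (use t0 in \<open>auto simp: Bv_def\<close>)
    have z1: "aev (Bv 0) t1 = 0"
      unfolding zrep_aev [OF t1] by (induction \<beta>1) (simp_all add: Bv_def case_prod_unfold)
    have t0_0: "app (aev (Bv Z) t0) w = 0" if "supp Len w" for Z w
      using sum0 [OF symmetric_zero that] z1 t0c [of Z 0] by simp
    have t1_0: "app (aev (Bv swapZ) t1) w = 0" if "supp Len w" for w
      using sum0 [OF symmetric_swapZ that] t0_0 [OF that] by simp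
    have t0Z_0: "app (aev (Bv swapZ) (JMult t0 (JVar VarZ))) w = 0" if "supp Len w" for w
      using t0_0 [OF that] t0_0 [of "app swapZ w"] symmetric_swapZ [of Len] by (simp add: Bv_def symmetric_op_def)
    have entry: "app (aev (Bv swapZ) t) (unitv (False, Len False)) (True, Len True)
        = wsum (\<lambda>(p, q). cent jside Len tau \<alpha> p True (Len True) * cent jside Len tau \<alpha> q False (Len False)) \<beta>"
      if t: "zrep VarZ t \<beta>" and Vt: "jvars t \<subseteq> xyz_vars n m" for t \<beta>
    proof -
      have w: "wp (Bv swapZ) p = wp (chain jside Len tau \<alpha>) p" if "VarZ \<notin> set p" for p
        using that by (induction p) (auto simp: Bv_def)
      have noZ: "VarZ \<notin> set p \<and> VarZ \<notin> set q" if "(c, p, q) \<in> set \<beta>" for c p q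
        using zrep_noz [OF t that] .
      have "app (wsum (\<lambda>(p, q). wp (Bv swapZ) p * Bv swapZ VarZ * wp (Bv swapZ) (rev q)) \<gamma>) (unitv (False, Len False)) (True, Len True)
         = wsum (\<lambda>(p, q). cent jside Len tau \<alpha> p True (Len True) * cent jside Len tau \<alpha> q False (Len False)) \<gamma>"
        if "set \<gamma> \<subseteq> set \<beta>" for \<gamma>
        using that
      proof (induction \<gamma>)
        case (Cons u \<gamma>)
        obtain c p q where u: "u = (c, p, q)" using prod_cases3 by blast
        have "VarZ \<notin> set p" "VarZ \<notin> set (rev q)" using noZ [of c p q] Cons.prems u by auto
        note e = w [OF this(1)] w [OF this(2)]
        show ?case
          using Cons matrix_entry [of jside Len tau \<alpha> p q]
          by (simp add: u e scaleR_fun_def) (simp add: Bv_def)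
      qed simp
      then show ?thesis unfolding zrep_aev [OF t] by blast
    qed
    have "supp Len (unitv (False, Len False))" by (auto simp: supp_def unitv_def nodes_def)
    then show ?thesis
      using entry [OF t1 V(2)] entry [OF t0Z] t1_0 t0Z_0 V(1) by (simp add: xyz_vars_def)
  qed
  show "coef (\<lambda>(p, q). (nf jside p, nf jside q)) \<beta>1 \<kappa> = 0" "coef (\<lambda>(p, q). (nf jside p, nf jside q)) \<beta>0 \<kappa> = 0"
    by (rule coef_eq_0; use main in blast)+
qed

section \<open>The theorem\<close>

lemma degree_one_terms:
  assumes F: "F \<in> carrier (free_jordan V)" and deg: "jdegree V v F = 1"
  obtains t0 t1 where "t0 \<in> jterms V" "t1 \<in> jterms V" "jhomogeneous v 0 t0" "jhomogeneous v 1 t1"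
    "F = jclass V (JAdd t0 t1)"
proof -
  let ?F = "free_jordan V"
  define c where "c = homogeneous_component V v F"
  have c: "homogeneous_decomposition V v F c"
    unfolding c_def homogeneous_component_def by (rule theI' [OF homogeneous_decomposition_unique [OF F]])
  then have fin: "finite {d. c d \<noteq> \<zero>\<^bsub>?F\<^esub>}" and part: "c d \<in> homogeneous_part V v d" for d
    by (auto simp: homogeneous_decomposition_def)
  have "c d = \<zero>\<^bsub>?F\<^esub>" if "d \<notin> {0, 1}" for d
  proof (rule ccontr)
    assume "c d \<noteq> \<zero>\<^bsub>?F\<^esub>"
    then have "d \<le> Max (insert 0 {d. c d \<noteq> \<zero>\<^bsub>?F\<^esub>})" using fin by (intro Max_ge) auto
    with deg that show False by (auto simp: jdegree_def c_def)
  qed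
  then have "F = (\<Oplus>\<^bsub>?F\<^esub>d\<in>{0, 1}. c d)" by (intro homogeneous_decompositionE [OF c]) auto
  also have "\<dots> = c 0 \<oplus>\<^bsub>?F\<^esub> c 1" using homogeneous_part_closed [OF part] by (simp add: free_jordan.finsum_insert)
  finally have e: "F = c 0 \<oplus>\<^bsub>?F\<^esub> c 1" .
  obtain t0 where t0: "c 0 = jclass V t0" "t0 \<in> jterms V" "jhomogeneous v 0 t0"
    using part [of 0] by (auto simp: homogeneous_part_def)
  obtain t1 where t1: "c 1 = jclass V t1" "t1 \<in> jterms V" "jhomogeneous v 1 t1"
    using part [of 1] by (auto simp: homogeneous_part_def)
  show thesis by (rule that [OF t0(2) t1(2) t0(3) t1(3)]) (simp only: e t0(1) t1(1) free_jordan_ops(3) [OF t0(2) t1(2)])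
qed

text \<open>For unital J the map from the unitization that sends (r, x) to r times the unit plus x
  is a unital homomorphism. So vanishing in the unitization settles both cases of
  \<open>jordan_poly_vanishes\<close>.\<close>

lemma (in jordan_algebra) jterm_eval_with_unit:
  assumes u: "has_unit J" and a: "\<And>v. a v \<in> carrier J"
  shows "jterm_eval (with_unit J) a t
    = fst (jterm_eval (unitization J) (\<lambda>v. (0, a v)) t) \<odot> \<one>\<^bsub>with_unit J\<^esub> \<oplus> snd (jterm_eval (unitization J) (\<lambda>v. (0, a v)) t)"
proof -
  interpret W: unital_jordan_algebra "with_unit J" by (rule with_unit_unital_jordan_algebra [OF u])
  interpret U: unital_jordan_algebra "unitization J" by (rule unitization_unital_jordan_algebra)
  let ?e = "\<one>\<^bsub>with_unit J\<^esub>"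
  have e: "?e \<in> carrier J" "\<And>x. x \<in> carrier J \<Longrightarrow> ?e \<otimes> x = x" "\<And>x. x \<in> carrier J \<Longrightarrow> x \<otimes> ?e = x"
    using W.j_one_closed W.j_l_one m_comm by (simp_all add: with_unit_def)
  have ops: "x \<oplus>\<^bsub>with_unit J\<^esub> y = x \<oplus> y" "x \<otimes>\<^bsub>with_unit J\<^esub> y = x \<otimes> y" "r \<odot>\<^bsub>with_unit J\<^esub> x = r \<odot> x" "\<zero>\<^bsub>with_unit J\<^esub> = \<zero>" for x y r
    by (simp_all add: with_unit_def)
  have cl: "snd (jterm_eval (unitization J) (\<lambda>v. (0, a v)) t) \<in> carrier J" for t
    using U.jterm_eval_closed [of "\<lambda>v. (0, a v)" t] a by auto
  show ?thesis
  proof (induction t)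
    case (JMult s t)
    obtain r b q c where 1: "jterm_eval (unitization J) (\<lambda>v. (0, a v)) s = (r, b)"
      "jterm_eval (unitization J) (\<lambda>v. (0, a v)) t = (q, c)" by fastforce
    have bc: "b \<in> carrier J" "c \<in> carrier J" using cl [of s] cl [of t] 1 by simp_all
    have "(r \<odot> ?e \<oplus> b) \<otimes> (q \<odot> ?e \<oplus> c) = (r * q) \<odot> ?e \<oplus> ((r \<odot> c \<oplus> q \<odot> b) \<oplus> b \<otimes> c)"
      using bc e by (simp add: m_l_distr m_r_distr m_smult_l m_smult_r rscale_assoc [symmetric] mult.commute rscale_r_distr M.a_ac)
    then show ?case using JMult 1 by (simp add: ops)
  next
    case (JAdd s t)
    obtain r b q c where 1: "jterm_eval (unitization J) (\<lambda>v. (0, a v)) s = (r, b)"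
      "jterm_eval (unitization J) (\<lambda>v. (0, a v)) t = (q, c)" by fastforce
    have bc: "b \<in> carrier J" "c \<in> carrier J" using cl [of s] cl [of t] 1 by simp_all
    show ?case using JAdd 1 bc e by (simp add: ops rscale_l_distr M.a_ac)
  next
    case (JScale r' t)
    obtain r b where 1: "jterm_eval (unitization J) (\<lambda>v. (0, a v)) t = (r, b)" by fastforce
    have "b \<in> carrier J" using cl [of t] 1 by simp
    then show ?case using JScale 1 e by (simp add: ops rscale_r_distr rscale_assoc)
  qed (use a e in \<open>simp_all add: ops\<close>)
qed

lemma vanishes_if_unitization_zero:
  assumes J: "jordan_algebra J" and a: "\<And>v. a v \<in> carrier J" and t: "t \<in> jterms V"
    and zero: "jterm_eval (unitization J) (\<lambda>v. (0, a v)) t = (0, \<zero>\<^bsub>J\<^esub>)"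
  shows "jordan_poly_vanishes V J (jclass V t) a"
proof -
  interpret jordan_algebra J by (rule J)
  interpret U: unital_jordan_algebra "unitization J" by (rule unitization_unital_jordan_algebra)
  show ?thesis
  proof (cases "has_unit J")
    case True
    interpret W: unital_jordan_algebra "with_unit J" by (rule with_unit_unital_jordan_algebra [OF True])
    have e: "\<one>\<^bsub>with_unit J\<^esub> \<in> carrier J" using W.j_one_closed by (simp add: with_unit_def)
    have "jeval_unital V (with_unit J) a (jclass V t) = jterm_eval (with_unit J) a t"
      by (rule W.jeval_unital_jclass [OF _ t]) (simp add: with_unit_def a)
    also have "\<dots> = \<zero>\<^bsub>J\<^esub>" unfolding jterm_eval_with_unit [where a = a, OF True a] zero using e by simp
    finally show ?thesis using True by (simp add: jordan_poly_vanishes_def)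
  next
    case False
    have "jeval_unital V (unitization J) (\<lambda>v. (0, a v)) (jclass V t) = jterm_eval (unitization J) (\<lambda>v. (0, a v)) t"
      by (rule U.jeval_unital_jclass [OF _ t]) (simp add: a)
    then show ?thesis using False zero by (simp add: jordan_poly_vanishes_def)
  qed
qed

lemma jordan_poly_vanishes_cong:
  assumes "\<And>v. v \<in> V \<Longrightarrow> a v = b v"
  shows "jordan_poly_vanishes V J F a = jordan_poly_vanishes V J F b"
  using assms unfolding jordan_poly_vanishes_def jeval_unital_def by (simp cong: ball_cong)

theorem theorem4p3:
  fixes n m :: nat and F :: "jvar jterm set"
  assumes F: "F \<in> carrier (free_jordan (xyz_vars n m))"
    and degree_Z: "jdegree (xyz_vars n m) VarZ F = 1"
    and vanishes_JC:
      "\<forall>(J :: 'a normed_algebra) x y z. jc_algebra J \<longrightarrow>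
         operator_commuting_tuple J n x \<longrightarrow> operator_commuting_tuple J m y \<longrightarrow> z \<in> carrier J \<longrightarrow>
         jordan_poly_vanishes (xyz_vars n m) J F (xyz_assign x y z)"
  shows "\<forall>(J :: 'a normed_algebra) x y z. jb_algebra J \<longrightarrow>
         operator_commuting_tuple J n x \<longrightarrow> operator_commuting_tuple J m y \<longrightarrow> z \<in> carrier J \<longrightarrow>
         jordan_poly_vanishes (xyz_vars n m) J F (xyz_assign x y z)"
proof (intro allI impI)
  fix J :: "'a normed_algebra" and x y z
  assume J: "jb_algebra J" and x: "operator_commuting_tuple J n x" and y: "operator_commuting_tuple J m y"
    and z: "z \<in> carrier J"
  interpret jb_algebra J by (rule J)
  interpret U: unital_jordan_algebra "unitization J" by (rule unitization_unital_jordan_algebra)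
  let ?V = "xyz_vars n m"
  obtain t0 t1 where t: "t0 \<in> jterms ?V" "t1 \<in> jterms ?V" "jhomogeneous VarZ 0 t0" "jhomogeneous VarZ 1 t1"
    and F_eq: "F = jclass ?V (JAdd t0 t1)"
    using degree_one_terms [OF F degree_Z] by blast
  have V: "jvars t0 \<subseteq> ?V" "jvars t1 \<subseteq> ?V" using t by (auto simp: jterms_def)
  have Z0: "VarZ \<notin> jvars t0" using t(3) by (rule jhomogeneous_0_jvars)
  obtain \<beta>1 where \<beta>1: "zrep VarZ t1 \<beta>1" using jhomogeneous_1_zrep t(4) by fastforce
  obtain \<beta>0 where \<beta>0: "zrep VarZ (JMult t0 (JVar VarZ)) \<beta>0"
    using zrep_left [OF Z0 zrep_var] by blast
  \<comment> \<open>Letters that do not belong to the polynomial get the value 0, so that every X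
    and Y letter has its value in the span of its tuple.\<close>
  define a where "a v = (if v \<in> ?V then xyz_assign x y z v else \<zero>\<^bsub>J\<^esub>)" for v
  have cl: "a v \<in> carrier J" for v
    using x y z by (cases v) (auto simp: a_def xyz_vars_def operator_commuting_tuple_def)
  have aX: "a (VarX i) \<in> jspan (x ` {1..n})" and aY: "a (VarY i) \<in> jspan (y ` {1..m})" for i
    by (auto simp: a_def xyz_vars_def intro: jspan.intros)
  have "jordan_poly_vanishes ?V J (jclass ?V (JAdd t0 t1)) a"
  proof (cases "carrier J = {\<zero>\<^bsub>J\<^esub>}")
    case True
    then have u: "has_unit J" by (simp add: has_unit_def)
    interpret W: unital_jordan_algebra "with_unit J" by (rule with_unit_unital_jordan_algebra [OF u])
    have c: "a v \<in> carrier (with_unit J)" for v using cl by (simp add: with_unit_def)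
    then have "jterm_eval (with_unit J) a (JAdd t0 t1) \<in> carrier (with_unit J)" by (rule W.jterm_eval_closed)
    then have "jterm_eval (with_unit J) a (JAdd t0 t1) = \<zero>\<^bsub>J\<^esub>"
      using True by (simp add: with_unit_def del: jterm_eval.simps)
    then show ?thesis
      using W.jeval_unital_jclass [where V = ?V and t = "JAdd t0 t1", OF c] t u
      by (simp add: jordan_poly_vanishes_def del: jterm_eval.simps)
  next
    case False
    \<comment> \<open>A nonzero element guarantees that the type is large enough for the encoded
      matrix algebras.\<close>
    then obtain e where e: "e \<in> carrier J" "e \<noteq> \<zero>\<^bsub>J\<^esub>" using M.zero_closed by blast
    note coef = jc_coef_zero [OF J e V Z0 \<beta>1 \<beta>0 vanishes_JC [unfolded F_eq, rule_format]]
    have p1: "peq t1 JZero" by (rule coef_zero_peq [OF \<beta>1]) (rule coef(1))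
    have p2: "peq (JMult t0 (JVar VarZ)) JZero" by (rule coef_zero_peq [OF \<beta>0]) (rule coef(2))
    have e1: "jterm_eval (unitization J) (\<lambda>v. (0, a v)) t1 = \<zero>\<^bsub>unitization J\<^esub>"
      using unitization_eval_peq [where h = "\<lambda>v. (0, a v)", OF x y _ _ _ p1] cl aX aY by simp
    \<comment> \<open>With the unit in place of Z, the relation that t0 times Z is 0 gives the
      vanishing of t0, in which Z does not occur.\<close>
    define h where "h v = (if v = VarZ then \<one>\<^bsub>unitization J\<^esub> else (0, a v))" for v
    have "jterm_eval (unitization J) h (JMult t0 (JVar VarZ)) = jterm_eval (unitization J) h JZero"
      by (rule unitization_eval_peq [OF x y _ _ _ p2]) (use cl aX aY in \<open>auto simp: h_def\<close>)
    moreover have h0: "jterm_eval (unitization J) h t0 = jterm_eval (unitization J) (\<lambda>v. (0, a v)) t0"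
      by (rule U.jterm_eval_cong) (use Z0 in \<open>auto simp: h_def\<close>)
    moreover have c0: "jterm_eval (unitization J) (\<lambda>v. (0, a v)) t0 \<in> carrier (unitization J)"
      by (rule U.jterm_eval_closed) (simp add: cl)
    ultimately have "jterm_eval (unitization J) (\<lambda>v. (0, a v)) t0 = \<zero>\<^bsub>unitization J\<^esub>"
      using U.j_l_one [OF c0] U.m_comm [OF c0 U.j_one_closed] by (simp add: h_def del: unitization_simps)
    with e1 have "jterm_eval (unitization J) (\<lambda>v. (0, a v)) (JAdd t0 t1) = (0, \<zero>\<^bsub>J\<^esub>)" by simp
    then show ?thesis
      by (intro vanishes_if_unitization_zero [OF jordan_algebra_axioms cl]) (simp_all add: t)
  qed
  moreover have "jordan_poly_vanishes ?V J F (xyz_assign x y z) = jordan_poly_vanishes ?V J F a"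
    by (rule jordan_poly_vanishes_cong) (simp add: a_def)
  ultimately show "jordan_poly_vanishes ?V J F (xyz_assign x y z)" by (simp add: F_eq)
qed

end
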